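(* Let $G$ be a compact Lie group with fixed invariant inner product on $\mathfrak g$, such that the adjoint action lifts to a homomorphism $\tau:G\to\mathrm{Pin}(\mathfrak g)$, and let $\mathcal T\in\Omega(G)$ be the associated form. Let $(M,\omega,(\Phi_1,\Phi_2))$ be a group valued Hamiltonian $G\times G$-manifold and $(\tilde M,\tilde\omega,\tilde\Phi)$ its fusion: $\tilde M=M$ with the diagonal $G$-action, $\tilde\Phi=\Phi_1\Phi_2$ and $\tilde\omega=\omega-\frac12\Phi_1^*\theta^L\cdot\Phi_2^*\theta^R$. Then the corresponding forms $\Gamma=e^{\omega}\,\Phi_1^*\mathcal T\,\Phi_2^*\mathcal T$ and $\tilde\Gamma=e^{\tilde\omega}\,\tilde\Phi^*\mathcal T$ are related by $$\tilde\Gamma=\exp\Big(-\frac12\sum_i\iota_i^1\iota_i^2\Big)\Gamma,$$ where $\iota_i^1$ are the contraction operators for the action of the first $G$-factor on $M$ and $\iota_i^2$ those for the second $G$-factor. In particular $\tilde\Gamma_{[\dim M]}=\Gamma_{[\dim M]}$.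
   Context: $\mathfrak g$ is the Lie algebra of $G$ with an $\mathrm{Ad}(G)$-invariant inner product "$\cdot$" (on $\mathfrak g\oplus\mathfrak g$ use the direct sum). $\theta^L=g^{-1}dg$, $\theta^R=dg\,g^{-1}$. For a $G$-manifold, $\xi_M(m)=\frac{d}{dt}|_{t=0}\exp(-t\xi).m$. $\eta=\frac1{12}\theta^L\cdot[\theta^L,\theta^L]$. For a compact Lie group $K$ with invariant inner product on its Lie algebra $\mathfrak k$, a group valued Hamiltonian $K$-manifold is a triple $(M,\omega,\Phi)$ with $M$ a $K$-manifold, $\omega$ a $K$-invariant 2-form, $\Phi:M\to K$ smooth and equivariant for conjugation, such that (i) $d\omega=\Phi^*\eta$; (ii) $\iota(\xi_M)\omega=\frac12\Phi^*(\theta^L+\theta^R)\cdot\xi$ for $\xi\in\mathfrak k$; (iii) $\ker\omega_m=\{\xi_M(m)\mid(\mathrm{Ad}_{\Phi(m)}+1)\xi=0\}$ for all $m$. Here $K=G\times G$ and $\Phi=(\Phi_1,\Phi_2)$. The fusion is a group valued Hamiltonian $G$-manifold. For an orthonormal basis $e_i$ of $\mathfrak g$, $\mathrm{Cl}(\mathfrak g)$ has generators $x_i$ with $x_ix_j+x_jx_i=\delta_{ij}$; $\alpha$ is its parity automorphism, $\widetilde{\mathrm{Ad}}(x)y=\alpha(x)yx^{-1}$; $\mathrm{Pin}(\mathfrak g)\subset\mathrm{Cl}(\mathfrak g)^\times$ is generated by $\xi\in\mathfrak g$ with $\xi\cdot\xi=2$, $\widetilde{\mathrm{Ad}}:\mathrm{Pin}(\mathfrak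 g)\to\mathrm O(\mathfrak g)$ is a double cover, and $\widetilde{\mathrm{Ad}}\circ\tau=\mathrm{Ad}$. The symbol map $\sigma:\mathrm{Cl}(\mathfrak g)\to\wedge\mathfrak g$ is the linear map $x_{i_1}\cdots x_{i_s}\mapsto y_{i_1}\cdots y_{i_s}$, $i_1<\dots<i_s$. $\mathcal T\in\Omega(G)$ has value at $g$ obtained from $\sigma(\tau(g))$ by replacing each $y_i$ with $\frac12(\theta^R\cdot e_i)_g$. $\iota^1_i$, $\iota_i^2$ are contractions of forms on $M$ with the generating vector fields of $(e_i,0)$ and $(0,e_i)$ respectively. $\beta_{[k]}$ denotes the degree $k$ part of a form. *)

theory Defs
  imports "HOL-Analysis.Analysis" "HOL-Algebra.Group_Action" "HOL-Algebra.Generated_Groups"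
begin

section \<open>Clifford algebras\<close>

text \<open>
  The type below is the real algebra on countably many generators \<open>x\<^sub>0, x\<^sub>1, \<dots>\<close> with
  relations \<open>x\<^sub>i x\<^sub>j + x\<^sub>j x\<^sub>i = \<delta>\<^sub>i\<^sub>j\<close>. An element is given by its coefficients with respect to the
  ordered monomials \<open>x\<^sub>I = x\<^bsub>i\<^sub>1\<^esub> \<cdots> x\<^bsub>i\<^sub>s\<^esub>\<close>, \<open>I = {i\<^sub>1 < \<dots> < i\<^sub>s}\<close>. The Clifford algebra of an
  \<open>n\<close>-dimensional Euclidean space with an orthonormal basis indexed by \<open>{..<n}\<close> is the
  subalgebra spanned by the \<open>x\<^sub>I\<close> with \<open>I \<subseteq> {..<n}\<close>.
\<close>

typedef cliff = "{f :: nat set \<Rightarrow> real. finite {I. f I \<noteq> 0} \<and> (\<forall>I. f I \<noteq> 0 \<longrightarrow> finite I)}"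
  morphisms cl_coeff Abs_cliff
  by (rule exI[of _ "\<lambda>_. 0"]) simp

setup_lifting type_definition_cliff

text \<open>The structure constants: \<open>x\<^sub>I x\<^sub>J = cl_sign I J \<cdot> x\<^bsub>I \<triangle> J\<^esub>\<close>. Sorting the product costs one sign per
  inversion, and each repeated generator contributes \<open>x\<^sub>i\<^sup>2 = 1/2\<close>.\<close>

definition cl_sign :: "nat set \<Rightarrow> nat set \<Rightarrow> real" where
  "cl_sign I J = (-1) ^ card {(i, j). i \<in> I \<and> j \<in> J \<and> j < i} * (1/2) ^ card (I \<inter> J)"

lemma finite_cl_supp: "finite {I. cl_coeff x I \<noteq> 0}"
  using cl_coeff[of x] by blast

lemma cl_supp_finite: "cl_coeff x I \<noteq> 0 \<Longrightarrow> finite I"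
  using cl_coeff[of x] by blast

lemma cl_eqI: "(\<And>I. cl_coeff x I = cl_coeff y I) \<Longrightarrow> x = y"
  by (auto simp: cl_coeff_inject[symmetric])

instantiation cliff :: real_vector
begin

lift_definition zero_cliff :: cliff is "\<lambda>_. 0" by simp

lift_definition plus_cliff :: "cliff \<Rightarrow> cliff \<Rightarrow> cliff" is "\<lambda>f g I. f I + g I"
proof -
  fix f g :: "nat set \<Rightarrow> real"
  assume f: "finite {I. f I \<noteq> 0} \<and> (\<forall>I. f I \<noteq> 0 \<longrightarrow> finite I)"
    and g: "finite {I. g I \<noteq> 0} \<and> (\<forall>I. g I \<noteq> 0 \<longrightarrow> finite I)"
  have "{I. f I + g I \<noteq> 0} \<subseteq> {I. f I \<noteq> 0} \<union> {I. g I \<noteq> 0}" by auto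
  with f g show "finite {I. f I + g I \<noteq> 0} \<and> (\<forall>I. f I + g I \<noteq> 0 \<longrightarrow> finite I)"
    by (metis (no_types, lifting) add_0 finite_UnI finite_subset)
qed

lift_definition uminus_cliff :: "cliff \<Rightarrow> cliff" is "\<lambda>f I. - f I" by simp

lift_definition minus_cliff :: "cliff \<Rightarrow> cliff \<Rightarrow> cliff" is "\<lambda>f g I. f I - g I"
proof -
  fix f g :: "nat set \<Rightarrow> real"
  assume f: "finite {I. f I \<noteq> 0} \<and> (\<forall>I. f I \<noteq> 0 \<longrightarrow> finite I)"
    and g: "finite {I. g I \<noteq> 0} \<and> (\<forall>I. g I \<noteq> 0 \<longrightarrow> finite I)"
  have "{I. f I - g I \<noteq> 0} \<subseteq> {I. f I \<noteq> 0} \<union> {I. g I \<noteq> 0}" by auto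
  moreover have "f I - g I \<noteq> 0 \<Longrightarrow> finite I" for I using f g by (cases "f I = 0") auto
  ultimately show "finite {I. f I - g I \<noteq> 0} \<and> (\<forall>I. f I - g I \<noteq> 0 \<longrightarrow> finite I)"
    using f g by (meson finite_UnI finite_subset)
qed

lift_definition scaleR_cliff :: "real \<Rightarrow> cliff \<Rightarrow> cliff" is "\<lambda>c f I. c * f I" by simp

instance
  by standard (transfer; auto simp: fun_eq_iff algebra_simps)+

end

lemma cl_coeff_sum: "cl_coeff (\<Sum>a\<in>S. f a) I = (\<Sum>a\<in>S. cl_coeff (f a) I)"
  by (induction S rule: infinite_finite_induct) (auto simp: zero_cliff.rep_eq plus_cliff.rep_eq)

lemma sym_diff_cancel: "sym_diff I (sym_diff I J) = (J :: 'a set)"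
  by blast

lemma inj_sym_diff: "inj (\<lambda>J. sym_diff I J)"
  by (rule inj_on_inverseI[where g = "\<lambda>J. sym_diff I J"]) (rule sym_diff_cancel)

instantiation cliff :: times
begin

lift_definition times_cliff :: "cliff \<Rightarrow> cliff \<Rightarrow> cliff" is
  "\<lambda>f g K. \<Sum>I | f I \<noteq> 0. f I * g (sym_diff I K) * cl_sign I (sym_diff I K)"
proof -
  fix f g :: "nat set \<Rightarrow> real"
  assume f: "finite {I. f I \<noteq> 0} \<and> (\<forall>I. f I \<noteq> 0 \<longrightarrow> finite I)"
    and g: "finite {I. g I \<noteq> 0} \<and> (\<forall>I. g I \<noteq> 0 \<longrightarrow> finite I)"
  let ?h = "\<lambda>K. \<Sum>I | f I \<noteq> 0. f I * g (sym_diff I K) * cl_sign I (sym_diff I K)"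
  have sub: "{K. ?h K \<noteq> 0} \<subseteq> (\<lambda>(I, J). sym_diff I J) ` ({I. f I \<noteq> 0} \<times> {J. g J \<noteq> 0})"
  proof
    fix K assume "K \<in> {K. ?h K \<noteq> 0}"
    then have "?h K \<noteq> 0" by (rule CollectD)
    from sum.not_neutral_contains_not_neutral[OF this]
    obtain I where "f I \<noteq> 0" "g (sym_diff I K) \<noteq> 0" by (metis mult_eq_0_iff)
    then have "(I, sym_diff I K) \<in> {I. f I \<noteq> 0} \<times> {J. g J \<noteq> 0}" by simp
    moreover have "K = (\<lambda>(I, J). sym_diff I J) (I, sym_diff I K)"
      unfolding prod.case by (rule sym_diff_cancel[symmetric])
    ultimately show "K \<in> (\<lambda>(I, J). sym_diff I J) ` ({I. f I \<noteq> 0} \<times> {J. g J \<noteq> 0})"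
      by (rule image_eqI[rotated])
  qed
  have "finite ((\<lambda>(I, J). sym_diff I J) ` ({I. f I \<noteq> 0} \<times> {J. g J \<noteq> 0}))"
    using f g by blast
  from finite_subset[OF sub this] have 1: "finite {K. ?h K \<noteq> 0}" .
  have 2: "finite K" if "?h K \<noteq> 0" for K
  proof -
    from that have "K \<in> {K. ?h K \<noteq> 0}" by (rule CollectI)
    from subsetD[OF sub this] obtain I J where "f I \<noteq> 0" "g J \<noteq> 0" "K = sym_diff I J"
      by blast
    with f g show ?thesis by blast
  qed
  from 1 2 show "finite {K. ?h K \<noteq> 0} \<and> (\<forall>K. ?h K \<noteq> 0 \<longrightarrow> finite K)" by blast
qed

instance ..

end

lemma cl_coeff_times:
  assumes "finite S" "{I. cl_coeff x I \<noteq> 0} \<subseteq> S"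
  shows "cl_coeff (x * y) K =
    (\<Sum>I\<in>S. cl_coeff x I * cl_coeff y (sym_diff I K) * cl_sign I (sym_diff I K))"
  unfolding times_cliff.rep_eq
  by (rule sum.mono_neutral_left) (use assms in auto)

lemma prod_sym_diff:
  fixes f :: "'a \<Rightarrow> real"
  assumes "finite I" "finite J" "\<And>i. f i * f i = 1"
  shows "prod f (sym_diff I J) = prod f I * prod f J"
proof -
  have I: "prod f I = prod f (I - J) * prod f (I \<inter> J)"
    using prod.Int_Diff[OF assms(1), of f J] by (simp add: mult.commute)
  have J: "prod f J = prod f (J - I) * prod f (I \<inter> J)"
    using prod.Int_Diff[OF assms(2), of f I] by (simp add: mult.commute Int_commute)
  have one: "prod f (I \<inter> J) * prod f (I \<inter> J) = 1"
    using assms(3) by (simp add: prod.distrib[symmetric])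
  have "prod f (sym_diff I J) = prod f (I - J) * prod f (J - I)"
    using assms by (subst prod.union_disjoint) auto
  also have "\<dots> = prod f I * prod f J"
    unfolding I J using one by (simp add: algebra_simps)
  finally show ?thesis .
qed

lemma cl_sign_eq_prod:
  assumes "finite I" "finite J"
  shows "cl_sign I J =
    (\<Prod>i\<in>I. \<Prod>j\<in>J. if j < i then -1 else 1) * (1/2) ^ card (I \<inter> J)"
proof -
  have "(\<Prod>i\<in>I. \<Prod>j\<in>J. if j < i then -1 else 1) =
      (\<Prod>p\<in>I \<times> J. if snd p < fst p then -1 else (1::real))"
    by (subst prod.cartesian_product) (simp add: case_prod_beta)
  also have "\<dots> = (\<Prod>p\<in>{p \<in> I \<times> J. snd p < fst p}. -1)"
    using assms by (intro prod.mono_neutral_cong_right) auto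
  also have "{p \<in> I \<times> J. snd p < fst p} = {(i, j). i \<in> I \<and> j \<in> J \<and> j < i}" by auto
  finally show ?thesis by (simp add: cl_sign_def)
qed

lemma cl_sign_cocycle:
  assumes "finite I" "finite J" "finite K"
  shows "cl_sign I J * cl_sign (sym_diff I J) K = cl_sign J K * cl_sign I (sym_diff J K)"
proof -
  let ?q = "\<lambda>i j. if j < i then -1 else 1 :: real"
  let ?s = "\<lambda>I J. \<Prod>i\<in>I. \<Prod>j\<in>J. ?q i j"
  have s1: "?s (sym_diff I J) K = ?s I K * ?s J K"
    using assms by (intro prod_sym_diff) (auto simp: prod.distrib[symmetric] intro!: prod.neutral)
  have "?s I (sym_diff J K) = (\<Prod>i\<in>I. (\<Prod>j\<in>J. ?q i j) * (\<Prod>j\<in>K. ?q i j))"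
    by (intro prod.cong refl prod_sym_diff) (use assms in auto)
  then have s2: "?s I (sym_diff J K) = ?s I J * ?s I K"
    by (simp add: prod.distrib)
  let ?U = "I \<union> J \<union> K"
  have fU: "finite ?U" using assms by auto
  have c: "card X = (\<Sum>u\<in>?U. of_bool (u \<in> X))" if "X \<subseteq> ?U" for X
    using that fU by (simp add: Int_absorb1)
  have card: "card (I \<inter> J) + card (sym_diff I J \<inter> K) = card (J \<inter> K) + card (I \<inter> sym_diff J K)"
  proof -
    have "card (I \<inter> J) + card (sym_diff I J \<inter> K) =
        (\<Sum>u\<in>?U. of_bool (u \<in> I \<inter> J) + of_bool (u \<in> sym_diff I J \<inter> K))"
      by (subst (1 2) c) (auto simp del: sum_of_bool_eq simp: sum.distrib)
    also have "\<dots> = (\<Sum>u\<in>?U. of_bool (u \<in> J \<inter> K) + of_bool (u \<in> I \<inter> sym_diff J K))"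
      by (rule sum.cong) (auto simp: of_bool_def)
    also have "\<dots> = card (J \<inter> K) + card (I \<inter> sym_diff J K)"
      by (subst (1 2) c) (auto simp del: sum_of_bool_eq simp: sum.distrib)
    finally show ?thesis .
  qed
  have "cl_sign I J * cl_sign (sym_diff I J) K =
      ?s I J * ?s I K * ?s J K * (1/2) ^ (card (I \<inter> J) + card (sym_diff I J \<inter> K))"
    using assms by (simp add: cl_sign_eq_prod s1 power_add)
  also have "\<dots> = cl_sign J K * cl_sign I (sym_diff J K)"
    using assms by (subst card) (simp add: cl_sign_eq_prod s2 power_add)
  finally show ?thesis .
qed

lemma cl_sign_empty [simp]: "cl_sign {} J = 1" "cl_sign I {} = 1"
  by (simp_all add: cl_sign_def)

instantiation cliff :: real_algebra_1
begin

lift_definition one_cliff :: cliff is "\<lambda>I. if I = {} then 1 else 0" by simp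

instance
proof
  fix x y z :: cliff and a :: real
  let ?S = "\<lambda>x. {I. cl_coeff x I \<noteq> 0}"
  show "x * y * z = x * (y * z)"
  proof (rule cl_eqI)
    fix K
    let ?T = "(\<lambda>(I, J). sym_diff I J) ` (?S x \<times> ?S y)"
    let ?f = "cl_coeff x" and ?g = "cl_coeff y" and ?h = "cl_coeff z"
    have xy: "?S (x * y) \<subseteq> ?T"
    proof
      fix L assume "L \<in> ?S (x * y)"
      then have "(\<Sum>I | ?f I \<noteq> 0. ?f I * ?g (sym_diff I L) * cl_sign I (sym_diff I L)) \<noteq> 0"
        by (simp add: times_cliff.rep_eq)
      from sum.not_neutral_contains_not_neutral[OF this]
      obtain I where "?f I \<noteq> 0" "?g (sym_diff I L) \<noteq> 0" by auto
      then have "(I, sym_diff I L) \<in> ?S x \<times> ?S y" by simp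
      then show "L \<in> ?T" by (rule image_eqI[rotated]) (use sym_diff_cancel in auto)
    qed
    have fT: "finite ?T" by (intro finite_imageI finite_cartesian_product finite_cl_supp)
    have inner: "(\<Sum>L\<in>?T. ?f I * ?g (sym_diff I L) * cl_sign I (sym_diff I L) *
          ?h (sym_diff L K) * cl_sign L (sym_diff L K)) =
        (\<Sum>J\<in>?S y. ?f I * ?g J * cl_sign I J *
          ?h (sym_diff (sym_diff I J) K) * cl_sign (sym_diff I J) (sym_diff (sym_diff I J) K))"
      if I: "I \<in> ?S x" for I
    proof -
      have "(\<Sum>L\<in>?T. ?f I * ?g (sym_diff I L) * cl_sign I (sym_diff I L) *
          ?h (sym_diff L K) * cl_sign L (sym_diff L K)) =
        (\<Sum>L\<in>sym_diff I ` ?S y. ?f I * ?g (sym_diff I L) * cl_sign I (sym_diff I L) *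
          ?h (sym_diff L K) * cl_sign L (sym_diff L K))"
      proof (rule sum.mono_neutral_right[OF fT])
        show "sym_diff I ` ?S y \<subseteq> ?T" using I by force
        show "\<forall>L\<in>?T - sym_diff I ` ?S y. ?f I * ?g (sym_diff I L) * cl_sign I (sym_diff I L) *
            ?h (sym_diff L K) * cl_sign L (sym_diff L K) = 0"
        proof
          fix L assume L: "L \<in> ?T - sym_diff I ` ?S y"
          have "?g (sym_diff I L) = 0"
          proof (rule ccontr)
            assume "?g (sym_diff I L) \<noteq> 0"
            then have "sym_diff I (sym_diff I L) \<in> sym_diff I ` ?S y" by blast
            with L show False by (simp add: sym_diff_cancel)
          qed
          then show "?f I * ?g (sym_diff I L) * cl_sign I (sym_diff I L) *
            ?h (sym_diff L K) * cl_sign L (sym_diff L K) = 0" by simp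
        qed
      qed
      also have "\<dots> = (\<Sum>J\<in>?S y. ?f I * ?g J * cl_sign I J *
          ?h (sym_diff (sym_diff I J) K) * cl_sign (sym_diff I J) (sym_diff (sym_diff I J) K))"
        using inj_on_subset[OF inj_sym_diff[of I] subset_UNIV]
        by (subst sum.reindex) (simp_all add: sym_diff_cancel)
      finally show ?thesis .
    qed
    have "cl_coeff (x * y * z) K =
        (\<Sum>L\<in>?T. cl_coeff (x * y) L * ?h (sym_diff L K) * cl_sign L (sym_diff L K))"
      by (rule cl_coeff_times[OF fT xy])
    also have "\<dots> = (\<Sum>L\<in>?T. \<Sum>I\<in>?S x. ?f I * ?g (sym_diff I L) * cl_sign I (sym_diff I L) *
          ?h (sym_diff L K) * cl_sign L (sym_diff L K))"
      by (simp add: times_cliff.rep_eq sum_distrib_right)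
    also have "\<dots> = (\<Sum>I\<in>?S x. \<Sum>L\<in>?T. ?f I * ?g (sym_diff I L) * cl_sign I (sym_diff I L) *
          ?h (sym_diff L K) * cl_sign L (sym_diff L K))"
      by (rule sum.swap)
    also have "\<dots> = (\<Sum>I\<in>?S x. \<Sum>J\<in>?S y. ?f I * ?g J * cl_sign I J *
          ?h (sym_diff (sym_diff I J) K) * cl_sign (sym_diff I J) (sym_diff (sym_diff I J) K))"
      using inner by (rule sum.cong[OF refl])
    also have "\<dots> = (\<Sum>I\<in>?S x. \<Sum>J\<in>?S y. ?f I * (?g J * ?h (sym_diff J (sym_diff I K)) *
          cl_sign J (sym_diff J (sym_diff I K))) * cl_sign I (sym_diff I K))"
    proof (intro sum.cong refl)
      fix I J assume IJ: "I \<in> ?S x" "J \<in> ?S y"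
      let ?L = "sym_diff (sym_diff I J) K"
      have L: "sym_diff J (sym_diff I K) = ?L" "sym_diff J ?L = sym_diff I K" by blast+
      show "?f I * ?g J * cl_sign I J * ?h ?L * cl_sign (sym_diff I J) ?L =
        ?f I * (?g J * ?h (sym_diff J (sym_diff I K)) * cl_sign J (sym_diff J (sym_diff I K))) *
          cl_sign I (sym_diff I K)"
      proof (cases "?h ?L = 0")
        case True
        then show ?thesis unfolding L by simp
      next
        case False
        have "?f I \<noteq> 0" "?g J \<noteq> 0" using IJ by simp_all
        from this[THEN cl_supp_finite] cl_supp_finite[OF False]
        have fin: "finite I" "finite J" "finite ?L" .
        have "cl_sign I J * cl_sign (sym_diff I J) ?L = cl_sign J ?L * cl_sign I (sym_diff I K)"
          using cl_sign_cocycle[OF fin] unfolding L .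
        then show ?thesis unfolding L by (simp add: algebra_simps)
      qed
    qed
    also have "\<dots> = cl_coeff (x * (y * z)) K"
      by (simp only: times_cliff.rep_eq sum_distrib_left sum_distrib_right)
    finally show "cl_coeff (x * y * z) K = cl_coeff (x * (y * z)) K" .
  qed
  show "(x + y) * z = x * z + y * z"
  proof (rule cl_eqI)
    fix K
    let ?U = "?S x \<union> ?S y"
    have U: "finite ?U" "?S x \<subseteq> ?U" "?S y \<subseteq> ?U" "?S (x + y) \<subseteq> ?U"
      by (auto simp: finite_cl_supp plus_cliff.rep_eq)
    show "cl_coeff ((x + y) * z) K = cl_coeff (x * z + y * z) K"
      by (simp only: plus_cliff.rep_eq[of "x * z"] cl_coeff_times[OF U(1,2)]
          cl_coeff_times[OF U(1,3)] cl_coeff_times[OF U(1,4)])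
        (simp only: plus_cliff.rep_eq sum.distrib distrib_right)
  qed
  show "x * (y + z) = x * y + x * z"
    by (rule cl_eqI)
      (simp only: times_cliff.rep_eq plus_cliff.rep_eq sum.distrib distrib_left distrib_right)
  show "scaleR a x * y = scaleR a (x * y)"
  proof (rule cl_eqI)
    fix K
    have sub: "?S (scaleR a x) \<subseteq> ?S x" by (auto simp: scaleR_cliff.rep_eq)
    show "cl_coeff (scaleR a x * y) K = cl_coeff (scaleR a (x * y)) K"
      by (simp only: scaleR_cliff.rep_eq[of a "x * y"] cl_coeff_times[OF finite_cl_supp sub]
          times_cliff.rep_eq[of x])
        (simp only: scaleR_cliff.rep_eq sum_distrib_left mult.assoc)
  qed
  show "x * scaleR a y = scaleR a (x * y)"
    by (rule cl_eqI)
      (simp only: times_cliff.rep_eq scaleR_cliff.rep_eq sum_distrib_left mult.assoc mult.left_commute[of _ a])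
  show "1 * x = x"
  proof (rule cl_eqI)
    fix K
    have "?S 1 \<subseteq> {{}}" by (auto simp: one_cliff.rep_eq)
    then show "cl_coeff (1 * x) K = cl_coeff x K"
      by (subst cl_coeff_times[of "{{}}"]) (auto simp: one_cliff.rep_eq)
  qed
  show "x * 1 = x"
  proof (rule cl_eqI)
    fix K
    have "cl_coeff (x * 1) K = (\<Sum>I\<in>insert K (?S x). cl_coeff x I * cl_coeff 1 (sym_diff I K) *
        cl_sign I (sym_diff I K))"
      by (rule cl_coeff_times) (auto simp: finite_cl_supp)
    also have "\<dots> = (\<Sum>I\<in>insert K (?S x). if I = K then cl_coeff x K else 0)"
      by (rule sum.cong) (auto simp: one_cliff.rep_eq)
    also have "\<dots> = cl_coeff x K" by (simp add: finite_cl_supp)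
    finally show "cl_coeff (x * 1) K = cl_coeff x K" .
  qed
  show "(0::cliff) \<noteq> 1"
    by (metis one_cliff.rep_eq zero_cliff.rep_eq zero_neq_one)
qed

end

lift_definition cl_monom :: "nat set \<Rightarrow> cliff" is "\<lambda>I J. if finite I \<and> J = I then 1 else 0"
  by (auto intro: finite_subset[of _ "{I}" for I])

definition cl_gen :: "nat \<Rightarrow> cliff" where
  "cl_gen i = cl_monom {i}"

lemma cl_monom_mult:
  assumes "finite I" "finite J"
  shows "cl_monom I * cl_monom J = cl_sign I J *\<^sub>R cl_monom (sym_diff I J)"
proof (rule cl_eqI)
  fix K
  have "sym_diff I K = J \<longleftrightarrow> K = sym_diff I J" by blast
  then show "cl_coeff (cl_monom I * cl_monom J) K = cl_coeff (cl_sign I J *\<^sub>R cl_monom (sym_diff I J)) K"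
    using assms by (subst cl_coeff_times[of "{I}"])
      (auto simp: cl_monom.rep_eq scaleR_cliff.rep_eq sym_diff_cancel)
qed

lemma cl_monom_empty: "cl_monom {} = 1"
  by (rule cl_eqI) (simp add: cl_monom.rep_eq one_cliff.rep_eq)

lemma cl_gen_relation: "cl_gen i * cl_gen j + cl_gen j * cl_gen i = (if i = j then 1 else 0)"
proof (cases "i = j")
  case True
  have e: "{(a, b). a \<in> {i} \<and> b \<in> {i} \<and> b < a} = {}" by auto
  have "cl_sign {i} {i} = 1/2" unfolding cl_sign_def e by simp
  then have "cl_gen i * cl_gen i = (1/2) *\<^sub>R 1"
    by (simp only: cl_gen_def cl_monom_mult[OF finite.insertI[OF finite.emptyI] finite.insertI[OF finite.emptyI]])
      (simp add: cl_monom_empty)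
  then show ?thesis using True by (simp add: scaleR_left_distrib[symmetric])
next
  case False
  have "{(a, b). a = i \<and> b = j \<and> b < a} = (if j < i then {(i, j)} else {})" for i j :: nat by auto
  then have "cl_sign {i} {j} = (if j < i then -1 else 1)" if "i \<noteq> j" for i j
    using that by (simp add: cl_sign_def)
  with False show ?thesis
    by (auto simp: cl_gen_def cl_monom_mult Un_commute scaleR_left_distrib[symmetric])
qed

lemma cl_monom_insert_min:
  assumes "finite I" "\<And>j. j \<in> I \<Longrightarrow> i < j"
  shows "cl_monom (insert i I) = cl_gen i * cl_monom I"
proof -
  have e: "i \<notin> I" "{(a, b). a \<in> {i} \<and> b \<in> I \<and> b < a} = {}" using assms(2) by fastforce+
  have "cl_sign {i} I = 1" unfolding cl_sign_def e(2) using e(1) by simp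
  moreover have "sym_diff {i} I = insert i I" using e(1) by auto
  ultimately show ?thesis using assms(1) by (simp add: cl_gen_def cl_monom_mult)
qed

lift_definition cl_parity :: "cliff \<Rightarrow> cliff" is "\<lambda>f I. (-1) ^ card I * f I"
  by auto

definition Clifford :: "nat \<Rightarrow> cliff monoid" where
  "Clifford n = \<lparr>carrier = span (cl_monom ` Pow {..<n}), mult = (*), one = 1\<rparr>"

text \<open>The exterior algebra on generators \<open>y\<^sub>i\<close> is represented by coefficients with respect to the
  monomials \<open>y\<^sub>I\<close>; the symbol map sends \<open>x\<^sub>I\<close> to \<open>y\<^sub>I\<close>, so it keeps the coefficients.\<close>

definition symbol :: "cliff \<Rightarrow> nat set \<Rightarrow> real" where
  "symbol x = cl_coeff x"

section \<open>Smooth manifolds and tangent vectors\<close>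

fun Ck_on :: "nat \<Rightarrow> ('a::real_normed_vector \<Rightarrow> 'b::real_normed_vector) \<Rightarrow> 'a set \<Rightarrow> bool" where
  "Ck_on 0 f S = continuous_on S f"
| "Ck_on (Suc k) f S =
    ((\<forall>x\<in>S. f differentiable at x) \<and> (\<forall>v. Ck_on k (\<lambda>x. frechet_derivative f (at x) v) S))"

text \<open>Only used for open subsets of finite-dimensional spaces.\<close>

definition smooth_on :: "('a::real_normed_vector \<Rightarrow> 'b::real_normed_vector) \<Rightarrow> 'a set \<Rightarrow> bool" where
  "smooth_on f S \<longleftrightarrow> (\<forall>k. Ck_on k f S)"

text \<open>A chart \<open>(U, \<phi>)\<close> takes values in a finite-dimensional normed space \<^typ>\<open>'e\<close>, which is allowed
  to be \<open>0\<close>-dimensional (unlike a type of class \<^class>\<open>euclidean_space\<close>).\<close>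

type_synonym ('m, 'e) chart = "'m set \<times> ('m \<Rightarrow> 'e)"

definition chart_inv :: "('m, 'e) chart \<Rightarrow> 'e \<Rightarrow> 'm" where
  "chart_inv c = inv_into (fst c) (snd c)"

definition transition :: "('m, 'e) chart \<Rightarrow> ('m, 'e) chart \<Rightarrow> 'e \<Rightarrow> 'e" where
  "transition c d = snd d \<circ> chart_inv c"

definition manifold ::
  "('m::{t2_space, second_countable_topology}, 'e::real_normed_vector) chart set \<Rightarrow> bool" where
  "manifold A \<longleftrightarrow>
    (\<exists>B::'e set. finite B \<and> span B = UNIV) \<and>
    (\<forall>c\<in>A. open (fst c) \<and> open (snd c ` fst c) \<and>
       homeomorphism (fst c) (snd c ` fst c) (snd c) (chart_inv c)) \<and>
    (\<Union>c\<in>A. fst c) = UNIV \<and>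
    (\<forall>c\<in>A. \<forall>d\<in>A. smooth_on (transition c d) (snd c ` (fst c \<inter> fst d)))"

definition smooth_map ::
  "('m::topological_space, 'e::real_normed_vector) chart set \<Rightarrow>
   ('n::topological_space, 'f::real_normed_vector) chart set \<Rightarrow> ('m \<Rightarrow> 'n) \<Rightarrow> bool" where
  "smooth_map A B F \<longleftrightarrow> continuous_on UNIV F \<and>
    (\<forall>c\<in>A. \<forall>d\<in>B. smooth_on (snd d \<circ> F \<circ> chart_inv c) (snd c ` (fst c \<inter> F -` fst d)))"

definition prod_atlas ::
  "('m, 'e) chart set \<Rightarrow> ('n, 'f) chart set \<Rightarrow> ('m \<times> 'n, 'e \<times> 'f) chart set" where
  "prod_atlas A B = {(fst c \<times> fst d, map_prod (snd c) (snd d)) | c d. c \<in> A \<and> d \<in> B}"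

definition real_line :: "(real, real) chart set" where
  "real_line = {(UNIV, id)}"

text \<open>A tangent vector at \<open>m\<close> is a family of coordinate vectors, one for each chart around \<open>m\<close>, that
  transforms by the derivatives of the transition maps. Coordinates with respect to all other
  charts are set to \<open>0\<close>.\<close>

typedef (overloaded) ('m, 'e) tvec = "UNIV :: (('m, 'e) chart \<Rightarrow> 'e) set"
  morphisms coord Tvec
  by simp

setup_lifting type_definition_tvec

instantiation tvec :: (type, real_vector) real_vector
begin

lift_definition zero_tvec :: "('a, 'b) tvec" is "\<lambda>_. 0" .
lift_definition plus_tvec :: "('a, 'b) tvec \<Rightarrow> ('a, 'b) tvec \<Rightarrow> ('a, 'b) tvec"
  is "\<lambda>v w c. v c + w c" .
lift_definition minus_tvec :: "('a, 'b) tvec \<Rightarrow> ('a, 'b) tvec \<Rightarrow> ('a, 'b) tvec"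
  is "\<lambda>v w c. v c - w c" .
lift_definition uminus_tvec :: "('a, 'b) tvec \<Rightarrow> ('a, 'b) tvec" is "\<lambda>v c. - v c" .
lift_definition scaleR_tvec :: "real \<Rightarrow> ('a, 'b) tvec \<Rightarrow> ('a, 'b) tvec" is "\<lambda>a v c. a *\<^sub>R v c" .

instance
  by standard (transfer; simp add: fun_eq_iff algebra_simps)+

end

definition charts_at :: "('m, 'e) chart set \<Rightarrow> 'm \<Rightarrow> ('m, 'e) chart set" where
  "charts_at A m = {c \<in> A. m \<in> fst c}"

definition tangent_space ::
  "('m, 'e::real_normed_vector) chart set \<Rightarrow> 'm \<Rightarrow> ('m, 'e) tvec set" where
  "tangent_space A m =
    {v. (\<forall>c\<in>charts_at A m. \<forall>d\<in>charts_at A m.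
           coord v d = frechet_derivative (transition c d) (at (snd c m)) (coord v c)) \<and>
        (\<forall>c. c \<notin> charts_at A m \<longrightarrow> coord v c = 0)}"

text \<open>The tangent vector at \<open>m\<close> with prescribed coordinates \<open>u\<close> in the chart \<open>c\<close>.\<close>

definition coord_vec ::
  "('m, 'e::real_normed_vector) chart set \<Rightarrow> ('m, 'e) chart \<Rightarrow> 'm \<Rightarrow> 'e \<Rightarrow> ('m, 'e) tvec" where
  "coord_vec A c m u =
    Tvec (\<lambda>d. if d \<in> charts_at A m then frechet_derivative (transition c d) (at (snd c m)) u else 0)"

definition some_chart :: "('m, 'e) chart set \<Rightarrow> 'm \<Rightarrow> ('m, 'e) chart" where
  "some_chart A m = (SOME c. c \<in> charts_at A m)"

definition differential ::
  "('m, 'e::real_normed_vector) chart set \<Rightarrow> ('n, 'f::real_normed_vector) chart set \<Rightarrow>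
   ('m \<Rightarrow> 'n) \<Rightarrow> 'm \<Rightarrow> ('m, 'e) tvec \<Rightarrow> ('n, 'f) tvec" where
  "differential A B F m v =
    (let c = some_chart A m in
     Tvec (\<lambda>d. if d \<in> charts_at B (F m)
       then frechet_derivative (snd d \<circ> F \<circ> chart_inv c) (at (snd c m)) (coord v c) else 0))"

definition velocity ::
  "('m, 'e::real_normed_vector) chart set \<Rightarrow> (real \<Rightarrow> 'm) \<Rightarrow> real \<Rightarrow> ('m, 'e) tvec" where
  "velocity A \<gamma> t =
    Tvec (\<lambda>d. if d \<in> charts_at A (\<gamma> t) then vector_derivative (snd d \<circ> \<gamma>) (at t) else 0)"

text \<open>In a chart, \<open>[X, Y] = DY(X) - DX(Y)\<close>.\<close>

definition vf_bracket ::
  "('m, 'e::real_normed_vector) chart set \<Rightarrow> ('m \<Rightarrow> ('m, 'e) tvec) \<Rightarrow> ('m \<Rightarrow> ('m, 'e) tvec) \<Rightarrow>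
   'm \<Rightarrow> ('m, 'e) tvec" where
  "vf_bracket A X Y m =
    Tvec (\<lambda>c. if c \<in> charts_at A m
      then frechet_derivative (\<lambda>y. coord (Y (chart_inv c y)) c) (at (snd c m)) (coord (X m) c)
         - frechet_derivative (\<lambda>y. coord (X (chart_inv c y)) c) (at (snd c m)) (coord (Y m) c)
      else 0)"

section \<open>Exterior forms\<close>

text \<open>A form of mixed degree on a vector space is a function on lists of vectors whose restriction
  to lists of length \<open>k\<close> is the degree \<open>k\<close> part. The wedge product with respect to a bilinear
  pairing \<open>B\<close> of the coefficients is the sum over shuffles, so that
  \<open>(\<alpha> \<and> \<beta>)(v, w) = B (\<alpha> v) (\<beta> w) - B (\<alpha> w) (\<beta> v)\<close> for covectors.\<close>

definition shuffle_sign :: "nat set \<Rightarrow> nat \<Rightarrow> real" where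
  "shuffle_sign S k = (-1) ^ card {(i, j). i \<in> S \<and> j \<in> {..<k} - S \<and> j < i}"

definition wedge_by ::
  "('a \<Rightarrow> 'b \<Rightarrow> 'c::real_vector) \<Rightarrow> ('v list \<Rightarrow> 'a) \<Rightarrow> ('v list \<Rightarrow> 'b) \<Rightarrow> 'v list \<Rightarrow> 'c" where
  "wedge_by B \<alpha> \<beta> vs =
    (\<Sum>S\<in>Pow {..<length vs}. shuffle_sign S (length vs) *\<^sub>R B (\<alpha> (nths vs S)) (\<beta> (nths vs (- S))))"

abbreviation wedge :: "('v list \<Rightarrow> real) \<Rightarrow> ('v list \<Rightarrow> real) \<Rightarrow> 'v list \<Rightarrow> real" where
  "wedge \<equiv> wedge_by (*)"

definition unit_form :: "'v list \<Rightarrow> real" where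
  "unit_form vs = (if vs = [] then 1 else 0)"

definition one_form :: "('v \<Rightarrow> 'a::zero) \<Rightarrow> 'v list \<Rightarrow> 'a" where
  "one_form a vs = (case vs of [v] \<Rightarrow> a v | _ \<Rightarrow> 0)"

definition wedge_power :: "('v list \<Rightarrow> real) \<Rightarrow> nat \<Rightarrow> 'v list \<Rightarrow> real" where
  "wedge_power \<alpha> k = (wedge \<alpha> ^^ k) unit_form"

text \<open>For a form without degree \<open>0\<close> part, the series is a finite sum at each argument.\<close>

definition exp_form :: "('v list \<Rightarrow> real) \<Rightarrow> 'v list \<Rightarrow> real" where
  "exp_form \<alpha> vs = (\<Sum>k. wedge_power \<alpha> k vs / fact k)"

type_synonym ('m, 'e) form = "'m \<Rightarrow> ('m, 'e) tvec list \<Rightarrow> real"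

text \<open>Values of a form outside the tangent spaces are irrelevant.\<close>

definition form_eq ::
  "('m, 'e::real_normed_vector) chart set \<Rightarrow> ('m, 'e) form \<Rightarrow> ('m, 'e) form \<Rightarrow> bool" where
  "form_eq A \<alpha> \<beta> \<longleftrightarrow> (\<forall>m. \<forall>vs\<in>lists (tangent_space A m). \<alpha> m vs = \<beta> m vs)"

definition alternating_form :: "'v::real_vector set \<Rightarrow> nat \<Rightarrow> ('v list \<Rightarrow> real) \<Rightarrow> bool" where
  "alternating_form V k \<alpha> \<longleftrightarrow>
    (\<forall>vs. length vs \<noteq> k \<longrightarrow> \<alpha> vs = 0) \<and>
    (\<forall>vs\<in>lists V. \<forall>i u w a b. length vs = k \<and> i < k \<and> u \<in> V \<and> w \<in> V \<longrightarrow>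
       \<alpha> (vs[i := a *\<^sub>R u + b *\<^sub>R w]) = a * \<alpha> (vs[i := u]) + b * \<alpha> (vs[i := w])) \<and>
    (\<forall>vs\<in>lists V. \<forall>i j. length vs = k \<and> i < j \<and> j < k \<and> vs ! i = vs ! j \<longrightarrow> \<alpha> vs = 0)"

definition diff_form ::
  "('m, 'e::real_normed_vector) chart set \<Rightarrow> nat \<Rightarrow> ('m, 'e) form \<Rightarrow> bool" where
  "diff_form A k \<alpha> \<longleftrightarrow>
    (\<forall>m. alternating_form (tangent_space A m) k (\<alpha> m)) \<and>
    (\<forall>c\<in>A. \<forall>us. length us = k \<longrightarrow>
       smooth_on (\<lambda>y. \<alpha> (chart_inv c y) (map (coord_vec A c (chart_inv c y)) us)) (snd c ` fst c))"

definition wedge_forms :: "('m, 'e) form \<Rightarrow> ('m, 'e) form \<Rightarrow> ('m, 'e) form" where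
  "wedge_forms \<alpha> \<beta> m = wedge (\<alpha> m) (\<beta> m)"

definition pullback ::
  "('m, 'e::real_normed_vector) chart set \<Rightarrow> ('n, 'f::real_normed_vector) chart set \<Rightarrow>
   ('m \<Rightarrow> 'n) \<Rightarrow> ('n, 'f) form \<Rightarrow> ('m, 'e) form" where
  "pullback A B F \<beta> m vs = \<beta> (F m) (map (differential A B F m) vs)"

definition contraction :: "('m \<Rightarrow> ('m, 'e) tvec) \<Rightarrow> ('m, 'e) form \<Rightarrow> ('m, 'e) form" where
  "contraction X \<alpha> m vs = \<alpha> m (X m # vs)"

definition degree_part :: "nat \<Rightarrow> ('m, 'e) form \<Rightarrow> ('m, 'e) form" where
  "degree_part k \<alpha> m vs = (if length vs = k then \<alpha> m vs else 0)"

text \<open>For an operator that lowers the degree, only finitely many terms are nonzero on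
  tangent vectors.\<close>

definition exp_operator ::
  "(('m, 'e) form \<Rightarrow> ('m, 'e) form) \<Rightarrow> ('m, 'e) form \<Rightarrow> ('m, 'e) form" where
  "exp_operator D \<alpha> m vs = (\<Sum>k. (D ^^ k) \<alpha> m vs / fact k)"

text \<open>The exterior derivative in a chart \<open>c\<close>: the tangent vectors at \<open>m\<close> are extended to vector fields
  with constant coordinates in \<open>c\<close>, and
  \<open>(d\<alpha>)(v\<^sub>0, \<dots>, v\<^sub>k) = \<Sum>\<^sub>i (-1)\<^sup>i v\<^sub>i(\<alpha>(v\<^sub>0, \<dots>, v\<^sub>i omitted, \<dots>, v\<^sub>k))\<close>.\<close>

definition ext_deriv ::
  "('m, 'e::real_normed_vector) chart set \<Rightarrow> ('m, 'e) form \<Rightarrow> ('m, 'e) form" where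
  "ext_deriv A \<alpha> m vs =
    (let c = some_chart A m in
     \<Sum>i<length vs. (-1) ^ i *
       frechet_derivative
         (\<lambda>y. \<alpha> (chart_inv c y)
            (map (\<lambda>v. coord_vec A c (chart_inv c y) (coord v c)) (take i vs @ drop (Suc i) vs)))
         (at (snd c m)) (coord (vs ! i) c))"

section \<open>Lie groups\<close>

definition lie_group ::
  "('g::{t2_space, second_countable_topology}, 'e::real_normed_vector) chart set \<Rightarrow> 'g monoid \<Rightarrow> bool"
where
  "lie_group A G \<longleftrightarrow> group G \<and> carrier G = UNIV \<and> manifold A \<and>
    smooth_map (prod_atlas A A) A (\<lambda>(g, h). g \<otimes>\<^bsub>G\<^esub> h) \<and> smooth_map A A (\<lambda>g. inv\<^bsub>G\<^esub> g)"

definition compact_lie_group ::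
  "('g::{t2_space, second_countable_topology}, 'e::real_normed_vector) chart set \<Rightarrow> 'g monoid \<Rightarrow> bool"
where
  "compact_lie_group A G \<longleftrightarrow> lie_group A G \<and> compact (UNIV :: 'g set)"

definition lie_algebra ::
  "('g, 'e::real_normed_vector) chart set \<Rightarrow> 'g monoid \<Rightarrow> ('g, 'e) tvec set" where
  "lie_algebra A G = tangent_space A \<one>\<^bsub>G\<^esub>"

definition Ad ::
  "('g, 'e::real_normed_vector) chart set \<Rightarrow> 'g monoid \<Rightarrow> 'g \<Rightarrow> ('g, 'e) tvec \<Rightarrow> ('g, 'e) tvec" where
  "Ad A G g = differential A A (\<lambda>h. g \<otimes>\<^bsub>G\<^esub> h \<otimes>\<^bsub>G\<^esub> inv\<^bsub>G\<^esub> g) \<one>\<^bsub>G\<^esub>"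

text \<open>The Lie bracket on the Lie algebra is that of left-invariant vector fields.\<close>

definition lie_bracket ::
  "('g, 'e::real_normed_vector) chart set \<Rightarrow> 'g monoid \<Rightarrow>
   ('g, 'e) tvec \<Rightarrow> ('g, 'e) tvec \<Rightarrow> ('g, 'e) tvec" where
  "lie_bracket A G \<xi> \<zeta> =
    vf_bracket A (\<lambda>g. differential A A (\<lambda>h. g \<otimes>\<^bsub>G\<^esub> h) \<one>\<^bsub>G\<^esub> \<xi>)
                 (\<lambda>g. differential A A (\<lambda>h. g \<otimes>\<^bsub>G\<^esub> h) \<one>\<^bsub>G\<^esub> \<zeta>) \<one>\<^bsub>G\<^esub>"

text \<open>\<open>one_param A G \<xi> t\<close> is \<open>exp(t\<xi>)\<close>: the smooth homomorphism from the real line with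
  initial velocity \<open>\<xi>\<close>, which exists and is unique.\<close>

definition one_param ::
  "('g::topological_space, 'e::real_normed_vector) chart set \<Rightarrow> 'g monoid \<Rightarrow>
   ('g, 'e) tvec \<Rightarrow> real \<Rightarrow> 'g" where
  "one_param A G \<xi> =
    (SOME \<gamma>. smooth_map real_line A \<gamma> \<and> (\<forall>s t. \<gamma> (s + t) = \<gamma> s \<otimes>\<^bsub>G\<^esub> \<gamma> t) \<and> velocity A \<gamma> 0 = \<xi>)"

definition theta_L ::
  "('g, 'e::real_normed_vector) chart set \<Rightarrow> 'g monoid \<Rightarrow> 'g \<Rightarrow> ('g, 'e) tvec \<Rightarrow> ('g, 'e) tvec" where
  "theta_L A G g = differential A A (\<lambda>h. inv\<^bsub>G\<^esub> g \<otimes>\<^bsub>G\<^esub> h) g"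

definition theta_R ::
  "('g, 'e::real_normed_vector) chart set \<Rightarrow> 'g monoid \<Rightarrow> 'g \<Rightarrow> ('g, 'e) tvec \<Rightarrow> ('g, 'e) tvec" where
  "theta_R A G g = differential A A (\<lambda>h. h \<otimes>\<^bsub>G\<^esub> inv\<^bsub>G\<^esub> g) g"

type_synonym ('g, 'e) pairing = "('g, 'e) tvec \<Rightarrow> ('g, 'e) tvec \<Rightarrow> real"

definition invariant_inner_product ::
  "('g, 'e::real_normed_vector) chart set \<Rightarrow> 'g monoid \<Rightarrow> ('g, 'e) pairing \<Rightarrow> bool" where
  "invariant_inner_product A G ip \<longleftrightarrow>
    (\<forall>\<xi>\<in>lie_algebra A G. \<forall>\<zeta>\<in>lie_algebra A G.
       ip \<xi> \<zeta> = ip \<zeta> \<xi> \<and> (\<forall>g. ip (Ad A G g \<xi>) (Ad A G g \<zeta>) = ip \<xi> \<zeta>) \<and>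
       (\<forall>\<mu>\<in>lie_algebra A G. \<forall>a b. ip (a *\<^sub>R \<xi> + b *\<^sub>R \<zeta>) \<mu> = a * ip \<xi> \<mu> + b * ip \<zeta> \<mu>)) \<and>
    (\<forall>\<xi>\<in>lie_algebra A G. \<xi> \<noteq> 0 \<longrightarrow> ip \<xi> \<xi> > 0)"

definition orthonormal_basis ::
  "('g, 'e::real_normed_vector) chart set \<Rightarrow> 'g monoid \<Rightarrow> ('g, 'e) pairing \<Rightarrow>
   nat \<Rightarrow> (nat \<Rightarrow> ('g, 'e) tvec) \<Rightarrow> bool" where
  "orthonormal_basis A G ip n e \<longleftrightarrow>
    span (e ` {..<n}) = lie_algebra A G \<and>
    (\<forall>i<n. \<forall>j<n. ip (e i) (e j) = (if i = j then 1 else 0))"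

text \<open>The form \<open>\<eta> = 1/12 \<theta>\<^sup>L \<cdot> [\<theta>\<^sup>L, \<theta>\<^sup>L]\<close>.\<close>

definition eta_form ::
  "('g, 'e::real_normed_vector) chart set \<Rightarrow> 'g monoid \<Rightarrow> ('g, 'e) pairing \<Rightarrow> ('g, 'e) form" where
  "eta_form A G ip g vs =
    (let \<theta> = one_form (theta_L A G g)
     in (1/12) * wedge_by ip \<theta> (wedge_by (lie_bracket A G) \<theta> \<theta>) vs)"

text \<open>The direct sum inner product on the Lie algebra of \<open>G \<times> G\<close>, and the elements \<open>(\<xi>, 0)\<close> and
  \<open>(0, \<xi>)\<close>, in terms of the projections and inclusions of the factors.\<close>

definition prod_ip ::
  "('g, 'e::real_normed_vector) chart set \<Rightarrow> 'g monoid \<Rightarrow> ('g, 'e) pairing \<Rightarrow>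
   ('g \<times> 'g, 'e \<times> 'e) pairing" where
  "prod_ip A G ip \<xi> \<zeta> =
    (let p = (\<one>\<^bsub>G\<^esub>, \<one>\<^bsub>G\<^esub>);
         d1 = differential (prod_atlas A A) A fst p;
         d2 = differential (prod_atlas A A) A snd p
     in ip (d1 \<xi>) (d1 \<zeta>) + ip (d2 \<xi>) (d2 \<zeta>))"

definition incl1 ::
  "('g, 'e::real_normed_vector) chart set \<Rightarrow> 'g monoid \<Rightarrow> ('g, 'e) tvec \<Rightarrow>
   ('g \<times> 'g, 'e \<times> 'e) tvec" where
  "incl1 A G = differential A (prod_atlas A A) (\<lambda>g. (g, \<one>\<^bsub>G\<^esub>)) \<one>\<^bsub>G\<^esub>"

definition incl2 ::
  "('g, 'e::real_normed_vector) chart set \<Rightarrow> 'g monoid \<Rightarrow> ('g, 'e) tvec \<Rightarrow>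
   ('g \<times> 'g, 'e \<times> 'e) tvec" where
  "incl2 A G = differential A (prod_atlas A A) (\<lambda>g. (\<one>\<^bsub>G\<^esub>, g)) \<one>\<^bsub>G\<^esub>"

section \<open>Lifts of the adjoint action to the Pin group\<close>

definition cl_incl :: "('g, 'e) pairing \<Rightarrow> nat \<Rightarrow> (nat \<Rightarrow> ('g, 'e) tvec) \<Rightarrow> ('g, 'e) tvec \<Rightarrow> cliff" where
  "cl_incl ip n e \<xi> = (\<Sum>i<n. ip \<xi> (e i) *\<^sub>R cl_gen i)"

definition Pin ::
  "('g, 'e::real_normed_vector) chart set \<Rightarrow> 'g monoid \<Rightarrow> ('g, 'e) pairing \<Rightarrow>
   nat \<Rightarrow> (nat \<Rightarrow> ('g, 'e) tvec) \<Rightarrow> cliff monoid" where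
  "Pin A G ip n e =
    (units_of (Clifford n))
      \<lparr>carrier := generate (units_of (Clifford n))
         (cl_incl ip n e ` {\<xi> \<in> lie_algebra A G. ip \<xi> \<xi> = 2})\<rparr>"

text \<open>Homomorphisms of Lie groups are continuous; continuity into the (finite-dimensional) Clifford
  algebra is continuity of all coefficients.\<close>

definition pin_lift ::
  "('g::topological_space, 'e::real_normed_vector) chart set \<Rightarrow> 'g monoid \<Rightarrow> ('g, 'e) pairing \<Rightarrow>
   nat \<Rightarrow> (nat \<Rightarrow> ('g, 'e) tvec) \<Rightarrow> ('g \<Rightarrow> cliff) \<Rightarrow> bool" where
  "pin_lift A G ip n e \<tau> \<longleftrightarrow>
    \<tau> \<in> hom G (Pin A G ip n e) \<and>
    (\<forall>I. continuous_on UNIV (\<lambda>g. cl_coeff (\<tau> g) I)) \<and>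
    (\<forall>g. \<forall>\<xi>\<in>lie_algebra A G.
       cl_parity (\<tau> g) * cl_incl ip n e \<xi> * inv\<^bsub>Clifford n\<^esub> (\<tau> g) = cl_incl ip n e (Ad A G g \<xi>))"

text \<open>Substituting the one-forms \<open>1/2 \<theta>\<^sup>R \<cdot> e\<^sub>i\<close> for the generators \<open>y\<^sub>i\<close> in the symbol of \<open>\<tau>(g)\<close>.\<close>

definition T_form ::
  "('g, 'e::real_normed_vector) chart set \<Rightarrow> 'g monoid \<Rightarrow> ('g, 'e) pairing \<Rightarrow>
   nat \<Rightarrow> (nat \<Rightarrow> ('g, 'e) tvec) \<Rightarrow> ('g \<Rightarrow> cliff) \<Rightarrow> ('g, 'e) form" where
  "T_form A G ip n e \<tau> g vs =
    (\<Sum>I\<in>Pow {..<n}. symbol (\<tau> g) I *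
       foldr (\<lambda>i. wedge (one_form (\<lambda>v. 1/2 * ip (theta_R A G g v) (e i))))
         (sorted_list_of_set I) unit_form vs)"

section \<open>Group valued Hamiltonian manifolds\<close>

text \<open>In this section \<open>A\<close> is the atlas of the group and \<open>B\<close> the atlas of the manifold acted upon.\<close>

definition lie_group_action ::
  "('k::topological_space, 'e::real_normed_vector) chart set \<Rightarrow> 'k monoid \<Rightarrow>
   ('m::topological_space, 'f::real_normed_vector) chart set \<Rightarrow> ('k \<Rightarrow> 'm \<Rightarrow> 'm) \<Rightarrow> bool" where
  "lie_group_action A K B act \<longleftrightarrow>
    group_action K UNIV act \<and> smooth_map (prod_atlas A B) B (\<lambda>(k, m). act k m)"

definition generating_field ::
  "('k::topological_space, 'e::real_normed_vector) chart set \<Rightarrow> 'k monoid \<Rightarrow>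
   ('m, 'f::real_normed_vector) chart set \<Rightarrow> ('k \<Rightarrow> 'm \<Rightarrow> 'm) \<Rightarrow>
   ('k, 'e) tvec \<Rightarrow> 'm \<Rightarrow> ('m, 'f) tvec" where
  "generating_field A K B act \<xi> m = velocity B (\<lambda>t. act (one_param A K \<xi> (- t)) m) 0"

definition group_valued_hamiltonian ::
  "('k::topological_space, 'e::real_normed_vector) chart set \<Rightarrow> 'k monoid \<Rightarrow> ('k, 'e) pairing \<Rightarrow>
   ('m::{t2_space, second_countable_topology}, 'f::real_normed_vector) chart set \<Rightarrow>
   ('k \<Rightarrow> 'm \<Rightarrow> 'm) \<Rightarrow> ('m, 'f) form \<Rightarrow> ('m \<Rightarrow> 'k) \<Rightarrow> bool" where
  "group_valued_hamiltonian A K ip B act \<omega> \<Phi> \<longleftrightarrow>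
    manifold B \<and> lie_group_action A K B act \<and>
    diff_form B 2 \<omega> \<and> (\<forall>k. form_eq B (pullback B B (act k) \<omega>) \<omega>) \<and>
    smooth_map B A \<Phi> \<and> (\<forall>k m. \<Phi> (act k m) = k \<otimes>\<^bsub>K\<^esub> \<Phi> m \<otimes>\<^bsub>K\<^esub> inv\<^bsub>K\<^esub> k) \<and>
    form_eq B (ext_deriv B \<omega>) (pullback B A \<Phi> (eta_form A K ip)) \<and>
    (\<forall>\<xi>\<in>lie_algebra A K.
       form_eq B (contraction (generating_field A K B act \<xi>) \<omega>)
         (pullback B A \<Phi> (\<lambda>k. one_form (\<lambda>v. 1/2 * ip (theta_L A K k v + theta_R A K k v) \<xi>)))) \<and>
    (\<forall>m. {v \<in> tangent_space B m. \<forall>w\<in>tangent_space B m. \<omega> m [v, w] = 0} =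
         {generating_field A K B act \<xi> m | \<xi>. \<xi> \<in> lie_algebra A K \<and> Ad A K (\<Phi> m) \<xi> + \<xi> = 0})"

text \<open>The fusion of \<open>(M, \<omega>, (\<Phi>\<^sub>1, \<Phi>\<^sub>2))\<close> as a triple (action, two-form, moment map) on the same manifold.\<close>

definition fusion ::
  "('g, 'e::real_normed_vector) chart set \<Rightarrow> 'g monoid \<Rightarrow> ('g, 'e) pairing \<Rightarrow>
   ('m, 'f::real_normed_vector) chart set \<Rightarrow>
   ('g \<times> 'g \<Rightarrow> 'm \<Rightarrow> 'm) \<Rightarrow> ('m, 'f) form \<Rightarrow> ('m \<Rightarrow> 'g) \<Rightarrow> ('m \<Rightarrow> 'g) \<Rightarrow>
   ('g \<Rightarrow> 'm \<Rightarrow> 'm) \<times> ('m, 'f) form \<times> ('m \<Rightarrow> 'g)" where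
  "fusion A G ip B act \<omega> \<Phi>1 \<Phi>2 =
    (\<lambda>g. act (g, g),
     \<lambda>m vs. \<omega> m vs - 1/2 *
       wedge_by ip (one_form (\<lambda>v. theta_L A G (\<Phi>1 m) (differential B A \<Phi>1 m v)))
                   (one_form (\<lambda>v. theta_R A G (\<Phi>2 m) (differential B A \<Phi>2 m v))) vs,
     \<lambda>m. \<Phi>1 m \<otimes>\<^bsub>G\<^esub> \<Phi>2 m)"

end

theory Submission
  imports Defs
begin

text \<open>
  Fix a point \<open>m\<close>, put \<open>g\<^sub>i = \<Phi>\<^sub>i(m)\<close>, \<open>a\<^sub>i = 1/2 \<Phi>\<^sub>1\<^sup>*\<theta>\<^sup>R \<cdot> e\<^sub>i\<close> and \<open>b\<^sub>i = 1/2 \<Phi>\<^sub>2\<^sup>*\<theta>\<^sup>R \<cdot> e\<^sub>i\<close>, and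
  write \<open>S\<close> for the substitution of these \<open>2n\<close> one-forms \<open>c\<^sub>j\<close> into the symbol of an element of
  \<open>Cl(\<gg> \<oplus> \<gg>)\<close>, so that \<open>\<Gamma> = e\<^sup>\<omega> S(Z)\<close> with \<open>Z = \<tau>(g\<^sub>1) \<otimes> \<tau>(g\<^sub>2)\<close>. Clifford multiplication becomes
  \<open>S(x\<^sub>j B) + S(\<alpha>(B) x\<^sub>j) = 2 c\<^sub>j S(B)\<close> and
  \<open>\<iota>\<^sub>v S(B) = \<Sum>\<^sub>k c\<^sub>k(v) S(x\<^sub>k B - \<alpha>(B) x\<^sub>k)\<close>. Together with the moment map condition this shows that the
  contraction of \<open>e\<^sup>\<omega> S(B)\<close> with the \<open>j\<close>-th generating vector field is
  \<open>e\<^sup>\<omega> S(y\<^sub>j B + \<alpha>(B) x\<^sub>j)\<close>, where \<open>y\<^sub>j\<close> is the image of \<open>x\<^sub>j\<close> under the adjoint action of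
  \<open>(g\<^sub>1, g\<^sub>2)\<close>. The summands of \<open>-1/2 \<Sum> \<iota>\<^sub>i\<^sup>1\<iota>\<^sub>i\<^sup>2\<close> therefore act on \<open>B\<close> as commuting operators of square
  zero, and since \<open>y\<^sub>j Z = \<alpha>(Z) x\<^sub>j\<close> the exponential multiplies \<open>Z\<close> by
  \<open>\<kappa> = \<Prod>\<^sub>i (1 - 2 x\<^sub>i x\<^sub>n\<^sub>+\<^sub>i)\<close> from the right.

  It remains to see that \<open>S(Z\<kappa>)\<close> is \<open>e\<^sup>\<zeta>\<close>, \<open>\<zeta>\<close> the change of the two-form, times the symbol of
  \<open>\<tau>(g\<^sub>1)\<tau>(g\<^sub>2)\<close> with \<open>a + Ad(g\<^sub>1) b\<close> substituted. In a free model, where the one-forms \<open>c\<^sub>j\<close> have dual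
  vectors, left and right multiplication by generators are the operators \<open>c\<^sub>j \<plusminus> 1/2 \<iota>\<^sub>j\<close>, which act
  compatibly on both sides. For \<open>\<tau>(g\<^sub>1)\<^sup>-\<^sup>1\<close> in place of \<open>\<tau>(g\<^sub>2)\<close> on the \<open>a\<close>-side the identity is the
  expansion of \<open>e\<^sup>\<zeta>\<close> as a product, and the operators carry it to the general case.

  The operator \<open>-1/2 \<Sum> \<iota>\<^sub>i\<^sup>1\<iota>\<^sub>i\<^sup>2\<close> lowers the degree, and an alternating form vanishes above the dimension,
  so the top degree parts agree. The generating vector fields refer to one-parameter subgroups,
  whose existence is proved by Picard iteration in a chart.
\<close>

section \<open>The algebra of forms\<close>

text \<open>On \<open>M\<close> the one-forms \<open>c_j\<close> may be linearly dependent, so a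
  single multiplication by a generator is in general not an operator on forms; only graded brackets
  are visible, through products with \<open>c_j\<close> and, summed over all generators, through
  contractions. This is why the exponential is computed on Clifford elements and why the last
  identity is proved for independent coordinates and then pulled back. The coefficient in \<kappa>
  arises as follows: by the twist relation the two terms of each contraction agree when applied to
  \<open>Z\<close>, so each contraction contributes a factor 2, and the factor \<open>-1/2\<close>
  turns the resulting 4 into \<open>-2\<close>. The same \<open>-2\<close> arises in \<zeta>, where
  \<open>\<theta>\<^sup>L\<close> is the inverse of \<open>Ad\<close> applied to
  \<open>\<theta>\<^sup>R\<close> and both one-forms are halved. Starting from the inverse of the
  first factor makes one side the bare exponential, without any symbol. One-parameter subgroups
  enter because the values of \<open>c_j\<close> on a generating field are found by differentiating
  the equivariance of the moment map along its defining curve.\<close>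

lemma shuffle_sign_insert_0:
  assumes "finite T"
  shows "shuffle_sign (insert 0 (Suc ` T)) (Suc n) = shuffle_sign T n"
proof -
  have "{(i, j). i \<in> insert 0 (Suc ` T) \<and> j \<in> {..<Suc n} - insert 0 (Suc ` T) \<and> j < i} =
      map_prod Suc Suc ` {(i, j). i \<in> T \<and> j \<in> {..<n} - T \<and> j < i}" (is "?L = ?R")
  proof (rule Set.set_eqI)
    fix p show "p \<in> ?L \<longleftrightarrow> p \<in> ?R"
      by (cases p; case_tac "fst p"; case_tac "snd p") (auto simp: image_iff map_prod_def)
  qed
  moreover have "inj_on (map_prod Suc Suc) X" for X
    by (auto simp: inj_on_def map_prod_def)
  ultimately show ?thesis by (simp add: shuffle_sign_def card_image)
qed

text \<open>Position 0 lies outside the shuffled set and is passed by every element of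
  \<open>T\<close>, which adds \<open>card T\<close> inversions.\<close>

lemma shuffle_sign_Suc:
  assumes "T \<subseteq> {..<n}"
  shows "shuffle_sign (Suc ` T) (Suc n) = (-1) ^ card T * shuffle_sign T n"
proof -
  have "{(i, j). i \<in> Suc ` T \<and> j \<in> {..<Suc n} - Suc ` T \<and> j < i} =
      map_prod Suc Suc ` {(i, j). i \<in> T \<and> j \<in> {..<n} - T \<and> j < i} \<union> (\<lambda>i. (Suc i, 0)) ` T"
    (is "?L = ?R \<union> ?Q")
  proof (rule Set.set_eqI)
    fix p show "p \<in> ?L \<longleftrightarrow> p \<in> ?R \<union> ?Q"
      by (cases p; case_tac "fst p"; case_tac "snd p") (auto simp: image_iff map_prod_def)
  qed
  moreover have "inj_on (map_prod Suc Suc) X" for X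
    by (auto simp: inj_on_def map_prod_def)
  moreover have "card (?R \<union> ?Q) = card ?R + card ?Q"
  proof (rule card_Un_disjoint)
    have "{(i, j). i \<in> T \<and> j \<in> {..<n} - T \<and> j < i} \<subseteq> {..<n} \<times> {..<n}" using assms by auto
    then show "finite ?R" by (meson finite_imageI finite_subset finite_SigmaI finite_lessThan)
    show "finite ?Q" using finite_subset[OF assms] by auto
  qed auto
  moreover have "card ?Q = card T" by (rule card_image) (auto simp: inj_on_def)
  ultimately show ?thesis by (simp add: shuffle_sign_def card_image power_add)
qed

lemma Pow_lessThan_Suc:
  "Pow {..<Suc n} = (\<lambda>T. insert 0 (Suc ` T)) ` Pow {..<n} \<union> (\<lambda>T. Suc ` T) ` Pow {..<n}"
proof (rule Set.set_eqI)
  fix S :: "nat set"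
  have *: "S = (if 0 \<in> S then insert 0 (Suc ` {i. Suc i \<in> S}) else Suc ` {i. Suc i \<in> S})"
    by (auto simp: image_iff) (metis not0_implies_Suc)+
  show "S \<in> Pow {..<Suc n} \<longleftrightarrow>
      S \<in> (\<lambda>T. insert 0 (Suc ` T)) ` Pow {..<n} \<union> (\<lambda>T. Suc ` T) ` Pow {..<n}"
  proof
    assume S: "S \<in> Pow {..<Suc n}"
    then have "{i. Suc i \<in> S} \<in> Pow {..<n}" by auto
    with * show "S \<in> (\<lambda>T. insert 0 (Suc ` T)) ` Pow {..<n} \<union> (\<lambda>T. Suc ` T) ` Pow {..<n}"
      by (cases "0 \<in> S") (metis UnI1 image_eqI, metis UnI2 image_eqI)
  qed auto
qed

lemma wedge_Nil: "wedge \<alpha> \<beta> [] = \<alpha> [] * \<beta> []"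
  by (simp add: wedge_by_def shuffle_sign_def)

text \<open>Every shuffle gives the first argument either to \<alpha> or to \<beta>. In the second
  case it is moved past all arguments of \<alpha>, hence the sign.\<close>

lemma wedge_Cons:
  "wedge \<alpha> \<beta> (v # vs) = wedge (\<lambda>ws. \<alpha> (v # ws)) \<beta> vs +
     wedge (\<lambda>ws. (-1) ^ length ws * \<alpha> ws) (\<lambda>ws. \<beta> (v # ws)) vs"
proof -
  let ?n = "length vs"
  let ?f = "\<lambda>S. shuffle_sign S (Suc ?n) * (\<alpha> (nths (v # vs) S) * \<beta> (nths (v # vs) (- S)))"
  have i1: "inj_on (\<lambda>T. insert 0 (Suc ` T)) (Pow {..<?n})"
    by (rule inj_on_inverseI[where g = "\<lambda>S. {i. Suc i \<in> S}"]) auto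
  have i2: "inj_on (\<lambda>T. Suc ` T) (Pow {..<?n})"
    by (rule inj_on_inverseI[where g = "\<lambda>S. {i. Suc i \<in> S}"]) auto
  have "wedge \<alpha> \<beta> (v # vs) = sum ?f (Pow {..<Suc ?n})" by (simp add: wedge_by_def)
  also have "\<dots> = sum ?f ((\<lambda>T. insert 0 (Suc ` T)) ` Pow {..<?n}) + sum ?f ((\<lambda>T. Suc ` T) ` Pow {..<?n})"
    unfolding Pow_lessThan_Suc by (rule sum.union_disjoint) auto
  also have "sum ?f ((\<lambda>T. insert 0 (Suc ` T)) ` Pow {..<?n}) = wedge (\<lambda>ws. \<alpha> (v # ws)) \<beta> vs"
    unfolding sum.reindex[OF i1] wedge_by_def
  proof (rule sum.cong, simp)
    fix T assume T: "T \<in> Pow {..<?n}"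
    then have "finite T" by (auto intro: finite_subset)
    moreover have "{j. j \<notin> T} = - T" by auto
    ultimately show "(?f \<circ> (\<lambda>T. insert 0 (Suc ` T))) T = shuffle_sign T ?n *\<^sub>R (\<alpha> (v # nths vs T) * \<beta> (nths vs (- T)))"
      by (simp add: shuffle_sign_insert_0 nths_Cons image_iff)
  qed
  also have "sum ?f ((\<lambda>T. Suc ` T) ` Pow {..<?n}) =
     wedge (\<lambda>ws. (-1) ^ length ws * \<alpha> ws) (\<lambda>ws. \<beta> (v # ws)) vs"
    unfolding sum.reindex[OF i2] wedge_by_def
  proof (rule sum.cong, simp)
    fix T assume T: "T \<in> Pow {..<?n}"
    then have "{i. i < ?n \<and> i \<in> T} = T" by auto
    moreover have "{j. j \<notin> T} = - T" by auto
    ultimately show "(?f \<circ> (\<lambda>T. Suc ` T)) T = shuffle_sign T ?n *\<^sub>R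
        ((-1) ^ length (nths vs T) * \<alpha> (nths vs T) * \<beta> (v # nths vs (- T)))"
      using T by (simp add: shuffle_sign_Suc nths_Cons image_iff length_nths)
  qed
  finally show ?thesis .
qed

text \<open>Neither linearity nor alternation is imposed. Contraction with a vector is an antiderivation
  for \<^const>\<open>wedge_by\<close> on arbitrary functions of lists, so identities between products follow by
  induction on the list of arguments.\<close>

typedef 'v mform = "UNIV :: ('v list \<Rightarrow> real) set" morphisms mval Mform by simp

setup_lifting type_definition_mform

lemma mform_eqI: "(\<And>vs. mval \<alpha> vs = mval \<beta> vs) \<Longrightarrow> \<alpha> = \<beta>"
  by (auto simp: mval_inject[symmetric])

lemma mval_Mform [simp]: "mval (Mform f) = f"
  by (simp add: Mform_inverse)

instantiation mform :: (type) real_vector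
begin
lift_definition zero_mform :: "'a mform" is "\<lambda>_. 0" .
lift_definition plus_mform :: "'a mform \<Rightarrow> 'a mform \<Rightarrow> 'a mform" is "\<lambda>f g vs. f vs + g vs" .
lift_definition minus_mform :: "'a mform \<Rightarrow> 'a mform \<Rightarrow> 'a mform" is "\<lambda>f g vs. f vs - g vs" .
lift_definition uminus_mform :: "'a mform \<Rightarrow> 'a mform" is "\<lambda>f vs. - f vs" .
lift_definition scaleR_mform :: "real \<Rightarrow> 'a mform \<Rightarrow> 'a mform" is "\<lambda>c f vs. c * f vs" .
instance by standard (transfer; simp add: fun_eq_iff algebra_simps)+
end

lemmas mval_linear [simp] = zero_mform.rep_eq plus_mform.rep_eq minus_mform.rep_eq
  uminus_mform.rep_eq scaleR_mform.rep_eq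

lift_definition contr :: "'v \<Rightarrow> 'v mform \<Rightarrow> 'v mform" is "\<lambda>v f vs. f (v # vs)" .
lift_definition mpar :: "'v mform \<Rightarrow> 'v mform" is "\<lambda>f vs. (-1) ^ length vs * f vs" .

lemma contr_linear [simp]:
  "contr v (\<alpha> + \<beta>) = contr v \<alpha> + contr v \<beta>" "contr v (\<alpha> - \<beta>) = contr v \<alpha> - contr v \<beta>"
  "contr v (- \<alpha>) = - contr v \<alpha>" "contr v (c *\<^sub>R \<alpha>) = c *\<^sub>R contr v \<alpha>" "contr v 0 = 0"
  by (transfer; simp)+

lemma mpar_linear [simp]:
  "mpar (\<alpha> + \<beta>) = mpar \<alpha> + mpar \<beta>" "mpar (\<alpha> - \<beta>) = mpar \<alpha> - mpar \<beta>"
  "mpar (- \<alpha>) = - mpar \<alpha>" "mpar (c *\<^sub>R \<alpha>) = c *\<^sub>R mpar \<alpha>" "mpar 0 = 0" "mpar (mpar \<alpha>) = \<alpha>"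
  by (transfer; simp add: fun_eq_iff algebra_simps flip: power_mult_distrib)+

lemma contr_mpar [simp]: "contr v (mpar \<alpha>) = - mpar (contr v \<alpha>)"
  by transfer simp

instantiation mform :: (type) "{times, one}"
begin
lift_definition times_mform :: "'a mform \<Rightarrow> 'a mform \<Rightarrow> 'a mform" is wedge .
lift_definition one_mform :: "'a mform" is unit_form .
instance ..
end

lemma mval_mult_Nil: "mval (\<alpha> * \<beta>) [] = mval \<alpha> [] * mval \<beta> []"
  by transfer (rule wedge_Nil)

lemma mval_Cons: "mval \<alpha> (v # vs) = mval (contr v \<alpha>) vs"
  by transfer simp

lemma contr_mult0: "mval (contr v (\<alpha> * \<beta>)) vs = mval (contr v \<alpha> * \<beta>) vs + mval (mpar \<alpha> * contr v \<beta>) vs"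
  by transfer (rule wedge_Cons)

lemma contr_one [simp]: "contr v 1 = 0"
  by transfer (simp add: unit_form_def)

lemma mval_one_Nil [simp]: "mval 1 [] = 1"
  by transfer (simp add: unit_form_def)

lemma mpar_Nil [simp]: "mval (mpar \<alpha>) [] = mval \<alpha> []"
  by transfer simp

lemma mpar_one [simp]: "mpar 1 = 1"
  by transfer (auto simp: unit_form_def)

lemma mform_distrib:
  fixes \<alpha> \<beta> \<gamma> :: "'v mform"
  shows "(\<alpha> + \<beta>) * \<gamma> = \<alpha> * \<gamma> + \<beta> * \<gamma>" "\<alpha> * (\<beta> + \<gamma>) = \<alpha> * \<beta> + \<alpha> * \<gamma>"
    "(c *\<^sub>R \<alpha>) * \<beta> = c *\<^sub>R (\<alpha> * \<beta>)" "\<alpha> * (c *\<^sub>R \<beta>) = c *\<^sub>R (\<alpha> * \<beta>)"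
  by (rule mform_eqI; simp add: times_mform.rep_eq wedge_by_def sum.distrib sum_distrib_left
      distrib_left distrib_right mult_ac)+

lemma contr_mult: "contr v (\<alpha> * \<beta>) = contr v \<alpha> * \<beta> + mpar \<alpha> * contr v \<beta>"
  by (rule mform_eqI) (simp add: contr_mult0)

lemma mpar_mult [simp]: "mpar (\<alpha> * \<beta>) = mpar \<alpha> * mpar \<beta>" for \<alpha> :: "'v mform"
proof (rule mform_eqI)
  fix vs :: "'v list" show "mval (mpar (\<alpha> * \<beta>)) vs = mval (mpar \<alpha> * mpar \<beta>) vs"
  proof (induction vs arbitrary: \<alpha> \<beta>)
    case (Cons v vs)
    \<comment> \<open>The laws for negatives in a ring become available only with the class instance
      below, so the sign is written as a scalar.\<close>
    have "- mpar (contr v \<alpha>) = (-1) *\<^sub>R mpar (contr v \<alpha>)" for \<alpha> :: "'v mform" by simp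
    then show ?case
      by (simp only: mval_Cons contr_mpar contr_mult mpar_linear mform_distrib) (simp add: Cons)
  qed (simp add: mval_mult_Nil)
qed

text \<open>Associativity avoids triple shuffles: contracting both bracketings with the first
  argument gives triple products evaluated on a shorter list, and \<open>mpar\<close> is
  multiplicative.\<close>

instance mform :: (type) real_algebra_1
proof
  fix a b c :: "'a mform" and r :: real
  show "(a + b) * c = a * c + b * c" "a * (b + c) = a * b + a * c"
    "(r *\<^sub>R a) * b = r *\<^sub>R (a * b)" "a * (r *\<^sub>R b) = r *\<^sub>R (a * b)" by (rule mform_distrib)+
  show "a * b * c = a * (b * c)"
  proof (rule mform_eqI)
    fix vs show "mval (a * b * c) vs = mval (a * (b * c)) vs"
      by (induction vs arbitrary: a b c) (simp_all add: mval_mult_Nil mval_Cons contr_mult mform_distrib)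
  qed
  have z: "0 * b = 0" for b :: "'a mform" using mform_distrib(3)[of 0 0 b] by simp
  have z': "b * 0 = 0" for b :: "'a mform" using mform_distrib(4)[of b 0 0] by simp
  show "1 * a = a"
  proof (rule mform_eqI)
    fix vs show "mval (1 * a) vs = mval a vs"
      by (induction vs arbitrary: a) (simp_all add: mval_mult_Nil mval_Cons contr_mult z)
  qed
  show "a * 1 = a"
  proof (rule mform_eqI)
    fix vs show "mval (a * 1) vs = mval a vs"
      by (induction vs arbitrary: a) (simp_all add: mval_mult_Nil mval_Cons contr_mult z')
  qed
  show "(0::'a mform) \<noteq> 1" by (metis mval_one_Nil zero_mform.rep_eq zero_neq_one)
qed

lemma mval_sum: "mval (\<Sum>i\<in>S. f i) vs = (\<Sum>i\<in>S. mval (f i) vs)"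
  by (induction S rule: infinite_finite_induct) simp_all

lemma contr_sum: "contr v (\<Sum>i\<in>S. f i) = (\<Sum>i\<in>S. contr v (f i))"
  by (induction S rule: infinite_finite_induct) simp_all

definition mone :: "('v \<Rightarrow> real) \<Rightarrow> 'v mform" where "mone a = Mform (one_form a)"

lemma contr_mone [simp]: "contr v (mone a) = a v *\<^sub>R 1"
  by (rule mform_eqI) (auto simp: mone_def contr.rep_eq one_form_def one_mform.rep_eq unit_form_def split: list.splits)

lemma mone_Nil [simp]: "mval (mone a) [] = 0"
  by (simp add: mone_def one_form_def)

lemma mpar_mone [simp]: "mpar (mone a) = - mone a"
  by (rule mform_eqI) (auto simp: mone_def mpar.rep_eq one_form_def split: list.splits)

lemma mone_linear:
  "mone (\<lambda>v. a v + b v) = mone a + mone b" "mone (\<lambda>v. a v - b v) = mone a - mone b"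
  "mone (\<lambda>v. r * a v) = r *\<^sub>R mone a" "mone (\<lambda>v. 0) = 0"
  by (rule mform_eqI; auto simp: mone_def one_form_def split: list.splits)+

lemma mone_sum: "mone (\<lambda>v. \<Sum>i\<in>S. a i v) = (\<Sum>i\<in>S. mone (a i))"
  by (induction S rule: infinite_finite_induct) (simp_all add: mone_linear)

lemma mone_comm: "mone a * \<beta> = mpar \<beta> * mone a"
proof (rule mform_eqI)
  fix vs show "mval (mone a * \<beta>) vs = mval (mpar \<beta> * mone a) vs"
    by (induction vs arbitrary: \<beta>)
      (simp_all add: mval_mult_Nil mval_Cons contr_mult)
qed

lemma mone_square [simp]: "mone a * mone a = 0"
  using mone_comm[of a "mone a"] by (simp add: eq_neg_iff_add_eq_0 flip: scaleR_2)

lemma mone_anticomm: "mone a * mone b = - (mone b * mone a)"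
  using mone_comm[of a "mone b"] by simp

subsection \<open>Exponentials of two-forms\<close>

definition mhom :: "nat \<Rightarrow> 'v mform \<Rightarrow> bool" where
  "mhom k \<alpha> \<longleftrightarrow> (\<forall>vs. length vs \<noteq> k \<longrightarrow> mval \<alpha> vs = 0)"

lemma mhom_contr: "mhom (Suc k) \<alpha> \<Longrightarrow> mhom k (contr v \<alpha>)"
  by (auto simp: mhom_def contr.rep_eq)

lemma mhom_0_contr: "mhom 0 \<alpha> \<Longrightarrow> contr v \<alpha> = 0"
  by (auto simp: mhom_def contr.rep_eq intro!: mform_eqI)

lemma mhom_zero [simp]: "mhom k 0"
  by (simp add: mhom_def)

lemma mhom_add: "mhom k \<alpha> \<Longrightarrow> mhom k \<beta> \<Longrightarrow> mhom k (\<alpha> + \<beta>)"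
  by (simp add: mhom_def)

lemma mhom_scale: "mhom k \<alpha> \<Longrightarrow> mhom k (c *\<^sub>R \<alpha>)"
  by (simp add: mhom_def)

lemma mhom_sum: "(\<And>i. i \<in> S \<Longrightarrow> mhom k (f i)) \<Longrightarrow> mhom k (\<Sum>i\<in>S. f i)"
  by (induction S rule: infinite_finite_induct) (auto intro: mhom_add)

lemma mhom_mone: "mhom 1 (mone a)"
  by (auto simp: mhom_def mone_def one_form_def split: list.splits)

lemma mpar_mhom: "mhom k \<alpha> \<Longrightarrow> mpar \<alpha> = (-1) ^ k *\<^sub>R \<alpha>"
  by (rule mform_eqI) (auto simp: mhom_def mpar.rep_eq)

lemma mhom_1_mone: "mhom 1 \<alpha> \<Longrightarrow> \<alpha> = mone (\<lambda>v. mval \<alpha> [v])"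
  by (rule mform_eqI) (auto simp: mhom_def mone_def one_form_def split: list.splits)

lemma mhom_mult:
  assumes "mhom j \<alpha>" "mhom k \<beta>"
  shows "mhom (j + k) (\<alpha> * \<beta>)"
  unfolding mhom_def
proof (intro allI impI)
  fix vs :: "'a list"
  show "length vs \<noteq> j + k \<Longrightarrow> mval (\<alpha> * \<beta>) vs = 0" using assms
  proof (induction vs arbitrary: \<alpha> \<beta> j k)
    case Nil
    then show ?case by (auto simp: mval_mult_Nil mhom_def)
  next
    case (Cons v vs)
    have "mval (contr v \<alpha> * \<beta>) vs = 0"
      using Cons.IH[of "j - 1" k "contr v \<alpha>" \<beta>] Cons.prems mhom_0_contr[of \<alpha> v] mhom_contr[of "j - 1" \<alpha> v]
      by (cases j) auto
    moreover have "mval (\<alpha> * contr v \<beta>) vs = 0"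
      using Cons.IH[of j "k - 1" \<alpha> "contr v \<beta>"] Cons.prems mhom_0_contr[of \<beta> v] mhom_contr[of "k - 1" \<beta> v]
      by (cases k) auto
    ultimately show ?case using mpar_mhom[OF Cons.prems(2)] by (simp add: mval_Cons contr_mult)
  qed
qed

lemma mhom_power: "mhom j \<alpha> \<Longrightarrow> mhom (j * k) (\<alpha> ^ k)"
proof (induction k)
  case 0
  then show ?case by (simp add: mhom_def one_mform.rep_eq unit_form_def)
next
  case (Suc k)
  then show ?case using mhom_mult[of j \<alpha> "j * k" "\<alpha> ^ k"] by simp
qed

lemma mhom_2_comm:
  assumes "mhom 2 \<alpha>" shows "\<alpha> * \<beta> = \<beta> * \<alpha>"
proof (rule mform_eqI)
  fix vs show "mval (\<alpha> * \<beta>) vs = mval (\<beta> * \<alpha>) vs"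
  proof (induction vs arbitrary: \<beta>)
    case (Cons v vs)
    have "mhom 1 (contr v \<alpha>)" using assms mhom_contr[of 1] by (simp add: numeral_2_eq_2)
    then have "contr v \<alpha> * \<beta> = mpar \<beta> * contr v \<alpha>" using mone_comm mhom_1_mone by metis
    moreover have "mpar \<alpha> = \<alpha>" using mpar_mhom[OF assms] by simp
    ultimately show ?case using Cons by (simp add: mval_Cons contr_mult)
  qed (simp add: mval_mult_Nil)
qed

definition mexp :: "'v mform \<Rightarrow> 'v mform" where "mexp \<alpha> = Mform (exp_form (mval \<alpha>))"

lemma mval_power: "mval (\<alpha> ^ k) = wedge_power (mval \<alpha>) k"
  by (induction k) (auto simp: wedge_power_def one_mform.rep_eq times_mform.rep_eq)

text \<open>The power \<open>\<alpha> ^ k\<close> lives in degree \<open>2 * k\<close>, so terms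
  with \<open>k > length vs\<close> vanish. Any larger bound \<open>n\<close> is allowed, so lists
  of different lengths can share one truncated series.\<close>

lemma mval_mexp:
  assumes "mhom 2 \<alpha>" "length vs \<le> n"
  shows "mval (mexp \<alpha>) vs = (\<Sum>k\<le>n. mval (\<alpha> ^ k) vs / fact k)"
  unfolding mexp_def mval_Mform exp_form_def mval_power[symmetric]
  by (rule suminf_finite) (use mhom_power[OF assms(1)] assms(2) in \<open>auto simp: mhom_def\<close>)

lemma mpar_mhom_2: "mhom 2 \<alpha> \<Longrightarrow> mpar \<alpha> = \<alpha>"
  using mpar_mhom[of 2 \<alpha>] by simp

lemma mhom_2_contr: "mhom 2 \<alpha> \<Longrightarrow> mhom 1 (contr v \<alpha>)"
  using mhom_contr[of 1 \<alpha> v] by (simp add: numeral_2_eq_2)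

lemma contr_power_Suc:
  assumes "mhom 2 \<alpha>"
  shows "contr v (\<alpha> ^ Suc k) = real (Suc k) *\<^sub>R (contr v \<alpha> * \<alpha> ^ k)"
proof (induction k)
  case (Suc k)
  have "contr v (\<alpha> ^ Suc (Suc k)) = contr v \<alpha> * \<alpha> ^ Suc k + \<alpha> * contr v (\<alpha> ^ Suc k)"
    using mpar_mhom_2[OF assms] by (simp add: contr_mult)
  also have "\<alpha> * contr v (\<alpha> ^ Suc k) = contr v (\<alpha> ^ Suc k) * \<alpha>" by (rule mhom_2_comm[OF assms])
  also have "\<dots> = real (Suc k) *\<^sub>R (contr v \<alpha> * \<alpha> ^ Suc k)"
    by (subst Suc) (simp add: mult.assoc power_commutes)
  also have "contr v \<alpha> * \<alpha> ^ Suc k + real (Suc k) *\<^sub>R (contr v \<alpha> * \<alpha> ^ Suc k) =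
      real (Suc (Suc k)) *\<^sub>R (contr v \<alpha> * \<alpha> ^ Suc k)"
    by (simp add: scaleR_left_distrib scaleR_2)
  finally show ?case .
qed simp

text \<open>The one-form uses up one argument, so the other factor is only evaluated on shorter
  lists. This closes the inductions on length for the exponential.\<close>

lemma mhom_1_mult_cong:
  assumes "mhom 1 \<alpha>" "\<And>ws. length ws < length vs \<Longrightarrow> mval \<beta> ws = mval \<gamma> ws"
  shows "mval (\<alpha> * \<beta>) vs = mval (\<alpha> * \<gamma>) vs"
  using assms(2)
proof (induction vs arbitrary: \<beta> \<gamma>)
  case Nil
  then show ?case using assms(1) by (simp add: mval_mult_Nil mhom_def)
next
  case (Cons v vs)
  obtain r where r: "contr v \<alpha> = r *\<^sub>R 1" using mhom_1_mone[OF assms(1)] contr_mone by metis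
  have "mval (\<alpha> * contr v \<beta>) vs = mval (\<alpha> * contr v \<gamma>) vs"
    by (rule Cons.IH) (use Cons.prems in \<open>simp flip: mval_Cons\<close>)
  then show ?case using Cons.prems[of vs] mpar_mhom[OF assms(1)] by (simp add: mval_Cons contr_mult r)
qed

text \<open>The exponential rule for the derivation \<open>contr v\<close>. The series is cut off so
  that contraction acts term by term, and the factor from \<open>contr_power_Suc\<close> turns
  \<open>1 / fact (Suc k)\<close> into \<open>1 / fact k\<close>.\<close>

lemma contr_mexp:
  assumes "mhom 2 \<alpha>" shows "contr v (mexp \<alpha>) = contr v \<alpha> * mexp \<alpha>"
proof (rule mform_eqI)
  fix vs :: "'a list"
  let ?n = "Suc (length vs)"
  let ?E = "\<lambda>n. \<Sum>k\<le>n. (1 / fact k) *\<^sub>R \<alpha> ^ k"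
  have E: "mval (mexp \<alpha>) ws = mval (?E n) ws" if "length ws \<le> n" for ws n
    using mval_mexp[OF assms that] by (simp add: mval_sum)
  have "mval (contr v (mexp \<alpha>)) vs = mval (contr v (?E ?n)) vs"
    using E[of "v # vs" ?n] by (simp add: mval_Cons del: sum.atMost_Suc)
  also have "contr v (?E ?n) = (\<Sum>k\<le>length vs. (1 / fact (Suc k)) *\<^sub>R contr v (\<alpha> ^ Suc k))"
    by (simp add: sum.atMost_Suc_shift contr_sum del: sum.atMost_Suc)
  also have "\<dots> = contr v \<alpha> * ?E (length vs)"
    unfolding sum_distrib_left by (rule sum.cong) (simp_all only: contr_power_Suc[OF assms], simp)
  also have "mval \<dots> vs = mval (contr v \<alpha> * mexp \<alpha>) vs"
    by (rule mhom_1_mult_cong[OF mhom_2_contr[OF assms]]) (rule E[symmetric], simp)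
  finally show "mval (contr v (mexp \<alpha>)) vs = mval (contr v \<alpha> * mexp \<alpha>) vs" .
qed

lemma mexp_Nil: "mhom 2 \<alpha> \<Longrightarrow> mval (mexp \<alpha>) [] = 1"
  using mval_mexp[of \<alpha> "[]" 0] by simp

text \<open>The differential equation for the exponential determines a form from its value on the
  empty list, one argument at a time. Evenness, the addition law and the product expansion are
  obtained by checking it.\<close>

lemma mexp_unique:
  assumes "mhom 2 \<alpha>" "mval \<epsilon> [] = 1" "\<And>v. contr v \<epsilon> = contr v \<alpha> * \<epsilon>"
  shows "\<epsilon> = mexp \<alpha>"
proof (rule mform_eqI)
  fix vs show "mval \<epsilon> vs = mval (mexp \<alpha>) vs"
  proof (induction vs rule: length_induct)
    case (1 vs)
    show ?case
    proof (cases vs)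
      case Nil
      then show ?thesis using assms(2) mexp_Nil[OF assms(1)] by simp
    next
      case (Cons v us)
      then show ?thesis unfolding Cons mval_Cons assms(3) contr_mexp[OF assms(1)]
        by (intro mhom_1_mult_cong mhom_2_contr assms) (use 1[unfolded Cons] in auto)
    qed
  qed
qed

lemma mexp_even: "mhom 2 \<alpha> \<Longrightarrow> mpar (mexp \<alpha>) = mexp \<alpha>"
  by (rule mexp_unique) (simp_all add: mexp_Nil contr_mexp mpar_mhom[OF mhom_2_contr])

lemma mexp_comm:
  assumes "mhom 2 \<alpha>" shows "mexp \<alpha> * \<beta> = \<beta> * mexp \<alpha>"
proof (rule mform_eqI)
  fix vs show "mval (mexp \<alpha> * \<beta>) vs = mval (\<beta> * mexp \<alpha>) vs"
  proof (induction vs arbitrary: \<beta> rule: length_induct)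
    case (1 vs)
    show ?case
    proof (cases vs)
      case Nil
      then show ?thesis by (simp add: mval_mult_Nil)
    next
      case (Cons v us)
      have c: "contr v \<alpha> * \<gamma> = mpar \<gamma> * contr v \<alpha>" for \<gamma>
        using mone_comm mhom_1_mone[OF mhom_2_contr[OF assms]] by metis
      have "mval (contr v \<alpha> * (mexp \<alpha> * \<beta>)) us = mval (contr v \<alpha> * (\<beta> * mexp \<alpha>)) us"
        by (rule mhom_1_mult_cong[OF mhom_2_contr[OF assms]]) (use 1[unfolded Cons] in auto)
      also have "contr v \<alpha> * (\<beta> * mexp \<alpha>) = mpar \<beta> * (contr v \<alpha> * mexp \<alpha>)"
        by (metis c mult.assoc)
      finally have "mval (contr v \<alpha> * mexp \<alpha> * \<beta>) us = mval (mpar \<beta> * (contr v \<alpha> * mexp \<alpha>)) us"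
        by (simp add: mult.assoc)
      then show ?thesis using 1 Cons
        by (simp add: Cons mval_Cons contr_mult contr_mexp[OF assms] mexp_even[OF assms])
    qed
  qed
qed

lemma mexp_add:
  assumes "mhom 2 \<alpha>" "mhom 2 \<beta>" shows "mexp (\<alpha> + \<beta>) = mexp \<alpha> * mexp \<beta>"
proof (rule mexp_unique[symmetric])
  fix v
  have "mexp \<alpha> * contr v \<beta> = contr v \<beta> * mexp \<alpha>" by (rule mexp_comm[OF assms(1)])
  then show "contr v (mexp \<alpha> * mexp \<beta>) = contr v (\<alpha> + \<beta>) * (mexp \<alpha> * mexp \<beta>)"
    using assms by (simp add: contr_mult contr_mexp mexp_even distrib_right mult.assoc[symmetric])
qed (use assms in \<open>simp_all add: mhom_add mval_mult_Nil mexp_Nil\<close>)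

lemma mexp_zero: "mexp 0 = (1 :: 'v mform)"
  by (rule mexp_unique[symmetric]) simp_all

lemma mhom_2_mone: "mhom 2 (mone a * mone b)"
  using mhom_mult[OF mhom_mone mhom_mone] by (simp add: numeral_2_eq_2)

text \<open>The product of two one-forms squares to zero, so the series stops after the linear
  term.\<close>

lemma mexp_mone_mone: "mexp (r *\<^sub>R (mone a * mone b)) = 1 + r *\<^sub>R (mone a * mone b)"
proof (rule mexp_unique[symmetric])
  fix v
  have "mone a * (mone a * mone b) = 0" by (simp add: mult.assoc[symmetric])
  moreover have "mone b * (mone a * mone b) = 0"
    using mone_anticomm[of a b] by (simp add: mult.assoc[symmetric])
  ultimately show "contr v (1 + r *\<^sub>R (mone a * mone b)) =
      contr v (r *\<^sub>R (mone a * mone b)) * (1 + r *\<^sub>R (mone a * mone b))"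
    by (simp add: contr_mult distrib_left left_diff_distrib)
qed (simp_all add: mhom_scale mhom_2_mone mval_mult_Nil)


section \<open>Clifford algebras and symbols\<close>

lemmas cl_coeff_linear [simp] = zero_cliff.rep_eq plus_cliff.rep_eq minus_cliff.rep_eq
  uminus_cliff.rep_eq scaleR_cliff.rep_eq

text \<open>The subalgebra on the generators indexed by \<open>K\<close>. Arbitrary index sets allow
  half-lines such as \<open>{b<..}\<close>, which occur when the smallest generator is split off,
  and \<open>UNIV\<close>, which covers every element.\<close>

definition cl_on :: "nat set \<Rightarrow> cliff set" where
  "cl_on K = span (cl_monom ` {J. finite J \<and> J \<subseteq> K})"

lemma cl_on_mono: "K \<subseteq> L \<Longrightarrow> cl_on K \<subseteq> cl_on L"
  unfolding cl_on_def by (intro span_mono image_mono) auto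

lemma subspace_cl_on: "subspace (cl_on K)"
  unfolding cl_on_def by (rule subspace_span)

lemma cl_on_closed:
  "B \<in> cl_on K \<Longrightarrow> D \<in> cl_on K \<Longrightarrow> B + D \<in> cl_on K"
  "B \<in> cl_on K \<Longrightarrow> D \<in> cl_on K \<Longrightarrow> B - D \<in> cl_on K"
  "B \<in> cl_on K \<Longrightarrow> - B \<in> cl_on K"
  "B \<in> cl_on K \<Longrightarrow> r *\<^sub>R B \<in> cl_on K" "0 \<in> cl_on K"
  using subspace_cl_on[of K] by (auto simp: subspace_add subspace_diff subspace_neg subspace_scale subspace_0)

lemma cl_on_sum: "(\<And>i. i \<in> S \<Longrightarrow> f i \<in> cl_on K) \<Longrightarrow> sum f S \<in> cl_on K"
  by (rule subspace_sum[OF subspace_cl_on])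

lemma cl_monom_in: "finite J \<Longrightarrow> J \<subseteq> K \<Longrightarrow> cl_monom J \<in> cl_on K"
  unfolding cl_on_def by (intro span_base) auto

lemma cl_one_in: "1 \<in> cl_on K"
  using cl_monom_in[of "{}" K] by (simp add: cl_monom_empty)

lemma cl_gen_in: "j \<in> K \<Longrightarrow> cl_gen j \<in> cl_on K"
  unfolding cl_gen_def by (rule cl_monom_in) auto

lemma cl_on_monom_induct [consumes 1, case_names monom add scale]:
  assumes "B \<in> cl_on K" "\<And>J. finite J \<Longrightarrow> J \<subseteq> K \<Longrightarrow> P (cl_monom J)"
    and "\<And>B D. P B \<Longrightarrow> P D \<Longrightarrow> P (B + D)" "\<And>r B. P B \<Longrightarrow> P (r *\<^sub>R B)"
  shows "P B"
proof -
  have "P 0" using assms(4)[OF assms(2)[of "{}"], of 0] by simp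
  with assms(1) show ?thesis unfolding cl_on_def
    by (induction rule: span_induct_alt) (auto intro: assms)
qed

lemma cl_on_mult:
  assumes "B \<in> cl_on K" "D \<in> cl_on K" shows "B * D \<in> cl_on K"
  using assms(1)
proof (induction rule: cl_on_monom_induct)
  case (monom I)
  from assms(2) show ?case
  proof (induction rule: cl_on_monom_induct)
    case (monom J)
    then show ?case using \<open>finite I\<close> \<open>I \<subseteq> K\<close>
      by (simp add: cl_monom_mult) (intro cl_on_closed cl_monom_in; auto)
  qed (simp_all add: distrib_left cl_on_closed)
qed (simp_all add: distrib_right cl_on_closed)

lemma cl_monom_insert_max:
  assumes "finite I" "\<And>j. j \<in> I \<Longrightarrow> j < i"
  shows "cl_monom (insert i I) = cl_monom I * cl_gen i"
proof -
  have e: "i \<notin> I" "{(a, b). a \<in> I \<and> b \<in> {i} \<and> b < a} = {}" using assms(2) by fastforce+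
  have "cl_sign I {i} = 1" unfolding cl_sign_def e(2) using e(1) by simp
  moreover have "sym_diff I {i} = insert i I" using e(1) by auto
  ultimately show ?thesis using assms(1) by (simp add: cl_gen_def cl_monom_mult)
qed

lemma cl_on_induct [consumes 1, case_names one gen add scale]:
  assumes "B \<in> cl_on K" "P 1" "\<And>j B. j \<in> K \<Longrightarrow> B \<in> cl_on K \<Longrightarrow> P B \<Longrightarrow> P (cl_gen j * B)"
    and "\<And>B D. P B \<Longrightarrow> P D \<Longrightarrow> P (B + D)" "\<And>r B. P B \<Longrightarrow> P (r *\<^sub>R B)"
  shows "P B"
  using assms(1)
proof (induction rule: cl_on_monom_induct)
  case (monom J)
  then show ?case
  proof (induction rule: finite_linorder_min_induct)
    case (insert b A)
    then show ?case by (simp add: cl_monom_insert_min) (rule assms(3); simp add: cl_monom_in)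
  qed (simp add: cl_monom_empty assms(2))
qed (auto intro: assms)

text \<open>Here the largest generator is split off on the right. Both forms are needed in
  \<open>fusion_identity_free\<close>, where one factor varies by right and the other by left
  multiplications.\<close>

lemma cl_on_induct_right [consumes 1, case_names one gen add scale]:
  assumes "B \<in> cl_on K" "P 1" "\<And>j B. j \<in> K \<Longrightarrow> B \<in> cl_on K \<Longrightarrow> P B \<Longrightarrow> P (B * cl_gen j)"
    and "\<And>B D. P B \<Longrightarrow> P D \<Longrightarrow> P (B + D)" "\<And>r B. P B \<Longrightarrow> P (r *\<^sub>R B)"
  shows "P B"
  using assms(1)
proof (induction rule: cl_on_monom_induct)
  case (monom J)
  then show ?case
  proof (induction rule: finite_linorder_max_induct)
    case (insert b A)
    then show ?case by (simp add: cl_monom_insert_max) (rule assms(3); simp add: cl_monom_in)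
  qed (simp add: cl_monom_empty assms(2))
qed (auto intro: assms)

lemma cliff_expand: "B = (\<Sum>I | cl_coeff B I \<noteq> 0. cl_coeff B I *\<^sub>R cl_monom I)"
proof (rule cl_eqI)
  fix K
  have "cl_coeff (\<Sum>I | cl_coeff B I \<noteq> 0. cl_coeff B I *\<^sub>R cl_monom I) K =
      (\<Sum>I | cl_coeff B I \<noteq> 0. if I = K then cl_coeff B K else 0)"
    unfolding cl_coeff_sum
    by (rule sum.cong) (auto simp: cl_monom.rep_eq dest: cl_supp_finite)
  then show "cl_coeff B K = cl_coeff (\<Sum>I | cl_coeff B I \<noteq> 0. cl_coeff B I *\<^sub>R cl_monom I) K"
    by (simp add: finite_cl_supp)
qed

lemma cl_on_UNIV: "B \<in> cl_on UNIV"
  by (subst cliff_expand) (auto intro!: cl_on_sum cl_on_closed cl_monom_in dest: cl_supp_finite)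

lemma cl_on_lessThan: "\<exists>N. B \<in> cl_on {..<N::nat}"
proof -
  let ?U = "\<Union>{I. cl_coeff B I \<noteq> 0}"
  have "finite ?U" by (rule finite_Union) (auto simp: finite_cl_supp dest: cl_supp_finite)
  then obtain N where "?U \<subseteq> {..<N}" using finite_nat_bounded by blast
  then have "B \<in> cl_on {..<N}"
    by (subst cliff_expand) (auto intro!: cl_on_sum cl_on_closed cl_monom_in dest: cl_supp_finite)
  then show ?thesis ..
qed

lemma cl_supp_subset:
  assumes "B \<in> cl_on K" "cl_coeff B I \<noteq> 0" shows "I \<subseteq> K"
proof -
  have "\<forall>I. cl_coeff B I \<noteq> 0 \<longrightarrow> I \<subseteq> K" using assms(1)
    by (induction rule: cl_on_monom_induct) (auto simp: cl_monom.rep_eq split: if_splits, metis add_0 subsetD)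
  with assms(2) show ?thesis by blast
qed

section \<open>The parity automorphism\<close>

lemma cl_parity_linear [simp]:
  "cl_parity (B + D) = cl_parity B + cl_parity D" "cl_parity (B - D) = cl_parity B - cl_parity D"
  "cl_parity (- B) = - cl_parity B" "cl_parity (r *\<^sub>R B) = r *\<^sub>R cl_parity B" "cl_parity 0 = 0"
  "cl_parity (cl_parity B) = B"
  by (rule cl_eqI; simp add: cl_parity.rep_eq distrib_left right_diff_distrib mult.assoc[symmetric]
      power_mult_distrib[symmetric])+

lemma cl_parity_sum: "cl_parity (\<Sum>i\<in>S. f i) = (\<Sum>i\<in>S. cl_parity (f i))"
  by (induction S rule: infinite_finite_induct) simp_all

lemma cl_parity_monom: "finite I \<Longrightarrow> cl_parity (cl_monom I) = (-1) ^ card I *\<^sub>R cl_monom I"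
  by (rule cl_eqI) (auto simp: cl_parity.rep_eq cl_monom.rep_eq)

lemma cl_parity_one [simp]: "cl_parity 1 = 1"
  using cl_parity_monom[of "{}"] by (simp add: cl_monom_empty)

lemma cl_parity_gen [simp]: "cl_parity (cl_gen i) = - cl_gen i"
  by (simp add: cl_gen_def cl_parity_monom)

text \<open>The symmetric difference with \<open>{j}\<close> adds or removes exactly one index, so
  it always changes the parity of the cardinality, also when \<open>cl_gen j\<close> meets its own
  copy and disappears.\<close>

lemma cl_parity_gen_mult: "cl_parity (cl_gen j * B) = - cl_gen j * cl_parity B"
proof -
  have "B \<in> cl_on UNIV" by (rule cl_on_UNIV)
  then show ?thesis
  proof (induction rule: cl_on_monom_induct)
    case (monom J)
    have *: "(-1) ^ card (sym_diff {j} J) = - ((-1 :: real) ^ card J)"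
    proof (cases "j \<in> J")
      case True
      then have "sym_diff {j} J = J - {j}" by auto
      moreover have "card J = Suc (card (J - {j}))" using card_Suc_Diff1[OF monom(1) True] by simp
      ultimately show ?thesis by simp
    next
      case False
      then have "sym_diff {j} J = insert j J" by auto
      then show ?thesis using False monom(1) by simp
    qed
    have "finite (sym_diff {j} J)" using monom(1) by simp
    note p = cl_parity_monom[OF this, unfolded *]
    have "cl_gen j * cl_monom J = cl_sign {j} J *\<^sub>R cl_monom (sym_diff {j} J)"
      unfolding cl_gen_def using monom(1) by (intro cl_monom_mult) auto
    then show ?case
      by (simp only: cl_parity_linear p cl_parity_monom[OF monom(1)] mult_minus_left mult_scaleR_right) simp
  qed (simp_all add: distrib_left)
qed

lemma cl_parity_mult [simp]: "cl_parity (B * D) = cl_parity B * cl_parity D"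
proof -
  have "B \<in> cl_on UNIV" by (rule cl_on_UNIV)
  then show ?thesis
    by (induction rule: cl_on_induct) (simp_all add: distrib_right mult.assoc cl_parity_gen_mult)
qed

lemma cl_parity_in: "B \<in> cl_on K \<Longrightarrow> cl_parity B \<in> cl_on K"
  by (induction rule: cl_on_monom_induct) (auto simp: cl_parity_monom intro: cl_on_closed cl_monom_in)

lemma cl_gen_comm:
  assumes "B \<in> cl_on K" "j \<notin> K"
  shows "cl_gen j * B = cl_parity B * cl_gen j"
  using assms(1)
proof (induction rule: cl_on_induct)
  case (gen i B)
  then have "cl_gen j * cl_gen i = - (cl_gen i * cl_gen j)"
    using cl_gen_relation[of i j] assms(2) by (auto simp: eq_neg_iff_add_eq_0 add.commute)
  then show ?case using gen by (simp add: mult.assoc[symmetric]) (simp add: mult.assoc)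
qed (simp_all add: distrib_left distrib_right)

lemma cl_gen_square: "cl_gen j * cl_gen j = (1/2) *\<^sub>R 1"
proof -
  have "2 *\<^sub>R (cl_gen j * cl_gen j) = 1" using cl_gen_relation[of j j] by (simp add: scaleR_2)
  then have "(1/2) *\<^sub>R (2 *\<^sub>R (cl_gen j * cl_gen j)) = (1/2) *\<^sub>R 1" by (simp only:)
  then show ?thesis by simp
qed

subsection \<open>Substituting one-forms into symbols\<close>

definition cov_prod :: "(nat \<Rightarrow> 'v \<Rightarrow> real) \<Rightarrow> nat set \<Rightarrow> 'v mform" where
  "cov_prod c I = prod_list (map (\<lambda>i. mone (c i)) (sorted_list_of_set I))"

text \<open>The substitution \<open>S\<close> of the overview. Summing over the support instead of
  the subsets of a fixed \<open>{..<n}\<close> makes it independent of the number of generators, so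
  the same map serves the algebra and its double.\<close>

definition fsubst :: "(nat \<Rightarrow> 'v \<Rightarrow> real) \<Rightarrow> cliff \<Rightarrow> 'v mform" where
  "fsubst c B = (\<Sum>I | cl_coeff B I \<noteq> 0. cl_coeff B I *\<^sub>R cov_prod c I)"

lemma fsubst_superset:
  "finite S \<Longrightarrow> {I. cl_coeff B I \<noteq> 0} \<subseteq> S \<Longrightarrow> fsubst c B = (\<Sum>I\<in>S. cl_coeff B I *\<^sub>R cov_prod c I)"
  unfolding fsubst_def by (rule sum.mono_neutral_left) auto

lemma fsubst_add: "fsubst c (B + D) = fsubst c B + fsubst c D"
proof -
  let ?S = "{I. cl_coeff B I \<noteq> 0} \<union> {I. cl_coeff D I \<noteq> 0}"
  have "finite ?S" by (simp add: finite_cl_supp)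
  then show ?thesis
    by (subst (1 2 3) fsubst_superset[of ?S]) (auto simp: scaleR_left_distrib sum.distrib)
qed

lemma fsubst_scale: "fsubst c (r *\<^sub>R B) = r *\<^sub>R fsubst c B"
  by (subst (1 2) fsubst_superset[of "{I. cl_coeff B I \<noteq> 0}"]) (auto simp: finite_cl_supp scaleR_sum_right)

lemma fsubst_minus: "fsubst c (- B) = - fsubst c B"
  using fsubst_scale[of c "-1" B] by simp

lemma fsubst_diff: "fsubst c (B - D) = fsubst c B - fsubst c D"
  using fsubst_add[of c B "- D"] by (simp add: fsubst_minus)

lemma fsubst_zero: "fsubst c 0 = 0"
  using fsubst_scale[of c 0 0] by simp

lemma fsubst_sum: "fsubst c (\<Sum>i\<in>S. f i) = (\<Sum>i\<in>S. fsubst c (f i))"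
  by (induction S rule: infinite_finite_induct) (simp_all add: fsubst_zero fsubst_add)

lemmas fsubst_linear = fsubst_add fsubst_scale fsubst_minus fsubst_diff fsubst_zero fsubst_sum

lemma fsubst_monom: "finite I \<Longrightarrow> fsubst c (cl_monom I) = cov_prod c I"
  by (subst fsubst_superset[of "{I}"]) (auto simp: cl_monom.rep_eq split: if_splits)

lemma cov_prod_insert_min:
  assumes "finite I" "\<And>j. j \<in> I \<Longrightarrow> i < j"
  shows "cov_prod c (insert i I) = mone (c i) * cov_prod c I"
proof -
  have "sorted_list_of_set (insert i I) = i # sorted_list_of_set I"
    using assms by (intro sorted_distinct_set_unique)
      (auto simp: less_imp_le simp del: sorted_list_of_set_insert_remove)
  then show ?thesis by (simp add: cov_prod_def)
qed

lemma fsubst_one [simp]: "fsubst c 1 = 1"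
  using fsubst_monom[of "{}" c] by (simp add: cl_monom_empty cov_prod_def)

text \<open>A generator below all others leaves the monomials sorted, and on sorted products the
  symbol map is multiplicative. The bracket formulas are reduced to this case.\<close>

lemma fsubst_gen_min: "B \<in> cl_on {i<..} \<Longrightarrow> fsubst c (cl_gen i * B) = mone (c i) * fsubst c B"
proof (induction rule: cl_on_monom_induct)
  case (monom J)
  then have "i < j" if "j \<in> J" for j using that by auto
  then show ?case using monom
    by (simp add: cl_monom_insert_min[symmetric] fsubst_monom cov_prod_insert_min)
qed (simp_all add: distrib_left fsubst_linear)

lemma fsubst_gen [simp]: "fsubst c (cl_gen i) = mone (c i)"
  using fsubst_gen_min[OF cl_one_in, of c i] by simp

lemma mpar_fsubst: "mpar (fsubst c B) = fsubst c (cl_parity B)"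
proof -
  have "B \<in> cl_on UNIV" by (rule cl_on_UNIV)
  then show ?thesis
  proof (induction rule: cl_on_monom_induct)
    case (monom J)
    from monom(1) show ?case
    proof (induction rule: finite_linorder_min_induct)
      case (insert b A)
      then have A: "cl_monom A \<in> cl_on {b<..}" by (intro cl_monom_in) auto
      then show ?case using insert
        by (simp add: cl_monom_insert_min fsubst_gen_min[OF A] fsubst_linear
            fsubst_gen_min[OF cl_parity_in[OF A]])
    qed (simp add: cl_monom_empty)
  qed (simp_all add: fsubst_linear)
qed

text \<open>In this graded bracket the terms where \<open>cl_gen j\<close> meets itself cancel, and
  the wedge product remains twice. The induction compares \<open>j\<close> with the smallest index
  \<open>b\<close>: below \<open>b\<close> the product is sorted, at \<open>b\<close> both sides
  vanish, and above \<open>b\<close> the generator \<open>cl_gen b\<close> is moved to the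
  front.\<close>

lemma fsubst_left_right:
  "fsubst c (cl_gen j * B) + fsubst c (cl_parity B * cl_gen j) = 2 *\<^sub>R (mone (c j) * fsubst c B)"
proof -
  have "B \<in> cl_on UNIV" by (rule cl_on_UNIV)
  then show ?thesis
  proof (induction rule: cl_on_monom_induct)
    case (monom J)
    from monom(1) show ?case
    proof (induction rule: finite_linorder_min_induct)
      case empty
      then show ?case by (simp add: cl_monom_empty scaleR_2)
    next
      case (insert b A)
      then have A: "cl_monom A \<in> cl_on {b<..}" by (intro cl_monom_in) auto
      note A' = cl_parity_in[OF A]
      have eq: "cl_monom (insert b A) = cl_gen b * cl_monom A"
        using insert by (intro cl_monom_insert_min) auto
      consider "j < b" | "j = b" | "b < j" by linarith
      then show ?case
      proof cases
        case 1
        then have B: "cl_monom (insert b A) \<in> cl_on {j<..}" using insert by (intro cl_monom_in) auto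
        then have "cl_gen j * cl_monom (insert b A) = cl_parity (cl_monom (insert b A)) * cl_gen j"
          by (rule cl_gen_comm) simp
        then show ?thesis using fsubst_gen_min[OF B, of c] by (simp add: scaleR_2)
      next
        case 2
        have "cl_parity (cl_monom A) * cl_gen b = cl_gen b * cl_monom A"
          using cl_gen_comm[OF A] by simp
        moreover have "mone (c b) * (mone (c b) * fsubst c (cl_monom A)) = 0"
          by (simp add: mult.assoc[symmetric])
        ultimately show ?thesis using 2
          by (simp add: eq mult.assoc fsubst_linear fsubst_gen_min[OF A])
      next
        case 3
        then have j: "cl_gen j \<in> cl_on {b<..}" by (intro cl_gen_in) auto
        have "cl_gen j * cl_gen b = - (cl_gen b * cl_gen j)"
          using cl_gen_relation[of b j] 3 by (auto simp: eq_neg_iff_add_eq_0 add.commute)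
        then have "cl_gen j * (cl_gen b * cl_monom A) = - (cl_gen b * (cl_gen j * cl_monom A))"
          by (simp add: mult.assoc[symmetric])
        then have "fsubst c (cl_gen j * (cl_gen b * cl_monom A)) +
            fsubst c (cl_parity (cl_gen b * cl_monom A) * cl_gen j) =
            - (mone (c b) * (fsubst c (cl_gen j * cl_monom A) + fsubst c (cl_parity (cl_monom A) * cl_gen j)))"
          using fsubst_gen_min[OF cl_on_mult[OF j A], of c] fsubst_gen_min[OF cl_on_mult[OF A' j], of c]
          by (simp add: mult.assoc fsubst_linear distrib_left)
        also have "\<dots> = 2 *\<^sub>R (mone (c j) * (mone (c b) * fsubst c (cl_monom A)))"
          using mone_anticomm[of "c b" "c j"] insert by (simp add: mult.assoc[symmetric])
        finally show ?thesis unfolding eq fsubst_gen_min[OF A] .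
      qed
    qed
  next
    case (scale r B)
    have "r *\<^sub>R (fsubst c (cl_gen j * B) + fsubst c (cl_parity B * cl_gen j)) =
        r *\<^sub>R (2 *\<^sub>R (mone (c j) * fsubst c B))" using scale by simp
    then show ?case by (simp add: fsubst_linear scaleR_right_distrib mult.commute)
  qed (simp_all add: distrib_left distrib_right fsubst_linear scaleR_right_distrib algebra_simps)
qed

text \<open>The bracket \<open>cl_gen k * B - cl_parity B * cl_gen k\<close> is the formal
  derivative by the \<open>k\<close>-th generator; the relations make it 1 for
  \<open>B = cl_gen k\<close>. The formula is the chain rule for the substitution
  \<open>c\<close>.\<close>

lemma contr_fsubst:
  assumes "B \<in> cl_on {..<N}"
  shows "contr v (fsubst c B) = (\<Sum>k<N. c k v *\<^sub>R fsubst c (cl_gen k * B - cl_parity B * cl_gen k))"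
  using assms
proof (induction rule: cl_on_monom_induct)
  case (monom J)
  then show ?case
  proof (induction rule: finite_linorder_min_induct)
    case empty
    then show ?case by (simp add: cl_monom_empty fsubst_linear)
  next
    case (insert b A)
    let ?a = "cl_monom A"
    let ?g = "\<lambda>k. cl_gen k * ?a - cl_parity ?a * cl_gen k"
    have A: "?a \<in> cl_on {b<..}" using insert by (intro cl_monom_in) auto
    note A' = cl_parity_in[OF A]
    have b: "b < N" using insert.prems by auto
    have eq: "cl_monom (insert b A) = cl_gen b * ?a"
      using insert by (intro cl_monom_insert_min) auto
    have bA: "cl_gen b * ?a = cl_parity ?a * cl_gen b"
      by (rule cl_gen_comm[OF A]) simp
    have t: "c k v *\<^sub>R fsubst c (cl_gen k * (cl_gen b * ?a) - cl_parity (cl_gen b * ?a) * cl_gen k) =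
        (if k = b then c b v *\<^sub>R fsubst c ?a else 0) - c k v *\<^sub>R (mone (c b) * fsubst c (?g k))" for k
    proof (cases "k = b")
      case True
      have "cl_gen b * (cl_gen b * ?a) = (1/2) *\<^sub>R ?a"
        by (simp add: mult.assoc[symmetric] cl_gen_square)
      then have "cl_gen b * (cl_gen b * ?a) + cl_gen b * (cl_gen b * ?a) = ?a"
        by (simp flip: scaleR_2)
      then have "fsubst c (cl_gen b * (cl_gen b * ?a) - cl_parity (cl_gen b * ?a) * cl_gen b) = fsubst c ?a"
        by (simp add: mult.assoc bA[symmetric])
      then show ?thesis using True by (simp add: fsubst_linear bA)
    next
      case False
      have "cl_gen k * cl_gen b = - (cl_gen b * cl_gen k)"
        using cl_gen_relation[of b k] False by (auto simp: eq_neg_iff_add_eq_0 add.commute)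
      then have 1: "cl_gen k * (cl_gen b * ?a) - cl_parity (cl_gen b * ?a) * cl_gen k = - (cl_gen b * ?g k)"
        by (simp add: mult.assoc[symmetric]) (simp add: mult.assoc algebra_simps)
      have "fsubst c (cl_gen b * ?g k) = mone (c b) * fsubst c (?g k)"
      \<comment> \<open>Below \<open>b\<close> the bracket is not in the range of
        \<open>fsubst_gen_min\<close>, but there \<open>cl_gen k\<close> does not occur in
        \<open>?a\<close> and the bracket is zero.\<close>
      proof (cases "k < b")
        case True
        have "?a \<in> cl_on {b..}" using insert by (intro cl_monom_in) (auto simp: less_imp_le)
        then have "?g k = 0" using cl_gen_comm[of ?a "{b..}" k] True by simp
        then show ?thesis by (simp add: fsubst_zero)
      next
        case F: False
        then have "cl_gen k \<in> cl_on {b<..}" using False by (intro cl_gen_in) auto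
        then show ?thesis using A A' by (intro fsubst_gen_min cl_on_closed cl_on_mult)
      qed
      then show ?thesis using False unfolding 1 by (simp add: fsubst_minus)
    qed
    have "contr v (fsubst c (cl_monom (insert b A))) = c b v *\<^sub>R fsubst c ?a -
        (\<Sum>k<N. c k v *\<^sub>R (mone (c b) * fsubst c (?g k)))"
      unfolding eq fsubst_gen_min[OF A] using insert
      by (simp add: contr_mult sum_distrib_left sum_negf)
    also have "\<dots> = (\<Sum>k<N. (if k = b then c b v *\<^sub>R fsubst c ?a else 0) - c k v *\<^sub>R (mone (c b) * fsubst c (?g k)))"
      using b by (simp add: sum_subtractf sum_negf)
    finally show ?case unfolding eq t .
  qed
qed (simp_all add: fsubst_linear distrib_left distrib_right scaleR_right_distrib scaleR_sum_right
    scaleR_right_diff_distrib sum.distrib[symmetric] sum_subtractf[symmetric] algebra_simps)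

text \<open>All generators of \<open>B\<close> precede those of \<open>D\<close>, so juxtaposed
  monomials are already sorted and no relation is applied.\<close>

lemma fsubst_mult_separated:
  assumes "B \<in> cl_on {..<n}" "D \<in> cl_on {n..}"
  shows "fsubst c (B * D) = fsubst c B * fsubst c D"
  using assms(1)
proof (induction rule: cl_on_monom_induct)
  case (monom J)
  then show ?case
  proof (induction rule: finite_linorder_min_induct)
    case empty
    then show ?case by (simp add: cl_monom_empty)
  next
    case (insert b A)
    have A: "cl_monom A \<in> cl_on {b<..}" using insert by (intro cl_monom_in) auto
    have "{n..} \<subseteq> {b<..}" using insert.prems by auto
    with assms(2) have "D \<in> cl_on {b<..}" using cl_on_mono by blast
    then have AD: "cl_monom A * D \<in> cl_on {b<..}" using A by (rule cl_on_mult[rotated])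
    show ?case using insert
      by (simp add: cl_monom_insert_min mult.assoc fsubst_gen_min[OF AD] fsubst_gen_min[OF A])
  qed
qed (simp_all add: distrib_right fsubst_linear)

section \<open>The inclusion of the second summand into the Clifford algebra of a direct sum\<close>

definition cl_shift :: "nat \<Rightarrow> cliff \<Rightarrow> cliff" where
  "cl_shift n B = (\<Sum>I | cl_coeff B I \<noteq> 0. cl_coeff B I *\<^sub>R cl_monom ((+) n ` I))"

lemma cl_shift_superset:
  "finite S \<Longrightarrow> {I. cl_coeff B I \<noteq> 0} \<subseteq> S \<Longrightarrow> cl_shift n B = (\<Sum>I\<in>S. cl_coeff B I *\<^sub>R cl_monom ((+) n ` I))"
  unfolding cl_shift_def by (rule sum.mono_neutral_left) auto

lemma cl_shift_add: "cl_shift n (B + D) = cl_shift n B + cl_shift n D"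
proof -
  let ?S = "{I. cl_coeff B I \<noteq> 0} \<union> {I. cl_coeff D I \<noteq> 0}"
  have "finite ?S" by (simp add: finite_cl_supp)
  then show ?thesis
    by (subst (1 2 3) cl_shift_superset[of ?S]) (auto simp: scaleR_left_distrib sum.distrib)
qed

lemma cl_shift_scale: "cl_shift n (r *\<^sub>R B) = r *\<^sub>R cl_shift n B"
  by (subst (1 2) cl_shift_superset[of "{I. cl_coeff B I \<noteq> 0}"]) (auto simp: finite_cl_supp scaleR_sum_right)

lemma cl_shift_monom: "finite I \<Longrightarrow> cl_shift n (cl_monom I) = cl_monom ((+) n ` I)"
  by (subst cl_shift_superset[of "{I}"]) (auto simp: cl_monom.rep_eq split: if_splits)

lemma cl_shift_one [simp]: "cl_shift n 1 = 1"
  using cl_shift_monom[of "{}" n] by (simp add: cl_monom_empty)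

lemma cl_sign_shift: "cl_sign ((+) n ` I) ((+) n ` J) = cl_sign I J"
proof -
  have "{(i, j). i \<in> (+) n ` I \<and> j \<in> (+) n ` J \<and> j < i} =
      map_prod ((+) n) ((+) n) ` {(i, j). i \<in> I \<and> j \<in> J \<and> j < i}"
    by (auto simp: image_iff map_prod_def)
  moreover have "inj_on (map_prod ((+) n) ((+) n)) X" for X
    by (auto simp: inj_on_def map_prod_def)
  moreover have "(+) n ` I \<inter> (+) n ` J = (+) n ` (I \<inter> J)" by auto
  ultimately show ?thesis by (simp add: cl_sign_def card_image)
qed

lemma cl_shift_gen_mult: "cl_shift n (cl_gen j * B) = cl_gen (n + j) * cl_shift n B"
proof -
  have "B \<in> cl_on UNIV" by (rule cl_on_UNIV)
  then show ?thesis
  proof (induction rule: cl_on_monom_induct)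
    case (monom J)
    have "sym_diff {n + j} ((+) n ` J) = (+) n ` sym_diff {j} J" by auto
    moreover have "cl_sign {n + j} ((+) n ` J) = cl_sign {j} J"
      using cl_sign_shift[of n "{j}" J] by simp
    ultimately show ?case using monom(1)
      by (simp add: cl_gen_def cl_monom_mult cl_shift_monom cl_shift_scale)
  qed (simp_all add: distrib_left cl_shift_add cl_shift_scale)
qed

lemma cl_shift_in: "B \<in> cl_on K \<Longrightarrow> cl_shift n B \<in> cl_on ((+) n ` K)"
  by (induction rule: cl_on_monom_induct)
    (auto simp: cl_shift_monom cl_shift_add cl_shift_scale intro: cl_on_closed cl_monom_in)

lemma fsubst_shift: "fsubst c (cl_shift n B) = fsubst (\<lambda>i. c (n + i)) B"
proof -
  have "B \<in> cl_on UNIV" by (rule cl_on_UNIV)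
  then show ?thesis
  proof (induction rule: cl_on_monom_induct)
    case (monom J)
    from monom(1) show ?case
    proof (induction rule: finite_linorder_min_induct)
      case empty
      then show ?case by (simp add: cl_monom_empty)
    next
      case (insert b A)
      have A: "cl_monom A \<in> cl_on {b<..}" using insert by (intro cl_monom_in) auto
      have "cl_shift n (cl_monom A) \<in> cl_on ((+) n ` {b<..})" by (rule cl_shift_in[OF A])
      moreover have "(+) n ` {b<..} \<subseteq> {n + b<..}" by auto
      ultimately have "cl_shift n (cl_monom A) \<in> cl_on {n + b<..}" using cl_on_mono by blast
      then show ?case using insert
        by (simp add: cl_monom_insert_min cl_shift_gen_mult fsubst_gen_min fsubst_gen_min[OF A])
    qed
  qed (simp_all add: cl_shift_add cl_shift_scale fsubst_linear)
qed


section \<open>The fusion identity for symbols\<close>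

text \<open>For \<open>p i = cl_gen i * cl_gen (n + i)\<close> this is the element \<kappa> of the
  overview. General \<open>p\<close> is allowed because conjugation by the lift of the first group
  element replaces \<open>cl_gen i\<close> by its rotated image.\<close>

primrec cl_chain :: "(nat \<Rightarrow> cliff) \<Rightarrow> nat \<Rightarrow> cliff" where
  "cl_chain p 0 = 1"
| "cl_chain p (Suc m) = (1 - 2 *\<^sub>R p m) * cl_chain p m"

lemma cl_parity_chain: "(\<And>i. i < m \<Longrightarrow> cl_parity (p i) = p i) \<Longrightarrow> cl_parity (cl_chain p m) = cl_chain p m"
  by (induction m) simp_all

lemma cl_chain_comm: "(\<And>i. i < m \<Longrightarrow> y * p i = p i * y) \<Longrightarrow> y * cl_chain p m = cl_chain p m * y"
proof (induction m)
  case (Suc m)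
  have "y * (1 - 2 *\<^sub>R p m) = (1 - 2 *\<^sub>R p m) * y"
    using Suc.prems[of m] by (simp add: algebra_simps)
  then have "y * cl_chain p (Suc m) = (1 - 2 *\<^sub>R p m) * (y * cl_chain p m)"
    by (simp add: mult.assoc[symmetric])
  then show ?case using Suc by (simp add: mult.assoc)
qed simp

lemma cl_chain_in: "(\<And>i. i < m \<Longrightarrow> p i \<in> cl_on K) \<Longrightarrow> cl_chain p m \<in> cl_on K"
  by (induction m) (auto intro!: cl_on_mult cl_on_closed cl_one_in)

lemma cl_chain_conj:
  "(\<And>i. i < m \<Longrightarrow> A * p i = q i * A) \<Longrightarrow> A * cl_chain p m = cl_chain q m * A"
proof (induction m)
  case (Suc m)
  have "A * (1 - 2 *\<^sub>R p m) = (1 - 2 *\<^sub>R q m) * A"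
    using Suc.prems[of m] by (simp add: algebra_simps)
  then have "A * cl_chain p (Suc m) = (1 - 2 *\<^sub>R q m) * (A * cl_chain p m)"
    by (simp add: mult.assoc[symmetric])
  then show ?case using Suc by (simp add: mult.assoc)
qed simp

section \<open>Vectors inside the Clifford algebra\<close>

definition cl_vec :: "nat \<Rightarrow> (nat \<Rightarrow> real) \<Rightarrow> cliff" where
  "cl_vec N u = (\<Sum>k<N. u k *\<^sub>R cl_gen k)"

lemma cl_parity_vec [simp]: "cl_parity (cl_vec N u) = - cl_vec N u"
  by (simp add: cl_vec_def cl_parity_sum sum_negf)

lemma cl_vec_in: "N \<le> M \<Longrightarrow> cl_vec N u \<in> cl_on {..<M}"
  unfolding cl_vec_def by (intro cl_on_sum cl_on_closed cl_gen_in) auto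

lemma cl_vec_relation: "cl_vec N u * cl_vec N w + cl_vec N w * cl_vec N u = (\<Sum>k<N. u k * w k) *\<^sub>R 1"
proof -
  have "cl_vec N u * cl_vec N w = (\<Sum>k<N. \<Sum>l<N. (u k * w l) *\<^sub>R (cl_gen k * cl_gen l))"
    by (simp add: cl_vec_def sum_product mult.commute)
  moreover have "cl_vec N w * cl_vec N u = (\<Sum>k<N. \<Sum>l<N. (u k * w l) *\<^sub>R (cl_gen l * cl_gen k))"
    by (subst sum.swap) (simp add: cl_vec_def sum_product mult.commute)
  ultimately have "cl_vec N u * cl_vec N w + cl_vec N w * cl_vec N u =
      (\<Sum>k<N. \<Sum>l<N. (u k * w l) *\<^sub>R (if k = l then 1 else 0))"
    by (simp add: sum.distrib[symmetric] scaleR_right_distrib[symmetric] cl_gen_relation)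
  also have "\<dots> = (\<Sum>k<N. (u k * w k) *\<^sub>R 1)"
    by (intro sum.cong refl) (simp add: if_distrib[of "scaleR _"] cong: if_cong)
  finally show ?thesis by (simp add: scaleR_left.sum)
qed

lemma fsubst_vec_left_right:
  "fsubst c (cl_vec N u * B) + fsubst c (cl_parity B * cl_vec N u) =
     2 *\<^sub>R ((\<Sum>k<N. u k *\<^sub>R mone (c k)) * fsubst c B)"
proof -
  have "fsubst c (cl_vec N u * B) + fsubst c (cl_parity B * cl_vec N u) =
      (\<Sum>k<N. u k *\<^sub>R (fsubst c (cl_gen k * B) + fsubst c (cl_parity B * cl_gen k)))"
    by (simp add: cl_vec_def fsubst_linear sum_distrib_left sum_distrib_right sum.distrib scaleR_right_distrib)
  then show ?thesis
    by (simp add: fsubst_left_right sum_distrib_left sum_distrib_right scaleR_sum_right mult.commute)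
qed

text \<open>The two terms of the bracket formula coincide when the vector graded-commutes with
  \<open>B\<close>, so the symbol map is multiplicative on such products.\<close>

lemma fsubst_vec_mult:
  assumes "cl_vec N u * B = cl_parity B * cl_vec N u"
  shows "fsubst c (cl_vec N u * B) = (\<Sum>k<N. u k *\<^sub>R mone (c k)) * fsubst c B"
proof -
  have "2 *\<^sub>R fsubst c (cl_vec N u * B) = 2 *\<^sub>R ((\<Sum>k<N. u k *\<^sub>R mone (c k)) * fsubst c B)"
    using fsubst_vec_left_right[of c N u B] assms by (simp add: scaleR_2)
  then show ?thesis by simp
qed

lemma fsubst_gen_mult:
  assumes "cl_gen j * B = cl_parity B * cl_gen j"
  shows "fsubst c (cl_gen j * B) = mone (c j) * fsubst c B"
proof -
  have "2 *\<^sub>R fsubst c (cl_gen j * B) = 2 *\<^sub>R (mone (c j) * fsubst c B)"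
    using fsubst_left_right[of c j B] assms by (simp add: scaleR_2)
  then show ?thesis by simp
qed

text \<open>The free model: the vectors are sequences of reals and the one-forms are the coordinates, so
  that every generator has a dual vector.\<close>

abbreviation (input) crd :: "nat \<Rightarrow> (nat \<Rightarrow> real) \<Rightarrow> real" where "crd \<equiv> \<lambda>i v. v i"

definition unit_seq :: "nat \<Rightarrow> nat \<Rightarrow> real" where "unit_seq j i = (if i = j then 1 else 0)"

lemma contr_unit_fsubst:
  "contr (unit_seq j) (fsubst crd B) = fsubst crd (cl_gen j * B - cl_parity B * cl_gen j)"
proof -
  obtain N where "B \<in> cl_on {..<N}" using cl_on_lessThan by blast
  \<comment> \<open>The bound is raised beyond \<open>j\<close> so that the term selected by the
    dual vector occurs in the sum.\<close>
  then have "B \<in> cl_on {..<max N (Suc j)}" using cl_on_mono[of "{..<N}" "{..<max N (Suc j)}"] by auto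
  then have "contr (unit_seq j) (fsubst crd B) = (\<Sum>k<max N (Suc j). unit_seq j k *\<^sub>R fsubst crd (cl_gen k * B - cl_parity B * cl_gen k))"
    by (rule contr_fsubst)
  also have "\<dots> = (\<Sum>k<max N (Suc j). if k = j then fsubst crd (cl_gen j * B - cl_parity B * cl_gen j) else 0)"
    by (rule sum.cong) (auto simp: unit_seq_def)
  also have "\<dots> = fsubst crd (cl_gen j * B - cl_parity B * cl_gen j)" by (simp add: less_max_iff_disj)
  finally show ?thesis .
qed

text \<open>Half the sum of the two graded brackets, which a dual vector isolates for each single
  \<open>j\<close>. Half the difference gives \<open>fsubst_gen_right\<close>.\<close>

lemma fsubst_gen_left:
  "fsubst crd (cl_gen j * B) = mone (crd j) * fsubst crd B + (1/2) *\<^sub>R contr (unit_seq j) (fsubst crd B)"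
proof -
  have "2 *\<^sub>R (mone (crd j) * fsubst crd B + (1/2) *\<^sub>R contr (unit_seq j) (fsubst crd B)) =
      2 *\<^sub>R fsubst crd (cl_gen j * B)"
    using fsubst_left_right[of crd j B, symmetric]
    by (simp add: contr_unit_fsubst scaleR_right_distrib fsubst_linear scaleR_2)
  then show ?thesis by simp
qed

lemma fsubst_gen_right:
  "fsubst crd (cl_parity B * cl_gen j) = mone (crd j) * fsubst crd B - (1/2) *\<^sub>R contr (unit_seq j) (fsubst crd B)"
proof -
  have "2 *\<^sub>R (mone (crd j) * fsubst crd B - (1/2) *\<^sub>R contr (unit_seq j) (fsubst crd B)) =
      2 *\<^sub>R fsubst crd (cl_parity B * cl_gen j)"
    using fsubst_left_right[of crd j B, symmetric]
    by (simp add: contr_unit_fsubst scaleR_right_diff_distrib fsubst_linear scaleR_2)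
  then show ?thesis by simp
qed

text \<open>For the matrix of \<open>Ad\<close> at the first moment value this is
  \<open>-1/2\<close> times the pairing of the pulled back \<open>\<theta>\<^sup>L\<close> and
  \<open>\<theta>\<^sup>R\<close>. The matrix enters transposed because
  \<open>\<theta>\<^sup>L\<close> is the inverse of \<open>Ad\<close> applied to
  \<open>\<theta>\<^sup>R\<close>; as each \<open>c i\<close> is half of a Maurer-Cartan component,
  \<open>-1/2\<close> becomes \<open>-2\<close>.\<close>

definition fusion_two_form :: "nat \<Rightarrow> (nat \<Rightarrow> nat \<Rightarrow> real) \<Rightarrow> (nat \<Rightarrow> 'v \<Rightarrow> real) \<Rightarrow> 'v mform" where
  "fusion_two_form n O' c =
     (\<Sum>i<n. (-2) *\<^sub>R ((\<Sum>k<n. O' k i *\<^sub>R mone (c k)) * mone (c (n + i))))"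

text \<open>Half the components of the pullback of \<open>\<theta>\<^sup>R\<close> under the product
  of the two moment maps, compare \<open>theta_R_product\<close>.\<close>

definition fusion_cov :: "nat \<Rightarrow> (nat \<Rightarrow> nat \<Rightarrow> real) \<Rightarrow> (nat \<Rightarrow> 'v \<Rightarrow> real) \<Rightarrow> nat \<Rightarrow> 'v \<Rightarrow> real" where
  "fusion_cov n O' c i v = c i v + (\<Sum>k<n. O' i k * c (n + k) v)"

lemma mone_fusion_cov:
  "mone (fusion_cov n O' c i) = mone (c i) + (\<Sum>k<n. O' i k *\<^sub>R mone (c (n + k)))"
  unfolding fusion_cov_def[abs_def] by (simp add: mone_linear mone_sum)

lemma mhom_fusion_two_form: "mhom 2 (fusion_two_form n O' c)"
  unfolding fusion_two_form_def sum_distrib_right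
  by (intro mhom_sum mhom_scale) (simp add: mhom_scale mhom_2_mone)

text \<open>The factors commute; they are listed from the last to the first index to match
  \<open>cl_chain\<close>.\<close>

lemma mexp_sum_mone:
  "mexp (\<Sum>i<m. (-2) *\<^sub>R (mone (a i) * mone (b i))) =
    prod_list (map (\<lambda>i. 1 - 2 *\<^sub>R (mone (a i) * mone (b i))) (rev [0..<m]))"
proof (induction m)
  case 0
  then show ?case by (simp add: mexp_zero)
next
  case (Suc m)
  have "mexp (\<Sum>i<Suc m. (-2) *\<^sub>R (mone (a i) * mone (b i))) =
      mexp ((-2) *\<^sub>R (mone (a m) * mone (b m)) + (\<Sum>i<m. (-2) *\<^sub>R (mone (a i) * mone (b i))))"
    by (simp add: add.commute)
  also have "\<dots> = mexp ((-2) *\<^sub>R (mone (a m) * mone (b m))) * mexp (\<Sum>i<m. (-2) *\<^sub>R (mone (a i) * mone (b i)))"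
    by (intro mexp_add mhom_scale mhom_sum mhom_2_mone)
  finally show ?case unfolding Suc mexp_mone_mone by simp
qed

context
  fixes n :: nat and R :: "nat \<Rightarrow> nat \<Rightarrow> real"
  assumes orth: "\<And>i j. i < n \<Longrightarrow> j < n \<Longrightarrow> (\<Sum>k<n. R k i * R k j) = (if i = j then 1 else 0)"
begin

abbreviation (input) "rot i \<equiv> cl_vec n (\<lambda>k. R k i)"
abbreviation (input) "\<zeta> \<equiv> fusion_two_form n R crd"
abbreviation (input) "fsub \<equiv> fsubst crd"
abbreviation (input) "fsub' \<equiv> fsubst (fusion_cov n R crd)"

lemma rot_anticomm: "i < n \<Longrightarrow> j < n \<Longrightarrow> i \<noteq> j \<Longrightarrow> rot i * rot j = - (rot j * rot i)"
  using cl_vec_relation[of n "\<lambda>k. R k i" "\<lambda>k. R k j"] orth[of i j] by (simp add: eq_neg_iff_add_eq_0)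

lemma rot_gen_anticomm: "rot i * cl_gen (n + j) = - (cl_gen (n + j) * rot i)"
  using cl_gen_comm[OF cl_vec_in[of n n "\<lambda>k. R k i"], of "n + j"] by simp

lemma gen_shift_anticomm: "i \<noteq> j \<Longrightarrow> cl_gen (n + i) * cl_gen (n + j) = - (cl_gen (n + j) * cl_gen (n + i))"
  using cl_gen_relation[of "n + i" "n + j"] by (simp add: eq_neg_iff_add_eq_0)

text \<open>By orthogonality the vectors \<open>rot i\<close> and \<open>cl_gen (n + i)\<close> all
  anticommute. The two vectors of a new factor therefore commute with the even product of the
  earlier ones, and the symbol map is multiplicative along the chain.\<close>

lemma fsubst_rot_chain:
  assumes "m \<le> n"
  shows "fsub (cl_chain (\<lambda>i. rot i * cl_gen (n + i)) m) =
    prod_list (map (\<lambda>i. 1 - 2 *\<^sub>R (mone (\<lambda>v. \<Sum>k<n. R k i * crd k v) * mone (crd (n + i)))) (rev [0..<m]))"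
  using assms
proof (induction m)
  case (Suc m)
  let ?p = "\<lambda>i. rot i * cl_gen (n + i)"
  let ?D = "cl_chain ?p m"
  have mn: "m < n" using Suc.prems by simp
  have even: "cl_parity ?D = ?D" by (rule cl_parity_chain) simp
  have c1: "rot m * ?D = ?D * rot m"
  proof (rule cl_chain_comm)
    fix i assume i: "i < m"
    have "rot m * (rot i * cl_gen (n + i)) = - (rot i * (rot m * cl_gen (n + i)))"
      using rot_anticomm[of m i] i mn by (simp add: mult.assoc[symmetric])
    then show "rot m * ?p i = ?p i * rot m" using rot_gen_anticomm[of m i] by (simp add: mult.assoc)
  qed
  have c2: "cl_gen (n + m) * ?D = ?D * cl_gen (n + m)"
  proof (rule cl_chain_comm)
    fix i assume i: "i < m"
    have "cl_gen (n + m) * rot i = - (rot i * cl_gen (n + m))"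
      using rot_gen_anticomm[of i m] by simp
    then have "cl_gen (n + m) * (rot i * cl_gen (n + i)) = - (rot i * (cl_gen (n + m) * cl_gen (n + i)))"
      by (simp add: mult.assoc[symmetric])
    then show "cl_gen (n + m) * ?p i = ?p i * cl_gen (n + m)" using gen_shift_anticomm[of m i] i by (simp add: mult.assoc)
  qed
  let ?B = "cl_gen (n + m) * ?D"
  have "rot m * ?B = cl_parity ?B * rot m"
    using c1 rot_gen_anticomm[of m m] even by (simp add: mult.assoc[symmetric]) (simp add: mult.assoc)
  then have "fsub (rot m * ?B) = (\<Sum>k<n. R k m *\<^sub>R mone (crd k)) * fsub ?B"
    by (rule fsubst_vec_mult)
  moreover have "fsub ?B = mone (crd (n + m)) * fsub ?D"
    by (rule fsubst_gen_mult) (simp add: c2 even)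
  ultimately have "fsub (rot m * ?B) = (\<Sum>k<n. R k m *\<^sub>R mone (crd k)) * (mone (crd (n + m)) * fsub ?D)"
    by (simp only:)
  then have "fsub (cl_chain ?p (Suc m)) =
      (1 - 2 *\<^sub>R ((\<Sum>k<n. R k m *\<^sub>R mone (crd k)) * mone (crd (n + m)))) * fsub ?D"
    by (simp add: left_diff_distrib fsubst_linear mult.assoc)
  then show ?case using Suc by (simp add: mone_sum mone_linear)
qed simp

lemma contr_left_two_form:
  assumes "j < n"
  shows "contr (unit_seq j) \<zeta> = (\<Sum>k<n. (-2 * R j k) *\<^sub>R mone (crd (n + k)))"
proof -
  have "(\<Sum>k<n. (R k i * unit_seq j k) *\<^sub>R 1) = R j i *\<^sub>R (1 :: (nat \<Rightarrow> real) mform)" for i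
  proof -
    have "(\<Sum>k<n. (R k i * unit_seq j k) *\<^sub>R 1) = (\<Sum>k<n. if k = j then R j i *\<^sub>R (1 :: (nat \<Rightarrow> real) mform) else 0)"
      by (rule sum.cong) (auto simp: unit_seq_def)
    then show ?thesis using assms by simp
  qed
  moreover have "unit_seq j (n + i) = 0" for i using assms by (simp add: unit_seq_def)
  ultimately show ?thesis
    by (simp add: fusion_two_form_def contr_sum contr_mult)
qed

lemma contr_right_two_form:
  assumes "j < n"
  shows "contr (unit_seq (n + j)) \<zeta> = 2 *\<^sub>R (\<Sum>k<n. R k j *\<^sub>R mone (crd k))"
proof -
  have 1: "(\<Sum>k<n. (R k i * unit_seq (n + j) k) *\<^sub>R 1) = (0 :: (nat \<Rightarrow> real) mform)" for i
    by (rule sum.neutral) (auto simp: unit_seq_def)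
  have "mpar (\<Sum>k<n. R k i *\<^sub>R mone (crd k)) = - (\<Sum>k<n. R k i *\<^sub>R mone (crd k))" for i
    by (simp add: mone_sum[symmetric] mone_linear(3)[symmetric])
  then have "contr (unit_seq (n + j)) \<zeta> = (\<Sum>i<n. if i = j then 2 *\<^sub>R (\<Sum>k<n. R k j *\<^sub>R mone (crd k)) else 0)"
    unfolding fusion_two_form_def contr_sum
    by (intro sum.cong refl) (auto simp: contr_mult contr_sum 1 unit_seq_def)
  then show ?thesis using assms by simp
qed

lemma mexp_fusion_two_form:
  "mexp \<zeta> = fsub (cl_chain (\<lambda>i. rot i * cl_gen (n + i)) n)"
  unfolding fsubst_rot_chain[OF order_refl] mexp_sum_mone[symmetric] fusion_two_form_def
  by (simp add: mone_sum mone_linear)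

text \<open>The contraction also hits the exponential and contributes
  \<open>-2 *\<^sub>R ?b\<close>. This cancels the second summand of the substituted one-form, so
  multiplication by \<open>crd j\<close> alone is left, as for the symbol on the doubled
  algebra.\<close>

lemma fusion_step_right:
  assumes "j < n" "B \<in> cl_on {..<n}"
  shows "mone (crd j) * (mexp \<zeta> * fsub' B) - (1/2) *\<^sub>R contr (unit_seq j) (mexp \<zeta> * fsub' B) =
    mexp \<zeta> * fsub' (cl_parity B * cl_gen j)"
proof -
  let ?E = "mexp \<zeta>"
  note h = mhom_fusion_two_form[of n R crd]
  let ?b = "\<Sum>k<n. R j k *\<^sub>R mone (crd (n + k))"
  have "contr (unit_seq j) (fsub' B) = (\<Sum>k<n. if k = j then fsub' (cl_gen j * B - cl_parity B * cl_gen j) else 0)"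
    unfolding contr_fsubst[OF assms(2)]
    by (rule sum.cong) (use assms(1) in \<open>auto simp: fusion_cov_def unit_seq_def\<close>)
  then have c: "contr (unit_seq j) (fsub' B) = fsub' (cl_gen j * B) - fsub' (cl_parity B * cl_gen j)"
    using assms(1) by (simp add: fsubst_linear)
  have "contr (unit_seq j) \<zeta> = -2 *\<^sub>R ?b"
    unfolding contr_left_two_form[OF assms(1)] by (simp add: scaleR_sum_right)
  then have "contr (unit_seq j) (?E * fsub' B) = ?E * (- 2 *\<^sub>R ?b * fsub' B + (fsub' (cl_gen j * B) - fsub' (cl_parity B * cl_gen j)))"
    by (simp only: contr_mult contr_mexp[OF h] mexp_even[OF h] c distrib_left mult.assoc mexp_comm[OF h, symmetric])
  moreover have m: "mone (crd j) * (?E * fsub' B) = ?E * (mone (crd j) * fsub' B)"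
    by (simp only: mult.assoc[symmetric] mexp_comm[OF h, of "mone (crd j)"])
  moreover have "fsub' (cl_gen j * B) = 2 *\<^sub>R ((mone (crd j) + ?b) * fsub' B) - fsub' (cl_parity B * cl_gen j)"
    using fsubst_left_right[of "fusion_cov n R crd" j B] by (simp add: mone_fusion_cov eq_diff_eq)
  ultimately have "contr (unit_seq j) (?E * fsub' B) =
      2 *\<^sub>R (?E * (mone (crd j) * fsub' B)) - 2 *\<^sub>R (?E * fsub' (cl_parity B * cl_gen j))"
    by (simp add: algebra_simps flip: scaleR_2)
  with m show ?thesis by (simp add: scaleR_right_diff_distrib)
qed

text \<open>The dual vector of the generator \<open>n + j\<close> meets \<open>fusion_cov\<close>
  only in its rotated summand, which yields \<open>rot j\<close>. Orthogonality collapses the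
  rotated sum of the substituted one-forms to \<open>?a + mone (crd (n + j))\<close>, and the
  contraction of the two-form cancels \<open>?a\<close>.\<close>

lemma fusion_step_left:
  assumes "j < n" "B \<in> cl_on {..<n}"
  shows "mone (crd (n + j)) * (mexp \<zeta> * fsub' B) + (1/2) *\<^sub>R contr (unit_seq (n + j)) (mexp \<zeta> * fsub' B) =
    mexp \<zeta> * fsub' (rot j * B)"
proof -
  let ?E = "mexp \<zeta>"
  note h = mhom_fusion_two_form[of n R crd]
  let ?a = "\<Sum>k<n. R k j *\<^sub>R mone (crd k)"
  have d: "fusion_cov n R crd k (unit_seq (n + j)) = R k j" if "k < n" for k
  proof -
    have "(\<Sum>l<n. R k l * unit_seq (n + j) (n + l)) = (\<Sum>l<n. if l = j then R k j else 0)"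
      by (rule sum.cong) (auto simp: unit_seq_def)
    then show ?thesis using that assms(1) by (simp add: fusion_cov_def unit_seq_def)
  qed
  have "contr (unit_seq (n + j)) (fsub' B) = (\<Sum>k<n. R k j *\<^sub>R fsub' (cl_gen k * B - cl_parity B * cl_gen k))"
    unfolding contr_fsubst[OF assms(2)] by (rule sum.cong) (simp_all add: d)
  then have c: "contr (unit_seq (n + j)) (fsub' B) = fsub' (rot j * B) - fsub' (cl_parity B * rot j)"
    by (simp add: cl_vec_def fsubst_linear sum_distrib_left sum_distrib_right sum_subtractf scaleR_right_diff_distrib)
  have "contr (unit_seq (n + j)) (?E * fsub' B) = ?E * (2 *\<^sub>R ?a * fsub' B + (fsub' (rot j * B) - fsub' (cl_parity B * rot j)))"
    by (simp only: contr_mult contr_mexp[OF h] mexp_even[OF h] c contr_right_two_form[OF assms(1)]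
        distrib_left mult.assoc mexp_comm[OF h, symmetric])
  moreover have m: "mone (crd (n + j)) * (?E * fsub' B) = ?E * (mone (crd (n + j)) * fsub' B)"
    by (simp only: mult.assoc[symmetric] mexp_comm[OF h, of "mone (crd (n + j))"])
  moreover have "fsub' (cl_parity B * rot j) = 2 *\<^sub>R ((?a + mone (crd (n + j))) * fsub' B) - fsub' (rot j * B)"
  proof -
    have "(\<Sum>k<n. R k j *\<^sub>R mone (fusion_cov n R crd k)) =
        ?a + (\<Sum>k<n. \<Sum>l<n. (R k j * R k l) *\<^sub>R mone (crd (n + l)))"
      by (simp add: mone_fusion_cov scaleR_right_distrib sum.distrib scaleR_sum_right)
    also have "(\<Sum>k<n. \<Sum>l<n. (R k j * R k l) *\<^sub>R mone (crd (n + l))) =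
        (\<Sum>l<n. (\<Sum>k<n. R k j * R k l) *\<^sub>R mone (crd (n + l)))"
      by (subst sum.swap) (simp add: scaleR_left.sum)
    also have "\<dots> = (\<Sum>l<n. if l = j then mone (crd (n + j)) else 0)"
      using assms(1) by (intro sum.cong refl) (simp add: orth)
    finally show ?thesis using fsubst_vec_left_right[of "fusion_cov n R crd" n "\<lambda>k. R k j" B] assms(1)
      by (simp add: eq_diff_eq add.commute)
  qed
  ultimately have "contr (unit_seq (n + j)) (?E * fsub' B) =
      2 *\<^sub>R (?E * fsub' (rot j * B)) - 2 *\<^sub>R (?E * (mone (crd (n + j)) * fsub' B))"
    by (simp add: algebra_simps flip: scaleR_2)
  with m show ?thesis by (simp add: scaleR_right_diff_distrib)
qed

text \<open>First the factor \<open>A' W\<close> is varied by right multiplications, starting from \<open>A A' = 1\<close>, where the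
  identity is \<open>mexp_fusion_two_form\<close> up to conjugation by \<open>A\<close>; then \<open>X\<close> is varied by left
  multiplications.\<close>

lemma fusion_identity_free:
  assumes A: "A \<in> cl_on {..<n}" and A': "A' \<in> cl_on {..<n}" and inv: "A * A' = 1" "A' * A = 1"
    and tw: "\<And>j. j < n \<Longrightarrow> cl_parity A * cl_gen j = rot j * A"
    and X: "X \<in> cl_on {..<n}"
  shows "fsub (A * cl_shift n X * cl_chain (\<lambda>i. cl_gen i * cl_gen (n + i)) n) = mexp \<zeta> * fsub' (A * X)"
proof -
  let ?k = "cl_chain (\<lambda>i. cl_gen i * cl_gen (n + i)) n"
  let ?E = "mexp \<zeta>"
  note h = mhom_fusion_two_form[of n R crd]
  have even: "cl_parity ?k = ?k" by (rule cl_parity_chain) simp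
  have tw': "A * cl_gen j = rot j * cl_parity A" if "j < n" for j
    using arg_cong[OF tw[OF that], of cl_parity] by simp
  have conj: "A * ?k = cl_chain (\<lambda>i. rot i * cl_gen (n + i)) n * A"
  proof (rule cl_chain_conj)
    fix i assume i: "i < n"
    have "A * (cl_gen i * cl_gen (n + i)) = rot i * (cl_parity A * cl_gen (n + i))"
      using tw'[OF i] by (simp add: mult.assoc[symmetric])
    also have "cl_parity A * cl_gen (n + i) = cl_gen (n + i) * A"
      using cl_gen_comm[OF A, of "n + i"] by simp
    finally show "A * (cl_gen i * cl_gen (n + i)) = rot i * cl_gen (n + i) * A" by (simp add: mult.assoc)
  qed
  have right: "?E * fsub' (A * (A' * W)) = fsub (A * ?k * (A' * W))" if "W \<in> cl_on {..<n}" for W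
    using that
  proof (induction rule: cl_on_induct_right)
    case one
    then show ?case using inv conj by (simp add: mexp_fusion_two_form mult.assoc)
  next
    case (gen j W)
    let ?B = "A * (A' * W)" and ?Z = "A * ?k * (A' * W)"
    have B: "?B \<in> cl_on {..<n}" using A A' gen by (intro cl_on_mult)
    have "?E * fsub' (cl_parity ?B * cl_gen j) = fsub (cl_parity ?Z * cl_gen j)"
      using fusion_step_right[OF _ B, of j] gen by (simp only: gen fsubst_gen_right lessThan_iff)
    \<comment> \<open>The operator realises \<open>cl_parity ?B * cl_gen j\<close>. Applying parity
      to both sides removes the automorphism up to a common sign, since the exponential and the
      chain are even.\<close>
    then have "mpar (?E * fsub' (cl_parity ?B * cl_gen j)) = mpar (fsub (cl_parity ?Z * cl_gen j))" by simp
    then show ?case by (simp add: mexp_even[OF h] mpar_fsubst fsubst_minus mult.assoc even)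
  qed (simp_all add: distrib_left fsubst_linear)
  have base: "?E * fsub' A = fsub (A * ?k)"
    using right[OF A] inv by (simp add: mult.assoc)
  \<comment> \<open>The claim for \<open>cl_parity A\<close> is carried along because moving
    \<open>cl_gen (n + j)\<close> past \<open>A\<close> exchanges \<open>A\<close> and
    \<open>cl_parity A\<close> on both sides.\<close>
  have "?E * fsub' (A * X) = fsub (A * cl_shift n X * ?k) \<and>
      ?E * fsub' (cl_parity A * X) = fsub (cl_parity A * cl_shift n X * ?k)"
    using X
  proof (induction rule: cl_on_induct)
    case one
    have "?E * fsub' (cl_parity A) = fsub (cl_parity A * ?k)"
      using arg_cong[OF base, of mpar] by (simp add: mexp_even[OF h] mpar_fsubst even)
    then show ?case using base by simp
  next
    case (gen j X)
    have j: "j < n" using gen by simp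
    have step: "?E * fsub' (rot j * D) = fsub (cl_gen (n + j) * Z)" if "D \<in> cl_on {..<n}" "?E * fsub' D = fsub Z" for D Z
      using fusion_step_left[OF j that(1)] that(2) by (simp only: fsubst_gen_left)
    have "?E * fsub' (rot j * (A * X)) = fsub (cl_gen (n + j) * (A * cl_shift n X * ?k))"
      using gen A by (intro step cl_on_mult) auto
    moreover have "?E * fsub' (rot j * (cl_parity A * X)) = fsub (cl_gen (n + j) * (cl_parity A * cl_shift n X * ?k))"
      using gen cl_parity_in[OF A] by (intro step cl_on_mult) auto
    moreover have "cl_gen (n + j) * (A * cl_shift n X * ?k) = cl_parity A * cl_shift n (cl_gen j * X) * ?k"
      using cl_gen_comm[OF A, of "n + j"] by (simp add: cl_shift_gen_mult mult.assoc[symmetric])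
    moreover have "cl_gen (n + j) * (cl_parity A * cl_shift n X * ?k) = A * cl_shift n (cl_gen j * X) * ?k"
      using cl_gen_comm[OF cl_parity_in[OF A], of "n + j"] by (simp add: cl_shift_gen_mult mult.assoc[symmetric])
    moreover have "rot j * (A * X) = cl_parity A * (cl_gen j * X)"
      using tw[OF j] by (simp add: mult.assoc[symmetric])
    moreover have "rot j * (cl_parity A * X) = A * (cl_gen j * X)"
      using tw'[OF j] by (simp add: mult.assoc[symmetric])
    ultimately show ?case by simp
  qed (simp_all add: distrib_left distrib_right fsubst_linear cl_shift_add cl_shift_scale)
  then show ?thesis by simp
qed

end

subsection \<open>Pulling back from the free model\<close>

lift_definition mpull :: "('u \<Rightarrow> 'v) \<Rightarrow> 'v mform \<Rightarrow> 'u mform" is "\<lambda>f \<alpha> vs. \<alpha> (map f vs)" .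

lemma mpull_linear [simp]:
  "mpull f (\<alpha> + \<beta>) = mpull f \<alpha> + mpull f \<beta>" "mpull f (r *\<^sub>R \<alpha>) = r *\<^sub>R mpull f \<alpha>" "mpull f 0 = 0"
  "mpull f (- \<alpha>) = - mpull f \<alpha>"
  by (rule mform_eqI; simp add: mpull.rep_eq)+

lemma mpull_mult [simp]: "mpull f (\<alpha> * \<beta>) = mpull f \<alpha> * mpull f \<beta>"
  by (rule mform_eqI) (simp add: mpull.rep_eq times_mform.rep_eq wedge_by_def nths_map)

lemma mpull_one [simp]: "mpull f 1 = 1"
  by (rule mform_eqI) (simp add: mpull.rep_eq one_mform.rep_eq unit_form_def)

lemma mpull_mone [simp]: "mpull f (mone a) = mone (\<lambda>v. a (f v))"
  by (rule mform_eqI) (auto simp: mpull.rep_eq mone_def one_form_def split: list.splits)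

lemma mpull_sum: "mpull f (\<Sum>i\<in>S. \<alpha> i) = (\<Sum>i\<in>S. mpull f (\<alpha> i))"
  by (induction S rule: infinite_finite_induct) simp_all

lemma mpull_power [simp]: "mpull f (\<alpha> ^ k) = mpull f \<alpha> ^ k"
  by (induction k) simp_all

lemma mpull_mexp [simp]: "mpull f (mexp \<alpha>) = mexp (mpull f \<alpha>)"
proof (rule mform_eqI)
  fix vs
  have "mval (mpull f \<alpha> ^ k) vs = mval (\<alpha> ^ k) (map f vs)" for k
    by (simp only: mpull_power[symmetric] mpull.rep_eq)
  moreover have "mval (mpull f (mexp \<alpha>)) vs = mval (mexp \<alpha>) (map f vs)"
    by (simp only: mpull.rep_eq)
  ultimately show "mval (mpull f (mexp \<alpha>)) vs = mval (mexp (mpull f \<alpha>)) vs"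
    by (simp only: mexp_def mval_Mform exp_form_def mval_power[symmetric])
qed

lemma mpull_cov_prod: "mpull f (cov_prod c I) = cov_prod (\<lambda>i v. c i (f v)) I"
proof -
  have "mpull f (prod_list (map (\<lambda>i. mone (c i)) xs)) = prod_list (map (\<lambda>i. mone (\<lambda>v. c i (f v))) xs)" for xs
    by (induction xs) simp_all
  then show ?thesis by (simp add: cov_prod_def)
qed

lemma mpull_fsubst: "mpull f (fsubst c B) = fsubst (\<lambda>i v. c i (f v)) B"
  by (simp add: fsubst_def mpull_sum mpull_cov_prod)

text \<open>The map sending a vector \<open>v\<close> to the sequence of the values
  \<open>c i v\<close> pulls the coordinate \<open>crd i\<close> back to \<open>c i\<close>.
  Pullback respects products, exponentials and substitutions, so the free identity specialises to
  every family \<open>c\<close>.\<close>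

lemma fusion_identity:
  fixes c :: "nat \<Rightarrow> 'v \<Rightarrow> real"
  assumes orth: "\<And>i j. i < n \<Longrightarrow> j < n \<Longrightarrow> (\<Sum>k<n. R k i * R k j) = (if i = j then 1 else 0)"
    and "A \<in> cl_on {..<n}" "A' \<in> cl_on {..<n}" "A * A' = 1" "A' * A = 1"
    and "\<And>j. j < n \<Longrightarrow> cl_parity A * cl_gen j = cl_vec n (\<lambda>k. R k j) * A"
    and "X \<in> cl_on {..<n}"
  shows "fsubst c (A * cl_shift n X * cl_chain (\<lambda>i. cl_gen i * cl_gen (n + i)) n) =
    mexp (fusion_two_form n R c) * fsubst (fusion_cov n R c) (A * X)"
proof -
  have "mpull (\<lambda>v i. c i v) (fsubst crd (A * cl_shift n X * cl_chain (\<lambda>i. cl_gen i * cl_gen (n + i)) n)) =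
    mpull (\<lambda>v i. c i v) (mexp (fusion_two_form n R crd) * fsubst (fusion_cov n R crd) (A * X))"
    by (subst fusion_identity_free[OF assms]) simp_all
  moreover have "(\<lambda>i v. fusion_cov n R crd i (\<lambda>i. c i v)) = fusion_cov n R c"
    by (simp add: fusion_cov_def fun_eq_iff)
  moreover have "mpull (\<lambda>v i. c i v) (fusion_two_form n R crd) = fusion_two_form n R c"
    by (simp add: fusion_two_form_def mpull_sum)
  ultimately show ?thesis by (simp add: mpull_fsubst)
qed


section \<open>The exponential of the contraction operator\<close>

text \<open>The effect on \<open>Z\<close> of contracting \<open>e\<^sup>\<omega> S(Z)\<close> with the \<open>j\<close>-th generating vector field, see
  \<open>contr_mexp_fsubst\<close>.\<close>

definition cl_tw :: "(nat \<Rightarrow> cliff) \<Rightarrow> nat \<Rightarrow> cliff \<Rightarrow> cliff" where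
  "cl_tw y j Z = y j * Z + cl_parity Z * cl_gen j"

lemma cl_tw_linear:
  "cl_tw y j (Z + W) = cl_tw y j Z + cl_tw y j W" "cl_tw y j (r *\<^sub>R Z) = r *\<^sub>R cl_tw y j Z"
  by (simp_all add: cl_tw_def distrib_left distrib_right scaleR_right_distrib)

text \<open>The mixed left-right terms cancel by parity. What remains is the anticommutator of the
  vectors \<open>y\<close> on the left minus that of the generators on the right; these are equal
  scalars.\<close>

lemma cl_tw_anticomm:
  assumes "y i * y j + y j * y i = cl_gen i * cl_gen j + cl_gen j * cl_gen i"
    and "cl_parity (y i) = - y i" "cl_parity (y j) = - y j"
  shows "cl_tw y i (cl_tw y j Z) = - cl_tw y j (cl_tw y i Z)"
proof -
  have "cl_tw y i (cl_tw y j Z) + cl_tw y j (cl_tw y i Z) =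
     (y i * y j + y j * y i) * Z - Z * (cl_gen i * cl_gen j + cl_gen j * cl_gen i)"
    using assms(2,3) by (simp add: cl_tw_def algebra_simps)
  also have "\<dots> = 0"
    unfolding assms(1) cl_gen_relation[of i j] by simp
  finally show ?thesis by (simp add: eq_neg_iff_add_eq_0)
qed

text \<open>The binomial formula, in which only the terms with at most one factor \<open>g\<close>
  survive.\<close>

lemma funpow_commuting_sum:
  fixes f g :: "'a::real_vector \<Rightarrow> 'a"
  assumes lf: "\<And>x y. f (x + y) = f x + f y" "\<And>r x. f (r *\<^sub>R x) = r *\<^sub>R f x"
    and lg: "\<And>x y. g (x + y) = g x + g y" "\<And>r x. g (r *\<^sub>R x) = r *\<^sub>R g x"
    and fg: "\<And>x. f (g x) = g (f x)" and gg: "\<And>x. g (g x) = 0"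
  shows "((\<lambda>x. f x + g x) ^^ Suc k) x = (f ^^ Suc k) x + real (Suc k) *\<^sub>R g ((f ^^ k) x)"
proof (induction k)
  case (Suc k)
  have fgk: "f (g ((f ^^ k) x)) = g ((f ^^ Suc k) x)" by (simp add: fg)
  have "((\<lambda>x. f x + g x) ^^ Suc (Suc k)) x =
      f ((f ^^ Suc k) x + real (Suc k) *\<^sub>R g ((f ^^ k) x)) + g ((f ^^ Suc k) x + real (Suc k) *\<^sub>R g ((f ^^ k) x))"
    using Suc by simp
  also have "\<dots> = (f ^^ Suc (Suc k)) x + (real (Suc k) *\<^sub>R g ((f ^^ Suc k) x) + g ((f ^^ Suc k) x))"
    by (simp only: lf lg gg fgk funpow.simps comp_apply) simp
  also have "real (Suc k) *\<^sub>R g ((f ^^ Suc k) x) + g ((f ^^ Suc k) x) = real (Suc (Suc k)) *\<^sub>R g ((f ^^ Suc k) x)"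
    by (simp only: of_nat_Suc[of "Suc k"] scaleR_left_distrib) simp
  finally show ?case .
qed simp

text \<open>This is \<open>exp (f + g) = (1 + g) exp f\<close>. The truncation behind
  \<open>g\<close> is one lower because \<open>g\<close> itself uses one power.\<close>

lemma exp_commuting_step:
  fixes f g :: "'a::real_vector \<Rightarrow> 'a"
  assumes lf: "\<And>x y. f (x + y) = f x + f y" "\<And>r x. f (r *\<^sub>R x) = r *\<^sub>R f x"
    and lg: "\<And>x y. g (x + y) = g x + g y" "\<And>r x. g (r *\<^sub>R x) = r *\<^sub>R g x"
    and fg: "\<And>x. f (g x) = g (f x)" and gg: "\<And>x. g (g x) = 0"
  shows "(\<Sum>k\<le>Suc m. (1 / fact k) *\<^sub>R ((\<lambda>x. f x + g x) ^^ k) x) =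
    (\<Sum>k\<le>Suc m. (1 / fact k) *\<^sub>R (f ^^ k) x) + g (\<Sum>k\<le>m. (1 / fact k) *\<^sub>R (f ^^ k) x)"
proof -
  have g0: "g 0 = 0" using lg(2)[of 0 0] by simp
  have gs: "g (\<Sum>k\<in>A. h k) = (\<Sum>k\<in>A. g (h k))" for h and A :: "nat set"
    by (induction A rule: infinite_finite_induct) (simp_all add: g0 lg)
  have c: "(1 / fact (Suc k)) * real (Suc k) = 1 / fact k" for k
    by (simp add: fact_Suc)
  have "(\<Sum>k\<le>Suc m. (1 / fact k) *\<^sub>R ((\<lambda>x. f x + g x) ^^ k) x) =
      x + (\<Sum>k\<le>m. (1 / fact (Suc k)) *\<^sub>R ((\<lambda>x. f x + g x) ^^ Suc k) x)"
    by (subst sum.atMost_Suc_shift) simp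
  also have "\<dots> = x + (\<Sum>k\<le>m. (1 / fact (Suc k)) *\<^sub>R (f ^^ Suc k) x + (1 / fact k) *\<^sub>R g ((f ^^ k) x))"
    unfolding funpow_commuting_sum[of f g, OF assms] scaleR_right_distrib scaleR_scaleR c ..
  also have "\<dots> = (x + (\<Sum>k\<le>m. (1 / fact (Suc k)) *\<^sub>R (f ^^ Suc k) x)) + g (\<Sum>k\<le>m. (1 / fact k) *\<^sub>R (f ^^ k) x)"
    by (simp only: sum.distrib gs lg add.assoc)
  also have "x + (\<Sum>k\<le>m. (1 / fact (Suc k)) *\<^sub>R (f ^^ Suc k) x) = (\<Sum>k\<le>Suc m. (1 / fact k) *\<^sub>R (f ^^ k) x)"
    by (subst sum.atMost_Suc_shift) simp
  finally show ?thesis .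
qed

definition fusion_summand :: "nat \<Rightarrow> (nat \<Rightarrow> cliff) \<Rightarrow> nat \<Rightarrow> cliff \<Rightarrow> cliff" where
  "fusion_summand n y i W = - (1/2) *\<^sub>R cl_tw y i (cl_tw y (n + i) W)"

text \<open>For \<open>m = n\<close> this is the operator of the overview transported to Clifford
  elements. Partial sums are used so that the summands can be exponentiated one after
  another.\<close>

definition fusion_op :: "nat \<Rightarrow> (nat \<Rightarrow> cliff) \<Rightarrow> nat \<Rightarrow> cliff \<Rightarrow> cliff" where
  "fusion_op n y m W = (\<Sum>i<m. fusion_summand n y i W)"

context
  fixes n :: nat and y :: "nat \<Rightarrow> cliff" and Z :: cliff
  assumes rel: "\<And>i j. i < 2 * n \<Longrightarrow> j < 2 * n \<Longrightarrow> y i * y j + y j * y i = (if i = j then 1 else 0)"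
    and odd: "\<And>i. i < 2 * n \<Longrightarrow> cl_parity (y i) = - y i"
    and tw: "\<And>i. i < 2 * n \<Longrightarrow> y i * Z = cl_parity Z * cl_gen i"
begin

lemma fusion_summand_linear:
  "fusion_summand n y i (V + W) = fusion_summand n y i V + fusion_summand n y i W"
  "fusion_summand n y i (r *\<^sub>R W) = r *\<^sub>R fusion_summand n y i W"
  by (simp_all add: fusion_summand_def cl_tw_linear scaleR_right_distrib)

lemma tw_minus: "cl_tw y i (- W) = - cl_tw y i W"
  using cl_tw_linear(2)[of y i "-1" W] by simp

lemma tw_anti: "i < 2 * n \<Longrightarrow> j < 2 * n \<Longrightarrow> cl_tw y i (cl_tw y j W) = - cl_tw y j (cl_tw y i W)"
  by (rule cl_tw_anticomm) (simp_all add: rel odd cl_gen_relation)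

lemma tw_square: "i < 2 * n \<Longrightarrow> cl_tw y i (cl_tw y i W) = 0"
  using tw_anti[of i i W] by (simp add: eq_neg_iff_add_eq_0 flip: scaleR_2)

lemma tw_zero: "cl_tw y i 0 = 0"
  by (simp add: cl_tw_def)

lemma fusion_summand_comm:
  assumes "i < n" "j < n"
  shows "fusion_summand n y i (fusion_summand n y j W) = fusion_summand n y j (fusion_summand n y i W)"
proof -
  have "cl_tw y i (cl_tw y (n + i) (cl_tw y j (cl_tw y (n + j) W))) =
      cl_tw y j (cl_tw y (n + j) (cl_tw y i (cl_tw y (n + i) W)))"
    using assms tw_anti[of "n + i" j] tw_anti[of "n + i" "n + j"] tw_anti[of i j] tw_anti[of i "n + j"]
    by (simp add: tw_minus)
  then show ?thesis by (simp add: fusion_summand_def cl_tw_linear tw_minus)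
qed

lemma fusion_summand_square: "i < n \<Longrightarrow> fusion_summand n y i (fusion_summand n y i W) = 0"
  using tw_anti[of "n + i" i] tw_square[of i] tw_square[of "n + i"]
  by (simp add: fusion_summand_def cl_tw_linear tw_minus tw_zero)

text \<open>By the twist relation both terms of \<open>cl_tw\<close> agree on \<open>Z * K\<close>,
  so each of the two twists produces a factor 2, and together with \<open>-1/2\<close> the
  coefficient \<open>-2\<close> appears.\<close>

lemma fusion_summand_chain:
  assumes "m < n"
  defines "K \<equiv> cl_chain (\<lambda>i. cl_gen i * cl_gen (n + i)) m"
  shows "Z * K + fusion_summand n y m (Z * K) = Z * ((1 - 2 *\<^sub>R (cl_gen m * cl_gen (n + m))) * K)"
proof -
  have even: "cl_parity K = K" unfolding K_def by (rule cl_parity_chain) simp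
  have K: "K \<in> cl_on ({..<m} \<union> {n..<n + m})"
    unfolding K_def by (intro cl_chain_in cl_on_mult cl_gen_in) auto
  have c1: "cl_gen m * K = K * cl_gen m" using cl_gen_comm[OF K, of m] assms even by auto
  have c2: "cl_gen (n + m) * K = K * cl_gen (n + m)" using cl_gen_comm[OF K, of "n + m"] assms even by auto
  have c3: "cl_gen (n + m) * cl_gen m = - (cl_gen m * cl_gen (n + m))"
    using cl_gen_relation[of "n + m" m] assms(1) by (simp add: eq_neg_iff_add_eq_0)
  have tw1: "y (n + m) * Z = cl_parity Z * cl_gen (n + m)" using tw[of "n + m"] assms(1) by simp
  have tw2: "y m * cl_parity Z = Z * cl_gen m"
    using arg_cong[OF tw[of m], of cl_parity] assms(1) odd[of m] by simp
  have "cl_tw y (n + m) (Z * K) = 2 *\<^sub>R (cl_parity Z * (cl_gen (n + m) * K))"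
    using tw1 c2 even by (simp add: cl_tw_def scaleR_2 mult.assoc[symmetric]) (simp add: mult.assoc)
  moreover have "cl_tw y m (cl_parity Z * (cl_gen (n + m) * K)) = 2 *\<^sub>R (Z * (cl_gen m * cl_gen (n + m) * K))"
  proof -
    have "y m * (cl_parity Z * (cl_gen (n + m) * K)) = Z * (cl_gen m * cl_gen (n + m) * K)"
      using tw2 by (simp add: mult.assoc[symmetric])
    moreover have "cl_parity (cl_parity Z * (cl_gen (n + m) * K)) * cl_gen m = Z * (cl_gen m * cl_gen (n + m) * K)"
    proof -
      have "cl_gen (n + m) * (cl_gen m * K) = - (cl_gen m * (cl_gen (n + m) * K))"
        using c3 by (simp add: mult.assoc[symmetric])
      then show ?thesis by (simp add: mult.assoc c1[symmetric] even)
    qed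
    ultimately show ?thesis by (simp add: cl_tw_def scaleR_2)
  qed
  ultimately show ?thesis
    by (simp add: fusion_summand_def cl_tw_linear left_diff_distrib right_diff_distrib)
qed

lemma fusion_op_linear:
  "fusion_op n y m (V + W) = fusion_op n y m V + fusion_op n y m W" "fusion_op n y m (r *\<^sub>R W) = r *\<^sub>R fusion_op n y m W"
  by (simp_all add: fusion_op_def fusion_summand_linear sum.distrib scaleR_sum_right)

lemma fusion_op_Suc: "fusion_op n y (Suc m) = (\<lambda>W. fusion_op n y m W + fusion_summand n y m W)"
  by (rule ext) (simp add: fusion_op_def)

lemma fusion_summand_sum: "fusion_summand n y i (\<Sum>j\<in>J. f j) = (\<Sum>j\<in>J. fusion_summand n y i (f j))"
  using fusion_summand_linear(2)[of i 0 0]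
  by (induction J rule: infinite_finite_induct) (simp_all add: fusion_summand_linear)

lemma fusion_op_comm: "m < n \<Longrightarrow> fusion_op n y m (fusion_summand n y m W) = fusion_summand n y m (fusion_op n y m W)"
  by (simp add: fusion_op_def fusion_summand_sum fusion_summand_comm)

text \<open>In a power with more factors than there are summands some summand repeats; the summands
  commute and each has square zero.\<close>

lemma fusion_op_nilpotent: "m \<le> n \<Longrightarrow> m < k \<Longrightarrow> (fusion_op n y m ^^ k) W = 0"
proof (induction m arbitrary: k)
  case 0
  then obtain l where "k = Suc l" by (cases k) auto
  then show ?case by (simp add: fusion_op_def)
next
  case (Suc m)
  then obtain l where l: "k = Suc l" "m < l" by (cases k) auto
  have "fusion_summand n y m 0 = 0" using fusion_summand_linear(2)[of m 0 0] by simp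
  moreover have "(fusion_op n y (Suc m) ^^ Suc l) W =
      (fusion_op n y m ^^ Suc l) W + real (Suc l) *\<^sub>R fusion_summand n y m ((fusion_op n y m ^^ l) W)"
    unfolding fusion_op_Suc
    by (rule funpow_commuting_sum)
      (use Suc.prems in \<open>simp_all add: fusion_op_linear fusion_summand_linear fusion_op_comm fusion_summand_square\<close>)
  ultimately show ?case using Suc.IH[of l] Suc.IH[of "Suc l"] Suc.prems l by simp
qed

lemma exp_fusion_op:
  assumes "m \<le> n"
  shows "(\<Sum>k\<le>m. (1 / fact k) *\<^sub>R (fusion_op n y m ^^ k) Z) = Z * cl_chain (\<lambda>i. cl_gen i * cl_gen (n + i)) m"
  using assms
proof (induction m)
  case (Suc m)
  have "(\<Sum>k\<le>Suc m. (1 / fact k) *\<^sub>R (fusion_op n y (Suc m) ^^ k) Z) =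
      (\<Sum>k\<le>Suc m. (1 / fact k) *\<^sub>R (fusion_op n y m ^^ k) Z) + fusion_summand n y m (\<Sum>k\<le>m. (1 / fact k) *\<^sub>R (fusion_op n y m ^^ k) Z)"
    unfolding fusion_op_Suc
    by (rule exp_commuting_step)
      (use Suc.prems in \<open>simp_all add: fusion_op_linear fusion_summand_linear fusion_op_comm fusion_summand_square\<close>)
  \<comment> \<open>The last term is zero by nilpotency, so both sums can be cut at \<open>m\<close>
    and the induction hypothesis applies to each.\<close>
  also have "(\<Sum>k\<le>Suc m. (1 / fact k) *\<^sub>R (fusion_op n y m ^^ k) Z) = (\<Sum>k\<le>m. (1 / fact k) *\<^sub>R (fusion_op n y m ^^ k) Z)"
    using fusion_op_nilpotent[of m "Suc m" Z] Suc.prems by simp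
  finally show ?case using Suc fusion_summand_chain[of m] by simp
qed simp

end

subsection \<open>Contractions with generating vector fields\<close>

text \<open>Contracting the exponent gives half the sum of left and right multiplications,
  contracting the symbol half their differences, with opposite signs for the vector \<open>u\<close>
  and the generator \<open>j\<close>. Adding them leaves only the left multiplication by the vector
  and the twisted right multiplication by the generator. The hypotheses have the shapes taken by the
  moment map condition and by the equivariance of the moment map.\<close>

lemma contr_mexp_fsubst:
  assumes w: "mhom 2 w"
    and wX: "contr X w = mone (c j) + (\<Sum>k<N. u k *\<^sub>R mone (c k))"
    and cX: "\<And>k. k < N \<Longrightarrow> c k X = (u k - (if k = j then 1 else 0)) / 2"
    and j: "j < N" and B: "B \<in> cl_on {..<N}"
  shows "contr X (mexp w * fsubst c B) = mexp w * fsubst c (cl_vec N u * B + cl_parity B * cl_gen j)"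
proof -
  let ?f = "fsubst c" and ?v = "cl_vec N u"
  have "contr X (?f B) = (\<Sum>k<N. (u k / 2) *\<^sub>R ?f (cl_gen k * B - cl_parity B * cl_gen k) -
      (if k = j then (1/2) *\<^sub>R ?f (cl_gen j * B - cl_parity B * cl_gen j) else 0))"
    unfolding contr_fsubst[OF B]
    by (rule sum.cong) (use cX in \<open>auto simp: diff_divide_distrib scaleR_left_diff_distrib\<close>)
  also have "\<dots> = (1/2) *\<^sub>R (?f (?v * B) - ?f (cl_parity B * ?v)) - (1/2) *\<^sub>R (?f (cl_gen j * B) - ?f (cl_parity B * cl_gen j))"
    using j by (simp add: sum_subtractf cl_vec_def fsubst_linear sum_distrib_left sum_distrib_right
        scaleR_sum_right scaleR_right_diff_distrib)
  finally have 1: "contr X (?f B) = (1/2) *\<^sub>R (?f (?v * B) - ?f (cl_parity B * ?v)) - (1/2) *\<^sub>R (?f (cl_gen j * B) - ?f (cl_parity B * cl_gen j))" .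
  have 2: "contr X w * ?f B = (1/2) *\<^sub>R (?f (?v * B) + ?f (cl_parity B * ?v)) + (1/2) *\<^sub>R (?f (cl_gen j * B) + ?f (cl_parity B * cl_gen j))"
    unfolding fsubst_vec_left_right fsubst_left_right wX by (simp add: distrib_right)
  have "contr X (mexp w * ?f B) = mexp w * (contr X w * ?f B + contr X (?f B))"
    by (simp only: contr_mult contr_mexp[OF w] mexp_even[OF w] mexp_comm[OF w, of "contr X w", symmetric] mult.assoc distrib_left)
  also have "contr X w * ?f B + contr X (?f B) = ?f (?v * B + cl_parity B * cl_gen j)"
  proof -
    have "2 *\<^sub>R (contr X w * ?f B + contr X (?f B)) = 2 *\<^sub>R ?f (?v * B + cl_parity B * cl_gen j)"
      unfolding 1 2 by (simp add: fsubst_linear algebra_simps scaleR_2)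
    then show ?thesis by simp
  qed
  finally show ?thesis .
qed


section \<open>Restriction to a subspace and alternating forms\<close>

lift_definition mrestr :: "'v set \<Rightarrow> 'v mform \<Rightarrow> 'v mform" is
  "\<lambda>V \<alpha> vs. if set vs \<subseteq> V then \<alpha> vs else 0" .

lemma mval_mrestr: "set vs \<subseteq> V \<Longrightarrow> mval (mrestr V \<alpha>) vs = mval \<alpha> vs"
  by transfer simp

lemma mrestr_linear [simp]:
  "mrestr V (\<alpha> + \<beta>) = mrestr V \<alpha> + mrestr V \<beta>" "mrestr V (r *\<^sub>R \<alpha>) = r *\<^sub>R mrestr V \<alpha>"
  "mrestr V 0 = 0" "mrestr V (mrestr V \<alpha>) = mrestr V \<alpha>"
  by (rule mform_eqI; simp add: mrestr.rep_eq)+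

text \<open>The cut-off value is 0, and if some argument leaves \<open>V\<close>, then in every
  splitting one of the two sublists contains it, so every term of the product vanishes too.\<close>

lemma mrestr_mult [simp]: "mrestr V (\<alpha> * \<beta>) = mrestr V \<alpha> * mrestr V \<beta>"
proof (rule mform_eqI)
  fix vs
  show "mval (mrestr V (\<alpha> * \<beta>)) vs = mval (mrestr V \<alpha> * mrestr V \<beta>) vs"
  proof (cases "set vs \<subseteq> V")
    case True
    then have "set (nths vs S) \<subseteq> V" for S using set_nths_subset[of vs S] by blast
    with True show ?thesis by (simp add: mrestr.rep_eq times_mform.rep_eq wedge_by_def)
  next
    case False
    then obtain x where "x \<in> set vs" "x \<notin> V" by auto
    then obtain i where i: "i < length vs" "vs ! i \<notin> V" by (metis in_set_conv_nth)
    have "\<not> (set (nths vs S) \<subseteq> V \<and> set (nths vs (- S)) \<subseteq> V)" for S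
      using i by (cases "i \<in> S") (auto simp: set_nths)
    then have z: "mval (mrestr V \<alpha>) (nths vs S) * mval (mrestr V \<beta>) (nths vs (- S)) = 0" for S
      by (auto simp: mrestr.rep_eq)
    have "mval (mrestr V \<alpha> * mrestr V \<beta>) vs = 0"
      unfolding times_mform.rep_eq wedge_by_def z by simp
    with False show ?thesis by (simp add: mrestr.rep_eq[of V "\<alpha> * \<beta>"])
  qed
qed

lemma mrestr_one [simp]: "mrestr V 1 = 1"
  by (rule mform_eqI) (auto simp: mrestr.rep_eq one_mform.rep_eq unit_form_def)

lemma mrestr_mone [simp]: "mrestr V (mone a) = mone (\<lambda>v. if v \<in> V then a v else 0)"
  by (rule mform_eqI) (auto simp: mrestr.rep_eq mone_def one_form_def split: list.splits)

lemma mrestr_sum: "mrestr V (\<Sum>i\<in>S. \<alpha> i) = (\<Sum>i\<in>S. mrestr V (\<alpha> i))"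
  by (induction S rule: infinite_finite_induct) simp_all

lemma mrestr_power [simp]: "mrestr V (\<alpha> ^ k) = mrestr V \<alpha> ^ k"
  by (induction k) simp_all

lemma mrestr_mexp: 
  assumes "mhom 2 \<alpha>" shows "mrestr V (mexp \<alpha>) = mexp (mrestr V \<alpha>)"
proof (rule mform_eqI)
  fix vs
  have h: "mhom 2 (mrestr V \<alpha>)" using assms by (simp add: mhom_def mrestr.rep_eq)
  have "mval (mrestr V \<alpha> ^ k) vs = (if set vs \<subseteq> V then mval (\<alpha> ^ k) vs else 0)" for k
    by (simp only: mrestr_power[symmetric] mrestr.rep_eq)
  then have "mval (mexp (mrestr V \<alpha>)) vs = (if set vs \<subseteq> V then mval (mexp \<alpha>) vs else 0)"
    by (simp add: mval_mexp[OF h order_refl] mval_mexp[OF assms order_refl])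
  then show "mval (mrestr V (mexp \<alpha>)) vs = mval (mexp (mrestr V \<alpha>)) vs"
    by (simp add: mrestr.rep_eq[of V "mexp \<alpha>"])
qed

lemma mrestr_cov_prod: "mrestr V (cov_prod c I) = cov_prod (\<lambda>i v. if v \<in> V then c i v else 0) I"
proof -
  have "mrestr V (prod_list (map (\<lambda>i. mone (c i)) xs)) =
      prod_list (map (\<lambda>i. mone (\<lambda>v. if v \<in> V then c i v else 0)) xs)" for xs
    by (induction xs) simp_all
  then show ?thesis by (simp add: cov_prod_def)
qed

lemma mrestr_fsubst: "mrestr V (fsubst c B) = fsubst (\<lambda>i v. if v \<in> V then c i v else 0) B"
  by (simp add: fsubst_def mrestr_sum mrestr_cov_prod)

section \<open>Multilinear alternating forms described by iterated contractions\<close>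

definition alt1 :: "'v::real_vector set \<Rightarrow> 'v mform \<Rightarrow> bool" where
  "alt1 V \<alpha> \<longleftrightarrow>
    (\<forall>v\<in>V. \<forall>w\<in>V. \<forall>r s. contr (r *\<^sub>R v + s *\<^sub>R w) \<alpha> = r *\<^sub>R contr v \<alpha> + s *\<^sub>R contr w \<alpha>) \<and>
    (\<forall>v\<in>V. contr v (contr v \<alpha>) = 0)"

text \<open>\<open>alt_upto V k \<alpha>\<close> says that \<open>\<alpha>\<close> is linear in each of the first \<open>k\<close> slots and vanishes whenever
  two neighbouring arguments starting in one of these slots agree.\<close>

primrec alt_upto :: "'v::real_vector set \<Rightarrow> nat \<Rightarrow> 'v mform \<Rightarrow> bool" where
  "alt_upto V 0 \<alpha> = True"
| "alt_upto V (Suc k) \<alpha> = (alt1 V \<alpha> \<and> (\<forall>v\<in>V. alt_upto V k (contr v \<alpha>)))"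

definition malt :: "'v::real_vector set \<Rightarrow> 'v mform \<Rightarrow> bool" where
  "malt V \<alpha> \<longleftrightarrow> (\<forall>k. alt_upto V k \<alpha>)"

lemma malt_contr: "malt V \<alpha> \<Longrightarrow> v \<in> V \<Longrightarrow> malt V (contr v \<alpha>)"
  unfolding malt_def by (metis alt_upto.simps(2))

lemma malt_alt1: "malt V \<alpha> \<Longrightarrow> alt1 V \<alpha>"
  unfolding malt_def by (metis alt_upto.simps(2))

lemma alt_upto_add: "alt_upto V k \<alpha> \<Longrightarrow> alt_upto V k \<beta> \<Longrightarrow> alt_upto V k (\<alpha> + \<beta>)"
  by (induction k arbitrary: \<alpha> \<beta>) (auto simp: alt1_def scaleR_right_distrib algebra_simps)

lemma alt_upto_scale: "alt_upto V k \<alpha> \<Longrightarrow> alt_upto V k (r *\<^sub>R \<alpha>)"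
  by (induction k arbitrary: \<alpha>) (auto simp: alt1_def scaleR_right_distrib mult.commute)

lemma alt_upto_mpar: "alt_upto V k \<alpha> \<Longrightarrow> alt_upto V k (mpar \<alpha>)"
proof (induction k arbitrary: \<alpha>)
  case (Suc k)
  have "alt_upto V k (- mpar (contr v \<alpha>))" if "v \<in> V" for v
    using Suc alt_upto_scale[of V k "mpar (contr v \<alpha>)" "-1"] that by simp
  with Suc.prems show ?case by (auto simp: alt1_def)
qed simp

text \<open>In the double contraction of a product with the same vector the two mixed terms cancel,
  because \<open>contr\<close> and \<open>mpar\<close> anticommute.\<close>

lemma alt_upto_mult: "alt_upto V k \<alpha> \<Longrightarrow> alt_upto V k \<beta> \<Longrightarrow> alt_upto V k (\<alpha> * \<beta>)"
proof (induction k arbitrary: \<alpha> \<beta>)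
  case (Suc k)
  have mono: "alt_upto V k \<gamma>" if "alt_upto V (Suc k) \<gamma>" for \<gamma>
    using that by (induction k arbitrary: \<gamma>) auto
  have "alt_upto V k (contr v (\<alpha> * \<beta>))" if "v \<in> V" for v
    unfolding contr_mult using Suc that mono
    by (intro alt_upto_add Suc.IH alt_upto_mpar) (auto simp del: alt_upto.simps(2) dest: alt_upto.simps(2)[THEN iffD1])
  moreover have "alt1 V (\<alpha> * \<beta>)"
    using Suc.prems by (auto simp: alt1_def contr_mult algebra_simps)
  ultimately show ?case by simp
qed simp

lemma malt_add: "malt V \<alpha> \<Longrightarrow> malt V \<beta> \<Longrightarrow> malt V (\<alpha> + \<beta>)"
  by (simp add: malt_def alt_upto_add)

lemma malt_scale: "malt V \<alpha> \<Longrightarrow> malt V (r *\<^sub>R \<alpha>)"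
  by (simp add: malt_def alt_upto_scale)

lemma malt_mult: "malt V \<alpha> \<Longrightarrow> malt V \<beta> \<Longrightarrow> malt V (\<alpha> * \<beta>)"
  by (simp add: malt_def alt_upto_mult)

lemma malt_zero: "malt V 0"
proof -
  have "alt_upto V k 0" for k by (induction k) (simp_all add: alt1_def)
  then show ?thesis by (simp add: malt_def)
qed

lemma malt_sum: "(\<And>i. i \<in> S \<Longrightarrow> malt V (f i)) \<Longrightarrow> malt V (\<Sum>i\<in>S. f i)"
  by (induction S rule: infinite_finite_induct) (auto intro: malt_zero malt_add)

lemma maltI: "alt1 V \<alpha> \<Longrightarrow> (\<And>v. v \<in> V \<Longrightarrow> malt V (contr v \<alpha>)) \<Longrightarrow> malt V \<alpha>"
  unfolding malt_def
proof
  fix k assume "alt1 V \<alpha>" "\<And>v. v \<in> V \<Longrightarrow> \<forall>k. alt_upto V k (contr v \<alpha>)"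
  then show "alt_upto V k \<alpha>" by (cases k) auto
qed

lemma malt_one: "malt V 1"
  by (rule maltI) (simp_all add: alt1_def malt_zero)

lemma malt_mone:
  assumes "\<And>v w r s. v \<in> V \<Longrightarrow> w \<in> V \<Longrightarrow> a (r *\<^sub>R v + s *\<^sub>R w) = r * a v + s * a w"
  shows "malt V (mone a)"
  by (rule maltI) (simp_all add: alt1_def assms scaleR_left_distrib malt_scale malt_one)

lemma malt_fsubst:
  assumes "\<And>i v w r s. v \<in> V \<Longrightarrow> w \<in> V \<Longrightarrow> c i (r *\<^sub>R v + s *\<^sub>R w) = r * c i v + s * c i w"
  shows "malt V (fsubst c B)"
proof -
  have "malt V (prod_list (map (\<lambda>i. mone (c i)) xs))" for xs
    by (induction xs) (auto intro!: malt_one malt_mult malt_mone assms)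
  then show ?thesis unfolding fsubst_def cov_prod_def by (intro malt_sum malt_scale)
qed

lemma malt_mexp:
  assumes h: "mhom 2 \<alpha>" and a: "malt V \<alpha>"
  shows "malt V (mexp \<alpha>)"
  unfolding malt_def
proof
  fix k
  have "contr v \<alpha> * (contr v \<alpha> * \<beta>) = 0" for v \<beta>
    using mone_square mhom_1_mone[OF mhom_2_contr[OF h]] by (metis mult.assoc mult_zero_left)
  then have g: "alt1 V (mexp \<alpha>)"
    using malt_alt1[OF a] unfolding alt1_def
    by (simp add: contr_mult contr_mexp[OF h] distrib_right mpar_mhom[OF mhom_2_contr[OF h]])
  show "alt_upto V k (mexp \<alpha>)"
  proof (induction k)
    case (Suc k)
    then show ?case using g malt_contr[OF a]
      by (auto simp: contr_mexp[OF h] malt_def intro!: alt_upto_mult)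
  qed simp
qed

text \<open>The claim is generalised to a prefix \<open>us\<close> of arguments already filled in:
  contraction lengthens the prefix, and the slot conditions at position \<open>length us\<close>
  become conditions on the first slot.\<close>

lemma alternating_form_malt:
  assumes V: "subspace V" and \<alpha>: "alternating_form V k (mval \<alpha>)"
  shows "malt V (mrestr V \<alpha>)"
proof -
  have "malt V (mrestr V (Mform (\<lambda>ws. mval \<alpha> (us @ ws))))" if "set us \<subseteq> V" for us
  proof -
    have "alt_upto V j (mrestr V (Mform (\<lambda>ws. mval \<alpha> (us @ ws))))" for j
      using that
    proof (induction j arbitrary: us)
      case (Suc j)
      let ?\<beta> = "\<lambda>us. mrestr V (Mform (\<lambda>ws. mval \<alpha> (us @ ws)))"
      have c: "contr v (?\<beta> us) = ?\<beta> (us @ [v])" if "v \<in> V" for v us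
        by (rule mform_eqI) (use that in \<open>simp add: contr.rep_eq mrestr.rep_eq\<close>)
      have lin: "contr (r *\<^sub>R v + s *\<^sub>R w) (?\<beta> us) = r *\<^sub>R contr v (?\<beta> us) + s *\<^sub>R contr w (?\<beta> us)"
        if vw: "v \<in> V" "w \<in> V" for v w r s
      proof (rule mform_eqI)
        fix ws
        have rs: "r *\<^sub>R v + s *\<^sub>R w \<in> V" using V vw by (simp add: subspace_add subspace_scale)
        show "mval (contr (r *\<^sub>R v + s *\<^sub>R w) (?\<beta> us)) ws = mval (r *\<^sub>R contr v (?\<beta> us) + s *\<^sub>R contr w (?\<beta> us)) ws"
        proof (cases "set ws \<subseteq> V \<and> length us + Suc (length ws) = k")
          case True
          let ?vs = "us @ v # ws"
          have "?vs \<in> lists V" using True Suc.prems vw by (auto simp: lists_eq_set)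
          with \<alpha> have "mval \<alpha> (?vs[length us := r *\<^sub>R v + s *\<^sub>R w]) =
              r * mval \<alpha> (?vs[length us := v]) + s * mval \<alpha> (?vs[length us := w])"
            unfolding alternating_form_def using True vw by (metis add_Suc_right length_append length_Cons less_add_Suc1)
          then show ?thesis using True rs vw by (simp add: contr.rep_eq mrestr.rep_eq)
        next
          case False
          then have "set ws \<subseteq> V \<Longrightarrow> mval \<alpha> (us @ u # ws) = 0" for u
            using \<alpha> by (auto simp: alternating_form_def)
          then show ?thesis using vw rs by (simp add: contr.rep_eq mrestr.rep_eq)
        qed
      qed
      have sq: "contr v (contr v (?\<beta> us)) = 0" if v: "v \<in> V" for v
      proof (rule mform_eqI)
        fix ws
        have "mval \<alpha> (us @ v # v # ws) = 0" if ws: "set ws \<subseteq> V"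
        proof (cases "length us + Suc (Suc (length ws)) = k")
          case True
          let ?vs = "us @ v # v # ws"
          have "?vs \<in> lists V" using ws Suc.prems v by (auto simp: lists_eq_set)
          moreover have "?vs ! length us = ?vs ! Suc (length us)" by (simp add: nth_append)
          moreover have "length ?vs = k" "Suc (length us) < k" using True by simp_all
          ultimately show ?thesis using \<alpha> unfolding alternating_form_def by (metis lessI)
        next
          case False
          then show ?thesis using \<alpha> by (auto simp: alternating_form_def)
        qed
        then show "mval (contr v (contr v (?\<beta> us))) ws = mval 0 ws"
          using v by (simp add: contr.rep_eq mrestr.rep_eq)
      qed
      have "alt_upto V j (contr v (?\<beta> us))" if "v \<in> V" for v
        unfolding c[OF that] by (rule Suc.IH) (use Suc.prems that in simp)
      with lin sq show ?case by (simp add: alt1_def)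
    qed simp
    then show ?thesis by (simp add: malt_def)
  qed
  from this[of "[]"] show ?thesis by (simp add: mval_inverse)
qed

text \<open>Polarisation: the double contraction with \<open>v + w\<close> vanishes and is
  expanded.\<close>

lemma malt_contr_anticomm:
  assumes V: "subspace V" and a: "malt V \<alpha>" and vw: "v \<in> V" "w \<in> V"
  shows "contr v (contr w \<alpha>) = - contr w (contr v \<alpha>)"
proof -
  have "v + w \<in> V" using V vw by (rule subspace_add)
  have lin: "contr (v + w) \<beta> = contr v \<beta> + contr w \<beta>" if "malt V \<beta>" for \<beta>
    using malt_alt1[OF that] vw unfolding alt1_def by (metis scaleR_one)
  have sq: "contr u (contr u \<alpha>) = 0" if "u \<in> V" for u
    using malt_alt1[OF a] that unfolding alt1_def by blast
  have "contr (v + w) (contr (v + w) \<alpha>) = contr v (contr w \<alpha>) + contr w (contr v \<alpha>)"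
    using sq[OF vw(1)] sq[OF vw(2)] by (simp add: lin a malt_contr vw)
  then show ?thesis using sq[OF \<open>v + w \<in> V\<close>] by (simp add: eq_neg_iff_add_eq_0)
qed

text \<open>Vectors that annihilate \<alpha> are divided out. Contracting with some \<open>x\<close>
  in \<open>F\<close> makes \<open>x\<close> itself annihilating and keeps the earlier ones, so
  \<open>F\<close> loses an element with each argument. No independence of \<open>F\<close> has to
  be maintained along the way.\<close>

lemma malt_vanishes:
  assumes V: "subspace V" and a: "malt V \<alpha>" and F: "finite F" "F \<subseteq> V"
    and span: "V \<subseteq> span (F \<union> {z \<in> V. contr z \<alpha> = 0})"
    and vs: "set vs \<subseteq> V" "card F < length vs"
  shows "mval \<alpha> vs = 0"
  using vs a F span
proof (induction vs arbitrary: F \<alpha>)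
  case (Cons v ws)
  let ?K = "\<lambda>\<alpha>. {z \<in> V. contr z \<alpha> = 0}"
  have FK: "F \<union> ?K \<alpha> \<subseteq> V" using Cons.prems by auto
  have lin: "contr (r *\<^sub>R x + s *\<^sub>R y) \<alpha> = r *\<^sub>R contr x \<alpha> + s *\<^sub>R contr y \<alpha>" if "x \<in> V" "y \<in> V" for x y r s
    using malt_alt1[OF Cons.prems(3)] that unfolding alt1_def by blast
  have base: "mval (contr x \<alpha>) ws = 0" if x: "x \<in> F \<union> ?K \<alpha>" for x
  proof (cases "x \<in> F")
    case True
    then have xV: "x \<in> V" using Cons.prems by auto
    have "contr z (contr x \<alpha>) = 0" if "z \<in> ?K \<alpha>" for z
      using malt_contr_anticomm[OF V Cons.prems(3), of z x] xV that by simp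
    moreover have "contr x (contr x \<alpha>) = 0"
      using malt_alt1[OF Cons.prems(3)] xV unfolding alt1_def by blast
    ultimately have "F \<union> ?K \<alpha> \<subseteq> (F - {x}) \<union> ?K (contr x \<alpha>)" using xV by auto
    then have "V \<subseteq> span ((F - {x}) \<union> ?K (contr x \<alpha>))" using Cons.prems(6) span_mono by blast
    moreover have "card (F - {x}) < length ws"
      using Cons.prems True by (simp add: card_gt_0_iff less_diff_conv2) (metis Suc_pred card_gt_0_iff empty_iff less_Suc_eq_le Suc_less_eq)
    ultimately show ?thesis using Cons.prems xV malt_contr[OF Cons.prems(3) xV]
      by (intro Cons.IH[of "F - {x}"]) auto
  next
    case False
    then show ?thesis using x by simp
  qed
  have "v \<in> span (F \<union> ?K \<alpha>)" using Cons.prems by auto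
  then have "v \<in> V \<and> mval (contr v \<alpha>) ws = 0"
  proof (induction rule: span_induct_alt)
    case base
    have "contr 0 \<alpha> = 0" using lin[of 0 0 0 0] V by (simp add: subspace_0)
    then show ?case using V by (simp add: subspace_0)
  next
    case (step r x y)
    then have "contr (r *\<^sub>R x + 1 *\<^sub>R y) \<alpha> = r *\<^sub>R contr x \<alpha> + 1 *\<^sub>R contr y \<alpha>"
      using FK by (intro lin) auto
    then show ?case using step base[of x] FK V by (auto simp: subspace_add subspace_scale)
  qed
  then show ?case by (simp add: mval_Cons)
qed simp


section \<open>Differential calculus on manifolds\<close>

text \<open>The part of \<^const>\<open>manifold\<close> that the chain rule needs: charts are homeomorphisms and the
  transition maps are differentiable. Unlike smoothness it is immediate for products.\<close>

definition dmanifold :: "('m::topological_space, 'e::real_normed_vector) chart set \<Rightarrow> bool" where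
  "dmanifold A \<longleftrightarrow>
    (\<forall>c\<in>A. open (fst c) \<and> open (snd c ` fst c) \<and> homeomorphism (fst c) (snd c ` fst c) (snd c) (chart_inv c)) \<and>
    (\<Union>c\<in>A. fst c) = UNIV \<and>
    (\<forall>c\<in>A. \<forall>d\<in>A. \<forall>m\<in>fst c \<inter> fst d. transition c d differentiable at (snd c m))"

definition rep :: "('m, 'e) chart \<Rightarrow> ('n, 'f) chart \<Rightarrow> ('m \<Rightarrow> 'n) \<Rightarrow> 'e \<Rightarrow> 'f" where
  "rep c d F = snd d \<circ> F \<circ> chart_inv c"

text \<open>Continuity is demanded separately: \<open>rep c d F\<close> applies \<open>snd d\<close>
  also to points that \<open>F\<close> moves out of the chart \<open>d\<close>, so its
  differentiability does not exclude that this happens arbitrarily close to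
  \<open>m\<close>.\<close>

definition mdiff ::
  "('m::topological_space, 'e::real_normed_vector) chart set \<Rightarrow>
   ('n::topological_space, 'f::real_normed_vector) chart set \<Rightarrow> ('m \<Rightarrow> 'n) \<Rightarrow> 'm \<Rightarrow> bool" where
  "mdiff A B F m \<longleftrightarrow> filterlim F (nhds (F m)) (nhds m) \<and>
     (\<forall>c\<in>charts_at A m. \<forall>d\<in>charts_at B (F m). rep c d F differentiable at (snd c m))"

lemma smooth_on_differentiable: "smooth_on f S \<Longrightarrow> x \<in> S \<Longrightarrow> f differentiable at x"
  unfolding smooth_on_def by (metis Ck_on.simps(2))

lemma manifold_dmanifold: "manifold A \<Longrightarrow> dmanifold A"
  unfolding manifold_def dmanifold_def by (auto intro!: smooth_on_differentiable)

lemma chart_at_ex: "dmanifold A \<Longrightarrow> \<exists>c. c \<in> charts_at A m"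
  unfolding dmanifold_def charts_at_def by blast

lemma some_chart_in: "dmanifold A \<Longrightarrow> some_chart A m \<in> charts_at A m"
  unfolding some_chart_def using chart_at_ex by (metis someI_ex)

context
  fixes A :: "('m::topological_space, 'e::real_normed_vector) chart set" and c m
  assumes A: "dmanifold A" and c: "c \<in> charts_at A m"
begin

lemma chart_hom: "homeomorphism (fst c) (snd c ` fst c) (snd c) (chart_inv c)"
  and open_chart: "open (fst c)" and open_chart_image: "open (snd c ` fst c)" and in_chart: "m \<in> fst c"
  using A c by (auto simp: dmanifold_def charts_at_def)

lemma chart_inv_chart: "p \<in> fst c \<Longrightarrow> chart_inv c (snd c p) = p"
  using chart_hom by (simp add: homeomorphism_def)

lemma chart_chart_inv: "y \<in> snd c ` fst c \<Longrightarrow> snd c (chart_inv c y) = y"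
  using chart_hom by (auto simp: homeomorphism_def)

lemma chart_inv_tendsto: "filterlim (chart_inv c) (nhds m) (nhds (snd c m))"
proof -
  have "continuous_on (snd c ` fst c) (chart_inv c)" using chart_hom by (simp add: homeomorphism_def)
  moreover have "snd c m \<in> snd c ` fst c" using in_chart by simp
  ultimately have "(chart_inv c \<longlongrightarrow> chart_inv c (snd c m)) (at (snd c m))"
    using open_chart_image by (metis at_within_open continuous_on_def)
  then show ?thesis using chart_inv_chart[OF in_chart] tendsto_at_iff_tendsto_nhds by metis
qed

end

lemma has_derivative_transform_nhds:
  assumes "(f has_derivative D) (at x)" "\<forall>\<^sub>F y in nhds x. f y = g y"
  shows "(g has_derivative D) (at x)"
  using assms(1)
proof (rule has_derivative_transform_eventually)
  show "\<forall>\<^sub>F x' in at x. f x' = g x'" using assms(2) by (simp add: eventually_at_filter eventually_mono)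
  show "f x = g x" using assms(2) by (rule eventually_nhds_x_imp_x)
qed simp

text \<open>By continuity \<open>F\<close> stays inside the chart \<open>d\<close> near
  \<open>m\<close>, where the intermediate coordinates cancel; agreement near the point is all that
  a derivative sees.\<close>

lemma rep_chain:
  assumes A: "dmanifold A" and B: "dmanifold B"
    and c: "c \<in> charts_at A m" and d: "d \<in> charts_at B (F m)"
    and lim: "filterlim F (nhds (F m)) (nhds m)"
    and L: "(rep c d F has_derivative L) (at (snd c m))"
    and K: "(rep d e H has_derivative K) (at (snd d (F m)))"
  shows "(rep c e (H \<circ> F) has_derivative K \<circ> L) (at (snd c m))"
proof -
  have "rep c d F (snd c m) = snd d (F m)"
    using chart_inv_chart[OF A c in_chart[OF A c]] by (simp add: rep_def)
  then have "(rep d e H \<circ> rep c d F has_derivative K \<circ> L) (at (snd c m))"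
    using L K by (intro diff_chain_at) simp_all
  moreover have "\<forall>\<^sub>F y in nhds (snd c m). F (chart_inv c y) \<in> fst d"
    by (rule topological_tendstoD[OF filterlim_compose[OF lim chart_inv_tendsto[OF A c]]
          open_chart[OF B d] in_chart[OF B d]])
  then have "\<forall>\<^sub>F y in nhds (snd c m). (rep d e H \<circ> rep c d F) y = rep c e (H \<circ> F) y"
    by eventually_elim (simp add: rep_def chart_inv_chart[OF B d])
  ultimately show ?thesis by (rule has_derivative_transform_nhds)
qed

lemma mdiff_rep:
  "mdiff A B F m \<Longrightarrow> c \<in> charts_at A m \<Longrightarrow> d \<in> charts_at B (F m) \<Longrightarrow>
    (rep c d F has_derivative frechet_derivative (rep c d F) (at (snd c m))) (at (snd c m))"
  by (simp add: mdiff_def frechet_derivative_works)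

lemma rep_derivative_chain:
  assumes "dmanifold A" "dmanifold B" "mdiff A B F m" "mdiff B C H (F m)"
    and "c \<in> charts_at A m" "d \<in> charts_at B (F m)" "e \<in> charts_at C (H (F m))"
  shows "frechet_derivative (rep c e (H \<circ> F)) (at (snd c m)) =
    frechet_derivative (rep d e H) (at (snd d (F m))) \<circ> frechet_derivative (rep c d F) (at (snd c m))"
  using assms by (intro frechet_derivative_at[symmetric] rep_chain[where d = d and A = A and B = B] mdiff_rep)
    (auto simp: mdiff_def)

lemma mdiff_compose:
  assumes A: "dmanifold A" and B: "dmanifold B" and F: "mdiff A B F m" and H: "mdiff B C H (F m)"
  shows "mdiff A C (H \<circ> F) m"
  unfolding mdiff_def
proof (intro conjI ballI)
  have "filterlim F (nhds (F m)) (nhds m)" "filterlim H (nhds (H (F m))) (nhds (F m))"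
    using F H by (simp_all add: mdiff_def)
  from filterlim_compose[OF this(2,1)]
  show "filterlim (H \<circ> F) (nhds ((H \<circ> F) m)) (nhds m)" by (simp add: o_def)
  fix c e assume c: "c \<in> charts_at A m" and e: "e \<in> charts_at C ((H \<circ> F) m)"
  obtain d where d: "d \<in> charts_at B (F m)" using chart_at_ex[OF B] by blast
  show "rep c e (H \<circ> F) differentiable at (snd c m)"
  proof (rule differentiableI, rule rep_chain[OF A B c d _ mdiff_rep[OF F c d] mdiff_rep[OF H d]])
    show "filterlim F (nhds (F m)) (nhds m)" using F by (simp add: mdiff_def)
    show "e \<in> charts_at C (H (F m))" using e by simp
  qed
qed

lemma rep_id: "rep c d id = transition c d"
  by (simp add: rep_def transition_def)

lemma mdiff_id: "dmanifold A \<Longrightarrow> mdiff A A id m"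
  unfolding mdiff_def rep_id by (auto simp: dmanifold_def charts_at_def filterlim_ident id_def)

lemma smooth_map_mdiff: "smooth_map A B F \<Longrightarrow> mdiff A B F m"
  unfolding mdiff_def
proof (intro conjI ballI)
  assume F: "smooth_map A B F"
  then show "filterlim F (nhds (F m)) (nhds m)"
    by (simp add: smooth_map_def continuous_on_def tendsto_at_iff_tendsto_nhds)
  fix c d assume cd: "c \<in> charts_at A m" "d \<in> charts_at B (F m)"
  then have "smooth_on (rep c d F) (snd c ` (fst c \<inter> F -` fst d))"
    using F by (auto simp: smooth_map_def rep_def charts_at_def)
  then show "rep c d F differentiable at (snd c m)"
    by (rule smooth_on_differentiable) (use cd in \<open>auto simp: charts_at_def\<close>)
qed

lemma differential_rep:
  "differential A B F m v = Tvec (\<lambda>d. if d \<in> charts_at B (F m)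
     then frechet_derivative (rep (some_chart A m) d F) (at (snd (some_chart A m) m)) (coord v (some_chart A m)) else 0)"
  unfolding differential_def rep_def Let_def ..

lemma tvec_eqI: "(\<And>c. coord v c = coord w c) \<Longrightarrow> v = w"
  by (auto simp: coord_inject[symmetric])

lemma coord_linear [simp]:
  "coord (v + w) c = coord v c + coord w c" "coord (v - w) c = coord v c - coord w c"
  "coord (- v) c = - coord v c" "coord (r *\<^sub>R v) c = r *\<^sub>R coord v c" "coord 0 c = 0"
  by (transfer; simp)+

lemma coord_Tvec [simp]: "coord (Tvec f) c = f c"
  by (simp add: Tvec_inverse)

lemma tangent_coord:
  "v \<in> tangent_space A m \<Longrightarrow> c \<in> charts_at A m \<Longrightarrow> d \<in> charts_at A m \<Longrightarrow>
    coord v d = frechet_derivative (rep c d id) (at (snd c m)) (coord v c)"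
  unfolding tangent_space_def rep_id by blast

lemma tangent_coord_0: "v \<in> tangent_space A m \<Longrightarrow> c \<notin> charts_at A m \<Longrightarrow> coord v c = 0"
  unfolding tangent_space_def by blast

lemma tangent_spaceI:
  assumes "\<And>c d. c \<in> charts_at A m \<Longrightarrow> d \<in> charts_at A m \<Longrightarrow>
      coord v d = frechet_derivative (rep c d id) (at (snd c m)) (coord v c)"
    and "\<And>c. c \<notin> charts_at A m \<Longrightarrow> coord v c = 0"
  shows "v \<in> tangent_space A m"
  unfolding tangent_space_def rep_id[symmetric] using assms by blast

lemma tangent_eqI:
  assumes "v \<in> tangent_space A m" "w \<in> tangent_space A m" "\<And>c. c \<in> charts_at A m \<Longrightarrow> coord v c = coord w c"
  shows "v = w"
proof (rule tvec_eqI)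
  fix c show "coord v c = coord w c"
    using assms(3)[of c] tangent_coord_0[OF assms(1), of c] tangent_coord_0[OF assms(2), of c] by fastforce
qed

text \<open>The definition fixes \<open>some_chart\<close>. The chain rule for
  \<open>F \<circ> id\<close> passes from it to an arbitrary chart.\<close>

lemma differential_coord:
  assumes A: "dmanifold A" and F: "mdiff A B F m" and v: "v \<in> tangent_space A m"
    and c: "c \<in> charts_at A m" and d: "d \<in> charts_at B (F m)"
  shows "coord (differential A B F m v) d = frechet_derivative (rep c d F) (at (snd c m)) (coord v c)"
proof -
  let ?c = "some_chart A m"
  have c0: "?c \<in> charts_at A m" by (rule some_chart_in[OF A])
  have "frechet_derivative (rep ?c d (F \<circ> id)) (at (snd ?c m)) =
    frechet_derivative (rep c d F) (at (snd c (id m))) \<circ> frechet_derivative (rep ?c c id) (at (snd ?c m))"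
    using F c d by (intro rep_derivative_chain[OF A A mdiff_id[OF A] _ c0]) simp_all
  then show ?thesis using tangent_coord[OF v c0 c] d by (simp add: differential_rep)
qed

lemma differential_in_tangent:
  assumes A: "dmanifold A" and B: "dmanifold B" and F: "mdiff A B F m"
  shows "differential A B F m v \<in> tangent_space B (F m)"
proof -
  let ?c = "some_chart A m"
  have c0: "?c \<in> charts_at A m" by (rule some_chart_in[OF A])
  show ?thesis
  proof (rule tangent_spaceI)
    fix d e assume that: "d \<in> charts_at B (F m)" "e \<in> charts_at B (F m)"
    then show "coord (differential A B F m v) e = frechet_derivative (rep d e id) (at (snd d (F m))) (coord (differential A B F m v) d)"
      using rep_derivative_chain[OF A B F mdiff_id[OF B] c0 that(1), of e]
      by (simp add: differential_rep)
  qed (simp add: differential_rep)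
qed

lemma differential_linear:
  assumes A: "dmanifold A" and F: "mdiff A B F m"
  shows "differential A B F m (r *\<^sub>R v + s *\<^sub>R w) = r *\<^sub>R differential A B F m v + s *\<^sub>R differential A B F m w"
proof -
  let ?c = "some_chart A m"
  have c0: "?c \<in> charts_at A m" by (rule some_chart_in[OF A])
  have "linear (frechet_derivative (rep ?c d F) (at (snd ?c m)))" if "d \<in> charts_at B (F m)" for d
    using mdiff_rep[OF F c0 that] by (rule has_derivative_linear)
  then show ?thesis
    by (intro tvec_eqI) (simp add: differential_rep linear_add linear_scale)
qed

lemma differential_lin:
  assumes "dmanifold A" "mdiff A B F m"
  shows "differential A B F m (v + w) = differential A B F m v + differential A B F m w"
    "differential A B F m (v - w) = differential A B F m v - differential A B F m w"
    "differential A B F m (- v) = - differential A B F m v"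
    "differential A B F m (r *\<^sub>R v) = r *\<^sub>R differential A B F m v"
    "differential A B F m 0 = 0"
  using differential_linear[OF assms, of 1 v 1 w] differential_linear[OF assms, of 1 v "-1" w]
    differential_linear[OF assms, of "-1" v 0 w] differential_linear[OF assms, of r v 0 w]
    differential_linear[OF assms, of 0 v 0 w] by simp_all

lemma differential_compose:
  assumes A: "dmanifold A" and B: "dmanifold B" and F: "mdiff A B F m" and H: "mdiff B C H (F m)"
  shows "differential B C H (F m) (differential A B F m v) = differential A C (H \<circ> F) m v"
proof (rule tvec_eqI)
  fix e
  let ?c = "some_chart A m" and ?d = "some_chart B (F m)"
  have c0: "?c \<in> charts_at A m" and d0: "?d \<in> charts_at B (F m)" using some_chart_in A B by auto
  show "coord (differential B C H (F m) (differential A B F m v)) e = coord (differential A C (H \<circ> F) m v) e"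
    using rep_derivative_chain[OF A B F H c0 d0] d0 by (simp add: differential_rep)
qed

lemma differential_id:
  assumes A: "dmanifold A" and v: "v \<in> tangent_space A m"
  shows "differential A A id m v = v"
proof (rule tangent_eqI)
  show "differential A A id m v \<in> tangent_space A m" using differential_in_tangent[OF A A mdiff_id[OF A]] by force
  fix d assume "d \<in> charts_at A m"
  then show "coord (differential A A id m v) d = coord v d"
    using tangent_coord[OF v some_chart_in[OF A]] by (simp add: differential_rep)
qed (rule v)

lemma mdiff_const: "mdiff A B (\<lambda>_. b) m"
  unfolding mdiff_def by (simp add: rep_def o_def)

lemma differential_const: "differential A B (\<lambda>_. b) m v = 0"
  by (rule tvec_eqI) (simp add: differential_rep rep_def o_def)

lemma subspace_tangent_space:
  assumes A: "dmanifold A" shows "subspace (tangent_space A m)"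
proof -
  have lin: "linear (frechet_derivative (rep c d id) (at (snd c m)))" if "c \<in> charts_at A m" "d \<in> charts_at A m" for c d
    using mdiff_rep[OF mdiff_id[OF A], of c m d] that by (intro has_derivative_linear) simp
  show ?thesis
  proof (rule subspaceI)
    show "0 \<in> tangent_space A m" by (rule tangent_spaceI) (simp_all add: linear_0 lin)
  next
    fix v w assume v: "v \<in> tangent_space A m" and w: "w \<in> tangent_space A m"
    show "v + w \<in> tangent_space A m"
    proof (rule tangent_spaceI)
      fix c d assume cd: "c \<in> charts_at A m" "d \<in> charts_at A m"
      show "coord (v + w) d = frechet_derivative (rep c d id) (at (snd c m)) (coord (v + w) c)"
        using tangent_coord[OF v cd] tangent_coord[OF w cd] linear_add[OF lin[OF cd]] by simp
    qed (simp add: tangent_coord_0[OF v] tangent_coord_0[OF w])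
  next
    fix r v assume v: "v \<in> tangent_space A m"
    show "r *\<^sub>R v \<in> tangent_space A m"
    proof (rule tangent_spaceI)
      fix c d assume cd: "c \<in> charts_at A m" "d \<in> charts_at A m"
      show "coord (r *\<^sub>R v) d = frechet_derivative (rep c d id) (at (snd c m)) (coord (r *\<^sub>R v) c)"
        using tangent_coord[OF v cd] linear_scale[OF lin[OF cd]] by simp
    qed (simp add: tangent_coord_0[OF v])
  qed
qed

text \<open>A tangent vector is determined by its coordinates in one chart. The linear image of the
  model space is what bounds the degree of alternating forms in \<open>Gam_vanishes\<close>.\<close>

lemma tangent_space_linear:
  fixes A :: "('m::topological_space, 'e::real_normed_vector) chart set"
  assumes A: "dmanifold A" and c: "c \<in> charts_at A m"
  shows "\<exists>J :: 'e \<Rightarrow> ('m, 'e) tvec. linear J \<and> range J = tangent_space A m"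
proof -
  define J where "J u = Tvec (\<lambda>d. if d \<in> charts_at A m then frechet_derivative (rep c d id) (at (snd c m)) u else 0)" for u
  have lin: "linear (frechet_derivative (rep c d id) (at (snd c m)))" if "d \<in> charts_at A m" for d
    using mdiff_rep[OF mdiff_id[OF A], of c m d] that c by (intro has_derivative_linear) simp
  have "linear J"
    by (rule linearI; rule tvec_eqI; simp add: J_def linear_add linear_scale lin)
  moreover have "J u \<in> tangent_space A m" for u
  proof (rule tangent_spaceI)
    fix d e assume that: "d \<in> charts_at A m" "e \<in> charts_at A m"
    then show "coord (J u) e = frechet_derivative (rep d e id) (at (snd d m)) (coord (J u) d)"
      using rep_derivative_chain[OF A A mdiff_id[OF A], of A id m c d e] c mdiff_id[OF A, of m] by (simp add: J_def)
  qed (simp add: J_def)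
  moreover have "v = J (coord v c)" if "v \<in> tangent_space A m" for v
  proof (rule tvec_eqI)
    fix d show "coord v d = coord (J (coord v c)) d"
      using tangent_coord[OF that c, of d] tangent_coord_0[OF that, of d] by (simp add: J_def)
  qed
  ultimately have "range J = tangent_space A m" by blast
  with \<open>linear J\<close> show ?thesis by blast
qed

subsection \<open>Products\<close>

abbreviation (input) prod_chart :: "('m, 'e) chart \<Rightarrow> ('n, 'f) chart \<Rightarrow> ('m \<times> 'n, 'e \<times> 'f) chart" where
  "prod_chart c d \<equiv> (fst c \<times> fst d, map_prod (snd c) (snd d))"

lemma charts_at_prod: "charts_at (prod_atlas A B) (a, b) = {prod_chart c d | c d. c \<in> charts_at A a \<and> d \<in> charts_at B b}"
  (is "?L = ?R")
proof (rule Set.set_eqI)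
  fix k show "k \<in> ?L \<longleftrightarrow> k \<in> ?R"
  proof
    assume "k \<in> ?L"
    then obtain c d where "c \<in> A" "d \<in> B" "k = prod_chart c d" "(a, b) \<in> fst k"
      unfolding charts_at_def prod_atlas_def by blast
    moreover then have "c \<in> charts_at A a" "d \<in> charts_at B b" by (auto simp: charts_at_def)
    ultimately show "k \<in> ?R" by blast
  next
    assume "k \<in> ?R"
    then obtain c d where "c \<in> charts_at A a" "d \<in> charts_at B b" "k = prod_chart c d" by blast
    moreover then have "k \<in> prod_atlas A B" unfolding prod_atlas_def charts_at_def by blast
    ultimately show "k \<in> ?L" by (auto simp: charts_at_def)
  qed
qed

lemma map_prod_image_Times: "map_prod f g ` (S \<times> T) = (f ` S) \<times> (g ` T)"
  by (auto simp: map_prod_def image_iff)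

lemma chart_inv_prod:
  assumes "homeomorphism (fst c) (snd c ` fst c) (snd c) (chart_inv c)"
    and "homeomorphism (fst d) (snd d ` fst d) (snd d) (chart_inv d)"
    and y: "y \<in> (snd c ` fst c) \<times> (snd d ` fst d)"
  shows "chart_inv (prod_chart c d) y = map_prod (chart_inv c) (chart_inv d) y"
proof -
  obtain p q where pq: "p \<in> fst c" "q \<in> fst d" "y = (snd c p, snd d q)" using y by auto
  have ic: "inj_on (snd c) (fst c)" and id: "inj_on (snd d) (fst d)"
    using assms(1,2) by (auto simp: homeomorphism_def intro: inj_on_inverseI)
  have "inj_on (map_prod (snd c) (snd d)) (fst c \<times> fst d)" by (rule map_prod_inj_on[OF ic id])
  then have "inv_into (fst c \<times> fst d) (map_prod (snd c) (snd d)) y = (p, q)"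
    by (intro inv_into_f_eq) (use pq in auto)
  then show ?thesis using pq ic id by (simp add: chart_inv_def)
qed

lemma continuous_on_map_prod:
  assumes "continuous_on S f" "continuous_on T g"
  shows "continuous_on (S \<times> T) (map_prod f g)"
  unfolding map_prod_def split_beta
  by (intro continuous_on_Pair continuous_on_compose2[OF assms(1)] continuous_on_compose2[OF assms(2)]
      continuous_on_fst continuous_on_snd continuous_on_id) auto

lemma dmanifold_prod:
  assumes A: "dmanifold A" and B: "dmanifold B"
  shows "dmanifold (prod_atlas A B)"
  unfolding dmanifold_def
proof (intro conjI ballI)
  have cA: "open (fst c)" "open (snd c ` fst c)" "homeomorphism (fst c) (snd c ` fst c) (snd c) (chart_inv c)" if "c \<in> A" for c
    using A that by (auto simp: dmanifold_def)
  have cB: "open (fst c)" "open (snd c ` fst c)" "homeomorphism (fst c) (snd c ` fst c) (snd c) (chart_inv c)" if "c \<in> B" for c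
    using B that by (auto simp: dmanifold_def)
  show "(\<Union>c\<in>prod_atlas A B. fst c) = UNIV"
  proof (rule Set.set_eqI)
    fix p :: "'a \<times> 'c"
    obtain c d where "c \<in> charts_at A (fst p)" "d \<in> charts_at B (snd p)" using chart_at_ex[OF A] chart_at_ex[OF B] by blast
    then have "prod_chart c d \<in> charts_at (prod_atlas A B) (fst p, snd p)"
      unfolding charts_at_prod by blast
    then show "p \<in> (\<Union>c\<in>prod_atlas A B. fst c) \<longleftrightarrow> p \<in> UNIV"
      unfolding charts_at_def mem_Collect_eq prod.collapse by blast
  qed
  fix k assume k: "k \<in> prod_atlas A B"
  then obtain c d where cd: "c \<in> A" "d \<in> B" "k = prod_chart c d" by (auto simp: prod_atlas_def)
  note hc = cA(3)[OF cd(1)] and hd = cB(3)[OF cd(2)]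
  show "open (fst k)" "open (snd k ` fst k)"
    unfolding cd(3) fst_conv snd_conv map_prod_image_Times
    by (intro open_Times cA(1,2)[OF cd(1)] cB(1,2)[OF cd(2)])+
  have "homeomorphism (fst c \<times> fst d) ((snd c ` fst c) \<times> (snd d ` fst d)) (map_prod (snd c) (snd d)) (map_prod (chart_inv c) (chart_inv d))"
    using hc hd unfolding homeomorphism_def map_prod_image_Times by (auto simp: continuous_on_map_prod)
  then show "homeomorphism (fst k) (snd k ` fst k) (snd k) (chart_inv k)"
    unfolding cd(3) fst_conv snd_conv map_prod_image_Times
    by (rule homeomorphism_cong) (use chart_inv_prod[OF hc hd] in auto)
  fix l m assume "l \<in> prod_atlas A B" and m: "m \<in> fst k \<inter> fst l"
  then obtain c' d' where cd': "c' \<in> A" "d' \<in> B" "l = prod_chart c' d'" by (auto simp: prod_atlas_def)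
  obtain a b where ab: "m = (a, b)" by (cases m)
  have tc: "transition c c' differentiable at (snd c a)" and td: "transition d d' differentiable at (snd d b)"
    using A B cd cd' m ab by (auto simp: dmanifold_def)
  let ?T = "\<lambda>y. (transition c c' (fst y), transition d d' (snd y))"
  have 1: "((\<lambda>y. transition c c' (fst y)) has_derivative (\<lambda>h. frechet_derivative (transition c c') (at (snd c a)) (fst h))) (at (snd c a, snd d b))"
    using tc by (intro has_derivative_compose[OF has_derivative_fst[OF has_derivative_ident]])
      (simp add: frechet_derivative_works)
  have 2: "((\<lambda>y. transition d d' (snd y)) has_derivative (\<lambda>h. frechet_derivative (transition d d') (at (snd d b)) (snd h))) (at (snd c a, snd d b))"
    using td by (intro has_derivative_compose[OF has_derivative_snd[OF has_derivative_ident]])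
      (simp add: frechet_derivative_works)
  note has_derivative_Pair[OF 1 2]
  moreover have "\<forall>\<^sub>F y in nhds (snd c a, snd d b). y \<in> (snd c ` fst c) \<times> (snd d ` fst d)"
    by (rule eventually_nhds_in_open) (use cA cB cd m ab in \<open>auto intro!: open_Times\<close>)
  then have "\<forall>\<^sub>F y in nhds (snd c a, snd d b). ?T y = transition k l y"
    by eventually_elim (use chart_inv_prod[OF hc hd] cd cd' in \<open>auto simp: transition_def\<close>)
  ultimately have "(transition k l has_derivative (\<lambda>h. (frechet_derivative (transition c c') (at (snd c a)) (fst h),
      frechet_derivative (transition d d') (at (snd d b)) (snd h)))) (at (snd c a, snd d b))"
    by (rule has_derivative_transform_nhds)
  then show "transition k l differentiable at (snd k m)"
    using cd ab by (auto intro: differentiableI)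
qed

context
  fixes A :: "('m::topological_space, 'e::real_normed_vector) chart set"
    and B :: "('n::topological_space, 'f::real_normed_vector) chart set"
  assumes A: "dmanifold A" and B: "dmanifold B"
begin

lemma rep_fst:
  assumes "c \<in> charts_at A a" "d \<in> charts_at B b" "e \<in> charts_at A a"
  shows "(rep (prod_chart c d) e fst has_derivative (\<lambda>h. frechet_derivative (transition c e) (at (snd c a)) (fst h)))
    (at (snd (prod_chart c d) (a, b)))"
proof -
  have "((\<lambda>y. transition c e (fst y)) has_derivative (\<lambda>h. frechet_derivative (transition c e) (at (snd c a)) (fst h))) (at (snd c a, snd d b))"
    using mdiff_rep[OF mdiff_id[OF A], of c a e] assms
    by (intro has_derivative_compose[OF has_derivative_fst[OF has_derivative_ident]]) (simp add: rep_id)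
  moreover have "\<forall>\<^sub>F y in nhds (snd c a, snd d b). y \<in> (snd c ` fst c) \<times> (snd d ` fst d)"
    using assms in_chart[OF A] in_chart[OF B] by (intro eventually_nhds_in_open open_Times open_chart_image[OF A] open_chart_image[OF B]) auto
  then have "\<forall>\<^sub>F y in nhds (snd c a, snd d b). transition c e (fst y) = rep (prod_chart c d) e fst y"
    by eventually_elim (simp add: chart_inv_prod[OF chart_hom[OF A assms(1)] chart_hom[OF B assms(2)]] transition_def rep_def)
  ultimately show ?thesis using has_derivative_transform_nhds by simp
qed

lemma rep_snd:
  assumes "c \<in> charts_at A a" "d \<in> charts_at B b" "e \<in> charts_at B b"
  shows "(rep (prod_chart c d) e snd has_derivative (\<lambda>h. frechet_derivative (transition d e) (at (snd d b)) (snd h)))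
    (at (snd (prod_chart c d) (a, b)))"
proof -
  have "((\<lambda>y. transition d e (snd y)) has_derivative (\<lambda>h. frechet_derivative (transition d e) (at (snd d b)) (snd h))) (at (snd c a, snd d b))"
    using mdiff_rep[OF mdiff_id[OF B], of d b e] assms
    by (intro has_derivative_compose[OF has_derivative_snd[OF has_derivative_ident]]) (simp add: rep_id)
  moreover have "\<forall>\<^sub>F y in nhds (snd c a, snd d b). y \<in> (snd c ` fst c) \<times> (snd d ` fst d)"
    using assms in_chart[OF A] in_chart[OF B] by (intro eventually_nhds_in_open open_Times open_chart_image[OF A] open_chart_image[OF B]) auto
  then have "\<forall>\<^sub>F y in nhds (snd c a, snd d b). transition d e (snd y) = rep (prod_chart c d) e snd y"
    by eventually_elim (simp add: chart_inv_prod[OF chart_hom[OF A assms(1)] chart_hom[OF B assms(2)]] transition_def rep_def)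
  ultimately show ?thesis using has_derivative_transform_nhds by simp
qed

lemma mdiff_fst: "mdiff (prod_atlas A B) A fst p"
proof (cases p)
  case (Pair a b)
  have "filterlim fst (nhds a) (nhds (a, b))" by (simp add: nhds_prod filterlim_fst)
  moreover have "rep k e fst differentiable at (snd k (a, b))"
    if k: "k \<in> charts_at (prod_atlas A B) (a, b)" and e: "e \<in> charts_at A a" for k e
  proof -
    from k obtain c d where cd: "c \<in> charts_at A a" "d \<in> charts_at B b" and "k = prod_chart c d"
      unfolding charts_at_prod by blast
    then show ?thesis using rep_fst[OF cd e] by (auto intro: differentiableI)
  qed
  ultimately show ?thesis unfolding Pair mdiff_def by simp
qed

lemma mdiff_snd: "mdiff (prod_atlas A B) B snd p"
proof (cases p)
  case (Pair a b)
  have "filterlim snd (nhds b) (nhds (a, b))" by (simp add: nhds_prod filterlim_snd)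
  moreover have "rep k e snd differentiable at (snd k (a, b))"
    if k: "k \<in> charts_at (prod_atlas A B) (a, b)" and e: "e \<in> charts_at B b" for k e
  proof -
    from k obtain c d where cd: "c \<in> charts_at A a" "d \<in> charts_at B b" and "k = prod_chart c d"
      unfolding charts_at_prod by blast
    then show ?thesis using rep_snd[OF cd e] by (auto intro: differentiableI)
  qed
  ultimately show ?thesis unfolding Pair mdiff_def by simp
qed

lemma frechet_transition_self:
  assumes "dmanifold C" "c \<in> charts_at C a" shows "frechet_derivative (transition c c) (at (snd c a)) = id"
proof -
  have "\<forall>\<^sub>F y in nhds (snd c a). y \<in> snd c ` fst c"
    using assms in_chart[OF assms] by (intro eventually_nhds_in_open open_chart_image[OF assms]) auto
  then have "\<forall>\<^sub>F y in nhds (snd c a). y = transition c c y"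
    by eventually_elim (simp add: transition_def chart_chart_inv[OF assms])
  then have "(transition c c has_derivative (\<lambda>h. h)) (at (snd c a))"
    using has_derivative_transform_nhds[OF has_derivative_ident] by blast
  then show ?thesis by (simp add: frechet_derivative_at[symmetric] id_def)
qed

lemma coord_prod:
  assumes w: "w \<in> tangent_space (prod_atlas A B) (a, b)" and c: "c \<in> charts_at A a" and d: "d \<in> charts_at B b"
  shows "coord w (prod_chart c d) = (coord (differential (prod_atlas A B) A fst (a, b) w) c,
      coord (differential (prod_atlas A B) B snd (a, b) w) d)"
proof -
  have p: "prod_chart c d \<in> charts_at (prod_atlas A B) (a, b)" unfolding charts_at_prod using c d by blast
  have "coord (differential (prod_atlas A B) A fst (a, b) w) c = fst (coord w (prod_chart c d))"
    using differential_coord[OF dmanifold_prod[OF A B] mdiff_fst w p, of c] c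
      frechet_derivative_at[OF rep_fst[OF c d c], symmetric] frechet_transition_self[OF A c] by simp
  moreover have "coord (differential (prod_atlas A B) B snd (a, b) w) d = snd (coord w (prod_chart c d))"
    using differential_coord[OF dmanifold_prod[OF A B] mdiff_snd w p, of d] d
      frechet_derivative_at[OF rep_snd[OF c d d], symmetric] frechet_transition_self[OF B d] by simp
  ultimately show ?thesis by simp
qed

lemma tangent_prod_eqI:
  assumes "v \<in> tangent_space (prod_atlas A B) p" "w \<in> tangent_space (prod_atlas A B) p"
    and "differential (prod_atlas A B) A fst p v = differential (prod_atlas A B) A fst p w"
    and "differential (prod_atlas A B) B snd p v = differential (prod_atlas A B) B snd p w"
  shows "v = w"
proof (rule tangent_eqI[OF assms(1,2)])
  fix k assume k: "k \<in> charts_at (prod_atlas A B) p"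
  obtain a b where p: "p = (a, b)" by (cases p)
  with k obtain c d where "k = prod_chart c d" "c \<in> charts_at A a" "d \<in> charts_at B b"
    by (auto simp: charts_at_prod)
  then show "coord v k = coord w k" using coord_prod assms p by simp
qed

lemma mdiff_Pair:
  assumes C: "dmanifold C" and F: "mdiff C A F m" and H: "mdiff C B H m"
  shows "mdiff C (prod_atlas A B) (\<lambda>x. (F x, H x)) m"
  unfolding mdiff_def
proof (intro conjI ballI)
  show "filterlim (\<lambda>x. (F x, H x)) (nhds (F m, H m)) (nhds m)"
    using F H unfolding mdiff_def by (simp add: tendsto_Pair)
  fix e k assume e: "e \<in> charts_at C m" and "k \<in> charts_at (prod_atlas A B) (F m, H m)"
  then obtain c d where k: "k = prod_chart c d" and c: "c \<in> charts_at A (F m)" and d: "d \<in> charts_at B (H m)"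
    by (auto simp: charts_at_prod)
  have "rep e k (\<lambda>x. (F x, H x)) = (\<lambda>y. (rep e c F y, rep e d H y))"
    by (auto simp: rep_def k)
  then show "rep e k (\<lambda>x. (F x, H x)) differentiable at (snd e m)"
    using differentiableI[OF has_derivative_Pair[OF mdiff_rep[OF F e c] mdiff_rep[OF H e d]]] by simp
qed

text \<open>A tangent vector of a product is determined by its two projections. Comparing
  projections splits the differential of the pair into \<open>w1 + w2\<close>, one vector along each
  factor, and the differential of \<open>K\<close> is linear.\<close>

lemma differential_binary:
  assumes C: "dmanifold C" and E: "dmanifold E" and F: "mdiff C A F m" and H: "mdiff C B H m"
    and K: "mdiff (prod_atlas A B) E (\<lambda>(x, y). K x y) (F m, H m)"
  shows "differential C E (\<lambda>x. K (F x) (H x)) m v =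
    differential A E (\<lambda>x. K x (H m)) (F m) (differential C A F m v) +
    differential B E (\<lambda>y. K (F m) y) (H m) (differential C B H m v)"
proof -
  let ?P = "prod_atlas A B" and ?K = "\<lambda>(x, y). K x y"
  note P = dmanifold_prod[OF A B]
  let ?v1 = "differential C A F m v" and ?v2 = "differential C B H m v"
  define w where "w = differential C ?P (\<lambda>x. (F x, H x)) m v"
  define w1 where "w1 = differential A ?P (\<lambda>x. (x, H m)) (F m) ?v1"
  define w2 where "w2 = differential B ?P (\<lambda>y. (F m, y)) (H m) ?v2"
  note dFH = mdiff_Pair[OF C F H]
  have i1: "mdiff A ?P (\<lambda>x. (x, H m)) (F m)"
    using mdiff_Pair[OF A mdiff_id[OF A] mdiff_const[of A B "H m"], of "F m"] by (simp add: id_def)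
  have i2: "mdiff B ?P (\<lambda>y. (F m, y)) (H m)"
    using mdiff_Pair[OF B mdiff_const[of B A "F m"] mdiff_id[OF B], of "H m"] by (simp add: id_def)
  have T: "w \<in> tangent_space ?P (F m, H m)" "w1 \<in> tangent_space ?P (F m, H m)" "w2 \<in> tangent_space ?P (F m, H m)"
    unfolding w_def w1_def w2_def
    using differential_in_tangent[OF C P dFH] differential_in_tangent[OF A P i1] differential_in_tangent[OF B P i2] by auto
  have T1: "?v1 \<in> tangent_space A (F m)" and T2: "?v2 \<in> tangent_space B (H m)"
    using differential_in_tangent[OF C A F] differential_in_tangent[OF C B H] by auto
  have f: "differential ?P A fst (F m, H m) w = ?v1" "differential ?P B snd (F m, H m) w = ?v2"
    using differential_compose[OF C P dFH mdiff_fst] differential_compose[OF C P dFH mdiff_snd]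
    by (simp_all add: w_def o_def)
  have f1: "differential ?P A fst (F m, H m) w1 = ?v1" "differential ?P B snd (F m, H m) w1 = 0"
    using differential_compose[OF A P i1 mdiff_fst] differential_compose[OF A P i1 mdiff_snd] differential_id[OF A T1]
    by (simp_all add: w1_def o_def id_def differential_const)
  have f2: "differential ?P A fst (F m, H m) w2 = 0" "differential ?P B snd (F m, H m) w2 = ?v2"
    using differential_compose[OF B P i2 mdiff_fst] differential_compose[OF B P i2 mdiff_snd] differential_id[OF B T2]
    by (simp_all add: w2_def o_def id_def differential_const)
  have "w = w1 + w2"
    by (rule tangent_prod_eqI[OF T(1)])
      (use T subspace_tangent_space[OF P] in \<open>simp_all add: subspace_add differential_lin[OF P mdiff_fst] differential_lin[OF P mdiff_snd] f f1 f2\<close>)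
  then have "differential ?P E ?K (F m, H m) w = differential ?P E ?K (F m, H m) w1 + differential ?P E ?K (F m, H m) w2"
    by (simp add: differential_lin[OF P K])
  moreover have "differential ?P E ?K (F m, H m) w = differential C E (\<lambda>x. K (F x) (H x)) m v"
    using differential_compose[OF C P dFH K] by (simp add: w_def o_def)
  moreover have "differential ?P E ?K (F m, H m) w1 = differential A E (\<lambda>x. K x (H m)) (F m) ?v1"
    using differential_compose[OF A P i1 K] by (simp add: w1_def o_def)
  moreover have "differential ?P E ?K (F m, H m) w2 = differential B E (\<lambda>y. K (F m) y) (H m) ?v2"
    using differential_compose[OF B P i2 K] by (simp add: w2_def o_def)
  ultimately show ?thesis by simp
qed

end

subsection \<open>Curves\<close>

lemma chart_inv_line [simp]: "chart_inv (UNIV, id) = (id :: real \<Rightarrow> real)"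
  by (rule ext) (simp add: chart_inv_def inv_into_def)

lemma dmanifold_line: "dmanifold real_line"
proof -
  have "(id :: real \<Rightarrow> real) differentiable at t" for t unfolding id_def by simp
  then show ?thesis
    unfolding dmanifold_def real_line_def by (auto simp: homeomorphism_def transition_def)
qed

lemma charts_at_line [simp]: "charts_at real_line t = {(UNIV, id)}"
  by (auto simp: charts_at_def real_line_def)

definition line_unit :: "(real, real) tvec" where
  "line_unit = Tvec (\<lambda>c. if c = (UNIV, id) then 1 else 0)"

lemma velocity_differential:
  assumes "mdiff real_line A \<gamma> t"
  shows "velocity A \<gamma> t = differential real_line A \<gamma> t line_unit"
proof (rule tvec_eqI)
  fix d
  have c: "some_chart real_line t = (UNIV, id)" using some_chart_in[OF dmanifold_line, of t] by simp
  show "coord (velocity A \<gamma> t) d = coord (differential real_line A \<gamma> t line_unit) d"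
  proof (cases "d \<in> charts_at A (\<gamma> t)")
    case True
    then have "snd d \<circ> \<gamma> differentiable at t" using assms by (simp add: mdiff_def rep_def)
    then show ?thesis
      using True frechet_derivative_eq_vector_derivative[of "snd d \<circ> \<gamma>" t]
      by (simp add: velocity_def differential_rep c rep_def line_unit_def)
  qed (simp add: velocity_def differential_rep)
qed

lemma velocity_compose:
  assumes "dmanifold A" "mdiff real_line A \<gamma> t" "mdiff A B F (\<gamma> t)"
  shows "velocity B (\<lambda>t. F (\<gamma> t)) t = differential A B F (\<gamma> t) (velocity A \<gamma> t)"
  using velocity_differential[OF mdiff_compose[OF dmanifold_line assms]]
    differential_compose[OF dmanifold_line assms] velocity_differential[OF assms(2)]
  by (simp add: o_def)


section \<open>Finite-dimensional normed spaces\<close>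

text \<open>Coordinates are bounded by the norm. Chart spaces carry just a norm and a finite
  spanning set, so this is the entry to all of their analysis. In the induction the new vector
  \<open>b\<close> has positive distance from the span of the old ones.\<close>

lemma finite_dim_coord_bound:
  fixes B :: "'a::real_normed_vector set"
  assumes "finite B" "independent B"
  shows "\<exists>c>0. \<forall>u. \<forall>b\<in>B. c * \<bar>u b\<bar> \<le> norm (\<Sum>b\<in>B. u b *\<^sub>R b)"
  using assms
proof (induction rule: finite_induct)
  case empty
  then show ?case by (intro exI[of _ 1]) auto
next
  case (insert b B)
  then have indB: "independent B" and bB: "b \<notin> span B" by (auto simp: independent_insert)
  from insert.IH[OF indB] obtain c where c: "c > 0"
    and cb: "\<And>u a. a \<in> B \<Longrightarrow> c * \<bar>u a\<bar> \<le> norm (\<Sum>b\<in>B. u b *\<^sub>R b)" by blast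
  \<comment> \<open>Otherwise a sequence in the span converges to \<open>- b\<close>. Its
    coordinates are Cauchy by the induction hypothesis, so the limit lies in the span as well,
    against independence.\<close>
  have "\<exists>\<delta>>0. \<forall>s\<in>span B. \<delta> \<le> norm (b + s)"
  proof (rule ccontr)
    assume "\<not> ?thesis"
    then have "\<forall>k. \<exists>s\<in>span B. norm (b + s) < 1 / real (Suc k)"
      by (metis not_le of_nat_0_less_iff zero_less_Suc zero_less_divide_1_iff)
    then obtain s where s: "\<And>k. s k \<in> span B" "\<And>k. norm (b + s k) < 1 / real (Suc k)" by metis
    have "\<forall>k. \<exists>u. s k = (\<Sum>b\<in>B. u b *\<^sub>R b)" using s(1) by (auto simp: span_finite[OF insert.hyps(1)])
    then obtain u where u: "\<And>k. s k = (\<Sum>b\<in>B. u k b *\<^sub>R b)" by metis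
    have lim: "(\<lambda>k. b + s k) \<longlonglongrightarrow> 0"
    proof (rule tendsto_norm_zero_cancel, rule tendsto_sandwich[OF _ _ tendsto_const LIMSEQ_inverse_real_of_nat])
      show "\<forall>\<^sub>F n in sequentially. norm (b + s n) \<le> inverse (real (Suc n))"
        using s(2) by (simp add: inverse_eq_divide less_imp_le)
    qed simp
    have "(\<lambda>k. (b + s k) - b) \<longlonglongrightarrow> 0 - b" by (intro tendsto_diff lim tendsto_const)
    then have lim': "s \<longlonglongrightarrow> - b" by simp
    then have Cs: "Cauchy s" using LIMSEQ_imp_Cauchy by blast
    have "convergent (\<lambda>k. u k a)" if a: "a \<in> B" for a
    proof (rule Cauchy_convergent, rule metric_CauchyI)
      fix e :: real assume e: "0 < e"
      then obtain N where N: "\<And>m n. m \<ge> N \<Longrightarrow> n \<ge> N \<Longrightarrow> dist (s m) (s n) < c * e"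
        using Cs c metric_CauchyD[of s "c * e"] by auto
      have "dist (u m a) (u n a) < e" if "m \<ge> N" "n \<ge> N" for m n
      proof -
        have "c * \<bar>u m a - u n a\<bar> \<le> norm (s m - s n)"
          using cb[OF a, of "\<lambda>b. u m b - u n b"] by (simp add: u sum_subtractf scaleR_left_diff_distrib)
        also have "\<dots> < c * e" using N[OF that] by (simp add: dist_norm)
        finally show ?thesis using c by (simp add: dist_real_def)
      qed
      then show "\<exists>M. \<forall>m\<ge>M. \<forall>n\<ge>M. dist (u m a) (u n a) < e" by blast
    qed
    then obtain l where l: "\<And>a. a \<in> B \<Longrightarrow> (\<lambda>k. u k a) \<longlonglongrightarrow> l a" unfolding convergent_def by metis
    then have "(\<lambda>k. \<Sum>a\<in>B. u k a *\<^sub>R a) \<longlonglongrightarrow> (\<Sum>a\<in>B. l a *\<^sub>R a)"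
      by (intro tendsto_sum tendsto_scaleR tendsto_const) auto
    moreover have "s = (\<lambda>k. \<Sum>a\<in>B. u k a *\<^sub>R a)" using u by auto
    ultimately have "- b = (\<Sum>a\<in>B. l a *\<^sub>R a)" using LIMSEQ_unique[OF lim'] by simp
    then have "- b \<in> span B" by (simp add: span_sum span_scale span_base)
    then show False using bB span_neg[of "- b" B] by simp
  qed
  then obtain \<delta> where \<delta>: "\<delta> > 0" "\<And>s. s \<in> span B \<Longrightarrow> \<delta> \<le> norm (b + s)" by blast
  \<comment> \<open>The first entry controls the coordinate of \<open>b\<close>. For the others the
    norm of the part in the old span is at most \<open>1 + norm b / \<delta>\<close> times the norm
    of the whole.\<close>
  let ?C = "min \<delta> (c / (1 + norm b / \<delta>))"
  have pos: "1 + norm b / \<delta> > 0" using \<delta>(1) by (simp add: add_pos_nonneg)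
  then have "?C > 0" using \<delta>(1) c by simp
  moreover have "?C * \<bar>u a\<bar> \<le> norm (\<Sum>b\<in>insert b B. u b *\<^sub>R b)" if a: "a \<in> insert b B" for u a
  proof -
    let ?s = "\<Sum>b\<in>B. u b *\<^sub>R b" and ?t = "\<Sum>b\<in>insert b B. u b *\<^sub>R b"
    have t: "?t = u b *\<^sub>R b + ?s" using insert.hyps by simp
    have sB: "?s \<in> span B" by (intro span_sum span_scale span_base)
    have ub: "\<delta> * \<bar>u b\<bar> \<le> norm ?t"
    proof (cases "u b = 0")
      case False
      have "?t = u b *\<^sub>R (b + (1 / u b) *\<^sub>R ?s)" using False by (simp add: t scaleR_right_distrib)
      moreover have "\<delta> \<le> norm (b + (1 / u b) *\<^sub>R ?s)" by (intro \<delta>(2) span_scale sB)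
      ultimately show ?thesis using mult_left_mono[of \<delta> "norm (b + (1 / u b) *\<^sub>R ?s)" "\<bar>u b\<bar>"]
        by (simp add: mult.commute)
    qed (simp add: \<delta>)
    show ?thesis
    proof (cases "a = b")
      case True
      have "?C * \<bar>u b\<bar> \<le> \<delta> * \<bar>u b\<bar>" by (intro mult_right_mono) auto
      with ub True show ?thesis by simp
    next
      case False
      then have "c * \<bar>u a\<bar> \<le> norm ?s" using cb a by auto
      also have "norm ?s \<le> norm ?t + \<bar>u b\<bar> * norm b"
        using norm_triangle_ineq4[of ?t "u b *\<^sub>R b"] by (simp add: t)
      also have "\<bar>u b\<bar> * norm b \<le> norm ?t / \<delta> * norm b"
        using ub \<delta>(1) by (intro mult_right_mono) (simp_all add: field_simps)
      finally have "c * \<bar>u a\<bar> \<le> (1 + norm b / \<delta>) * norm ?t" by (simp add: algebra_simps)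
      then have "c / (1 + norm b / \<delta>) * \<bar>u a\<bar> \<le> norm ?t"
        using pos by (simp add: field_simps)
      moreover have "?C * \<bar>u a\<bar> \<le> c / (1 + norm b / \<delta>) * \<bar>u a\<bar>" by (intro mult_right_mono) auto
      ultimately show ?thesis by linarith
    qed
  qed
  ultimately show ?case by blast
qed

definition fin_dim :: "'a::real_normed_vector itself \<Rightarrow> bool" where
  "fin_dim _ \<longleftrightarrow> (\<exists>B::'a set. finite B \<and> span B = UNIV)"

lemma fin_dim_coords:
  assumes "fin_dim TYPE('a::real_normed_vector)"
  obtains n and \<phi> :: "nat \<Rightarrow> 'a::real_normed_vector \<Rightarrow> real" and b :: "nat \<Rightarrow> 'a"
  where "\<And>i. i < n \<Longrightarrow> bounded_linear (\<phi> i)" "\<And>v. v = (\<Sum>i<n. \<phi> i v *\<^sub>R b i)"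
proof -
  obtain B0 :: "'a set" where "finite B0" "span B0 = UNIV" using assms unfolding fin_dim_def by blast
  then obtain B where "B \<subseteq> B0" "independent B" and sp: "span B = UNIV"
    using maximal_independent_subset[of B0] by (metis span_superset span_span span_mono subset_antisym top_greatest)
  with \<open>finite B0\<close> have fin: "finite B" and ind: "independent B" by (auto intro: finite_subset)
  obtain c where c: "c > 0" "\<And>u a. a \<in> B \<Longrightarrow> c * \<bar>u a\<bar> \<le> norm (\<Sum>b\<in>B. u b *\<^sub>R b)"
    using finite_dim_coord_bound[OF fin ind] by blast
  have rep: "(\<Sum>b\<in>B. representation B v b *\<^sub>R b) = v" for v
    using sum_representation_eq[OF ind _ fin order_refl, of v] sp by simp
  have bl: "bounded_linear (\<lambda>v. representation B v a)" if "a \<in> B" for a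
  proof (rule bounded_linear_intro[where K = "1 / c"])
    fix v w :: 'a and r :: real
    show "representation B (v + w) a = representation B v a + representation B w a"
      using representation_add[OF ind, of w v] sp by simp
    show "representation B (r *\<^sub>R v) a = r *\<^sub>R representation B v a"
      using representation_scale[OF ind, of v r] sp by simp
    show "norm (representation B v a) \<le> norm v * (1 / c)"
      using c(2)[OF that, of "representation B v"] c(1) by (simp add: rep field_simps)
  qed
  obtain f where f: "bij_betw f {..<card B} B" using ex_bij_betw_nat_finite[OF fin] by (auto simp: atLeast0LessThan)
  show ?thesis
  proof (rule that[of "card B" "\<lambda>i v. representation B v (f i)" f])
    show "bounded_linear (\<lambda>v. representation B v (f i))" if "i < card B" for i
      using bl f that by (auto simp: bij_betw_def)
    show "v = (\<Sum>i<card B. representation B v (f i) *\<^sub>R f i)" for v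
      using sum.reindex_bij_betw[OF f, of "\<lambda>b. representation B v b *\<^sub>R b"] rep[of v] by simp
  qed
qed

lemma fin_dim_prod:
  assumes "fin_dim TYPE('a::real_normed_vector)" "fin_dim TYPE('b::real_normed_vector)"
  shows "fin_dim TYPE('a::real_normed_vector \<times> 'b::real_normed_vector)"
proof -
  obtain A :: "'a set" and B :: "'b set" where AB: "finite A" "span A = UNIV" "finite B" "span B = UNIV"
    using assms unfolding fin_dim_def by blast
  let ?C = "(\<lambda>a. (a, 0)) ` A \<union> (\<lambda>b. (0, b)) ` B"
  have "linear (\<lambda>a::'a. (a, 0::'b))" "linear (\<lambda>b::'b. (0::'a, b))" by (auto intro!: linearI)
  then have "(a, 0) \<in> span ?C" "(0, b) \<in> span ?C" for a b
    using AB span_mono[of "(\<lambda>a. (a, 0)) ` A" ?C] span_mono[of "(\<lambda>b. (0, b)) ` B" ?C]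
    by (auto simp: linear_span_image)
  then have "(a, 0) + (0, b) \<in> span ?C" for a b by (rule span_add)
  then have "span ?C = UNIV" by auto
  moreover have "finite ?C" using AB by simp
  ultimately show ?thesis unfolding fin_dim_def by blast
qed

section \<open>Smooth functions\<close>

lemma frechet_cong_open:
  assumes "open S" "x \<in> S" "\<And>y. y \<in> S \<Longrightarrow> f y = g y"
  shows "f differentiable at x \<longleftrightarrow> g differentiable at x"
    and "frechet_derivative f (at x) = frechet_derivative g (at x)"
proof -
  have "(f has_derivative D) (at x) \<longleftrightarrow> (g has_derivative D) (at x)" for D
    using has_derivative_transform_within_open[of f D x UNIV S g] has_derivative_transform_within_open[of g D x UNIV S f] assms by auto
  then show "f differentiable at x \<longleftrightarrow> g differentiable at x"
    "frechet_derivative f (at x) = frechet_derivative g (at x)"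
    by (simp_all add: differentiable_def frechet_derivative_def)
qed

lemma Ck_on_cong:
  assumes "open S" "\<And>y. y \<in> S \<Longrightarrow> f y = g y" "Ck_on k f S"
  shows "Ck_on k g S"
  using assms(2,3)
proof (induction k arbitrary: f g)
  case 0
  then show ?case using continuous_on_cong[of S S f g] by simp
next
  case (Suc k)
  then have fg: "f differentiable at x \<longleftrightarrow> g differentiable at x" "frechet_derivative f (at x) = frechet_derivative g (at x)" if "x \<in> S" for x
    using frechet_cong_open[OF assms(1) that, of f g] by auto
  show ?case
    using Suc.prems(2) Suc.IH[of "\<lambda>x. frechet_derivative f (at x) v" "\<lambda>x. frechet_derivative g (at x) v" for v] fg by auto
qed

lemma Ck_on_Suc: "Ck_on (Suc k) f S \<Longrightarrow> Ck_on k f S"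
proof (induction k arbitrary: f)
  case 0
  then show ?case
    by (auto intro!: continuous_at_imp_continuous_on dest: differentiable_imp_continuous_within)
next
  case (Suc k)
  have "Ck_on k (\<lambda>x. frechet_derivative f (at x) v) S" for v
    using Suc by (metis Ck_on.simps(2))
  with Suc.prems show ?case by simp
qed

lemma Ck_on_const: "Ck_on k (\<lambda>x. c) S"
  by (induction k arbitrary: c) (auto simp: frechet_derivative_const)

lemma Ck_on_bounded_linear: "bounded_linear h \<Longrightarrow> Ck_on k h S"
proof (cases k)
  case 0
  assume "bounded_linear h"
  with 0 show ?thesis by (simp add: linear_continuous_on)
next
  case (Suc j)
  assume h: "bounded_linear h"
  then have d: "(h has_derivative h) (at x)" for x by (rule bounded_linear_imp_has_derivative)
  with Suc show ?thesis
    using frechet_derivative_at[OF d, symmetric] by (auto intro: Ck_on_const differentiableI)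
qed

lemma Ck_on_add:
  assumes "open S" shows "Ck_on k f S \<Longrightarrow> Ck_on k g S \<Longrightarrow> Ck_on k (\<lambda>x. f x + g x) S"
proof (induction k arbitrary: f g)
  case (Suc k)
  have D: "((\<lambda>x. f x + g x) has_derivative (\<lambda>v. frechet_derivative f (at x) v + frechet_derivative g (at x) v)) (at x)" if "x \<in> S" for x
    using Suc.prems that by (intro has_derivative_add) (auto simp: frechet_derivative_works)
  have "Ck_on k (\<lambda>x. frechet_derivative (\<lambda>x. f x + g x) (at x) v) S" for v
    by (rule Ck_on_cong[OF assms _ Suc.IH[of "\<lambda>x. frechet_derivative f (at x) v" "\<lambda>x. frechet_derivative g (at x) v"]])
      (use Suc.prems frechet_derivative_at[OF D, symmetric] in auto)
  with D show ?case by (auto intro: differentiableI)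
qed (auto intro: continuous_intros)

lemma Ck_on_sum:
  assumes "open S" shows "(\<And>i. i \<in> I \<Longrightarrow> Ck_on k (f i) S) \<Longrightarrow> Ck_on k (\<lambda>x. \<Sum>i\<in>I. f i x) S"
  by (induction I rule: infinite_finite_induct) (auto intro!: Ck_on_const Ck_on_add[OF assms])

lemma Ck_on_scaleR:
  assumes "open S" shows "Ck_on k f S \<Longrightarrow> Ck_on k g S \<Longrightarrow> Ck_on k (\<lambda>x. f x *\<^sub>R g x) S"
proof (induction k arbitrary: f g)
  case (Suc k)
  have D: "((\<lambda>x. f x *\<^sub>R g x) has_derivative (\<lambda>v. f x *\<^sub>R frechet_derivative g (at x) v + frechet_derivative f (at x) v *\<^sub>R g x)) (at x)" if "x \<in> S" for x
    using Suc.prems that by (intro has_derivative_scaleR) (auto simp: frechet_derivative_works)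
  have "Ck_on k (\<lambda>x. frechet_derivative (\<lambda>x. f x *\<^sub>R g x) (at x) v) S" for v
  proof (rule Ck_on_cong[OF assms])
    show "Ck_on k (\<lambda>x. f x *\<^sub>R frechet_derivative g (at x) v + frechet_derivative f (at x) v *\<^sub>R g x) S"
      using Suc.prems Ck_on_Suc[OF Suc.prems(1)] Ck_on_Suc[OF Suc.prems(2)]
      by (intro Ck_on_add[OF assms] Suc.IH) simp_all
  qed (simp add: frechet_derivative_at[OF D, symmetric])
  with D show ?case by (auto intro: differentiableI)
qed (auto intro: continuous_intros)

lemma Ck_on_linear_compose:
  assumes "open S" "bounded_linear h" shows "Ck_on k f S \<Longrightarrow> Ck_on k (\<lambda>x. h (f x)) S"
proof (induction k arbitrary: f)
  case 0
  then show ?case using assms(2) by (simp add: linear_continuous_on continuous_on_compose2[of UNIV h])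
next
  case (Suc k)
  have D: "((\<lambda>x. h (f x)) has_derivative (\<lambda>v. h (frechet_derivative f (at x) v))) (at x)" if "x \<in> S" for x
    using Suc.prems that by (intro bounded_linear.has_derivative[OF assms(2)]) (auto simp: frechet_derivative_works)
  have "Ck_on k (\<lambda>x. frechet_derivative (\<lambda>x. h (f x)) (at x) v) S" for v
    by (rule Ck_on_cong[OF assms(1) _ Suc.IH[of "\<lambda>x. frechet_derivative f (at x) v"]])
      (use Suc.prems frechet_derivative_at[OF D, symmetric] in auto)
  with D show ?case by (auto intro: differentiableI)
qed

text \<open>\<open>Ck_on\<close> speaks of derivatives in fixed directions, whereas the chain rule
  differentiates \<open>f\<close> in the varying direction given by the derivative of
  \<open>g\<close>. Expanding that direction in a basis gives a finite sum of products to which the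
  induction hypothesis applies.\<close>

lemma Ck_on_compose:
  fixes g :: "'c::real_normed_vector \<Rightarrow> 'a::real_normed_vector" and f :: "'a \<Rightarrow> 'b::real_normed_vector"
  assumes fd: "fin_dim TYPE('a)" and S: "open S" and gS: "g ` S \<subseteq> U"
  shows "Ck_on k f U \<Longrightarrow> Ck_on k g S \<Longrightarrow> Ck_on k (\<lambda>x. f (g x)) S"
proof (induction k arbitrary: f)
  case 0
  then show ?case using gS by (auto intro: continuous_on_compose2)
next
  case (Suc k)
  obtain n and \<phi> :: "nat \<Rightarrow> 'a \<Rightarrow> real" and b where \<phi>: "\<And>i. i < n \<Longrightarrow> bounded_linear (\<phi> i)"
    "\<And>v. v = (\<Sum>i<n. \<phi> i v *\<^sub>R b i)" by (rule fin_dim_coords[OF fd], rule that)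
  have fU: "f differentiable at (g x)" if "x \<in> S" for x using Suc.prems gS that by auto
  have D: "((\<lambda>x. f (g x)) has_derivative (\<lambda>v. frechet_derivative f (at (g x)) (frechet_derivative g (at x) v))) (at x)" if "x \<in> S" for x
    using Suc.prems that fU by (intro has_derivative_compose[of g _ x UNIV f]) (auto simp: frechet_derivative_works)
  have lin: "linear (frechet_derivative f (at (g x)))" if "x \<in> S" for x
    using fU[OF that] by (metis frechet_derivative_works has_derivative_linear)
  have "Ck_on k (\<lambda>x. frechet_derivative (\<lambda>x. f (g x)) (at x) v) S" for v
  proof (rule Ck_on_cong[OF S])
    show "Ck_on k (\<lambda>x. \<Sum>i<n. \<phi> i (frechet_derivative g (at x) v) *\<^sub>R frechet_derivative f (at (g x)) (b i)) S"
      using Suc.prems Ck_on_Suc[OF Suc.prems(2)]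
      by (intro Ck_on_sum[OF S] Ck_on_scaleR[OF S] Ck_on_linear_compose[OF S \<phi>(1)] Suc.IH) auto
    fix x assume x: "x \<in> S"
    have "frechet_derivative (\<lambda>x. f (g x)) (at x) v = frechet_derivative f (at (g x)) (frechet_derivative g (at x) v)"
      using frechet_derivative_at[OF D[OF x], symmetric] by simp
    also have "\<dots> = frechet_derivative f (at (g x)) (\<Sum>i<n. \<phi> i (frechet_derivative g (at x) v) *\<^sub>R b i)"
      by (rule arg_cong[OF \<phi>(2)])
    finally show "(\<Sum>i<n. \<phi> i (frechet_derivative g (at x) v) *\<^sub>R frechet_derivative f (at (g x)) (b i)) =
        frechet_derivative (\<lambda>x. f (g x)) (at x) v"
      by (simp add: linear_sum[OF lin[OF x]] linear_scale[OF lin[OF x]])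
  qed
  with D show ?case by (auto intro: differentiableI)
qed

lemma smooth_on_compose:
  fixes g :: "'c::real_normed_vector \<Rightarrow> 'a::real_normed_vector" and f :: "'a \<Rightarrow> 'b::real_normed_vector"
  assumes "fin_dim TYPE('a)" "open S" "g ` S \<subseteq> U" "smooth_on f U" "smooth_on g S"
  shows "smooth_on (\<lambda>x. f (g x)) S"
  using assms Ck_on_compose unfolding smooth_on_def by blast

lemma smooth_on_directional: "smooth_on f S \<Longrightarrow> smooth_on (\<lambda>x. frechet_derivative f (at x) v) S"
  unfolding smooth_on_def by (metis Ck_on.simps(2))

lemma smooth_on_cong: "open S \<Longrightarrow> (\<And>y. y \<in> S \<Longrightarrow> f y = g y) \<Longrightarrow> smooth_on f S \<Longrightarrow> smooth_on g S"
  unfolding smooth_on_def using Ck_on_cong by blast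

lemma smooth_on_Pair_const:
  fixes f :: "'c::real_normed_vector \<Rightarrow> 'a::real_normed_vector" and c :: "'b::real_normed_vector"
  assumes S: "open S" and f: "smooth_on f S"
  shows "smooth_on (\<lambda>x. (f x, c)) S" "smooth_on (\<lambda>x. (c, f x)) S"
proof -
  have 1: "bounded_linear (\<lambda>a::'a. (a, 0::'b))" "bounded_linear (\<lambda>a::'a. (0::'b, a))"
    by (auto intro!: bounded_linear_Pair bounded_linear_ident bounded_linear_zero)
  have fk: "Ck_on k f S" for k using f by (simp add: smooth_on_def)
  have "Ck_on k (\<lambda>x. (f x, 0) + (0, c)) S" for k
    by (rule Ck_on_add[OF S Ck_on_linear_compose[OF S 1(1) fk] Ck_on_const])
  moreover have "Ck_on k (\<lambda>x. (0, f x) + (c, 0)) S" for k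
    by (rule Ck_on_add[OF S Ck_on_linear_compose[OF S 1(2) fk] Ck_on_const])
  ultimately show "smooth_on (\<lambda>x. (f x, c)) S" "smooth_on (\<lambda>x. (c, f x)) S"
    unfolding smooth_on_def by simp_all
qed

lemma Ck_on_locally:
  assumes "\<And>x. x \<in> S \<Longrightarrow> \<exists>T. open T \<and> x \<in> T \<and> Ck_on k f T"
  shows "Ck_on k f S"
  using assms
proof (induction k arbitrary: f)
  case 0
  show ?case unfolding Ck_on.simps
  proof (rule continuous_at_imp_continuous_on, rule ballI)
    fix x assume "x \<in> S"
    with 0[of x] obtain T where "open T" "x \<in> T" "continuous_on T f" by auto
    then show "isCont f x" by (simp add: continuous_on_eq_continuous_at)
  qed
next
  case (Suc k)
  have "f differentiable at x" if "x \<in> S" for x using Suc.prems[OF that] by auto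
  moreover have "Ck_on k (\<lambda>x. frechet_derivative f (at x) v) S" for v
  proof (rule Suc.IH)
    fix x assume "x \<in> S"
    from Suc.prems[OF this] show "\<exists>T. open T \<and> x \<in> T \<and> Ck_on k (\<lambda>x. frechet_derivative f (at x) v) T"
      by auto
  qed
  ultimately show ?case by simp
qed

text \<open>Bootstrapping: if the solution is of class \<open>k\<close>, so is its derivative
  \<open>F (y t)\<close>, and the solution is of class \<open>Suc k\<close>.\<close>

lemma smooth_on_ode_solution:
  fixes y :: "real \<Rightarrow> 'a::real_normed_vector"
  assumes fd: "fin_dim TYPE('a)" and I: "open I" and F: "smooth_on F U"
    and y: "\<And>t. t \<in> I \<Longrightarrow> y t \<in> U" "\<And>t. t \<in> I \<Longrightarrow> (y has_vector_derivative F (y t)) (at t)"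
  shows "smooth_on y I"
proof -
  have d: "(y has_derivative (\<lambda>h. h *\<^sub>R F (y t))) (at t)" if "t \<in> I" for t
    using y(2)[OF that] by (simp add: has_vector_derivative_def)
  have "Ck_on k y I" for k
  proof (induction k)
    case 0
    then show ?case using d
      by (auto intro!: continuous_at_imp_continuous_on has_derivative_continuous)
  next
    case (Suc k)
    have "Ck_on k (\<lambda>t. frechet_derivative y (at t) h) I" for h
    proof (rule Ck_on_cong[OF I])
      show "Ck_on k (\<lambda>t. h *\<^sub>R F (y t)) I"
      proof (rule Ck_on_scaleR[OF I Ck_on_const], rule Ck_on_compose[OF fd I _ _ Suc])
        show "y ` I \<subseteq> U" using y(1) by auto
        show "Ck_on k F U" using F by (simp add: smooth_on_def)
      qed
    qed (simp add: frechet_derivative_at[OF d, symmetric])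
    with d show ?case by (auto intro: differentiableI)
  qed
  then show ?thesis by (simp add: smooth_on_def)
qed

lemma smooth_on_locally_lipschitz:
  fixes F :: "'a::real_normed_vector \<Rightarrow> 'b::real_normed_vector"
  assumes fd: "fin_dim TYPE('a)" and U: "open U" "x0 \<in> U" and F: "smooth_on F U"
  obtains \<rho> K where "\<rho> > 0" "K > 0" "ball x0 \<rho> \<subseteq> U"
    "\<And>x y. x \<in> ball x0 \<rho> \<Longrightarrow> y \<in> ball x0 \<rho> \<Longrightarrow> norm (F x - F y) \<le> K * norm (x - y)"
proof -
  obtain n and \<phi> :: "nat \<Rightarrow> 'a \<Rightarrow> real" and b where \<phi>: "\<And>i. i < n \<Longrightarrow> bounded_linear (\<phi> i)"
    "\<And>v. v = (\<Sum>i<n. \<phi> i v *\<^sub>R b i)" by (rule fin_dim_coords[OF fd], rule that)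
  let ?D = "\<lambda>x. frechet_derivative F (at x)"
  have F1: "Ck_on (Suc 0) F U" using F by (simp only: smooth_on_def)
  then have cont: "continuous_on U (\<lambda>x. ?D x v)" for v by simp
  have diff: "(F has_derivative ?D x) (at x)" if "x \<in> U" for x
    using F1 that by (simp add: frechet_derivative_works)
  \<comment> \<open>\<open>Ck_on\<close> gives continuity of the derivative in each fixed direction.
    This finite sum over a basis is continuous in the base point and dominates the operator
    norm.\<close>
  define M where "M = (\<lambda>x. \<Sum>i<n. onorm (\<phi> i) * norm (?D x (b i)))"
  have "continuous_on U M" unfolding M_def by (intro continuous_intros cont)
  then have "isCont M x0" using U by (simp add: continuous_on_eq_continuous_at)
  then obtain \<epsilon> where \<epsilon>: "\<epsilon> > 0" "\<And>x. dist x x0 < \<epsilon> \<Longrightarrow> dist (M x) (M x0) < 1"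
    unfolding continuous_at_eps_delta by (auto dest!: spec[of _ 1])
  obtain \<epsilon>' where \<epsilon>': "\<epsilon>' > 0" "ball x0 \<epsilon>' \<subseteq> U" using U open_contains_ball by blast
  let ?\<rho> = "min \<epsilon> \<epsilon>'" and ?K = "\<bar>M x0\<bar> + 1"
  have onorm: "onorm (?D x) \<le> ?K" if x: "x \<in> ball x0 ?\<rho>" for x
  proof (rule onorm_bound)
    have xU: "x \<in> U" using x \<epsilon>' by auto
    have lin: "linear (?D x)" using diff[OF xU] by (rule has_derivative_linear)
    fix v
    have "?D x v = ?D x (\<Sum>i<n. \<phi> i v *\<^sub>R b i)" by (rule arg_cong[OF \<phi>(2)])
    then have "norm (?D x v) = norm (\<Sum>i<n. \<phi> i v *\<^sub>R ?D x (b i))"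
      by (simp add: linear_scale[OF lin] linear_sum[OF lin])
    also have "\<dots> \<le> (\<Sum>i<n. (onorm (\<phi> i) * norm v) * norm (?D x (b i)))"
      by (intro sum_norm_le) (use onorm[OF \<phi>(1)] in \<open>simp add: mult_right_mono\<close>)
    also have "\<dots> = M x * norm v" unfolding M_def sum_distrib_right
      by (intro sum.cong refl) (simp add: mult_ac)
    also have "\<dots> \<le> ?K * norm v"
    proof (rule mult_right_mono)
      have "dist (M x) (M x0) < 1" using x by (intro \<epsilon>(2)) (simp add: dist_commute)
      then show "M x \<le> ?K" by (simp add: dist_real_def)
    qed simp
    finally show "norm (?D x v) \<le> ?K * norm v" .
  qed simp
  show ?thesis
  proof (rule that[of ?\<rho> ?K])
    fix x y assume xy: "x \<in> ball x0 ?\<rho>" "y \<in> ball x0 ?\<rho>"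
    show "norm (F x - F y) \<le> ?K * norm (x - y)"
    proof (rule differentiable_bound[OF convex_ball _ onorm xy])
      fix z assume "z \<in> ball x0 ?\<rho>"
      then have "z \<in> U" using \<epsilon>'(2) by auto
      then show "(F has_derivative ?D z) (at z within ball x0 ?\<rho>)"
        by (rule has_derivative_at_withinI[OF diff])
    qed
  next
    show "?\<rho> > 0" "?K > 0" using \<epsilon>(1) \<epsilon>'(1) by simp_all
    show "ball x0 ?\<rho> \<subseteq> U" using \<epsilon>'(2) by auto
  qed
qed


section \<open>Ordinary differential equations\<close>

instance bcontfun :: (metric_space, banach) banach ..

text \<open>The fixed point is sought among bounded continuous functions on the whole line: the time
  is clamped to a short interval by \<open>cl\<close>, and subtracting the integral up to 0 fixes
  the initial value.\<close>

lemma picard_banach: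
  fixes F :: "'b::banach \<Rightarrow> 'b"
  assumes K: "0 \<le> K" "\<And>u v. norm (F u - F v) \<le> K * norm (u - v)"
  obtains \<epsilon> x where "\<epsilon> > (0::real)" "x 0 = 0"
    "\<And>t. t \<in> {-\<epsilon><..<\<epsilon>} \<Longrightarrow> (x has_vector_derivative F (x t)) (at t)"
proof -
  \<comment> \<open>The two integrals in \<open>T\<close> run over lengths of at most
    \<open>2 * \<epsilon>\<close> and \<open>\<epsilon>\<close>, so the contraction constant is
    \<open>3 * \<epsilon> * K\<close>, here at most one half; the summand 1 covers
    \<open>K = 0\<close>.\<close>
  define \<epsilon> where "\<epsilon> = 1 / (6 * (K + 1))"
  have \<epsilon>: "\<epsilon> > 0" using K by (simp add: \<epsilon>_def)
  have \<epsilon>K: "3 * \<epsilon> * K \<le> 1 / 2" using K by (simp add: \<epsilon>_def field_simps)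
  define cl where "cl t = max (- \<epsilon>) (min \<epsilon> t)" for t
  have cl: "cl t \<in> {- \<epsilon>..\<epsilon>}" for t using \<epsilon> by (auto simp: cl_def)
  have clid: "cl t = t" if "t \<in> {- \<epsilon>..\<epsilon>}" for t using that by (auto simp: cl_def)
  define I where "I x u = integral {- \<epsilon>..u} (\<lambda>s. F (apply_bcontfun x s))" for x :: "real \<Rightarrow>\<^sub>C 'b" and u
  have "K-lipschitz_on UNIV F" using K by (intro lipschitz_onI) (auto simp: dist_norm)
  then have contF: "continuous_on UNIV F" by (rule lipschitz_on_continuous_on)
  have cont: "continuous_on S (\<lambda>s. F (apply_bcontfun x s))" for x S
    by (intro continuous_on_compose2[OF contF]) auto
  have int: "(\<lambda>s. F (apply_bcontfun x s)) integrable_on {a..b}" for x and a b :: real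
    by (intro integrable_continuous_real cont)
  have contI: "continuous_on {- \<epsilon>..\<epsilon>} (I x)" for x
    unfolding I_def by (intro indefinite_integral_continuous_1 int)
  have mem: "(\<lambda>t. I x (cl t) - I x 0) \<in> bcontfun" for x
    unfolding bcontfun_def
  proof (intro CollectI conjI)
    show "continuous_on UNIV (\<lambda>t. I x (cl t) - I x 0)"
    proof (intro continuous_intros continuous_on_compose2[OF contI])
      show "continuous_on UNIV cl" unfolding cl_def by (intro continuous_intros)
    qed (use cl in auto)
    have "compact ((\<lambda>u. I x u - I x 0) ` {- \<epsilon>..\<epsilon>})"
      by (intro compact_continuous_image continuous_intros contI) simp
    then have "bounded ((\<lambda>u. I x u - I x 0) ` {- \<epsilon>..\<epsilon>})" by (rule compact_imp_bounded)
    then show "bounded (range (\<lambda>t. I x (cl t) - I x 0))"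
      by (rule bounded_subset) (use cl in auto)
  qed
  define T where "T x = Bcontfun (\<lambda>t. I x (cl t) - I x 0)" for x
  have T: "apply_bcontfun (T x) t = I x (cl t) - I x 0" for x t
    unfolding T_def using mem by (simp add: Bcontfun_inverse)
  have diff: "norm (I x u - I y u) \<le> K * dist x y * (u + \<epsilon>)" if u: "u \<in> {- \<epsilon>..\<epsilon>}" for x y u
  proof -
    have "I x u - I y u = integral {- \<epsilon>..u} (\<lambda>s. F (apply_bcontfun x s) - F (apply_bcontfun y s))"
      unfolding I_def by (rule integral_diff[OF int int, symmetric])
    also have "norm \<dots> \<le> K * dist x y * (u - (- \<epsilon>))"
    proof (rule integral_bound)
      fix s
      have "norm (apply_bcontfun x s - apply_bcontfun y s) \<le> dist x y"
        using dist_bounded[of x s y] by (simp add: dist_norm)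
      then show "norm (F (apply_bcontfun x s) - F (apply_bcontfun y s)) \<le> K * dist x y"
        using K(2)[of "apply_bcontfun x s" "apply_bcontfun y s"] mult_left_mono[OF _ K(1)] by (meson order_trans)
    qed (use u in \<open>auto intro!: continuous_intros cont\<close>)
    finally show ?thesis by simp
  qed
  have "dist (T x) (T y) \<le> 1 / 2 * dist x y" for x y
  proof (rule dist_bound)
    fix t
    have "dist (apply_bcontfun (T x) t) (apply_bcontfun (T y) t) = norm ((I x (cl t) - I y (cl t)) - (I x 0 - I y 0))"
      by (simp add: T dist_norm algebra_simps)
    also have "\<dots> \<le> norm (I x (cl t) - I y (cl t)) + norm (I x 0 - I y 0)" by (rule norm_triangle_ineq4)
    also have "\<dots> \<le> K * dist x y * (cl t + \<epsilon>) + K * dist x y * (0 + \<epsilon>)"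
      using \<epsilon> cl by (intro add_mono diff) auto
    also have "\<dots> \<le> K * dist x y * (2 * \<epsilon>) + K * dist x y * \<epsilon>"
      using cl[of t] K by (intro add_mono mult_left_mono) auto
    also have "\<dots> = (3 * \<epsilon> * K) * dist x y" by (simp add: algebra_simps)
    also have "\<dots> \<le> 1 / 2 * dist x y" by (intro mult_right_mono \<epsilon>K) simp
    finally show "dist (apply_bcontfun (T x) t) (apply_bcontfun (T y) t) \<le> 1 / 2 * dist x y" .
  qed
  then obtain x where x: "T x = x"
    using banach_fix_type[of "1/2" T] by auto
  have xt: "apply_bcontfun x t = I x (cl t) - I x 0" for t using T[of x t] x by simp
  show ?thesis
  proof (rule that[OF \<epsilon>, of "apply_bcontfun x"])
    show "apply_bcontfun x 0 = 0" using xt[of 0] clid[of 0] \<epsilon> by simp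
    fix t assume t: "t \<in> {- \<epsilon><..<\<epsilon>}"
    have "((\<lambda>u. I x u) has_vector_derivative F (apply_bcontfun x t)) (at t within {- \<epsilon>..\<epsilon>})"
      unfolding I_def using t by (intro integral_has_vector_derivative cont) auto
    then have "(I x has_vector_derivative F (apply_bcontfun x t)) (at t within {- \<epsilon><..<\<epsilon>})"
      by (rule has_vector_derivative_within_subset) auto
    then have "(I x has_vector_derivative F (apply_bcontfun x t)) (at t)"
      using t by (simp add: at_within_open[OF t])
    then have "((\<lambda>u. I x u - I x 0) has_vector_derivative F (apply_bcontfun x t)) (at t)"
      using has_vector_derivative_diff[OF _ has_vector_derivative_const] by fastforce
    then show "(apply_bcontfun x has_vector_derivative F (apply_bcontfun x t)) (at t)"
      by (rule has_vector_derivative_transform_within_open[of _ _ _ "{- \<epsilon><..<\<epsilon>}"])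
        (use t xt clid in auto)
  qed
qed

lemma picard_fin_dim:
  fixes F :: "'a::real_normed_vector \<Rightarrow> 'a"
  assumes fd: "fin_dim TYPE('a)" and \<rho>: "\<rho> > 0" and K: "K \<ge> 0"
    and lip: "\<And>x y. x \<in> ball x0 \<rho> \<Longrightarrow> y \<in> ball x0 \<rho> \<Longrightarrow> norm (F x - F y) \<le> K * norm (x - y)"
  obtains \<epsilon> y where "\<epsilon> > (0::real)" "y 0 = x0" "\<And>t. t \<in> {-\<epsilon><..<\<epsilon>} \<Longrightarrow> y t \<in> ball x0 \<rho>"
    "\<And>t. t \<in> {-\<epsilon><..<\<epsilon>} \<Longrightarrow> (y has_vector_derivative F (y t)) (at t)"
proof -
  obtain n and \<phi> :: "nat \<Rightarrow> 'a \<Rightarrow> real" and b where \<phi>: "\<And>i. i < n \<Longrightarrow> bounded_linear (\<phi> i)"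
    "\<And>v. v = (\<Sum>i<n. \<phi> i v *\<^sub>R b i)" by (rule fin_dim_coords[OF fd], rule that)
  define N where "N = (\<Sum>i<n. norm (b i))"
  have N: "N \<ge> 0" by (simp add: N_def sum_nonneg)
  define r where "r = \<rho> / (2 * (N + 1))"
  have r: "r > 0" "r * N < \<rho>" using \<rho> N by (simp_all add: r_def field_simps add_nonneg_pos)
  \<comment> \<open>Picard iteration needs a Banach space: \<open>'a\<close> is replaced by the span of finitely many tent
    functions \<open>E i\<close>, whose coordinates are their values at the integers.\<close>
  define E :: "nat \<Rightarrow> real \<Rightarrow>\<^sub>C real" where "E i = Bcontfun (\<lambda>s. max 0 (1 - \<bar>s - real i\<bar>))" for i
  have E: "apply_bcontfun (E i) (real j) = (if j = i then 1 else 0)" for i j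
  proof -
    have "(\<lambda>s. max 0 (1 - \<bar>s - real i\<bar>)) \<in> bcontfun"
      by (rule bcontfun_normI[of _ 1]) (auto intro!: continuous_intros)
    then show ?thesis unfolding E_def by (subst Bcontfun_inverse) auto
  qed
  have app: "bounded_linear (\<lambda>f :: real \<Rightarrow>\<^sub>C real. apply_bcontfun f (real i))" for i
  proof (rule bounded_linear_intro[where K = 1])
    fix f :: "real \<Rightarrow>\<^sub>C real"
    show "norm (apply_bcontfun f (real i)) \<le> norm f * 1" using norm_bounded[of f "real i"] by simp
  qed simp_all
  define J where "J v = (\<Sum>i<n. \<phi> i v *\<^sub>R E i)" for v
  define P where "P f = (\<Sum>i<n. apply_bcontfun f (real i) *\<^sub>R b i)" for f :: "real \<Rightarrow>\<^sub>C real"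
  have J: "bounded_linear J" unfolding J_def
    by (intro bounded_linear_sum bounded_linear_compose[OF bounded_linear_scaleR_left] \<phi>(1)) auto
  have P: "bounded_linear P" unfolding P_def
    by (intro bounded_linear_sum bounded_linear_compose[OF bounded_linear_scaleR_left] app)
  have Ji: "apply_bcontfun (J v) (real i) = \<phi> i v" if "i < n" for v i
  proof -
    have "apply_bcontfun (J v) (real i) = (\<Sum>j<n. if i = j then \<phi> i v else 0)"
      unfolding J_def linear_sum[OF bounded_linear.linear[OF app]] by (intro sum.cong refl) (simp add: E)
    then show ?thesis using that by simp
  qed
  have PJ: "P (J v) = v" for v
  proof -
    have "P (J v) = (\<Sum>i<n. \<phi> i v *\<^sub>R b i)" unfolding P_def by (rule sum.cong) (simp_all add: Ji)
    then show ?thesis using \<phi>(2)[of v] by (rule trans[OF _ sym])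
  qed
  define cl where "cl s = max (- r) (min r s)" for s
  have cl: "\<bar>cl s\<bar> \<le> r" "\<bar>cl s - cl s'\<bar> \<le> \<bar>s - s'\<bar>" for s s' using r by (auto simp: cl_def)
  have clid: "\<bar>s\<bar> \<le> r \<Longrightarrow> cl s = s" for s by (auto simp: cl_def)
  \<comment> \<open>Clamping the coordinates keeps \<open>x0 + Q f\<close> inside the ball, so the
    local Lipschitz bound becomes a global one for \<open>G\<close>. For small \<open>f\<close> the
    map \<open>Q\<close> agrees with \<open>P\<close>, so for short times the solution is one of the
    original equation.\<close>
  define Q where "Q f = (\<Sum>i<n. cl (apply_bcontfun f (real i)) *\<^sub>R b i)" for f :: "real \<Rightarrow>\<^sub>C real"
  have "norm (Q f) < \<rho>" for f
  proof -
    have "norm (Q f) \<le> (\<Sum>i<n. r * norm (b i))"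
      unfolding Q_def by (intro sum_norm_le) (simp add: cl mult_right_mono)
    also have "\<dots> = r * N" by (simp add: N_def sum_distrib_left)
    finally show ?thesis using r by simp
  qed
  then have Qb: "x0 + Q f \<in> ball x0 \<rho>" for f by (simp add: dist_norm)
  have Qlip: "norm (Q f - Q g) \<le> N * norm (f - g)" for f g
  proof -
    have "norm (Q f - Q g) \<le> (\<Sum>i<n. norm (f - g) * norm (b i))"
      unfolding Q_def sum_subtractf[symmetric] scaleR_left_diff_distrib[symmetric]
    proof (intro sum_norm_le)
      fix i
      have "\<bar>cl (apply_bcontfun f (real i)) - cl (apply_bcontfun g (real i))\<bar> \<le> norm (f - g)"
        using cl(2)[of "apply_bcontfun f (real i)" "apply_bcontfun g (real i)"] norm_bounded[of "f - g" "real i"] by simp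
      then show "norm ((cl (apply_bcontfun f (real i)) - cl (apply_bcontfun g (real i))) *\<^sub>R b i) \<le> norm (f - g) * norm (b i)"
        by (simp add: mult_right_mono)
    qed
    then show ?thesis by (simp add: N_def sum_distrib_left mult.commute)
  qed
  define G where "G f = J (F (x0 + Q f))" for f
  have "norm (G f - G g) \<le> onorm J * K * N * norm (f - g)" for f g
  proof -
    have "norm (G f - G g) = norm (J (F (x0 + Q f) - F (x0 + Q g)))"
      by (simp add: G_def linear_diff[OF bounded_linear.linear[OF J]])
    also have "\<dots> \<le> onorm J * norm (F (x0 + Q f) - F (x0 + Q g))" by (rule onorm[OF J])
    also have "\<dots> \<le> onorm J * (K * norm (Q f - Q g))"
      using lip[OF Qb Qb, of f g] by (intro mult_left_mono onorm_pos_le J) simp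
    also have "\<dots> \<le> onorm J * (K * (N * norm (f - g)))"
      by (intro mult_left_mono onorm_pos_le J K Qlip)
    finally show ?thesis by (simp add: mult.assoc)
  qed
  then obtain \<epsilon> x where \<epsilon>: "\<epsilon> > 0" and x0: "x 0 = 0" and x: "\<And>t. t \<in> {-\<epsilon><..<\<epsilon>} \<Longrightarrow> (x has_vector_derivative G (x t)) (at t)"
    using picard_banach[of "onorm J * K * N" G] K N onorm_pos_le[OF J] by (metis mult_nonneg_nonneg)
  have "isCont x 0" using x[of 0] \<epsilon> has_vector_derivative_continuous by auto
  then obtain \<delta> where \<delta>: "\<delta> > 0" "\<And>t. \<bar>t\<bar> < \<delta> \<Longrightarrow> norm (x t) < r"
    using r(1) x0 unfolding continuous_at_eps_delta by (auto simp: dist_norm)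
  define y where "y t = x0 + P (x t)" for t
  have yQ: "y t = x0 + Q (x t)" if "\<bar>t\<bar> < \<delta>" for t
  proof -
    have "\<bar>apply_bcontfun (x t) (real i)\<bar> \<le> r" for i
      using norm_bounded[of "x t" "real i"] \<delta>(2)[OF that] by simp
    then show ?thesis by (simp add: y_def P_def Q_def clid)
  qed
  show ?thesis
  proof (rule that[of "min \<epsilon> \<delta>" y])
    show "y 0 = x0" by (simp add: y_def x0 linear_0[OF bounded_linear.linear[OF P]])
    fix t assume t: "t \<in> {- min \<epsilon> \<delta><..<min \<epsilon> \<delta>}"
    then have t\<delta>: "\<bar>t\<bar> < \<delta>" and t\<epsilon>: "t \<in> {- \<epsilon><..<\<epsilon>}" by auto
    show "y t \<in> ball x0 \<rho>" using yQ[OF t\<delta>] Qb by simp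
    have "((\<lambda>t. P (x t)) has_vector_derivative P (G (x t))) (at t)"
      by (rule bounded_linear.has_vector_derivative[OF P x[OF t\<epsilon>]])
    moreover have "P (G (x t)) = F (y t)" by (simp add: G_def PJ yQ[OF t\<delta>])
    ultimately have "((\<lambda>t. P (x t)) has_vector_derivative F (y t)) (at t)" by simp
    from has_vector_derivative_add[OF has_vector_derivative_const this, of x0]
    show "(y has_vector_derivative F (y t)) (at t)" by (simp add: y_def[abs_def])
  qed (use \<epsilon> \<delta> in auto)
qed

text \<open>The mean value inequality improves any bound for the distance of the two solutions by
  the factor \<open>K * \<delta>\<close>, at most one half; iterating from the diameter bound of
  \<open>D\<close> forces it to 0.\<close>

lemma ode_unique:
  fixes y z :: "real \<Rightarrow> 'a::real_normed_vector"
  assumes lip: "\<And>u v. u \<in> D \<Longrightarrow> v \<in> D \<Longrightarrow> norm (F u - F v) \<le> K * norm (u - v)"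
    and D: "bounded D" and \<delta>: "K * \<delta> \<le> 1 / 2" "K \<ge> 0"
    and y: "\<And>t. \<bar>t\<bar> < \<delta> \<Longrightarrow> y t \<in> D" "\<And>t. \<bar>t\<bar> < \<delta> \<Longrightarrow> (y has_vector_derivative F (y t)) (at t)"
    and z: "\<And>t. \<bar>t\<bar> < \<delta> \<Longrightarrow> z t \<in> D" "\<And>t. \<bar>t\<bar> < \<delta> \<Longrightarrow> (z has_vector_derivative F (z t)) (at t)"
    and yz: "y 0 = z 0" and t: "\<bar>t\<bar> < \<delta>"
  shows "y t = z t"
proof -
  obtain R where R: "\<And>u. u \<in> D \<Longrightarrow> norm u \<le> R" using D by (auto simp: bounded_iff)
  define C where "C = 2 * R"
  have bound: "norm (y t - z t) \<le> C / 2 ^ k" if "\<bar>t\<bar> < \<delta>" for t k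
    using that
  proof (induction k arbitrary: t)
    case 0
    then have "norm (y t) \<le> R" "norm (z t) \<le> R" using R y z by auto
    then show ?case using norm_triangle_ineq4[of "y t" "z t"] by (simp add: C_def)
  next
    case (Suc k)
    let ?w = "\<lambda>t. y t - z t" and ?S = "{-\<delta><..<\<delta>}"
    have C: "0 \<le> C / 2 ^ k" using Suc.IH[OF Suc.prems] norm_ge_zero order_trans by blast
    have "norm (?w t - ?w 0) \<le> K * (C / 2 ^ k) * norm (t - 0)"
    proof (rule differentiable_bound[of ?S])
      fix s assume s: "s \<in> ?S"
      then have s': "\<bar>s\<bar> < \<delta>" by auto
      have "(?w has_vector_derivative F (y s) - F (z s)) (at s)"
        by (intro has_vector_derivative_diff y z s')
      then show "(?w has_derivative (\<lambda>h. h *\<^sub>R (F (y s) - F (z s)))) (at s within ?S)"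
        unfolding has_vector_derivative_def by (rule has_derivative_at_withinI)
      have "norm (F (y s) - F (z s)) \<le> K * norm (y s - z s)" by (intro lip y z s')
      also have "\<dots> \<le> K * (C / 2 ^ k)" by (intro mult_left_mono Suc.IH s' \<delta>)
      finally have "norm (F (y s) - F (z s)) \<le> K * (C / 2 ^ k)" .
      then show "onorm (\<lambda>h. h *\<^sub>R (F (y s) - F (z s))) \<le> K * (C / 2 ^ k)"
      proof (intro onorm_bound)
        show "0 \<le> K * (C / 2 ^ k)" by (rule mult_nonneg_nonneg[OF \<delta>(2) C])
        fix h :: real
        assume "norm (F (y s) - F (z s)) \<le> K * (C / 2 ^ k)"
        from mult_left_mono[OF this abs_ge_zero[of h]]
        show "norm (h *\<^sub>R (F (y s) - F (z s))) \<le> K * (C / 2 ^ k) * norm h"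
          by (simp add: mult.commute)
      qed
    qed (use Suc.prems in auto)
    also have "\<dots> \<le> K * (C / 2 ^ k) * \<delta>" using Suc.prems by (intro mult_left_mono mult_nonneg_nonneg C \<delta>) auto
    also have "\<dots> = (K * \<delta>) * (C / 2 ^ k)" by simp
    also have "\<dots> \<le> 1 / 2 * (C / 2 ^ k)" by (intro mult_right_mono \<delta> C)
    finally show ?case using yz by simp
  qed
  have "(\<lambda>k. C / 2 ^ k) \<longlonglongrightarrow> C * 0"
    unfolding divide_inverse by (intro tendsto_mult tendsto_const) (simp add: LIMSEQ_inverse_realpow_zero)
  then have "norm (y t - z t) \<le> 0"
    using bound[OF t] by (intro LIMSEQ_le_const[of "\<lambda>k. C / 2 ^ k"]) auto
  then show ?thesis by simp
qed


section \<open>One-parameter subgroups\<close>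

lemma chart_image_open:
  assumes "dmanifold A" "c \<in> A" "open S" "S \<subseteq> fst c"
  shows "open (snd c ` S)"
proof -
  have h: "open (snd c ` fst c)" "homeomorphism (fst c) (snd c ` fst c) (snd c) (chart_inv c)"
    using assms by (auto simp: dmanifold_def)
  have "snd c ` S = snd c ` fst c \<inter> chart_inv c -` S"
    using h(2) assms(4) by (auto simp: homeomorphism_def image_iff subset_iff)
  moreover have "open (snd c ` fst c \<inter> chart_inv c -` S)"
    using h assms(3) by (intro continuous_open_preimage) (auto simp: homeomorphism_def)
  ultimately show ?thesis by simp
qed

lemma chart_inv_chart': "dmanifold A \<Longrightarrow> c \<in> A \<Longrightarrow> g \<in> fst c \<Longrightarrow> chart_inv c (snd c g) = g"
  using chart_inv_chart[of A c g g] by (simp add: charts_at_def)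

lemma tangent_eqI_chart:
  assumes "v \<in> tangent_space A m" "w \<in> tangent_space A m" "c \<in> charts_at A m" "coord v c = coord w c"
  shows "v = w"
  using assms tangent_coord[of v A m c] tangent_coord[of w A m c] by (intro tangent_eqI[OF assms(1,2)]) metis

text \<open>The extension is the \<open>n\<close>-th power of \<open>f (t / n)\<close> for any
  \<open>n\<close> that makes the argument small. Two choices are compared through the common
  refinement by \<open>n * m\<close>, and powers of products split because \<open>f (s / n)\<close>
  and \<open>f (t / n)\<close> commute.\<close>

lemma (in group) local_hom_extends:
  fixes f :: "real \<Rightarrow> 'a"
  assumes car: "carrier G = UNIV" and \<delta>: "\<delta> > 0"
    and f: "\<And>s t. \<bar>s\<bar> < \<delta> \<Longrightarrow> \<bar>t\<bar> < \<delta> \<Longrightarrow> f (s + t) = f s \<otimes> f t"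
  obtains \<gamma> where "\<And>s t. \<gamma> (s + t) = \<gamma> s \<otimes> \<gamma> t" "\<And>t. \<bar>t\<bar> < \<delta> \<Longrightarrow> \<gamma> t = f t"
proof -
  have inG [simp]: "x \<in> carrier G" for x using car by simp
  have f0: "f 0 = \<one>" using f[of 0 0] \<delta> l_cancel_one'[of "f 0" "f 0"] by simp
  have pow: "f (real k * \<tau>) = f \<tau> [^] k" if "real k * \<bar>\<tau>\<bar> < \<delta>" for k \<tau>
    using that
  proof (induction k)
    case (Suc k)
    have 1: "real k * \<bar>\<tau>\<bar> + \<bar>\<tau>\<bar> < \<delta>" using Suc.prems by (simp add: algebra_simps)
    moreover have "0 \<le> real k * \<bar>\<tau>\<bar>" by simp
    ultimately have k: "real k * \<bar>\<tau>\<bar> < \<delta>" and "\<bar>\<tau>\<bar> < \<delta>" by linarith+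
    moreover from k have "\<bar>real k * \<tau>\<bar> < \<delta>" by (simp add: abs_mult)
    ultimately have "f (real k * \<tau> + \<tau>) = f \<tau> [^] k \<otimes> f \<tau>" using f Suc.IH by simp
    then show ?case by (simp add: algebra_simps)
  qed (simp add: f0)
  have indep: "f (t / real n) [^] n = f (t / real m) [^] m"
    if "n > 0" "m > 0" "\<bar>t\<bar> / real n < \<delta>" "\<bar>t\<bar> / real m < \<delta>" for t n m
  proof -
    let ?\<tau> = "t / (real n * real m)"
    have "f (t / real n) = f ?\<tau> [^] m" using pow[of m ?\<tau>] that by simp
    moreover have "f (t / real m) = f ?\<tau> [^] n" using pow[of n ?\<tau>] that by simp
    ultimately show ?thesis by (simp add: nat_pow_pow mult.commute)
  qed
  have big: "\<exists>n>0. \<bar>t\<bar> / real n < \<delta>" for t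
  proof -
    obtain n where "\<bar>t\<bar> / \<delta> < real n" using reals_Archimedean2 by blast
    moreover have "0 \<le> \<bar>t\<bar> / \<delta>" using \<delta> by simp
    ultimately have "n > 0" by (metis gr0I not_le of_nat_0)
    with \<open>\<bar>t\<bar> / \<delta> < real n\<close> show ?thesis using \<delta> by (intro exI[of _ n]) (simp add: field_simps)
  qed
  define N where "N t = (SOME n. n > 0 \<and> \<bar>t\<bar> / real n < \<delta>)" for t
  have N: "N t > 0" "\<bar>t\<bar> / real (N t) < \<delta>" for t
    using someI_ex[OF big[of t]] by (auto simp: N_def)
  define \<gamma> where "\<gamma> t = f (t / real (N t)) [^] N t" for t
  have \<gamma>: "\<gamma> t = f (t / real n) [^] n" if "n > 0" "\<bar>t\<bar> / real n < \<delta>" for t n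
    unfolding \<gamma>_def using that N by (intro indep)
  show ?thesis
  proof (rule that[of \<gamma>])
    fix t assume "\<bar>t\<bar> < \<delta>"
    then show "\<gamma> t = f t" using \<gamma>[of 1 t] by simp
  next
    fix s t
    obtain n where n: "n > 0" "\<bar>\<bar>s\<bar> + \<bar>t\<bar>\<bar> / real n < \<delta>" using big by blast
    have le: "\<bar>r\<bar> / real n < \<delta>" if "\<bar>r\<bar> \<le> \<bar>s\<bar> + \<bar>t\<bar>" for r
    proof -
      have "\<bar>r\<bar> / real n \<le> \<bar>\<bar>s\<bar> + \<bar>t\<bar>\<bar> / real n" using that by (intro divide_right_mono) auto
      with n show ?thesis by linarith
    qed
    have l: "\<bar>s\<bar> / real n < \<delta>" "\<bar>t\<bar> / real n < \<delta>" "\<bar>s + t\<bar> / real n < \<delta>" by (rule le; simp)+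
    have st: "f ((s + t) / real n) = f (s / real n) \<otimes> f (t / real n)"
      using f[of "s / real n" "t / real n"] l n by (simp add: add_divide_distrib)
    have comm: "f (s / real n) \<otimes> f (t / real n) = f (t / real n) \<otimes> f (s / real n)"
      using f[of "s / real n" "t / real n"] f[of "t / real n" "s / real n"] l n by (simp add: add.commute)
    show "\<gamma> (s + t) = \<gamma> s \<otimes> \<gamma> t"
      using \<gamma>[of n s] \<gamma>[of n t] \<gamma>[of n "s + t"] n l pow_mult_distrib[OF comm inG inG, of n] by (simp add: st)
  qed
qed

context
  fixes A :: "('g::{t2_space, second_countable_topology}, 'e::real_normed_vector) chart set" and G :: "'g monoid"
  assumes L: "lie_group A G"
begin

interpretation group G using L by (simp add: lie_group_def)

lemma lie_in [simp]: "x \<in> carrier G"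
  using L by (simp add: lie_group_def)

lemma lie_dmanifold: "dmanifold A"
  using L by (simp add: lie_group_def manifold_dmanifold)

lemma lie_fin_dim: "fin_dim TYPE('e)"
  using L by (simp add: lie_group_def manifold_def fin_dim_def)

lemma lie_mult_smooth: "smooth_map (prod_atlas A A) A (\<lambda>(g, h). g \<otimes>\<^bsub>G\<^esub> h)"
  using L by (simp add: lie_group_def)

definition "mult_rep c c' d = rep (prod_chart c c') d (\<lambda>(g, h). g \<otimes>\<^bsub>G\<^esub> h)"

definition "mult_dom c c' d = (\<lambda>(g, h). (snd c g, snd c' h)) ` {(g, h). g \<in> fst c \<and> h \<in> fst c' \<and> g \<otimes>\<^bsub>G\<^esub> h \<in> fst d}"

lemma mult_dom_eq: "mult_dom c c' d = snd (prod_chart c c') ` (fst (prod_chart c c') \<inter> (\<lambda>(g, h). g \<otimes>\<^bsub>G\<^esub> h) -` fst d)"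
  by (force simp: mult_dom_def)

lemma mult_domI: "g \<in> fst c \<Longrightarrow> h \<in> fst c' \<Longrightarrow> g \<otimes>\<^bsub>G\<^esub> h \<in> fst d \<Longrightarrow> (snd c g, snd c' h) \<in> mult_dom c c' d"
  by (force simp: mult_dom_def)

lemma mult_cont: "continuous_on UNIV (\<lambda>(g, h). g \<otimes>\<^bsub>G\<^esub> h)"
  using lie_mult_smooth by (simp add: smooth_map_def)

lemma open_in_atlas: "c \<in> A \<Longrightarrow> open (fst c)"
  using lie_dmanifold by (simp add: dmanifold_def)

lemma mult_rep_smooth:
  assumes "c \<in> A" "c' \<in> A" "d \<in> A"
  shows "smooth_on (mult_rep c c' d) (mult_dom c c' d)" "open (mult_dom c c' d)"
proof -
  have pc: "prod_chart c c' \<in> prod_atlas A A" using assms unfolding prod_atlas_def by blast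
  show "smooth_on (mult_rep c c' d) (mult_dom c c' d)"
    using lie_mult_smooth pc assms(3) unfolding smooth_map_def mult_rep_def rep_def mult_dom_eq by blast
  have "open (fst (prod_chart c c') \<inter> (\<lambda>(g, h). g \<otimes>\<^bsub>G\<^esub> h) -` fst d)"
    using assms by (intro open_Int open_vimage mult_cont) (simp_all add: open_Times open_in_atlas)
  then show "open (mult_dom c c' d)" unfolding mult_dom_eq
    by (intro chart_image_open[OF dmanifold_prod[OF lie_dmanifold lie_dmanifold] pc]) auto
qed

lemma mult_rep_apply:
  assumes "c \<in> A" "c' \<in> A" "g \<in> fst c" "h \<in> fst c'"
  shows "mult_rep c c' d (snd c g, snd c' h) = snd d (g \<otimes>\<^bsub>G\<^esub> h)"
proof -
  have pc: "prod_chart c c' \<in> prod_atlas A A" using assms unfolding prod_atlas_def by blast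
  have "chart_inv (prod_chart c c') (snd (prod_chart c c') (g, h)) = (g, h)"
    by (rule chart_inv_chart'[OF dmanifold_prod[OF lie_dmanifold lie_dmanifold] pc]) (use assms in simp)
  then show ?thesis by (simp add: mult_rep_def rep_def)
qed

text \<open>The curve solves the equation of the left-invariant field \<open>F\<close> in a chart.
  Both \<open>y (s + t)\<close> and the product of \<open>y s\<close> with \<open>y t\<close> solve
  it in \<open>t\<close> with the same value at 0, so they agree. Smoothness is stated for
  translated times because it is later used near every point of the line.\<close>

lemma local_one_param:
  assumes \<xi>: "\<xi> \<in> lie_algebra A G" and c: "c \<in> charts_at A \<one>\<^bsub>G\<^esub>"
  obtains \<delta> y where "\<delta> > 0" "y 0 = snd c \<one>\<^bsub>G\<^esub>" "\<And>t. \<bar>t\<bar> < \<delta> \<Longrightarrow> y t \<in> snd c ` fst c"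
    "\<And>I \<tau>. open I \<Longrightarrow> \<forall>t\<in>I. \<bar>t - \<tau>\<bar> < \<delta> \<Longrightarrow> smooth_on (\<lambda>t. y (t - \<tau>)) I"
    "(y has_vector_derivative coord \<xi> c) (at 0)"
    "\<And>s t. \<bar>s\<bar> < \<delta> \<Longrightarrow> \<bar>t\<bar> < \<delta> \<Longrightarrow> chart_inv c (y (s + t)) = chart_inv c (y s) \<otimes>\<^bsub>G\<^esub> chart_inv c (y t)"
proof -
  let ?\<phi> = "snd c" and ?\<psi> = "chart_inv c" and ?M = "mult_rep c c c" and ?W = "mult_dom c c c"
  let ?U = "fst c"
  define e0 where "e0 = ?\<phi> \<one>\<^bsub>G\<^esub>"
  define u where "u = coord \<xi> c"
  note dm = lie_dmanifold
  have cA: "c \<in> A" and oneU: "\<one>\<^bsub>G\<^esub> \<in> ?U" using c by (auto simp: charts_at_def)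
  note M = mult_rep_apply[OF cA cA, of _ _ c]
  note smW = mult_rep_smooth[OF cA cA cA]
  have \<psi>: "g \<in> ?U \<Longrightarrow> ?\<psi> (?\<phi> g) = g" for g by (rule chart_inv_chart'[OF dm cA])
  have openU: "open (?\<phi> ` ?U)" using dm cA by (simp add: dmanifold_def)
  have e0U: "e0 \<in> ?\<phi> ` ?U" using oneU by (simp add: e0_def)
  have W1: "(x, e0) \<in> ?W" if "x \<in> ?\<phi> ` ?U" for x
    using that oneU by (auto simp: e0_def intro!: mult_domI)
  have W2: "(e0, x) \<in> ?W" if "x \<in> ?\<phi> ` ?U" for x
    using that oneU by (auto simp: e0_def intro!: mult_domI)
  have M1: "?M (x, e0) = x" if "x \<in> ?\<phi> ` ?U" for x using that oneU M by (auto simp: e0_def)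
  have M2: "?M (e0, x) = x" if "x \<in> ?\<phi> ` ?U" for x using that oneU M by (auto simp: e0_def)
  have MW: "?M p \<in> ?\<phi> ` ?U" "?\<psi> (?M p) = ?\<psi> (fst p) \<otimes>\<^bsub>G\<^esub> ?\<psi> (snd p)" "fst p \<in> ?\<phi> ` ?U" "snd p \<in> ?\<phi> ` ?U" if "p \<in> ?W" for p
    using that M \<psi> by (auto simp: mult_dom_def)
  have DM: "(?M has_derivative frechet_derivative ?M (at p)) (at p)" if "p \<in> ?W" for p
    using smooth_on_differentiable[OF smW(1) that] by (simp add: frechet_derivative_works)
  define F where "F x = frechet_derivative ?M (at (x, e0)) (0, u)" for x
  have fd2: "fin_dim TYPE('e \<times> 'e)" by (rule fin_dim_prod[OF lie_fin_dim lie_fin_dim])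
  have sid: "smooth_on (\<lambda>x. x) S" for S :: "'e set"
    unfolding smooth_on_def by (intro allI Ck_on_bounded_linear bounded_linear_ident)
  have Fsm: "smooth_on F (?\<phi> ` ?U)"
    unfolding F_def
    by (rule smooth_on_compose[OF fd2 openU _ smooth_on_directional[OF smW(1)] smooth_on_Pair_const(1)[OF openU sid]])
      (use W1 in auto)
  have F_e0: "F e0 = u"
  proof -
    have "((\<lambda>x. ?M (e0, x)) has_derivative (\<lambda>h. frechet_derivative ?M (at (e0, e0)) (0, h))) (at e0)"
      by (rule has_derivative_compose[OF has_derivative_Pair[OF has_derivative_const has_derivative_ident] DM[OF W1[OF e0U]]])
    moreover have "((\<lambda>x. ?M (e0, x)) has_derivative (\<lambda>h. h)) (at e0)"
      by (rule has_derivative_transform_within_open[OF has_derivative_ident openU e0U]) (simp add: M2)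
    ultimately have "(\<lambda>h. frechet_derivative ?M (at (e0, e0)) (0, h)) = (\<lambda>h. h)" by (rule has_derivative_unique)
    then show ?thesis unfolding F_def by (rule fun_cong)
  qed
  \<comment> \<open>Left invariance of \<open>F\<close> in coordinates, obtained by differentiating
    the associative law in the last factor at the unit.\<close>
  have assoc: "frechet_derivative ?M (at p) (0, F (snd p)) = F (?M p)" if p: "p \<in> ?W" for p
  proof -
    obtain x z where xz: "p = (x, z)" by (cases p)
    have zU: "z \<in> ?\<phi> ` ?U" and MU: "?M p \<in> ?\<phi> ` ?U" using MW[OF p] xz by auto
    define X where "X = {w. w \<in> ?\<phi> ` ?U \<and> (z, w) \<in> ?W}"
    have "X = ?\<phi> ` ?U \<inter> (\<lambda>w. (z, w)) -` ?W" by (auto simp: X_def)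
    moreover have "open ((\<lambda>w. (z, w)) -` ?W)" using smW(2) by (intro open_vimage continuous_intros) auto
    ultimately have oX: "open X" using openU by auto
    have e0X: "e0 \<in> X" using e0U W1[OF zU] by (simp add: X_def)
    have eq: "?M (?M p, w) = ?M (x, ?M (z, w))" if w: "w \<in> X" for w
    proof -
      have pw: "(z, w) \<in> ?W" and wU: "w \<in> ?\<phi> ` ?U" using w by (auto simp: X_def)
      have Mab: "?M (a, b) = ?\<phi> (?\<psi> a \<otimes>\<^bsub>G\<^esub> ?\<psi> b)" if "a \<in> ?\<phi> ` ?U" "b \<in> ?\<phi> ` ?U" for a b
        using that M \<psi> by auto
      have xU: "x \<in> ?\<phi> ` ?U" using MW(3)[OF p] xz by simp
      have "?M (?M p, w) = ?\<phi> ((?\<psi> x \<otimes>\<^bsub>G\<^esub> ?\<psi> z) \<otimes>\<^bsub>G\<^esub> ?\<psi> w)"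
        using Mab[OF MU wU] MW(2)[OF p] xz by simp
      moreover have "?M (x, ?M (z, w)) = ?\<phi> (?\<psi> x \<otimes>\<^bsub>G\<^esub> (?\<psi> z \<otimes>\<^bsub>G\<^esub> ?\<psi> w))"
        using Mab[OF xU MW(1)[OF pw]] MW(2)[OF pw] by simp
      ultimately show ?thesis by (simp add: m_assoc)
    qed
    have 1: "((\<lambda>w. ?M (?M p, w)) has_derivative (\<lambda>h. frechet_derivative ?M (at (?M p, e0)) (0, h))) (at e0)"
      by (rule has_derivative_compose[OF has_derivative_Pair[OF has_derivative_const has_derivative_ident] DM[OF W1[OF MU]]])
    have 2: "((\<lambda>w. ?M (z, w)) has_derivative (\<lambda>h. frechet_derivative ?M (at (z, e0)) (0, h))) (at e0)"
      by (rule has_derivative_compose[OF has_derivative_Pair[OF has_derivative_const has_derivative_ident] DM[OF W1[OF zU]]])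
    have DMp: "(?M has_derivative frechet_derivative ?M (at p)) (at (x, ?M (z, e0)))"
      using DM[OF p] xz M1[OF zU] by simp
    have "((\<lambda>w. ?M (x, ?M (z, w))) has_derivative (\<lambda>h. frechet_derivative ?M (at p) (0, frechet_derivative ?M (at (z, e0)) (0, h)))) (at e0)"
      by (rule has_derivative_compose[OF has_derivative_Pair[OF has_derivative_const 2] DMp])
    then have "((\<lambda>w. ?M (?M p, w)) has_derivative (\<lambda>h. frechet_derivative ?M (at p) (0, frechet_derivative ?M (at (z, e0)) (0, h)))) (at e0)"
      by (rule has_derivative_transform_within_open[OF _ oX e0X]) (simp add: eq)
    then have "(\<lambda>h. frechet_derivative ?M (at p) (0, frechet_derivative ?M (at (z, e0)) (0, h))) =
        (\<lambda>h. frechet_derivative ?M (at (?M p, e0)) (0, h))"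
      using 1 by (rule has_derivative_unique)
    from fun_cong[OF this, of u] show ?thesis using xz by (simp add: F_def)
  qed
  obtain \<rho> K where \<rho>: "\<rho> > 0" and K: "K > 0" and ball: "ball e0 \<rho> \<subseteq> ?\<phi> ` ?U"
    and lip: "\<And>x y. x \<in> ball e0 \<rho> \<Longrightarrow> y \<in> ball e0 \<rho> \<Longrightarrow> norm (F x - F y) \<le> K * norm (x - y)"
    by (rule smooth_on_locally_lipschitz[OF lie_fin_dim openU e0U Fsm], rule that)
  obtain \<epsilon> y where \<epsilon>: "\<epsilon> > 0" and y0: "y 0 = e0" and yb: "\<And>t. t \<in> {-\<epsilon><..<\<epsilon>} \<Longrightarrow> y t \<in> ball e0 \<rho>"
    and y: "\<And>t. t \<in> {-\<epsilon><..<\<epsilon>} \<Longrightarrow> (y has_vector_derivative F (y t)) (at t)"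
    by (rule picard_fin_dim[OF lie_fin_dim \<rho> less_imp_le[OF K] lip], assumption, assumption, rule that)
  \<comment> \<open>The product has to stay in the ball where \<open>F\<close> is Lipschitz, as the
    uniqueness argument compares both curves there.\<close>
  define O' where "O' = {p \<in> ?W. ?M p \<in> ball e0 \<rho>}"
  have "continuous_on ?W ?M"
    using DM by (intro continuous_at_imp_continuous_on) (auto intro: has_derivative_continuous)
  then have "open (?W \<inter> ?M -` ball e0 \<rho>)" using smW(2) by (intro continuous_open_preimage) auto
  then have oO: "open O'" by (simp add: O'_def Int_def vimage_def)
  have eO: "(e0, e0) \<in> O'" using W1[OF e0U] M1[OF e0U] \<rho> by (simp add: O'_def)
  obtain N1 N2 where N: "open N1" "open N2" "e0 \<in> N1" "e0 \<in> N2" "N1 \<times> N2 \<subseteq> O'"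
    using oO eO by (auto elim!: open_prod_elim)
  have yc: "isCont y 0" using y[of 0] \<epsilon> has_vector_derivative_continuous by auto
  have "\<forall>\<^sub>F t in nhds 0. y t \<in> N1 \<inter> N2"
    using yc N y0 unfolding isCont_def tendsto_at_iff_tendsto_nhds
    by (intro topological_tendstoD) auto
  then obtain \<delta>1 where \<delta>1: "\<delta>1 > 0" "\<And>t. \<bar>t\<bar> < \<delta>1 \<Longrightarrow> y t \<in> N1 \<inter> N2"
    unfolding eventually_nhds_metric by (auto simp: dist_real_def)
  \<comment> \<open>The bound \<open>\<epsilon> / 2\<close> keeps \<open>s + t\<close> in the
    interval of the solution, \<open>\<delta>1\<close> keeps products in the ball, and
    \<open>1 / (2 * K)\<close> is the smallness required for uniqueness.\<close>
  define \<delta> where "\<delta> = min \<delta>1 (min (\<epsilon> / 2) (1 / (2 * K)))"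
  have "\<delta> \<le> 1 / (2 * K)" by (simp add: \<delta>_def)
  from mult_left_mono[OF this less_imp_le[OF K]] have "K * \<delta> \<le> 1 / 2" using K by simp
  then have \<delta>: "\<delta> > 0" "\<delta> \<le> \<delta>1" "\<delta> \<le> \<epsilon> / 2" "K * \<delta> \<le> 1 / 2"
    using \<delta>1(1) \<epsilon> K by (simp_all add: \<delta>_def)
  have yst: "y (s + t) = ?M (y s, y t)" "(y s, y t) \<in> ?W" if s: "\<bar>s\<bar> < \<delta>" and t: "\<bar>t\<bar> < \<delta>" for s t
  proof -
    have O: "(y s, y t) \<in> O'" if "\<bar>t\<bar> < \<delta>" for t using \<delta>1(2)[of s] \<delta>1(2)[of t] s that \<delta> N(5) by auto
    then show "(y s, y t) \<in> ?W" using t by (simp add: O'_def)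
    have ysU: "y s \<in> ?\<phi> ` ?U" using MW(3) O[OF t] by (force simp: O'_def)
    show "y (s + t) = ?M (y s, y t)"
    proof (rule ode_unique[where D = "ball e0 \<rho>" and F = F and K = K and \<delta> = \<delta> and y = "\<lambda>t. y (s + t)" and z = "\<lambda>t. ?M (y s, y t)"])
      fix t :: real assume t: "\<bar>t\<bar> < \<delta>"
      have st: "s + t \<in> {-\<epsilon><..<\<epsilon>}" and t\<epsilon>: "t \<in> {-\<epsilon><..<\<epsilon>}" using s t \<delta>(3) \<epsilon> by (auto simp: abs_less_iff)
      show "y (s + t) \<in> ball e0 \<rho>" by (rule yb[OF st])
      have "((\<lambda>t. s + t) has_vector_derivative 1) (at t)"
        by (auto intro!: derivative_eq_intros)
      from vector_diff_chain_at[OF this y[OF st]]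
      show "((\<lambda>t. y (s + t)) has_vector_derivative F (y (s + t))) (at t)" by (simp add: o_def)
      have p: "(y s, y t) \<in> ?W" and "?M (y s, y t) \<in> ball e0 \<rho>" using O[OF t] by (auto simp: O'_def)
      then show "?M (y s, y t) \<in> ball e0 \<rho>" by simp
      have yd: "(y has_derivative (\<lambda>h. h *\<^sub>R F (y t))) (at t)" using y[OF t\<epsilon>] by (simp add: has_vector_derivative_def)
      have "((\<lambda>t. ?M (y s, y t)) has_derivative (\<lambda>h. frechet_derivative ?M (at (y s, y t)) (0, h *\<^sub>R F (y t)))) (at t)"
        by (rule has_derivative_compose[OF has_derivative_Pair[OF has_derivative_const yd] DM[OF p]])
      moreover have "frechet_derivative ?M (at (y s, y t)) (0, h *\<^sub>R F (y t)) = h *\<^sub>R F (?M (y s, y t))" for h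
        using assoc[OF p] linear_scale[OF has_derivative_linear[OF DM[OF p]], of h "(0, F (y t))"] by simp
      ultimately show "((\<lambda>t. ?M (y s, y t)) has_vector_derivative F (?M (y s, y t))) (at t)"
        by (simp add: has_vector_derivative_def)
    qed (use lip K \<delta> t ysU M1 y0 in auto)
  qed
  show ?thesis
  proof (rule that[of \<delta> y])
    show "\<delta> > 0" by (rule \<delta>(1))
    show "y 0 = ?\<phi> \<one>\<^bsub>G\<^esub>" by (simp add: y0 e0_def)
    have tU: "y t \<in> ?\<phi> ` ?U" "t \<in> {-\<epsilon><..<\<epsilon>}" if "\<bar>t\<bar> < \<delta>" for t
    proof -
      show "t \<in> {-\<epsilon><..<\<epsilon>}" using that \<delta>(3) \<epsilon> by auto
      then show "y t \<in> ?\<phi> ` ?U" using yb ball by blast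
    qed
    then show "y t \<in> ?\<phi> ` ?U" if "\<bar>t\<bar> < \<delta>" for t using that by blast
    show "(y has_vector_derivative coord \<xi> c) (at 0)" using y[of 0] \<epsilon> y0 F_e0 by (simp add: u_def)
    show "?\<psi> (y (s + t)) = ?\<psi> (y s) \<otimes>\<^bsub>G\<^esub> ?\<psi> (y t)" if "\<bar>s\<bar> < \<delta>" "\<bar>t\<bar> < \<delta>" for s t
      using yst[OF that] MW(2) by simp
    show "smooth_on (\<lambda>t. y (t - \<tau>)) I" if I: "open I" "\<forall>t\<in>I. \<bar>t - \<tau>\<bar> < \<delta>" for I \<tau>
    proof (rule smooth_on_ode_solution[OF lie_fin_dim I(1) Fsm])
      fix t assume t: "t \<in> I"
      show "y (t - \<tau>) \<in> ?\<phi> ` ?U" using tU I(2) t by blast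
      have "((\<lambda>t. t - \<tau>) has_vector_derivative 1) (at t)"
        by (auto intro!: derivative_eq_intros)
      from vector_diff_chain_at[OF this y[OF tU(2)[OF bspec[OF I(2) t]]]]
      show "((\<lambda>t. y (t - \<tau>)) has_vector_derivative F (y (t - \<tau>))) (at t)" by (simp add: o_def)
    qed
  qed
qed

text \<open>The local homomorphism extends algebraically. Near any \<tau> the extension is the local
  curve, translated in time, multiplied from the left by its value at \<tau>, so continuity and
  smoothness carry over from the local solution.\<close>

lemma one_parameter_subgroup_exists:
  assumes \<xi>: "\<xi> \<in> lie_algebra A G"
  shows "\<exists>\<gamma>. smooth_map real_line A \<gamma> \<and> (\<forall>s t. \<gamma> (s + t) = \<gamma> s \<otimes>\<^bsub>G\<^esub> \<gamma> t) \<and> velocity A \<gamma> 0 = \<xi>"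
proof -
  note dm = lie_dmanifold
  obtain c where c: "c \<in> charts_at A \<one>\<^bsub>G\<^esub>" using chart_at_ex[OF dm] by blast
  then have cA: "c \<in> A" and oneU: "\<one>\<^bsub>G\<^esub> \<in> fst c" by (auto simp: charts_at_def)
  obtain \<delta> y where \<delta>: "\<delta> > 0" and y0: "y 0 = snd c \<one>\<^bsub>G\<^esub>" and yU: "\<And>t. \<bar>t\<bar> < \<delta> \<Longrightarrow> y t \<in> snd c ` fst c"
    and ysm: "\<And>I \<tau>. open I \<Longrightarrow> \<forall>t\<in>I. \<bar>t - \<tau>\<bar> < \<delta> \<Longrightarrow> smooth_on (\<lambda>t. y (t - \<tau>)) I"
    and y': "(y has_vector_derivative coord \<xi> c) (at 0)"
    and hom: "\<And>s t. \<bar>s\<bar> < \<delta> \<Longrightarrow> \<bar>t\<bar> < \<delta> \<Longrightarrow> chart_inv c (y (s + t)) = chart_inv c (y s) \<otimes>\<^bsub>G\<^esub> chart_inv c (y t)"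
    by (rule local_one_param[OF \<xi> c], rule that)
  have car: "carrier G = UNIV" using L by (simp add: lie_group_def)
  obtain \<gamma> where \<gamma>: "\<And>s t. \<gamma> (s + t) = \<gamma> s \<otimes>\<^bsub>G\<^esub> \<gamma> t" and \<gamma>f: "\<And>t. \<bar>t\<bar> < \<delta> \<Longrightarrow> \<gamma> t = chart_inv c (y t)"
    by (rule local_hom_extends[OF car \<delta>, of "\<lambda>t. chart_inv c (y t)"], rule hom, assumption, assumption, rule that)
  have fc: "chart_inv c (y t) \<in> fst c" "snd c (chart_inv c (y t)) = y t" if "\<bar>t\<bar> < \<delta>" for t
    using yU[OF that] chart_inv_chart'[OF dm cA] by auto
  have loc: "\<gamma> t = \<gamma> \<tau> \<otimes>\<^bsub>G\<^esub> chart_inv c (y (t - \<tau>))" if "\<bar>t - \<tau>\<bar> < \<delta>" for t \<tau>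
    using \<gamma>[of \<tau> "t - \<tau>"] \<gamma>f[OF that] by simp
  have cont: "isCont \<gamma> \<tau>" for \<tau>
  proof -
    let ?I = "{\<tau> - \<delta><..<\<tau> + \<delta>}"
    have I: "\<bar>t - \<tau>\<bar> < \<delta>" if "t \<in> ?I" for t using that by auto
    have "Ck_on 0 (\<lambda>t. y (t - \<tau>)) ?I" using ysm[of ?I \<tau>] I unfolding smooth_on_def by auto
    then have "continuous_on ?I (\<lambda>t. y (t - \<tau>))" by simp
    moreover have "continuous_on (snd c ` fst c) (chart_inv c)"
      using dm cA unfolding dmanifold_def homeomorphism_def by blast
    moreover have "(\<lambda>t. y (t - \<tau>)) ` ?I \<subseteq> snd c ` fst c" using yU I by blast
    ultimately have "continuous_on ?I (\<lambda>t. chart_inv c (y (t - \<tau>)))"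
      by (metis continuous_on_compose2)
    then have "continuous_on ?I (\<lambda>t. (\<gamma> \<tau>, chart_inv c (y (t - \<tau>))))"
      by (intro continuous_on_Pair continuous_on_const)
    from continuous_on_compose2[OF mult_cont this]
    have "continuous_on ?I (\<lambda>t. \<gamma> \<tau> \<otimes>\<^bsub>G\<^esub> chart_inv c (y (t - \<tau>)))" by simp
    then have "continuous_on ?I \<gamma>" by (rule continuous_on_eq) (rule loc[OF I, symmetric])
    then show ?thesis using \<delta> by (simp add: continuous_on_eq_continuous_at)
  qed
  then have contU: "continuous_on UNIV \<gamma>" by (simp add: continuous_at_imp_continuous_on)
  have sm: "smooth_on (snd d \<circ> \<gamma>) (\<gamma> -` fst d)" if d: "d \<in> A" for d
    unfolding smooth_on_def
  proof (rule allI, rule Ck_on_locally)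
    fix k \<tau> assume \<tau>: "\<tau> \<in> \<gamma> -` fst d"
    obtain c' where c': "c' \<in> A" "\<gamma> \<tau> \<in> fst c'" using chart_at_ex[OF dm, of "\<gamma> \<tau>"] by (auto simp: charts_at_def)
    let ?T = "{\<tau> - \<delta><..<\<tau> + \<delta>} \<inter> \<gamma> -` fst d"
    have oT: "open ?T" using open_in_atlas[OF d] contU by (intro open_Int open_vimage) auto
    have I: "\<bar>t - \<tau>\<bar> < \<delta>" if "t \<in> ?T" for t using that by auto
    have dom: "(snd c' (\<gamma> \<tau>), y (t - \<tau>)) \<in> mult_dom c' c d"
      and app: "mult_rep c' c d (snd c' (\<gamma> \<tau>), y (t - \<tau>)) = snd d (\<gamma> t)" if t: "t \<in> ?T" for t
    proof -
      note f = fc[OF I[OF t]]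
      show "(snd c' (\<gamma> \<tau>), y (t - \<tau>)) \<in> mult_dom c' c d"
        using mult_domI[OF c'(2) f(1), of d] t f(2) unfolding loc[OF I[OF t], symmetric] by simp
      show "mult_rep c' c d (snd c' (\<gamma> \<tau>), y (t - \<tau>)) = snd d (\<gamma> t)"
        using mult_rep_apply[OF c'(1) cA c'(2) f(1), of d] f(2) unfolding loc[OF I[OF t], symmetric] by simp
    qed
    have "smooth_on (\<lambda>t. mult_rep c' c d (snd c' (\<gamma> \<tau>), y (t - \<tau>))) ?T"
      by (rule smooth_on_compose[OF fin_dim_prod[OF lie_fin_dim lie_fin_dim] oT _ mult_rep_smooth(1)[OF c'(1) cA d]
            smooth_on_Pair_const(2)[OF oT ysm[OF oT ballI[OF I]]]]) (use dom in auto)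
    then have "smooth_on (snd d \<circ> \<gamma>) ?T" by (rule smooth_on_cong[OF oT, rotated]) (simp add: app)
    then show "\<exists>T. open T \<and> \<tau> \<in> T \<and> Ck_on k (snd d \<circ> \<gamma>) T"
      using oT \<tau> \<delta> by (intro exI[of _ ?T]) (simp add: smooth_on_def)
  qed
  have smooth: "smooth_map real_line A \<gamma>"
    unfolding smooth_map_def real_line_def using contU sm by (simp add: o_assoc[symmetric])
  have \<gamma>0: "\<gamma> 0 = \<one>\<^bsub>G\<^esub>" using \<gamma>f[of 0] \<delta> y0 chart_inv_chart'[OF dm cA oneU] by simp
  note md = smooth_map_mdiff[OF smooth, of 0]
  have "velocity A \<gamma> 0 = \<xi>"
  proof (rule tangent_eqI_chart[OF _ _ c])
    show "velocity A \<gamma> 0 \<in> tangent_space A \<one>\<^bsub>G\<^esub>"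
      using differential_in_tangent[OF dmanifold_line dm md] velocity_differential[OF md] \<gamma>0 by simp
    show "\<xi> \<in> tangent_space A \<one>\<^bsub>G\<^esub>" using \<xi> by (simp add: lie_algebra_def)
    have "((snd c \<circ> \<gamma>) has_vector_derivative coord \<xi> c) (at 0)"
    proof (rule has_vector_derivative_transform_within_open[OF y', of "{-\<delta><..<\<delta>}"])
      fix t assume "t \<in> {-\<delta><..<\<delta>}"
      then have "\<bar>t\<bar> < \<delta>" by auto
      then show "y t = (snd c \<circ> \<gamma>) t" using \<gamma>f fc by simp
    qed (use \<delta> in auto)
    then show "coord (velocity A \<gamma> 0) c = coord \<xi> c"
      using c \<gamma>0 by (simp add: velocity_def vector_derivative_at)
  qed
  with smooth \<gamma> show ?thesis by blast
qed

end


section \<open>Maurer-Cartan forms and moment maps\<close>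

context
  fixes A :: "('g::{t2_space, second_countable_topology}, 'e::real_normed_vector) chart set" and G :: "'g monoid"
  assumes L: "lie_group A G"
begin

interpretation group G using L by (simp add: lie_group_def)

lemmas in_G [simp] = lie_in[OF L]
lemmas dm = lie_dmanifold[OF L]

lemma mdiff_mult: "mdiff (prod_atlas A A) A (\<lambda>(x, y). x \<otimes>\<^bsub>G\<^esub> y) p"
  by (rule smooth_map_mdiff[OF lie_mult_smooth[OF L]])

lemma mdiff_product:
  assumes "dmanifold C" "mdiff C A F m" "mdiff C A H m"
  shows "mdiff C A (\<lambda>x. F x \<otimes>\<^bsub>G\<^esub> H x) m"
  using mdiff_compose[OF assms(1) dmanifold_prod[OF dm dm] mdiff_Pair[OF dm dm assms] mdiff_mult]
  by (simp add: o_def)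

lemma mdiff_ident: "mdiff A A (\<lambda>x. x) m"
  using mdiff_id[OF dm, of m] by (simp add: id_def)

lemma mdiff_left: "mdiff A A (\<lambda>h. g \<otimes>\<^bsub>G\<^esub> h) m"
  by (rule mdiff_product[OF dm mdiff_const mdiff_ident])

lemma mdiff_right: "mdiff A A (\<lambda>h. h \<otimes>\<^bsub>G\<^esub> g) m"
  by (rule mdiff_product[OF dm mdiff_ident mdiff_const])

lemma mdiff_conj: "mdiff A A (\<lambda>h. g \<otimes>\<^bsub>G\<^esub> h \<otimes>\<^bsub>G\<^esub> k) m"
  by (rule mdiff_product[OF dm mdiff_left mdiff_const])

lemma mdiff_inv: "mdiff A A (\<lambda>h. inv\<^bsub>G\<^esub> h) m"
  using L by (intro smooth_map_mdiff) (simp add: lie_group_def)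

lemma differential_AA:
  assumes "mdiff A A F m" "mdiff A A H (F m)"
  shows "differential A A H (F m) (differential A A F m v) = differential A A (\<lambda>x. H (F x)) m v"
  using differential_compose[OF dm dm assms] by (simp add: o_def)

lemma differential_ident: "v \<in> tangent_space A m \<Longrightarrow> differential A A (\<lambda>x. x) m v = v"
  using differential_id[OF dm] by (simp add: id_def)

lemma theta_R_in: "theta_R A G g v \<in> lie_algebra A G"
  using differential_in_tangent[OF dm dm mdiff_right, of "inv\<^bsub>G\<^esub> g" g v]
  by (simp add: theta_R_def lie_algebra_def)

lemma theta_L_in: "theta_L A G g v \<in> lie_algebra A G"
  using differential_in_tangent[OF dm dm mdiff_left, of "inv\<^bsub>G\<^esub> g" g v]
  by (simp add: theta_L_def lie_algebra_def)

lemma Ad_in: "Ad A G g v \<in> lie_algebra A G"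
  using differential_in_tangent[OF dm dm mdiff_conj, of g "inv\<^bsub>G\<^esub> g" "\<one>\<^bsub>G\<^esub>" v]
  by (simp add: Ad_def lie_algebra_def)

lemma Ad_linear: "Ad A G g (r *\<^sub>R v + s *\<^sub>R w) = r *\<^sub>R Ad A G g v + s *\<^sub>R Ad A G g w"
  unfolding Ad_def by (rule differential_linear[OF dm mdiff_conj])

lemma theta_R_linear: "theta_R A G g (r *\<^sub>R v + s *\<^sub>R w) = r *\<^sub>R theta_R A G g v + s *\<^sub>R theta_R A G g w"
  unfolding theta_R_def by (rule differential_linear[OF dm mdiff_right])

lemma Ad_theta_L: "Ad A G g (theta_L A G g v) = theta_R A G g v"
  using differential_AA[OF mdiff_left[of "inv\<^bsub>G\<^esub> g" g] mdiff_conj[of g "inv\<^bsub>G\<^esub> g"], of v]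
  by (simp add: Ad_def theta_L_def theta_R_def m_assoc[symmetric])

lemma Ad_one: "v \<in> lie_algebra A G \<Longrightarrow> Ad A G \<one>\<^bsub>G\<^esub> v = v"
  by (simp add: Ad_def lie_algebra_def differential_ident)

text \<open>After right translation back to the unit the second factor cancels in the first summand
  and the first factor conjugates in the second. This cocycle rule is the origin of
  \<open>fusion_cov\<close>.\<close>

lemma theta_R_product:
  assumes C: "dmanifold C" and F: "mdiff C A F m" and H: "mdiff C A H m"
  shows "theta_R A G (F m \<otimes>\<^bsub>G\<^esub> H m) (differential C A (\<lambda>x. F x \<otimes>\<^bsub>G\<^esub> H x) m v) =
    theta_R A G (F m) (differential C A F m v) + Ad A G (F m) (theta_R A G (H m) (differential C A H m v))"
proof -
  let ?f = "F m" and ?h = "H m"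
  have "differential C A (\<lambda>x. F x \<otimes>\<^bsub>G\<^esub> H x) m v =
      differential A A (\<lambda>x. x \<otimes>\<^bsub>G\<^esub> ?h) ?f (differential C A F m v) +
      differential A A (\<lambda>y. ?f \<otimes>\<^bsub>G\<^esub> y) ?h (differential C A H m v)"
    by (rule differential_binary[OF dm dm C dm F H mdiff_mult])
  moreover have "theta_R A G (?f \<otimes>\<^bsub>G\<^esub> ?h) (w + w') = theta_R A G (?f \<otimes>\<^bsub>G\<^esub> ?h) w + theta_R A G (?f \<otimes>\<^bsub>G\<^esub> ?h) w'" for w w'
    using theta_R_linear[of _ 1 w 1 w'] by simp
  moreover have "theta_R A G (?f \<otimes>\<^bsub>G\<^esub> ?h) (differential A A (\<lambda>x. x \<otimes>\<^bsub>G\<^esub> ?h) ?f w) = theta_R A G ?f w" for w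
  proof -
    have "x \<otimes>\<^bsub>G\<^esub> ?h \<otimes>\<^bsub>G\<^esub> inv\<^bsub>G\<^esub> (?f \<otimes>\<^bsub>G\<^esub> ?h) = x \<otimes>\<^bsub>G\<^esub> inv\<^bsub>G\<^esub> ?f" for x
      by (simp add: inv_mult_group m_assoc inv_solve_left') (simp add: m_assoc[symmetric])
    then show ?thesis
      using differential_AA[OF mdiff_right[of ?h ?f] mdiff_right[of "inv\<^bsub>G\<^esub> (?f \<otimes>\<^bsub>G\<^esub> ?h)"], of w]
      by (simp add: theta_R_def)
  qed
  moreover have "theta_R A G (?f \<otimes>\<^bsub>G\<^esub> ?h) (differential A A (\<lambda>y. ?f \<otimes>\<^bsub>G\<^esub> y) ?h w) = Ad A G ?f (theta_R A G ?h w)" for w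
  proof -
    have "?f \<otimes>\<^bsub>G\<^esub> y \<otimes>\<^bsub>G\<^esub> inv\<^bsub>G\<^esub> (?f \<otimes>\<^bsub>G\<^esub> ?h) = ?f \<otimes>\<^bsub>G\<^esub> (y \<otimes>\<^bsub>G\<^esub> inv\<^bsub>G\<^esub> ?h) \<otimes>\<^bsub>G\<^esub> inv\<^bsub>G\<^esub> ?f" for y
      by (simp add: inv_mult_group m_assoc)
    then show ?thesis
      using differential_AA[OF mdiff_left[of ?f ?h] mdiff_right[of "inv\<^bsub>G\<^esub> (?f \<otimes>\<^bsub>G\<^esub> ?h)"], of w]
        differential_AA[OF mdiff_right[of "inv\<^bsub>G\<^esub> ?h" ?h] mdiff_conj[of ?f "inv\<^bsub>G\<^esub> ?f"], of w]
      by (simp add: theta_R_def Ad_def)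
  qed
  ultimately show ?thesis by simp
qed

lemma theta_R_one: "v \<in> lie_algebra A G \<Longrightarrow> theta_R A G \<one>\<^bsub>G\<^esub> v = v"
  by (simp add: theta_R_def lie_algebra_def differential_ident)

text \<open>The product rule is applied to the constant map given by an element times its
  inverse.\<close>

lemma theta_R_inv_one:
  assumes v: "v \<in> lie_algebra A G"
  shows "theta_R A G \<one>\<^bsub>G\<^esub> (differential A A (\<lambda>h. inv\<^bsub>G\<^esub> h) \<one>\<^bsub>G\<^esub> v) = - v"
proof -
  have "0 = v + theta_R A G \<one>\<^bsub>G\<^esub> (differential A A (\<lambda>h. inv\<^bsub>G\<^esub> h) \<one>\<^bsub>G\<^esub> v)"
    using theta_R_product[OF dm mdiff_ident mdiff_inv, of "\<one>\<^bsub>G\<^esub>" v] v theta_R_linear[of "\<one>\<^bsub>G\<^esub>" 0 0 0 0]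
    by (simp add: differential_const differential_ident[of v] lie_algebra_def[symmetric] theta_R_one Ad_one theta_R_in)
  then show ?thesis by (simp add: eq_neg_iff_add_eq_0 add.commute)
qed

lemma theta_R_conj:
  assumes v: "v \<in> lie_algebra A G"
  shows "theta_R A G g (differential A A (\<lambda>k. k \<otimes>\<^bsub>G\<^esub> g \<otimes>\<^bsub>G\<^esub> inv\<^bsub>G\<^esub> k) \<one>\<^bsub>G\<^esub> v) = v - Ad A G g v"
proof -
  have "theta_R A G g (differential A A (\<lambda>k. k \<otimes>\<^bsub>G\<^esub> g) \<one>\<^bsub>G\<^esub> v) = v"
    using differential_AA[OF mdiff_right[of g "\<one>\<^bsub>G\<^esub>"] mdiff_right[of "inv\<^bsub>G\<^esub> g"], of v] v
    by (simp add: theta_R_def m_assoc lie_algebra_def differential_ident)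
  moreover have "Ad A G g (- v) = - Ad A G g v" using Ad_linear[of g "-1" v 0 0] by simp
  ultimately show ?thesis
    using theta_R_product[OF dm mdiff_right[of g "\<one>\<^bsub>G\<^esub>"] mdiff_inv, of v] theta_R_inv_one[OF v] by simp
qed

section \<open>The product group and the inclusions of its factors\<close>

abbreviation (input) "PA \<equiv> prod_atlas A A"
abbreviation (input) "GG \<equiv> G \<times>\<times> G"

lemma PA: "dmanifold PA" by (rule dmanifold_prod[OF dm dm])
lemma one_in_lie: "subspace (lie_algebra A G)" unfolding lie_algebra_def by (rule subspace_tangent_space[OF dm])

lemma mdiff_emb: "mdiff A PA (\<lambda>g. (g, k)) m" "mdiff A PA (\<lambda>g. (k, g)) m"
  by (rule mdiff_Pair[OF dm dm dm mdiff_ident mdiff_const], rule mdiff_Pair[OF dm dm dm mdiff_const mdiff_ident])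

lemma fst_snd_incl:
  assumes v: "v \<in> lie_algebra A G"
  shows "differential PA A fst (\<one>\<^bsub>G\<^esub>, \<one>\<^bsub>G\<^esub>) (incl1 A G v) = v"
    "differential PA A snd (\<one>\<^bsub>G\<^esub>, \<one>\<^bsub>G\<^esub>) (incl1 A G v) = 0"
    "differential PA A fst (\<one>\<^bsub>G\<^esub>, \<one>\<^bsub>G\<^esub>) (incl2 A G v) = 0"
    "differential PA A snd (\<one>\<^bsub>G\<^esub>, \<one>\<^bsub>G\<^esub>) (incl2 A G v) = v"
  using v differential_compose[OF dm PA mdiff_emb(1) mdiff_fst[OF dm dm], of "\<one>\<^bsub>G\<^esub>" "\<one>\<^bsub>G\<^esub>" v]
    differential_compose[OF dm PA mdiff_emb(1) mdiff_snd[OF dm dm], of "\<one>\<^bsub>G\<^esub>" "\<one>\<^bsub>G\<^esub>" v]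
    differential_compose[OF dm PA mdiff_emb(2) mdiff_fst[OF dm dm], of "\<one>\<^bsub>G\<^esub>" "\<one>\<^bsub>G\<^esub>" v]
    differential_compose[OF dm PA mdiff_emb(2) mdiff_snd[OF dm dm], of "\<one>\<^bsub>G\<^esub>" "\<one>\<^bsub>G\<^esub>" v]
  by (simp_all add: incl1_def incl2_def o_def differential_ident lie_algebra_def differential_const)

lemma incl_in:
  "incl1 A G v \<in> lie_algebra PA GG" "incl2 A G v \<in> lie_algebra PA GG"
  using differential_in_tangent[OF dm PA mdiff_emb(1), of "\<one>\<^bsub>G\<^esub>" "\<one>\<^bsub>G\<^esub>" v]
    differential_in_tangent[OF dm PA mdiff_emb(2), of "\<one>\<^bsub>G\<^esub>" "\<one>\<^bsub>G\<^esub>" v]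
  by (simp_all add: incl1_def incl2_def lie_algebra_def)

lemma smooth_map_emb:
  assumes \<gamma>: "smooth_map real_line A \<gamma>"
  shows "smooth_map real_line PA (\<lambda>t. (\<gamma> t, k))" "smooth_map real_line PA (\<lambda>t. (k, \<gamma> t))"
proof -
  have cont: "continuous_on UNIV \<gamma>" using \<gamma> by (simp add: smooth_map_def)
  have sm: "smooth_on (snd c \<circ> \<gamma>) (\<gamma> -` fst c)" and op: "open (\<gamma> -` fst c)" if "c \<in> A" for c
    using \<gamma> that cont dm by (auto simp: smooth_map_def real_line_def dmanifold_def o_assoc[symmetric] intro!: open_vimage)
  \<comment> \<open>If \<open>k\<close> lies outside the factor of the product chart, the domain of
    the coordinate expression is empty.\<close>
  have e: "smooth_on f {}" for f :: "real \<Rightarrow> 'e \<times> 'e"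
  proof -
    have "Ck_on j f {}" for j by (induction j arbitrary: f) auto
    then show ?thesis by (simp add: smooth_on_def)
  qed
  have "smooth_on (snd d \<circ> (\<lambda>t. (\<gamma> t, k))) ((\<lambda>t. (\<gamma> t, k)) -` fst d)"
    "smooth_on (snd d \<circ> (\<lambda>t. (k, \<gamma> t))) ((\<lambda>t. (k, \<gamma> t)) -` fst d)" if d: "d \<in> PA" for d
  proof -
    obtain c c' where c: "c \<in> A" "c' \<in> A" and d: "d = prod_chart c c'" using d unfolding prod_atlas_def by blast
    show "smooth_on (snd d \<circ> (\<lambda>t. (\<gamma> t, k))) ((\<lambda>t. (\<gamma> t, k)) -` fst d)"
      using smooth_on_Pair_const(1)[OF op[OF c(1)] sm[OF c(1)], of "snd c' k"] e
      by (cases "k \<in> fst c'") (auto simp: d o_def vimage_def)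
    show "smooth_on (snd d \<circ> (\<lambda>t. (k, \<gamma> t))) ((\<lambda>t. (k, \<gamma> t)) -` fst d)"
      using smooth_on_Pair_const(2)[OF op[OF c(2)] sm[OF c(2)], of "snd c k"] e
      by (cases "k \<in> fst c") (auto simp: d o_def vimage_def)
  qed
  then show "smooth_map real_line PA (\<lambda>t. (\<gamma> t, k))" "smooth_map real_line PA (\<lambda>t. (k, \<gamma> t))"
    unfolding smooth_map_def real_line_def using cont
    by (auto simp: o_assoc[symmetric] intro!: continuous_intros)
qed

lemma hom_line_zero:
  assumes "\<And>s t. \<gamma> (s + t) = \<gamma> s \<otimes>\<^bsub>G\<^esub> \<gamma> t"
  shows "\<gamma> (0::real) = \<one>\<^bsub>G\<^esub>"
  using assms[of 0 0] l_cancel_one'[of "\<gamma> 0" "\<gamma> 0"] by simp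

text \<open>\<open>one_param\<close> is defined by choice, so its properties rest on existence. For
  elements of one summand a suitable curve is a one-parameter subgroup of \<open>G\<close> paired
  with the constant unit.\<close>

lemma one_param_incl:
  assumes v: "v \<in> lie_algebra A G" and i: "incl = incl1 A G \<or> incl = incl2 A G"
  defines "\<gamma> \<equiv> one_param PA GG (incl v)"
  shows "smooth_map real_line PA \<gamma>" "\<gamma> (s + t) = \<gamma> s \<otimes>\<^bsub>GG\<^esub> \<gamma> t" "velocity PA \<gamma> 0 = incl v"
proof -
  obtain \<gamma>1 where s: "smooth_map real_line A \<gamma>1" and h: "\<And>s t. \<gamma>1 (s + t) = \<gamma>1 s \<otimes>\<^bsub>G\<^esub> \<gamma>1 t"
    and vel: "velocity A \<gamma>1 0 = v" using one_parameter_subgroup_exists[OF L v] by blast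
  have \<gamma>0: "\<gamma>1 0 = \<one>\<^bsub>G\<^esub>" using hom_line_zero[OF h] .
  note md = smooth_map_mdiff[OF s, of 0]
  have "velocity PA (\<lambda>t. (\<gamma>1 t, \<one>\<^bsub>G\<^esub>)) 0 = incl1 A G v" "velocity PA (\<lambda>t. (\<one>\<^bsub>G\<^esub>, \<gamma>1 t)) 0 = incl2 A G v"
    using velocity_compose[OF dm md mdiff_emb(1), of "\<one>\<^bsub>G\<^esub>"] velocity_compose[OF dm md mdiff_emb(2), of "\<one>\<^bsub>G\<^esub>"] \<gamma>0 vel
    by (simp_all add: incl1_def incl2_def)
  then have "\<exists>\<gamma>. smooth_map real_line PA \<gamma> \<and> (\<forall>s t. \<gamma> (s + t) = \<gamma> s \<otimes>\<^bsub>GG\<^esub> \<gamma> t) \<and> velocity PA \<gamma> 0 = incl v"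
    using i smooth_map_emb[OF s, of "\<one>\<^bsub>G\<^esub>"] h
    by (elim disjE) (rule exI[of _ "\<lambda>t. (\<gamma>1 t, \<one>\<^bsub>G\<^esub>)"], simp, rule exI[of _ "\<lambda>t. (\<one>\<^bsub>G\<^esub>, \<gamma>1 t)"], simp)
  from someI_ex[OF this]
  show "smooth_map real_line PA \<gamma>" "\<gamma> (s + t) = \<gamma> s \<otimes>\<^bsub>GG\<^esub> \<gamma> t" "velocity PA \<gamma> 0 = incl v"
    unfolding \<gamma>_def one_param_def by blast+
qed

end

lemma mdiff_uminus: "mdiff real_line real_line uminus (t::real)"
proof -
  have "(uminus :: real \<Rightarrow> real) differentiable at t" by (simp add: derivative_intros)
  moreover have "filterlim (uminus :: real \<Rightarrow> real) (nhds (- t)) (nhds t)"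
    by (intro tendsto_minus filterlim_ident)
  ultimately show ?thesis by (simp add: mdiff_def rep_def)
qed

lemma velocity_reverse:
  fixes C :: "('m::topological_space, 'f::real_normed_vector) chart set"
  assumes "mdiff real_line C \<gamma> 0"
  shows "velocity C (\<lambda>t. \<gamma> (- t)) 0 = - velocity C \<gamma> 0"
proof (rule tvec_eqI)
  fix d
  show "coord (velocity C (\<lambda>t. \<gamma> (- t)) 0) d = coord (- velocity C \<gamma> 0) d"
  proof (cases "d \<in> charts_at C (\<gamma> 0)")
    case True
    then have "snd d \<circ> \<gamma> differentiable at 0" using assms by (simp add: mdiff_def rep_def)
    then have 1: "((snd d \<circ> \<gamma>) has_vector_derivative vector_derivative (snd d \<circ> \<gamma>) (at 0)) (at (- 0))"
      by (simp add: vector_derivative_works)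
    have "((uminus :: real \<Rightarrow> real) has_vector_derivative -1) (at 0)" by (auto intro!: derivative_eq_intros)
    from vector_diff_chain_at[OF this 1]
    have "((snd d \<circ> (\<lambda>t. \<gamma> (- t))) has_vector_derivative - vector_derivative (snd d \<circ> \<gamma>) (at 0)) (at 0)"
      by (simp add: o_def)
    then show ?thesis using True by (simp add: velocity_def vector_derivative_at)
  qed (simp add: velocity_def)
qed

section \<open>Generating fields and moment conditions for the two factors\<close>

context
  fixes A :: "('g::{t2_space, second_countable_topology}, 'e::real_normed_vector) chart set" and G :: "'g monoid"
    and B :: "('m::{t2_space, second_countable_topology}, 'f::real_normed_vector) chart set"
    and ip act \<omega> and \<Phi>1 \<Phi>2 :: "'m \<Rightarrow> 'g"
  assumes L: "lie_group A G"
    and ip: "invariant_inner_product A G ip"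
    and H: "group_valued_hamiltonian (prod_atlas A A) (G \<times>\<times> G) (prod_ip A G ip) B act \<omega> (\<lambda>m. (\<Phi>1 m, \<Phi>2 m))"
begin

interpretation group G using L by (simp add: lie_group_def)

lemma inG [simp]: "x \<in> carrier G" by (rule lie_in[OF L])

lemma dmA: "dmanifold A" by (rule lie_dmanifold[OF L])
lemma dmB: "dmanifold B" using H by (simp add: group_valued_hamiltonian_def manifold_dmanifold)
lemma dmP: "dmanifold (prod_atlas A A)" by (rule dmanifold_prod[OF dmA dmA])

lemma mdiff_moment: "mdiff B (prod_atlas A A) (\<lambda>m. (\<Phi>1 m, \<Phi>2 m)) m"
  using H by (intro smooth_map_mdiff) (simp add: group_valued_hamiltonian_def)

lemma mdiff_moments: "mdiff B A \<Phi>1 m" "mdiff B A \<Phi>2 m"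
  using mdiff_compose[OF dmB dmP mdiff_moment mdiff_fst[OF dmA dmA], of m]
    mdiff_compose[OF dmB dmP mdiff_moment mdiff_snd[OF dmA dmA], of m] by (simp_all add: o_def)

lemma equivariant:
  "\<Phi>1 (act k m) = fst k \<otimes>\<^bsub>G\<^esub> \<Phi>1 m \<otimes>\<^bsub>G\<^esub> inv\<^bsub>G\<^esub> (fst k)"
  "\<Phi>2 (act k m) = snd k \<otimes>\<^bsub>G\<^esub> \<Phi>2 m \<otimes>\<^bsub>G\<^esub> inv\<^bsub>G\<^esub> (snd k)"
proof -
  have "\<forall>k m. (\<lambda>m. (\<Phi>1 m, \<Phi>2 m)) (act k m) = k \<otimes>\<^bsub>G \<times>\<times> G\<^esub> (\<lambda>m. (\<Phi>1 m, \<Phi>2 m)) m \<otimes>\<^bsub>G \<times>\<times> G\<^esub> inv\<^bsub>G \<times>\<times> G\<^esub> k"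
    using H unfolding group_valued_hamiltonian_def by (elim conjE)
  then have "(\<Phi>1 (act k m), \<Phi>2 (act k m)) = k \<otimes>\<^bsub>G \<times>\<times> G\<^esub> (\<Phi>1 m, \<Phi>2 m) \<otimes>\<^bsub>G \<times>\<times> G\<^esub> inv\<^bsub>G \<times>\<times> G\<^esub> k"
    by (metis (no_types))
  moreover have "inv\<^bsub>G \<times>\<times> G\<^esub> k = (inv\<^bsub>G\<^esub> (fst k), inv\<^bsub>G\<^esub> (snd k))"
    using inv_DirProd[OF group_axioms group_axioms, of "fst k" "snd k"] by simp
  ultimately show "\<Phi>1 (act k m) = fst k \<otimes>\<^bsub>G\<^esub> \<Phi>1 m \<otimes>\<^bsub>G\<^esub> inv\<^bsub>G\<^esub> (fst k)"
    "\<Phi>2 (act k m) = snd k \<otimes>\<^bsub>G\<^esub> \<Phi>2 m \<otimes>\<^bsub>G\<^esub> inv\<^bsub>G\<^esub> (snd k)"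
    by (simp_all add: mult_DirProd')
qed

lemma act_one: "act (\<one>\<^bsub>G\<^esub>, \<one>\<^bsub>G\<^esub>) m = m"
proof -
  have "group_action (G \<times>\<times> G) UNIV act"
    using H by (simp add: group_valued_hamiltonian_def lie_group_action_def)
  from group_action.id_eq_one[OF this] show ?thesis by (metis one_DirProd restrict_apply' UNIV_I)
qed

text \<open>Equivariance sends the curve defining the field to a curve of conjugates of the moment
  value. The reversed time in the definition gives the sign that turns \<open>w - Ad w\<close> of
  \<open>theta_R_conj\<close> into \<open>Ad w - w\<close>.\<close>

lemma generating_field:
  fixes m
  assumes v: "v \<in> lie_algebra A G" and i: "incl = incl1 A G \<or> incl = incl2 A G"
  defines "X \<equiv> generating_field (prod_atlas A A) (G \<times>\<times> G) B act (incl v) m"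
  shows "X \<in> tangent_space B m"
    and "theta_R A G (\<Phi>1 m) (differential B A \<Phi>1 m X) =
      Ad A G (\<Phi>1 m) (differential (prod_atlas A A) A fst (\<one>\<^bsub>G\<^esub>, \<one>\<^bsub>G\<^esub>) (incl v)) - differential (prod_atlas A A) A fst (\<one>\<^bsub>G\<^esub>, \<one>\<^bsub>G\<^esub>) (incl v)"
    and "theta_R A G (\<Phi>2 m) (differential B A \<Phi>2 m X) =
      Ad A G (\<Phi>2 m) (differential (prod_atlas A A) A snd (\<one>\<^bsub>G\<^esub>, \<one>\<^bsub>G\<^esub>) (incl v)) - differential (prod_atlas A A) A snd (\<one>\<^bsub>G\<^esub>, \<one>\<^bsub>G\<^esub>) (incl v)"
proof -
  let ?P = "prod_atlas A A" and ?one = "(\<one>\<^bsub>G\<^esub>, \<one>\<^bsub>G\<^esub>)"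
  define \<gamma> where "\<gamma> = one_param ?P (G \<times>\<times> G) (incl v)"
  note \<gamma> = one_param_incl[OF L v i, folded \<gamma>_def]
  have \<gamma>0: "\<gamma> 0 = ?one"
  proof -
    have "fst (\<gamma> (s + t)) = fst (\<gamma> s) \<otimes>\<^bsub>G\<^esub> fst (\<gamma> t)" "snd (\<gamma> (s + t)) = snd (\<gamma> s) \<otimes>\<^bsub>G\<^esub> snd (\<gamma> t)" for s t
      using \<gamma>(2)[of s t] by (simp_all add: mult_DirProd')
    from hom_line_zero[OF L this(1)] hom_line_zero[OF L this(2)] show ?thesis by (simp add: prod_eq_iff)
  qed
  note md = smooth_map_mdiff[OF \<gamma>(1), of 0]
  have md': "mdiff real_line ?P (\<lambda>t. \<gamma> (- t)) 0"
    using mdiff_compose[OF dmanifold_line dmanifold_line mdiff_uminus[of 0], of ?P \<gamma>] md by (simp add: o_def)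
  have vel: "velocity ?P (\<lambda>t. \<gamma> (- t)) 0 = - incl v" using velocity_reverse[OF md] \<gamma>(3) by simp
  have "mdiff (prod_atlas ?P B) B (\<lambda>(k, m). act k m) p" for p
    using H by (intro smooth_map_mdiff) (simp add: group_valued_hamiltonian_def lie_group_action_def)
  then have c: "mdiff real_line B (\<lambda>t. act (\<gamma> (- t)) m) 0"
    using mdiff_compose[OF dmanifold_line dmanifold_prod[OF dmP dmB] mdiff_Pair[OF dmP dmB dmanifold_line md' mdiff_const[of _ _ m]], of B "\<lambda>(k, m). act k m"]
    by (simp add: o_def)
  have c0: "act (\<gamma> (- 0)) m = m" by (simp add: \<gamma>0 act_one)
  have X: "X = velocity B (\<lambda>t. act (\<gamma> (- t)) m) 0"
    by (simp add: X_def generating_field_def \<gamma>_def)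
  show "X \<in> tangent_space B m"
    using differential_in_tangent[OF dmanifold_line dmB c, of line_unit] velocity_differential[OF c] c0 by (simp add: X)
  \<comment> \<open>Both components are treated at once: \<open>pr\<close> stands for
    \<open>fst\<close> or \<open>snd\<close>, and \<open>w\<close> is the corresponding component of
    the Lie algebra element.\<close>
  have key: "theta_R A G (\<Phi> m) (differential B A \<Phi> m X) = Ad A G (\<Phi> m) w - w"
    if \<Phi>: "mdiff B A \<Phi> m" and pr: "mdiff ?P A pr (\<gamma> 0)" and pr1: "pr (\<gamma> 0) = \<one>\<^bsub>G\<^esub>"
      and eqv: "\<And>k. \<Phi> (act k m) = pr k \<otimes>\<^bsub>G\<^esub> \<Phi> m \<otimes>\<^bsub>G\<^esub> inv\<^bsub>G\<^esub> (pr k)"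
      and w: "w = differential ?P A pr (\<gamma> 0) (incl v)" for \<Phi> pr w
  proof -
    let ?h = "\<lambda>k. k \<otimes>\<^bsub>G\<^esub> \<Phi> m \<otimes>\<^bsub>G\<^esub> inv\<^bsub>G\<^esub> k"
    have h: "mdiff A A ?h (pr (\<gamma> (- 0)))" by (rule mdiff_product[OF L dmA mdiff_right[OF L] mdiff_inv[OF L]])
    have prc: "mdiff real_line A (\<lambda>t. pr (\<gamma> (- t))) 0"
      using mdiff_compose[OF dmanifold_line dmP md', of A pr] pr by (simp add: o_def)
    have "differential B A \<Phi> m X = velocity A (\<lambda>t. \<Phi> (act (\<gamma> (- t)) m)) 0"
      using velocity_compose[OF dmB c, of A \<Phi>] \<Phi> c0 by (simp add: X)
    also have "\<dots> = velocity A (\<lambda>t. ?h (pr (\<gamma> (- t)))) 0" by (simp add: eqv)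
    also have "\<dots> = differential A A ?h (pr (\<gamma> (- 0))) (velocity A (\<lambda>t. pr (\<gamma> (- t))) 0)"
      by (rule velocity_compose[OF dmA prc h])
    also have "velocity A (\<lambda>t. pr (\<gamma> (- t))) 0 = - w"
      using velocity_compose[OF dmP md', of A pr] pr vel differential_lin(3)[OF dmP pr] by (simp add: w)
    finally have d: "differential B A \<Phi> m X = differential A A ?h \<one>\<^bsub>G\<^esub> (- w)" using pr1 by simp
    have "w \<in> lie_algebra A G" using differential_in_tangent[OF dmP dmA pr] by (simp add: w pr1 lie_algebra_def)
    then have "- w \<in> lie_algebra A G" using one_in_lie[OF L] by (simp add: subspace_neg)
    from theta_R_conj[OF L this, of "\<Phi> m"] show ?thesis
      using Ad_linear[OF L, of "\<Phi> m" "-1" w 0 0] by (simp add: d)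
  qed
  show "theta_R A G (\<Phi>1 m) (differential B A \<Phi>1 m X) =
      Ad A G (\<Phi>1 m) (differential ?P A fst ?one (incl v)) - differential ?P A fst ?one (incl v)"
    by (rule key[OF mdiff_moments(1) mdiff_fst[OF dmA dmA]]) (simp_all add: \<gamma>0 equivariant)
  show "theta_R A G (\<Phi>2 m) (differential B A \<Phi>2 m X) =
      Ad A G (\<Phi>2 m) (differential ?P A snd ?one (incl v)) - differential ?P A snd ?one (incl v)"
    by (rule key[OF mdiff_moments(2) mdiff_snd[OF dmA dmA]]) (simp_all add: \<gamma>0 equivariant)
qed

lemma ip_linear:
  assumes "v \<in> lie_algebra A G" "w \<in> lie_algebra A G" "z \<in> lie_algebra A G"
  shows "ip (r *\<^sub>R v + s *\<^sub>R w) z = r * ip v z + s * ip w z"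
  using ip assms unfolding invariant_inner_product_def by blast

lemma ip_sym: "v \<in> lie_algebra A G \<Longrightarrow> w \<in> lie_algebra A G \<Longrightarrow> ip v w = ip w v"
  using ip unfolding invariant_inner_product_def by blast

lemma ip_Ad: "v \<in> lie_algebra A G \<Longrightarrow> w \<in> lie_algebra A G \<Longrightarrow> ip (Ad A G g v) (Ad A G g w) = ip v w"
  using ip unfolding invariant_inner_product_def by blast

lemma ip_simps:
  assumes "v \<in> lie_algebra A G" "w \<in> lie_algebra A G" "z \<in> lie_algebra A G"
  shows "ip (v + w) z = ip v z + ip w z" "ip (v - w) z = ip v z - ip w z" "ip 0 z = 0" "ip z 0 = 0"
proof -
  have z: "0 \<in> lie_algebra A G" using one_in_lie[OF L] by (rule subspace_0)
  show "ip (v + w) z = ip v z + ip w z" "ip (v - w) z = ip v z - ip w z"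
    using ip_linear[OF assms, of 1 1] ip_linear[OF assms, of 1 "-1"] by simp_all
  show "ip 0 z = 0" using ip_linear[OF assms(1,1,3), of 0 0] by simp
  then show "ip z 0 = 0" using ip_sym[OF assms(3) z] by simp
qed

lemma theta_prod:
  assumes p: "p = (a, b)"
  shows "differential (prod_atlas A A) A fst (\<one>\<^bsub>G\<^esub>, \<one>\<^bsub>G\<^esub>) (theta_L (prod_atlas A A) (G \<times>\<times> G) p u) =
      theta_L A G a (differential (prod_atlas A A) A fst p u)"
    "differential (prod_atlas A A) A fst (\<one>\<^bsub>G\<^esub>, \<one>\<^bsub>G\<^esub>) (theta_R (prod_atlas A A) (G \<times>\<times> G) p u) =
      theta_R A G a (differential (prod_atlas A A) A fst p u)"
    "differential (prod_atlas A A) A snd (\<one>\<^bsub>G\<^esub>, \<one>\<^bsub>G\<^esub>) (theta_L (prod_atlas A A) (G \<times>\<times> G) p u) =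
      theta_L A G b (differential (prod_atlas A A) A snd p u)"
    "differential (prod_atlas A A) A snd (\<one>\<^bsub>G\<^esub>, \<one>\<^bsub>G\<^esub>) (theta_R (prod_atlas A A) (G \<times>\<times> G) p u) =
      theta_R A G b (differential (prod_atlas A A) A snd p u)"
    "theta_L (prod_atlas A A) (G \<times>\<times> G) p u \<in> lie_algebra (prod_atlas A A) (G \<times>\<times> G)"
    "theta_R (prod_atlas A A) (G \<times>\<times> G) p u \<in> lie_algebra (prod_atlas A A) (G \<times>\<times> G)"
proof -
  let ?P = "prod_atlas A A" and ?one = "(\<one>\<^bsub>G\<^esub>, \<one>\<^bsub>G\<^esub>)"
  let ?l = "\<lambda>h. (inv\<^bsub>G\<^esub> a \<otimes>\<^bsub>G\<^esub> fst h, inv\<^bsub>G\<^esub> b \<otimes>\<^bsub>G\<^esub> snd h)"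
  let ?r = "\<lambda>h. (fst h \<otimes>\<^bsub>G\<^esub> inv\<^bsub>G\<^esub> a, snd h \<otimes>\<^bsub>G\<^esub> inv\<^bsub>G\<^esub> b)"
  have inv: "inv\<^bsub>G \<times>\<times> G\<^esub> p = (inv\<^bsub>G\<^esub> a, inv\<^bsub>G\<^esub> b)"
    using inv_DirProd[OF group_axioms group_axioms, of a b] p by simp
  have tl: "theta_L ?P (G \<times>\<times> G) p u = differential ?P ?P ?l p u"
  proof -
    have "(\<lambda>h. inv\<^bsub>G \<times>\<times> G\<^esub> p \<otimes>\<^bsub>G \<times>\<times> G\<^esub> h) = ?l" by (rule ext) (simp add: inv mult_DirProd')
    then show ?thesis unfolding theta_L_def by (simp only:)
  qed
  have tr: "theta_R ?P (G \<times>\<times> G) p u = differential ?P ?P ?r p u"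
  proof -
    have "(\<lambda>h. h \<otimes>\<^bsub>G \<times>\<times> G\<^esub> inv\<^bsub>G \<times>\<times> G\<^esub> p) = ?r" by (rule ext) (simp add: inv mult_DirProd')
    then show ?thesis unfolding theta_R_def by (simp only:)
  qed
  note f = mdiff_fst[OF dmA dmA, of p] and s = mdiff_snd[OF dmA dmA, of p]
  have l1: "mdiff ?P A (\<lambda>h. inv\<^bsub>G\<^esub> a \<otimes>\<^bsub>G\<^esub> fst h) p" and l2: "mdiff ?P A (\<lambda>h. inv\<^bsub>G\<^esub> b \<otimes>\<^bsub>G\<^esub> snd h) p"
    and r1: "mdiff ?P A (\<lambda>h. fst h \<otimes>\<^bsub>G\<^esub> inv\<^bsub>G\<^esub> a) p" and r2: "mdiff ?P A (\<lambda>h. snd h \<otimes>\<^bsub>G\<^esub> inv\<^bsub>G\<^esub> b) p"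
    by (intro mdiff_product[OF L dmP] mdiff_const f s)+
  have l: "mdiff ?P ?P ?l p" and r: "mdiff ?P ?P ?r p"
    by (rule mdiff_Pair[OF dmA dmA dmP l1 l2], rule mdiff_Pair[OF dmA dmA dmP r1 r2])
  have one: "?l p = ?one" "?r p = ?one" by (simp_all add: p)
  have ff: "mdiff ?P A fst x" and ss: "mdiff ?P A snd x" for x by (rule mdiff_fst[OF dmA dmA], rule mdiff_snd[OF dmA dmA])
  have comp: "differential A A h (pr p) (differential ?P A pr p u) = differential ?P A (\<lambda>x. h (pr x)) p u"
    if "mdiff ?P A pr p" "mdiff A A h (pr p)" for h pr
    using differential_compose[OF dmP dmA that] by (simp add: o_def)
  have outer: "differential ?P A pr ?one (differential ?P ?P h p u) = differential ?P A (\<lambda>x. pr (h x)) p u"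
    if "mdiff ?P A pr ?one" "mdiff ?P ?P h p" "h p = ?one" for h pr
    using differential_compose[OF dmP dmP that(2), of A pr u] that by (simp add: o_def)
  show "differential ?P A fst ?one (theta_L ?P (G \<times>\<times> G) p u) = theta_L A G a (differential ?P A fst p u)"
    using comp[OF f mdiff_left[OF L], of "inv\<^bsub>G\<^esub> a"] outer[OF ff l one(1)] unfolding tl by (simp add: theta_L_def p)
  show "differential ?P A fst ?one (theta_R ?P (G \<times>\<times> G) p u) = theta_R A G a (differential ?P A fst p u)"
    using comp[OF f mdiff_right[OF L], of "inv\<^bsub>G\<^esub> a"] outer[OF ff r one(2)] unfolding tr by (simp add: theta_R_def p)
  show "differential ?P A snd ?one (theta_L ?P (G \<times>\<times> G) p u) = theta_L A G b (differential ?P A snd p u)"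
    using comp[OF s mdiff_left[OF L], of "inv\<^bsub>G\<^esub> b"] outer[OF ss l one(1)] unfolding tl by (simp add: theta_L_def p)
  show "differential ?P A snd ?one (theta_R ?P (G \<times>\<times> G) p u) = theta_R A G b (differential ?P A snd p u)"
    using comp[OF s mdiff_right[OF L], of "inv\<^bsub>G\<^esub> b"] outer[OF ss r one(2)] unfolding tr by (simp add: theta_R_def p)
  show "theta_L ?P (G \<times>\<times> G) p u \<in> lie_algebra ?P (G \<times>\<times> G)" "theta_R ?P (G \<times>\<times> G) p u \<in> lie_algebra ?P (G \<times>\<times> G)"
    using differential_in_tangent[OF dmP dmP l, of u] differential_in_tangent[OF dmP dmP r, of u] one
    unfolding tl tr by (simp_all add: lie_algebra_def)
qed

text \<open>The pairing with an element of one summand only sees that component of the Maurer-Cartan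
  forms of the product, so the condition separates into one for each moment map.\<close>

lemma moment_condition:
  assumes v: "v \<in> lie_algebra A G" and w: "w \<in> tangent_space B m"
  shows "\<omega> m [generating_field (prod_atlas A A) (G \<times>\<times> G) B act (incl1 A G v) m, w] =
      (ip (theta_L A G (\<Phi>1 m) (differential B A \<Phi>1 m w)) v + ip (theta_R A G (\<Phi>1 m) (differential B A \<Phi>1 m w)) v) / 2"
    "\<omega> m [generating_field (prod_atlas A A) (G \<times>\<times> G) B act (incl2 A G v) m, w] =
      (ip (theta_L A G (\<Phi>2 m) (differential B A \<Phi>2 m w)) v + ip (theta_R A G (\<Phi>2 m) (differential B A \<Phi>2 m w)) v) / 2"
proof -
  let ?P = "prod_atlas A A" and ?GG = "G \<times>\<times> G" and ?\<Phi> = "\<lambda>m. (\<Phi>1 m, \<Phi>2 m)" and ?one = "(\<one>\<^bsub>G\<^esub>, \<one>\<^bsub>G\<^esub>)"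
  let ?u = "differential B ?P ?\<Phi> m w"
  have d: "differential ?P A fst (?\<Phi> m) ?u = differential B A \<Phi>1 m w" "differential ?P A snd (?\<Phi> m) ?u = differential B A \<Phi>2 m w"
    using differential_compose[OF dmB dmP mdiff_moment mdiff_fst[OF dmA dmA]] differential_compose[OF dmB dmP mdiff_moment mdiff_snd[OF dmA dmA]]
    by (simp_all add: o_def)
  have gen: "\<omega> m [generating_field ?P ?GG B act \<xi> m, w] =
      prod_ip A G ip (theta_L ?P ?GG (?\<Phi> m) ?u + theta_R ?P ?GG (?\<Phi> m) ?u) \<xi> / 2"
    if "\<xi> \<in> lie_algebra ?P ?GG" for \<xi>
  proof -
    have "\<forall>\<xi>\<in>lie_algebra ?P ?GG. form_eq B (contraction (generating_field ?P ?GG B act \<xi>) \<omega>)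
         (pullback B ?P ?\<Phi> (\<lambda>k. one_form (\<lambda>v. 1/2 * prod_ip A G ip (theta_L ?P ?GG k v + theta_R ?P ?GG k v) \<xi>)))"
      using H unfolding group_valued_hamiltonian_def by (elim conjE)
    note f = bspec[OF this that]
    have "[w] \<in> lists (tangent_space B m)" using w by simp
    with f have "contraction (generating_field ?P ?GG B act \<xi>) \<omega> m [w] =
        pullback B ?P ?\<Phi> (\<lambda>k. one_form (\<lambda>v. 1/2 * prod_ip A G ip (theta_L ?P ?GG k v + theta_R ?P ?GG k v) \<xi>)) m [w]"
      unfolding form_eq_def by blast
    then show ?thesis by (simp add: contraction_def pullback_def one_form_def)
  qed
  note tp = theta_prod[OF refl, of "\<Phi>1 m" "\<Phi>2 m"]
  have sum1: "differential ?P A fst ?one (x + y) = differential ?P A fst ?one x + differential ?P A fst ?one y"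
    and sum2: "differential ?P A snd ?one (x + y) = differential ?P A snd ?one x + differential ?P A snd ?one y" for x y
    by (rule differential_lin(1)[OF dmP mdiff_fst[OF dmA dmA]], rule differential_lin(1)[OF dmP mdiff_snd[OF dmA dmA]])
  have z: "ip (x + y) 0 = 0" if "x \<in> lie_algebra A G" "y \<in> lie_algebra A G" for x y
    using that one_in_lie[OF L] by (intro ip_simps(4)[of "x + y" "x + y"]) (auto simp: subspace_add)
  note th = theta_L_in[OF L] theta_R_in[OF L]
  show "\<omega> m [generating_field ?P ?GG B act (incl1 A G v) m, w] =
      (ip (theta_L A G (\<Phi>1 m) (differential B A \<Phi>1 m w)) v + ip (theta_R A G (\<Phi>1 m) (differential B A \<Phi>1 m w)) v) / 2"
    unfolding gen[OF incl_in(1)[OF L]] prod_ip_def Let_def sum1 sum2 tp d fst_snd_incl[OF L v]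
    using z[OF th] ip_simps(1)[OF th v] by simp
  show "\<omega> m [generating_field ?P ?GG B act (incl2 A G v) m, w] =
      (ip (theta_L A G (\<Phi>2 m) (differential B A \<Phi>2 m w)) v + ip (theta_R A G (\<Phi>2 m) (differential B A \<Phi>2 m w)) v) / 2"
    unfolding gen[OF incl_in(2)[OF L]] prod_ip_def Let_def sum1 sum2 tp d fst_snd_incl[OF L v]
    using z[OF th] ip_simps(1)[OF th v] by simp
qed

end


section \<open>Pin lifts\<close>

lemma fsubst_cong:
  assumes "B \<in> cl_on K" "\<And>i. i \<in> K \<Longrightarrow> c i = c' i"
  shows "fsubst c B = fsubst c' B"
  unfolding fsubst_def
proof (intro sum.cong refl)
  fix I assume "I \<in> {I. cl_coeff B I \<noteq> 0}"
  then have "I \<subseteq> K" "finite I" using cl_supp_subset[OF assms(1)] cl_supp_finite by auto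
  then have eq: "map (\<lambda>i. mone (c i)) (sorted_list_of_set I) = map (\<lambda>i. mone (c' i)) (sorted_list_of_set I)"
    using assms(2) by (intro map_cong) auto
  show "cl_coeff B I *\<^sub>R cov_prod c I = cl_coeff B I *\<^sub>R cov_prod c' I" by (simp only: cov_prod_def eq)
qed

lemma cl_shift_mult: "cl_shift n (B * D) = cl_shift n B * cl_shift n D"
proof -
  have "B \<in> cl_on UNIV" by (rule cl_on_UNIV)
  then show ?thesis
    by (induction rule: cl_on_induct)
      (simp_all add: distrib_right cl_shift_add cl_shift_scale cl_shift_gen_mult mult.assoc)
qed

lemma cl_shift_gen: "cl_shift n (cl_gen j) = cl_gen (n + j)"
  using cl_shift_gen_mult[of n j 1] by simp

lemma cl_shift_parity: "cl_shift n (cl_parity B) = cl_parity (cl_shift n B)"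
proof -
  have "B \<in> cl_on UNIV" by (rule cl_on_UNIV)
  then show ?thesis
  proof (induction rule: cl_on_induct)
    case (gen j B)
    have "- (cl_gen j * cl_parity B) = (-1) *\<^sub>R (cl_gen j * cl_parity B)" by simp
    then show ?case using gen by (simp only: cl_parity_gen_mult mult_minus_left cl_shift_scale cl_shift_gen_mult) simp
  qed (simp_all add: cl_shift_add cl_shift_scale)
qed

lemma cl_shift_vec: "cl_shift n (cl_vec n u) = (\<Sum>k<n. u k *\<^sub>R cl_gen (n + k))"
proof -
  have "cl_shift n (\<Sum>k\<in>S. u k *\<^sub>R cl_gen k) = (\<Sum>k\<in>S. u k *\<^sub>R cl_gen (n + k))" if "finite S" for S
    using that cl_shift_scale[of n 0 0]
    by (induction S rule: finite_induct) (simp_all add: cl_shift_add cl_shift_scale cl_shift_gen)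
  then show ?thesis by (simp add: cl_vec_def)
qed

lemma carrier_Clifford: "carrier (Clifford n) = cl_on {..<n}"
proof -
  have "{J. finite J \<and> J \<subseteq> {..<n}} = Pow {..<n}" by (auto intro: finite_subset)
  then show ?thesis by (simp add: Clifford_def cl_on_def)
qed

lemma Clifford_simps [simp]: "x \<otimes>\<^bsub>Clifford n\<^esub> y = x * y" "\<one>\<^bsub>Clifford n\<^esub> = 1"
  by (simp_all add: Clifford_def)

lemma monoid_Clifford: "monoid (Clifford n)"
  by (rule monoidI) (auto simp: carrier_Clifford cl_on_mult cl_one_in mult.assoc)

lemma foldr_wedge_prod_list:
  "foldr (\<lambda>i. wedge (one_form (a i))) xs unit_form = mval (prod_list (map (\<lambda>i. mone (a i)) xs))"
  by (induction xs) (simp_all add: one_mform.rep_eq times_mform.rep_eq mone_def)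

lemma T_form_fsubst:
  assumes "\<tau> g \<in> cl_on {..<n}"
  shows "T_form A G ip n e \<tau> g = mval (fsubst (\<lambda>i v. 1/2 * ip (theta_R A G g v) (e i)) (\<tau> g))"
proof -
  have "{I. cl_coeff (\<tau> g) I \<noteq> 0} \<subseteq> Pow {..<n}" using cl_supp_subset[OF assms] by auto
  then show ?thesis
    by (intro ext) (simp add: T_form_def fsubst_superset[of "Pow {..<n}"] mval_sum symbol_def
        cov_prod_def foldr_wedge_prod_list)
qed

context
  fixes A :: "('g::{t2_space, second_countable_topology}, 'e::real_normed_vector) chart set" and G :: "'g monoid"
    and ip :: "('g, 'e) pairing" and n :: nat and e :: "nat \<Rightarrow> ('g, 'e) tvec" and \<tau> :: "'g \<Rightarrow> cliff"
    and B :: "('m::{t2_space, second_countable_topology}, 'f::real_normed_vector) chart set"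
    and act :: "'g \<times> 'g \<Rightarrow> 'm \<Rightarrow> 'm" and \<omega> :: "('m, 'f) form" and \<Phi>1 \<Phi>2 :: "'m \<Rightarrow> 'g"
  assumes L: "lie_group A G"
    and ip: "invariant_inner_product A G ip"
    and on: "orthonormal_basis A G ip n e"
    and pin: "pin_lift A G ip n e \<tau>"
    and H: "group_valued_hamiltonian (prod_atlas A A) (G \<times>\<times> G) (prod_ip A G ip) B act \<omega> (\<lambda>m. (\<Phi>1 m, \<Phi>2 m))"
begin

interpretation group G using L by (simp add: lie_group_def)

abbreviation (input) "lie \<equiv> lie_algebra A G"

lemmas ipl = ip_linear[OF L ip H] and ips = ip_simps[OF L ip H] and ipsym = ip_sym[OF L ip H] and ipAd = ip_Ad[OF L ip H]

lemma e_lie: "i < n \<Longrightarrow> e i \<in> lie"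
  using on by (auto simp: orthonormal_basis_def intro: span_base)

lemma ip_e: "i < n \<Longrightarrow> j < n \<Longrightarrow> ip (e i) (e j) = (if i = j then 1 else 0)"
  using on by (simp add: orthonormal_basis_def)

lemma lie_sub: "subspace lie" by (rule one_in_lie[OF L])

lemma parseval:
  assumes v: "v \<in> lie" and w: "w \<in> lie"
  shows "ip v w = (\<Sum>k<n. ip v (e k) * ip w (e k))"
proof -
  have "v \<in> span (e ` {..<n})" using v on by (simp add: orthonormal_basis_def)
  then have "v \<in> lie \<and> ip v w = (\<Sum>k<n. ip v (e k) * ip w (e k))"
  proof (induction rule: span_induct_alt)
    case base
    then show ?case using ips(3)[OF w w] w e_lie lie_sub by (simp add: subspace_0)
  next
    case (step r x y)
    then obtain i where i: "i < n" "x = e i" by auto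
    have 1: "ip (r *\<^sub>R e i + y) z = r * ip (e i) z + ip y z" if "z \<in> lie" for z
      using ipl[of "e i" y z r 1] e_lie[OF i(1)] step that by simp
    have "(\<Sum>k<n. ip (e i) (e k) * ip w (e k)) = (\<Sum>k<n. if k = i then ip w (e i) else 0)"
      using i by (intro sum.cong refl) (auto simp: ip_e)
    also have "\<dots> = ip (e i) w" using i ipsym[OF w e_lie] by simp
    finally have "(\<Sum>k<n. (r * ip (e i) (e k) + ip y (e k)) * ip w (e k)) = r * ip (e i) w + ip y w"
      using step by (simp add: distrib_right sum.distrib mult.assoc sum_distrib_left[symmetric])
    then have "ip (r *\<^sub>R e i + y) w = (\<Sum>k<n. ip (r *\<^sub>R e i + y) (e k) * ip w (e k))"
      using 1[OF w] by (simp add: 1 e_lie)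
    then show ?case using i step e_lie lie_sub by (simp add: subspace_add subspace_scale)
  qed
  then show ?thesis by simp
qed

text \<open>The matrix of the adjoint action in the basis \<open>e\<close>; column \<open>i\<close>
  holds the coordinates of the image of \<open>e i\<close>.\<close>

definition rotm :: "'g \<Rightarrow> nat \<Rightarrow> nat \<Rightarrow> real" where "rotm g k i = ip (Ad A G g (e i)) (e k)"

lemma rotm_orth: "i < n \<Longrightarrow> j < n \<Longrightarrow> (\<Sum>k<n. rotm g k i * rotm g k j) = (if i = j then 1 else 0)"
  unfolding rotm_def using parseval[OF Ad_in[OF L] Ad_in[OF L], of g "e i" g "e j"] ipAd[of "e i" "e j" g]
  by (simp add: e_lie ip_e)

lemma ip_Ad_e:
  assumes v: "v \<in> lie" and i: "i < n"
  shows "ip (Ad A G g v) (e i) = (\<Sum>k<n. rotm g i k * ip v (e k))"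
proof -
  have "v \<in> span (e ` {..<n})" using v on by (simp add: orthonormal_basis_def)
  then have "v \<in> lie \<and> ip (Ad A G g v) (e i) = (\<Sum>k<n. rotm g i k * ip v (e k))"
  proof (induction rule: span_induct_alt)
    case base
    have "Ad A G g 0 = 0" using Ad_linear[OF L, of g 0 0 0 0] by simp
    then show ?case using ips(3)[OF v v] e_lie i lie_sub by (simp add: subspace_0)
  next
    case (step r x y)
    then obtain j where j: "j < n" "x = e j" by auto
    have "Ad A G g (r *\<^sub>R e j + y) = r *\<^sub>R Ad A G g (e j) + Ad A G g y"
      using Ad_linear[OF L, of g r "e j" 1 y] by simp
    then have 1: "ip (Ad A G g (r *\<^sub>R e j + y)) (e i) = r * rotm g i j + ip (Ad A G g y) (e i)"
      using ipl[OF Ad_in[OF L] Ad_in[OF L] e_lie[OF i], of r g "e j" 1 g y] by (simp add: rotm_def)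
    have 2: "ip (r *\<^sub>R e j + y) (e k) = r * ip (e j) (e k) + ip y (e k)" if "k < n" for k
      using ipl[of "e j" y "e k" r 1] e_lie[OF j(1)] e_lie[OF that] step by simp
    have "(\<Sum>k<n. rotm g i k * ip (e j) (e k)) = (\<Sum>k<n. if k = j then rotm g i j else 0)"
      using j by (intro sum.cong refl) (auto simp: ip_e)
    also have "\<dots> = rotm g i j" using j by simp
    finally have "(\<Sum>k<n. rotm g i k * (r * ip (e j) (e k) + ip y (e k))) = r * rotm g i j + ip (Ad A G g y) (e i)"
      using step by (simp add: distrib_left sum.distrib mult.left_commute sum_distrib_left[symmetric])
    then show ?case using 1 2 j step e_lie lie_sub by (simp add: subspace_add subspace_scale)
  qed
  then show ?thesis by simp
qed

text \<open>Invariance moves \<open>Ad\<close> to the other argument, so the transposed matrix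
  expresses the left form through the right one.\<close>

lemma ip_theta_L:
  assumes i: "i < n"
  shows "ip (theta_L A G g v) (e i) = (\<Sum>k<n. rotm g k i * ip (theta_R A G g v) (e k))"
proof -
  have "ip (theta_L A G g v) (e i) = ip (theta_R A G g v) (Ad A G g (e i))"
    using ipAd[OF theta_L_in[OF L] e_lie[OF i], of g g v] by (simp add: Ad_theta_L[OF L])
  also have "\<dots> = (\<Sum>k<n. ip (theta_R A G g v) (e k) * rotm g k i)"
    unfolding rotm_def by (rule parseval[OF theta_R_in[OF L] Ad_in[OF L]])
  finally show ?thesis by (simp add: mult.commute)
qed

lemma cl_incl_eq: "cl_incl ip n e v = cl_vec n (\<lambda>i. ip v (e i))"
  by (simp add: cl_incl_def cl_vec_def)

lemma cl_incl_e: "i < n \<Longrightarrow> cl_incl ip n e (e i) = cl_gen i"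
proof -
  assume i: "i < n"
  have "cl_incl ip n e (e i) = (\<Sum>k<n. if k = i then cl_gen i else 0)"
    unfolding cl_incl_def using i by (intro sum.cong refl) (auto simp: ip_e)
  then show ?thesis using i by simp
qed

text \<open>With the relation used here a vector of squared length 2 has Clifford square 1 and is
  its own inverse.\<close>

lemma Pin_in_Units: "carrier (Pin A G ip n e) \<subseteq> Units (Clifford n)"
proof -
  interpret C: monoid "Clifford n" by (rule monoid_Clifford)
  interpret U: group "units_of (Clifford n)" by (rule C.units_group)
  have "cl_incl ip n e v \<in> Units (Clifford n)" if v: "v \<in> lie" "ip v v = 2" for v
  proof -
    have "cl_incl ip n e v * cl_incl ip n e v + cl_incl ip n e v * cl_incl ip n e v = 2 *\<^sub>R 1"
      using cl_vec_relation[of n "\<lambda>i. ip v (e i)" "\<lambda>i. ip v (e i)"] parseval[OF v(1) v(1)] v by (simp add: cl_incl_eq)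
    then have "2 *\<^sub>R (cl_incl ip n e v * cl_incl ip n e v) = 2 *\<^sub>R 1" by (simp add: scaleR_2)
    then have "cl_incl ip n e v * cl_incl ip n e v = 1" by simp
    moreover have "cl_incl ip n e v \<in> carrier (Clifford n)" by (simp add: carrier_Clifford cl_incl_eq cl_vec_in)
    ultimately show ?thesis unfolding Units_def by auto
  qed
  then have "cl_incl ip n e ` {v \<in> lie. ip v v = 2} \<subseteq> carrier (units_of (Clifford n))"
    by (auto simp: units_of_carrier)
  from U.generate_incl[OF this] show ?thesis by (simp add: Pin_def units_of_carrier)
qed

lemma tau_Units: "\<tau> g \<in> Units (Clifford n)"
  using pin Pin_in_Units lie_in[OF L] unfolding pin_lift_def hom_def by blast

lemma tau_in: "\<tau> g \<in> cl_on {..<n}"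
  using tau_Units[of g] unfolding carrier_Clifford[symmetric] by (auto simp: Units_def)

lemma tau_inverse: "\<tau> g * inv\<^bsub>Clifford n\<^esub> \<tau> g = 1" "inv\<^bsub>Clifford n\<^esub> \<tau> g * \<tau> g = 1" "inv\<^bsub>Clifford n\<^esub> \<tau> g \<in> cl_on {..<n}"
proof -
  interpret C: monoid "Clifford n" by (rule monoid_Clifford)
  show "\<tau> g * inv\<^bsub>Clifford n\<^esub> \<tau> g = 1" "inv\<^bsub>Clifford n\<^esub> \<tau> g * \<tau> g = 1"
    using C.Units_r_inv[OF tau_Units] C.Units_l_inv[OF tau_Units] by simp_all
  show "inv\<^bsub>Clifford n\<^esub> \<tau> g \<in> cl_on {..<n}"
    using C.Units_inv_closed[OF tau_Units] by (simp add: carrier_Clifford)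
qed

lemma tau_mult: "\<tau> (g \<otimes>\<^bsub>G\<^esub> h) = \<tau> g * \<tau> h"
proof -
  have "\<tau> (g \<otimes>\<^bsub>G\<^esub> h) = \<tau> g \<otimes>\<^bsub>Pin A G ip n e\<^esub> \<tau> h"
    using pin lie_in[OF L] unfolding pin_lift_def hom_def by blast
  then show ?thesis by (simp add: Pin_def units_of_def)
qed

lemma tau_twist:
  assumes "j < n" shows "cl_parity (\<tau> g) * cl_gen j = cl_vec n (\<lambda>k. rotm g k j) * \<tau> g"
proof -
  have "cl_parity (\<tau> g) * cl_incl ip n e (e j) * inv\<^bsub>Clifford n\<^esub> \<tau> g = cl_incl ip n e (Ad A G g (e j))"
    using pin e_lie[OF assms] unfolding pin_lift_def by blast
  then have "cl_parity (\<tau> g) * cl_gen j * inv\<^bsub>Clifford n\<^esub> \<tau> g = cl_vec n (\<lambda>k. rotm g k j)"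
    unfolding cl_incl_e[OF assms] unfolding cl_incl_eq rotm_def .
  then have "cl_parity (\<tau> g) * cl_gen j * inv\<^bsub>Clifford n\<^esub> \<tau> g * \<tau> g = cl_vec n (\<lambda>k. rotm g k j) * \<tau> g"
    by simp
  then show ?thesis by (simp add: mult.assoc tau_inverse)
qed

section \<open>Fusion\<close>

context fixes m :: 'm begin

abbreviation (input) "V \<equiv> tangent_space B m"
abbreviation (input) "A1 \<equiv> \<tau> (\<Phi>1 m)"
abbreviation (input) "A2 \<equiv> \<tau> (\<Phi>2 m)"
abbreviation (input) "R1 \<equiv> rotm (\<Phi>1 m)"
abbreviation (input) "R2 \<equiv> rotm (\<Phi>2 m)"

definition mu1 :: "nat \<Rightarrow> ('m, 'f) tvec \<Rightarrow> real" where
  "mu1 i v = 1/2 * ip (theta_R A G (\<Phi>1 m) (differential B A \<Phi>1 m v)) (e i)"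

definition mu2 :: "nat \<Rightarrow> ('m, 'f) tvec \<Rightarrow> real" where
  "mu2 i v = 1/2 * ip (theta_R A G (\<Phi>2 m) (differential B A \<Phi>2 m v)) (e i)"

text \<open>The \<open>2 * n\<close> one-forms of the overview in one family. From index
  \<open>2 * n\<close> on the value is 0, because nothing is known about \<open>e\<close> beyond
  \<open>n\<close> while linearity is wanted for every index.\<close>

definition mu :: "nat \<Rightarrow> ('m, 'f) tvec \<Rightarrow> real" where
  "mu i = (if i < n then mu1 i else if i < 2 * n then mu2 (i - n) else (\<lambda>v. 0))"

text \<open>The hypotheses on \<open>\<omega>\<close> only concern tangent vectors. Cutting all forms off outside the tangent
  space, which commutes with products, turns them into identities of forms.\<close>

definition mures :: "nat \<Rightarrow> ('m, 'f) tvec \<Rightarrow> real" where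
  "mures i v = (if v \<in> V then mu i v else 0)"

definition "om = Mform (\<omega> m)"
definition "omres = mrestr V om"

lemma dmBm: "dmanifold B" by (rule dmB[OF L ip H])

lemma subV: "subspace V" by (rule subspace_tangent_space[OF dmBm])

lemma alt_om: "alternating_form V 2 (\<omega> m)"
  using H by (simp add: group_valued_hamiltonian_def diff_form_def)

lemma mhom_om: "mhom 2 om" "mhom 2 omres"
  using alt_om by (auto simp: mhom_def alternating_form_def om_def omres_def mrestr.rep_eq)

lemma mu_linear: "mu i (r *\<^sub>R v + s *\<^sub>R w) = r * mu i v + s * mu i w"
proof -
  have 1: "mu1 i (r *\<^sub>R v + s *\<^sub>R w) = r * mu1 i v + s * mu1 i w" if "i < n" for i
    unfolding mu1_def using differential_linear[OF dmBm mdiff_moments(1)[OF L ip H], of m r v s w]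
      theta_R_linear[OF L] ipl[OF theta_R_in[OF L] theta_R_in[OF L] e_lie[OF that]] by (simp add: algebra_simps)
  have 2: "mu2 i (r *\<^sub>R v + s *\<^sub>R w) = r * mu2 i v + s * mu2 i w" if "i < n" for i
    unfolding mu2_def using differential_linear[OF dmBm mdiff_moments(2)[OF L ip H], of m r v s w]
      theta_R_linear[OF L] ipl[OF theta_R_in[OF L] theta_R_in[OF L] e_lie[OF that]] by (simp add: algebra_simps)
  show ?thesis using 1 2[of "i - n"] by (auto simp: mu_def)
qed

abbreviation (input) "Z0 \<equiv> A1 * cl_shift n A2"

lemma cl_on_double: "{..<n} \<subseteq> {..<2 * n}" "(+) n ` {..<n} \<subseteq> {..<2 * n}" "(+) n ` {..<n} \<subseteq> {n..}"
  by auto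

lemma A1_in: "A1 \<in> cl_on {..<2 * n}" "cl_shift n A2 \<in> cl_on {..<2 * n}" "cl_shift n A2 \<in> cl_on {n..}"
  using tau_in cl_shift_in[OF tau_in, of n] cl_on_mono[OF cl_on_double(1)] cl_on_mono[OF cl_on_double(2)] cl_on_mono[OF cl_on_double(3)]
  by blast+

lemma Z0_in: "Z0 \<in> cl_on {..<2 * n}" by (rule cl_on_mult[OF A1_in(1,2)])

lemma wedge_mval: "wedge (mval \<alpha>) (mval \<beta>) = mval (\<alpha> * \<beta>)"
  by (simp add: times_mform.rep_eq)

lemma pullback_T_form:
  "pullback B A \<Phi> (T_form A G ip n e \<tau>) m =
    mval (fsubst (\<lambda>i v. 1/2 * ip (theta_R A G (\<Phi> m) (differential B A \<Phi> m v)) (e i)) (\<tau> (\<Phi> m)))"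
proof
  fix vs
  have "pullback B A \<Phi> (T_form A G ip n e \<tau>) m vs =
      mval (mpull (differential B A \<Phi> m) (fsubst (\<lambda>i v. 1/2 * ip (theta_R A G (\<Phi> m) v) (e i)) (\<tau> (\<Phi> m)))) vs"
    by (simp add: pullback_def T_form_fsubst[of \<tau> _ n, OF tau_in] mpull.rep_eq)
  then show "pullback B A \<Phi> (T_form A G ip n e \<tau>) m vs =
      mval (fsubst (\<lambda>i v. 1/2 * ip (theta_R A G (\<Phi> m) (differential B A \<Phi> m v)) (e i)) (\<tau> (\<Phi> m))) vs"
    by (simp add: mpull_fsubst)
qed

definition "Gam = wedge_forms (wedge_forms (\<lambda>m. exp_form (\<omega> m)) (pullback B A \<Phi>1 (T_form A G ip n e \<tau>)))
                   (pullback B A \<Phi>2 (T_form A G ip n e \<tau>)) m"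

lemma Gam_eq: "Gam = mval (mexp om * fsubst mu Z0)"
proof -
  have 1: "exp_form (\<omega> m) = mval (mexp om)" by (simp add: mexp_def om_def)
  have 2: "fsubst (\<lambda>i v. 1/2 * ip (theta_R A G (\<Phi>1 m) (differential B A \<Phi>1 m v)) (e i)) A1 = fsubst mu A1"
    by (rule fsubst_cong[OF tau_in]) (simp add: mu_def mu1_def fun_eq_iff)
  have 3: "fsubst (\<lambda>i v. 1/2 * ip (theta_R A G (\<Phi>2 m) (differential B A \<Phi>2 m v)) (e i)) A2 = fsubst mu (cl_shift n A2)"
    unfolding fsubst_shift by (rule fsubst_cong[OF tau_in]) (simp add: mu_def mu2_def fun_eq_iff)
  show ?thesis
    unfolding Gam_def wedge_forms_def 1 pullback_T_form 2 3 wedge_mval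
      fsubst_mult_separated[OF tau_in A1_in(3), of mu] mult.assoc ..
qed

lemma Gam_res: "mrestr V (Mform Gam) = mexp omres * fsubst mures Z0"
  unfolding Gam_eq mval_inverse mrestr_mult mrestr_mexp[OF mhom_om(1)] mrestr_fsubst omres_def mures_def[abs_def] ..

definition "om' = Mform (\<lambda>vs. \<omega> m vs - 1/2 * wedge_by ip
    (one_form (\<lambda>v. theta_L A G (\<Phi>1 m) (differential B A \<Phi>1 m v)))
    (one_form (\<lambda>v. theta_R A G (\<Phi>2 m) (differential B A \<Phi>2 m v))) vs)"

text \<open>Parseval turns the wedge product of Lie algebra valued forms into a sum of products of
  scalar one-forms, and \<open>ip_theta_L\<close> rewrites the left form through the right
  one.\<close>

lemma om'_eq: "om' = om + fusion_two_form n R1 mu"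
proof -
  let ?l = "\<lambda>v. theta_L A G (\<Phi>1 m) (differential B A \<Phi>1 m v)"
  let ?r = "\<lambda>v. theta_R A G (\<Phi>2 m) (differential B A \<Phi>2 m v)"
  have of1: "one_form f vs \<in> lie" if "\<And>v. f v \<in> lie" for f :: "('m, 'f) tvec \<Rightarrow> ('g, 'e) tvec" and vs
    using that lie_sub by (auto simp: one_form_def subspace_0 split: list.splits)
  have of2: "ip (one_form f vs) (e k) = one_form (\<lambda>v. ip (f v) (e k)) vs" if "k < n" for f :: "('m, 'f) tvec \<Rightarrow> ('g, 'e) tvec" and vs k
    using ips(3)[OF e_lie[OF that] e_lie[OF that] e_lie[OF that]] by (auto simp: one_form_def split: list.splits)
  have w: "wedge_by ip (one_form ?l) (one_form ?r) vs =
      mval (\<Sum>k<n. mone (\<lambda>v. ip (?l v) (e k)) * mone (\<lambda>v. ip (?r v) (e k))) vs" for vs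
  proof -
    have "ip (one_form ?l us) (one_form ?r ws) =
        (\<Sum>k<n. one_form (\<lambda>v. ip (?l v) (e k)) us * one_form (\<lambda>v. ip (?r v) (e k)) ws)" for us ws
      using parseval[OF of1 of1, of ?l ?r us ws] theta_L_in[OF L] theta_R_in[OF L] by (simp add: of2)
    then show ?thesis
      unfolding mval_sum times_mform.rep_eq wedge_by_def mone_def mval_Mform
      by (subst sum.swap) (simp add: sum_distrib_left)
  qed
  have l: "mone (\<lambda>v. ip (?l v) (e k)) = 2 *\<^sub>R (\<Sum>j<n. R1 j k *\<^sub>R mone (mu j))" if "k < n" for k
  proof -
    have "(\<lambda>v. ip (?l v) (e k)) = (\<lambda>v. 2 * (\<Sum>j<n. R1 j k * mu j v))"
      by (rule ext) (simp add: ip_theta_L[OF that] mu_def mu1_def sum_distrib_left)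
    then show ?thesis by (simp add: mone_linear mone_sum)
  qed
  have r: "mone (\<lambda>v. ip (?r v) (e k)) = 2 *\<^sub>R mone (mu (n + k))" if "k < n" for k
  proof -
    have "(\<lambda>v. ip (?r v) (e k)) = (\<lambda>v. 2 * mu (n + k) v)"
      by (rule ext) (use that in \<open>simp add: mu_def mu2_def\<close>)
    then show ?thesis by (simp add: mone_linear)
  qed
  have "(\<Sum>k<n. mone (\<lambda>v. ip (?l v) (e k)) * mone (\<lambda>v. ip (?r v) (e k))) =
      (\<Sum>k<n. (-2) *\<^sub>R ((-2) *\<^sub>R ((\<Sum>j<n. R1 j k *\<^sub>R mone (mu j)) * mone (mu (n + k)))))"
    by (intro sum.cong refl) (simp only: l r lessThan_iff, simp)
  also have "\<dots> = (-2) *\<^sub>R fusion_two_form n R1 mu"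
    unfolding fusion_two_form_def scaleR_sum_right[of "-2" _ "{..<n}"] ..
  finally have "(\<Sum>k<n. mone (\<lambda>v. ip (?l v) (e k)) * mone (\<lambda>v. ip (?r v) (e k))) = (-2) *\<^sub>R fusion_two_form n R1 mu" .
  then have "wedge_by ip (one_form ?l) (one_form ?r) vs = (-2) * mval (fusion_two_form n R1 mu) vs" for vs
    using w by simp
  then show ?thesis by (intro mform_eqI) (simp add: om'_def om_def)
qed

lemma mhom_om': "mhom 2 om'"
  unfolding om'_eq by (intro mhom_add mhom_om mhom_fusion_two_form)

definition "Gam' = wedge_forms (\<lambda>m. exp_form (\<lambda>vs. \<omega> m vs - 1/2 * wedge_by ip
    (one_form (\<lambda>v. theta_L A G (\<Phi>1 m) (differential B A \<Phi>1 m v)))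
    (one_form (\<lambda>v. theta_R A G (\<Phi>2 m) (differential B A \<Phi>2 m v))) vs))
   (pullback B A (\<lambda>m. \<Phi>1 m \<otimes>\<^bsub>G\<^esub> \<Phi>2 m) (T_form A G ip n e \<tau>)) m"

lemma Gam'_eq: "Gam' = mval (mexp om' * fsubst (fusion_cov n R1 mu) (A1 * A2))"
proof -
  let ?\<Phi> = "\<lambda>m. \<Phi>1 m \<otimes>\<^bsub>G\<^esub> \<Phi>2 m"
  have 1: "exp_form (\<lambda>vs. \<omega> m vs - 1/2 * wedge_by ip
    (one_form (\<lambda>v. theta_L A G (\<Phi>1 m) (differential B A \<Phi>1 m v)))
    (one_form (\<lambda>v. theta_R A G (\<Phi>2 m) (differential B A \<Phi>2 m v))) vs) = mval (mexp om')"
    by (simp add: mexp_def om'_def)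
  have 2: "fsubst (\<lambda>i v. 1/2 * ip (theta_R A G (?\<Phi> m) (differential B A ?\<Phi> m v)) (e i)) (\<tau> (?\<Phi> m)) =
      fsubst (fusion_cov n R1 mu) (\<tau> (?\<Phi> m))"
  proof (rule fsubst_cong[OF tau_in], rule ext)
    fix i v assume i: "i \<in> {..<n}"
    let ?t1 = "theta_R A G (\<Phi>1 m) (differential B A \<Phi>1 m v)" and ?t2 = "theta_R A G (\<Phi>2 m) (differential B A \<Phi>2 m v)"
    have "ip (theta_R A G (?\<Phi> m) (differential B A ?\<Phi> m v)) (e i) = ip ?t1 (e i) + ip (Ad A G (\<Phi>1 m) ?t2) (e i)"
      unfolding theta_R_product[OF L dmBm mdiff_moments(1)[OF L ip H] mdiff_moments(2)[OF L ip H]]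
      using i by (intro ips(1) theta_R_in[OF L] Ad_in[OF L] e_lie) simp
    also have "ip (Ad A G (\<Phi>1 m) ?t2) (e i) = (\<Sum>k<n. R1 i k * ip ?t2 (e k))"
      using i by (intro ip_Ad_e theta_R_in[OF L]) simp
    also have "\<dots> = (\<Sum>k<n. 2 * (R1 i k * mu (n + k) v))"
      by (intro sum.cong refl) (simp add: mu_def mu2_def)
    finally show "1/2 * ip (theta_R A G (?\<Phi> m) (differential B A ?\<Phi> m v)) (e i) = fusion_cov n R1 mu i v"
      using i by (simp add: fusion_cov_def mu_def[of i] mu1_def sum_distrib_left[symmetric])
  qed
  show ?thesis
    unfolding Gam'_def wedge_forms_def 1 pullback_T_form 2 wedge_mval unfolding tau_mult ..
qed

lemma Gam'_res: "mrestr V (Mform Gam') =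
    mexp omres * fsubst mures (Z0 * cl_chain (\<lambda>i. cl_gen i * cl_gen (n + i)) n)"
proof -
  have "mrestr V (\<Sum>i<n. (-2) *\<^sub>R ((\<Sum>k<n. R1 k i *\<^sub>R mone (mu k)) * mone (mu (n + i)))) = fusion_two_form n R1 mures"
    unfolding fusion_two_form_def mrestr_sum mrestr_linear mrestr_mult mrestr_mone mures_def[abs_def] ..
  then have 1: "mrestr V om' = omres + fusion_two_form n R1 mures"
    by (simp add: om'_eq omres_def fusion_two_form_def)
  have 2: "(\<lambda>i v. if v \<in> V then fusion_cov n R1 mu i v else 0) = fusion_cov n R1 mures"
    by (intro ext) (simp add: fusion_cov_def mures_def)
  have "mrestr V (Mform Gam') = mexp omres * (mexp (fusion_two_form n R1 mures) * fsubst (fusion_cov n R1 mures) (A1 * A2))"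
    unfolding Gam'_eq mval_inverse mrestr_mult mrestr_mexp[OF mhom_om'] mrestr_fsubst 1 2
      mexp_add[OF mhom_om(2) mhom_fusion_two_form] mult.assoc ..
  also have "mexp (fusion_two_form n R1 mures) * fsubst (fusion_cov n R1 mures) (A1 * A2) =
      fsubst mures (Z0 * cl_chain (\<lambda>i. cl_gen i * cl_gen (n + i)) n)"
    by (rule fusion_identity[symmetric, OF rotm_orth tau_in tau_inverse(3,1,2) tau_twist tau_in])
  finally show ?thesis .
qed

section \<open>Contractions with the generating fields of the two factors\<close>

abbreviation (input) "X1 i \<equiv> generating_field (prod_atlas A A) (G \<times>\<times> G) B act (incl1 A G (e i)) m"
abbreviation (input) "X2 i \<equiv> generating_field (prod_atlas A A) (G \<times>\<times> G) B act (incl2 A G (e i)) m"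

text \<open>The block diagonal matrix of the adjoint action of \<open>(\<Phi>\<^sub>1(m), \<Phi>\<^sub>2(m))\<close>, one column per index \<open>j\<close>.\<close>

definition Umat :: "nat \<Rightarrow> nat \<Rightarrow> real" where
  "Umat j k = (if j < n then (if k < n then R1 k j else 0) else (if k < n then 0 else R2 (k - n) (j - n)))"

abbreviation (input) "yv j \<equiv> cl_vec (2 * n) (Umat j)"

lemma sum_double: "(\<Sum>k<2 * n. f k) = (\<Sum>k<n. f k) + (\<Sum>k<n. f (n + k))" for f :: "nat \<Rightarrow> 'x::comm_monoid_add"
proof -
  have "{..<2 * n} = {..<n} \<union> (+) n ` {..<n}"
    by (auto simp: image_iff) (metis add_diff_inverse_nat lessThan_iff less_diff_conv2 mult_2 not_le_imp_less not_less)
  then have "(\<Sum>k<2 * n. f k) = (\<Sum>k<n. f k) + sum f ((+) n ` {..<n})"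
    by (simp only:) (rule sum.union_disjoint, auto)
  then show ?thesis by (simp add: sum.reindex)
qed

lemma X_in: "i < n \<Longrightarrow> X1 i \<in> V" "i < n \<Longrightarrow> X2 i \<in> V"
  using generating_field(1)[OF L ip H e_lie] by auto

lemma mu_X:
  assumes i: "i < n" and k: "k < 2 * n"
  shows "mures k (X1 i) = (Umat i k - (if k = i then 1 else 0)) / 2"
    "mures k (X2 i) = (Umat (n + i) k - (if k = n + i then 1 else 0)) / 2"
proof -
  note e = e_lie[OF i]
  have z: "0 \<in> lie" using lie_sub by (rule subspace_0)
  have Ad0: "Ad A G g 0 = 0" for g using Ad_linear[OF L, of g 0 0 0 0] by simp
  have d: "ip (Ad A G g (e i) - e i) (e k) = rotm g k i - (if k = i then 1 else 0)" if "k < n" for g k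
    using ips(2)[OF Ad_in[OF L] e e_lie[OF that]] ip_e[OF i that] by (auto simp: rotm_def)
  have z0: "ip 0 (e k) = 0" if "k < n" for k by (rule ips(3)[OF e e e_lie[OF that]])
  have "theta_R A G (\<Phi>1 m) (differential B A \<Phi>1 m (X1 i)) = Ad A G (\<Phi>1 m) (e i) - e i"
    "theta_R A G (\<Phi>2 m) (differential B A \<Phi>2 m (X1 i)) = 0"
    "theta_R A G (\<Phi>1 m) (differential B A \<Phi>1 m (X2 i)) = 0"
    "theta_R A G (\<Phi>2 m) (differential B A \<Phi>2 m (X2 i)) = Ad A G (\<Phi>2 m) (e i) - e i"
    using generating_field(2,3)[OF L ip H e, of "incl1 A G" m] generating_field(2,3)[OF L ip H e, of "incl2 A G" m]
    by (simp_all add: fst_snd_incl[OF L e] Ad0)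
  then show "mures k (X1 i) = (Umat i k - (if k = i then 1 else 0)) / 2"
    "mures k (X2 i) = (Umat (n + i) k - (if k = n + i then 1 else 0)) / 2"
    using i k X_in[OF i] d[of k] d[of "k - n"] z0[of k] z0[of "k - n"]
    by (auto simp: mures_def mu_def mu1_def mu2_def Umat_def)
qed

text \<open>The moment condition contains half of the sum of both Maurer-Cartan components. The
  right one is \<open>mures\<close> itself and the left one is a rotated sum, given by a column of
  the block matrix.\<close>

lemma contr_omres:
  assumes i: "i < n"
  shows "contr (X1 i) omres = mone (mures i) + (\<Sum>k<2 * n. Umat i k *\<^sub>R mone (mures k))"
    "contr (X2 i) omres = mone (mures (n + i)) + (\<Sum>k<2 * n. Umat (n + i) k *\<^sub>R mone (mures k))"
proof -
  have c: "contr X omres = mone (\<lambda>w. if w \<in> V then \<omega> m [X, w] else 0)" if "X \<in> V" for X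
    using mhom_1_mone[OF mhom_2_contr[OF mhom_om(2)], of X] that
    by (simp add: omres_def om_def contr.rep_eq mrestr.rep_eq cong: if_cong)
  note mc = moment_condition[OF L ip H e_lie[OF i]]
  have "(if w \<in> V then \<omega> m [X1 i, w] else 0) = mures i w + (\<Sum>k<2 * n. Umat i k * mures k w)" for w
  proof (cases "w \<in> V")
    case True
    then show ?thesis using mc(1)[OF True] i
      by (simp add: sum_double mures_def mu_def mu1_def Umat_def ip_theta_L sum_distrib_left sum_divide_distrib add_divide_distrib cong: sum.cong_simp)
  qed (simp add: mures_def)
  then show "contr (X1 i) omres = mone (mures i) + (\<Sum>k<2 * n. Umat i k *\<^sub>R mone (mures k))"
    using c[OF X_in(1)[OF i]] by (simp add: mone_linear mone_sum)
  have "(if w \<in> V then \<omega> m [X2 i, w] else 0) = mures (n + i) w + (\<Sum>k<2 * n. Umat (n + i) k * mures k w)" for w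
  proof (cases "w \<in> V")
    case True
    then show ?thesis using mc(2)[OF True] i
      by (simp add: sum_double mures_def mu_def mu2_def Umat_def ip_theta_L sum_distrib_left sum_divide_distrib add_divide_distrib cong: sum.cong_simp)
  qed (simp add: mures_def)
  then show "contr (X2 i) omres = mone (mures (n + i)) + (\<Sum>k<2 * n. Umat (n + i) k *\<^sub>R mone (mures k))"
    using c[OF X_in(2)[OF i]] by (simp add: mone_linear mone_sum)
qed

lemma contr_X:
  assumes "i < n" "W \<in> cl_on {..<2 * n}"
  shows "contr (X1 i) (mexp omres * fsubst mures W) = mexp omres * fsubst mures (cl_tw yv i W)"
    "contr (X2 i) (mexp omres * fsubst mures W) = mexp omres * fsubst mures (cl_tw yv (n + i) W)"
  unfolding cl_tw_def
  by (rule contr_mexp_fsubst[OF mhom_om(2) contr_omres(1)[OF assms(1)] mu_X(1)[OF assms(1)] _ assms(2)],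
      assumption, use assms(1) in simp,
      rule contr_mexp_fsubst[OF mhom_om(2) contr_omres(2)[OF assms(1)] mu_X(2)[OF assms(1)] _ assms(2)],
      assumption, use assms(1) in simp)

lemma cl_tw_in: "j < 2 * n \<Longrightarrow> W \<in> cl_on {..<2 * n} \<Longrightarrow> cl_tw yv j W \<in> cl_on {..<2 * n}"
  unfolding cl_tw_def by (intro cl_on_closed cl_on_mult cl_vec_in cl_parity_in cl_gen_in) auto

lemma yv_rel: "i < 2 * n \<Longrightarrow> j < 2 * n \<Longrightarrow> yv i * yv j + yv j * yv i = (if i = j then 1 else 0)"
proof -
  assume ij: "i < 2 * n" "j < 2 * n"
  have "(\<Sum>k<n. Umat i k * Umat j k) = (if i < n \<and> j < n then \<Sum>k<n. R1 k i * R1 k j else 0)"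
    by (auto simp: Umat_def intro!: sum.cong)
  moreover have "(\<Sum>k<n. Umat i (n + k) * Umat j (n + k)) =
      (if i < n \<or> j < n then 0 else \<Sum>k<n. R2 k (i - n) * R2 k (j - n))"
    by (auto simp: Umat_def)
  ultimately have "(\<Sum>k<2 * n. Umat i k * Umat j k) = (if i = j then 1 else 0)"
    unfolding sum_double using ij rotm_orth[of i j] rotm_orth[of "i - n" "j - n"] by auto
  then show ?thesis by (simp add: cl_vec_relation)
qed

lemma yv_left: "i < n \<Longrightarrow> yv i = cl_vec n (\<lambda>k. R1 k i)"
  by (simp add: cl_vec_def sum_double Umat_def)

lemma yv_right: "i < n \<Longrightarrow> yv (n + i) = cl_shift n (cl_vec n (\<lambda>k. R2 k i))"
  by (simp add: cl_shift_vec) (simp add: cl_vec_def sum_double Umat_def)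

text \<open>For \<open>j\<close> in the first block the twist of the first lift applies, and the
  generator then passes the shifted factor. In the second block the vector first passes the other
  lift, each time at the cost of a parity, and then the shifted twist applies.\<close>

lemma yv_twist:
  assumes "j < 2 * n" shows "yv j * Z0 = cl_parity Z0 * cl_gen j"
proof (cases "j < n")
  case True
  have "yv j * Z0 = cl_parity A1 * (cl_gen j * cl_shift n A2)"
    using tau_twist[OF True, of "\<Phi>1 m"] by (simp add: yv_left[OF True] mult.assoc[symmetric])
  also have "cl_gen j * cl_shift n A2 = cl_parity (cl_shift n A2) * cl_gen j"
    using cl_gen_comm[OF A1_in(3), of j] True by simp
  finally show ?thesis by (simp add: mult.assoc)
next
  case False
  define i where "i = j - n"
  have j: "j = n + i" "i < n" using False assms by (auto simp: i_def)
  have comm: "cl_gen (n + k) * A1 = cl_parity A1 * cl_gen (n + k)" for k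
    using cl_gen_comm[OF tau_in, of "n + k"] by simp
  have "yv j * A1 = cl_parity A1 * yv j"
    unfolding j yv_right[OF j(2)] cl_shift_vec sum_distrib_left sum_distrib_right
    by (simp add: comm)
  then have "yv j * Z0 = cl_parity A1 * cl_shift n (cl_vec n (\<lambda>k. R2 k i) * A2)"
    by (simp add: mult.assoc[symmetric]) (simp add: j yv_right[OF j(2)] cl_shift_mult mult.assoc)
  also have "cl_vec n (\<lambda>k. R2 k i) * A2 = cl_parity A2 * cl_gen i" using tau_twist[OF j(2), of "\<Phi>2 m"] by simp
  finally show ?thesis by (simp add: j cl_shift_mult cl_shift_parity cl_shift_gen mult.assoc)
qed

section \<open>The exponential of the contraction operator on the forms of the manifold\<close>

definition "Dop \<beta> = (\<lambda>m vs. - (1/2) * (\<Sum>i<n.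
    contraction (generating_field (prod_atlas A A) (G \<times>\<times> G) B act (incl1 A G (e i)))
      (contraction (generating_field (prod_atlas A A) (G \<times>\<times> G) B act (incl2 A G (e i))) \<beta>) m vs))"

abbreviation (input) "fop \<equiv> fusion_op n yv n"

lemma fop_in: "W \<in> cl_on {..<2 * n} \<Longrightarrow> fop W \<in> cl_on {..<2 * n}"
  unfolding fusion_op_def fusion_summand_def
  by (intro cl_on_sum cl_on_closed cl_tw_in) auto

text \<open>The inserted vectors are tangent, so agreement on lists of tangent vectors is enough and
  is preserved. The operator thereby becomes \<open>fop\<close> on the Clifford element.\<close>

lemma Dop_step:
  assumes \<beta>: "\<And>vs. vs \<in> lists V \<Longrightarrow> \<beta> m vs = mval (mexp omres * fsubst mures W) vs"
    and W: "W \<in> cl_on {..<2 * n}" and vs: "vs \<in> lists V"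
  shows "Dop \<beta> m vs = mval (mexp omres * fsubst mures (fop W)) vs"
proof -
  have "\<beta> m (X2 i # X1 i # vs) = mval (mexp omres * fsubst mures (cl_tw yv i (cl_tw yv (n + i) W))) vs" if "i < n" for i
  proof -
    have "\<beta> m (X2 i # X1 i # vs) = mval (contr (X1 i) (contr (X2 i) (mexp omres * fsubst mures W))) vs"
      using \<beta>[of "X2 i # X1 i # vs"] X_in[OF that] vs by (simp add: contr.rep_eq)
    then show ?thesis using that W by (simp add: contr_X cl_tw_in)
  qed
  then have "Dop \<beta> m vs = mval (\<Sum>i<n. (- (1/2)) *\<^sub>R (mexp omres * fsubst mures (cl_tw yv i (cl_tw yv (n + i) W)))) vs"
    by (simp add: Dop_def contraction_def mval_sum sum_distrib_left)
  then show ?thesis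
    by (simp add: fusion_op_def fusion_summand_def fsubst_linear sum_distrib_left)
qed

lemma Gam_list: "vs \<in> lists V \<Longrightarrow> Gam vs = mval (mexp omres * fsubst mures Z0) vs"
  using Gam_res mval_mrestr[of vs V "Mform Gam"] by (simp add: lists_eq_set)

lemma Dop_power:
  assumes "\<And>vs. vs \<in> lists V \<Longrightarrow> \<beta> m vs = mval (mexp omres * fsubst mures Z0) vs"
  shows "vs \<in> lists V \<Longrightarrow> (Dop ^^ k) \<beta> m vs = mval (mexp omres * fsubst mures ((fop ^^ k) Z0)) vs"
proof (induction k arbitrary: vs)
  case (Suc k)
  have "(fop ^^ k) Z0 \<in> cl_on {..<2 * n}" for k by (induction k) (auto simp: fop_in Z0_in)
  then show ?case using Dop_step[of "(Dop ^^ k) \<beta>" "(fop ^^ k) Z0" vs] Suc by simp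
qed (simp add: assms)

lemma exp_Dop:
  assumes \<beta>: "\<beta> m = Gam" and vs: "vs \<in> lists V"
  shows "(\<Sum>k. (Dop ^^ k) \<beta> m vs / fact k) = Gam' vs"
proof -
  have p: "(Dop ^^ k) \<beta> m vs = mval (mexp omres * fsubst mures ((fop ^^ k) Z0)) vs" for k
    using \<beta> Gam_list vs by (intro Dop_power) auto
  have nil: "(fop ^^ k) Z0 = 0" if "n < k" for k
    by (rule fusion_op_nilpotent[where Z = Z0]) (use that yv_rel yv_twist in auto)
  have "(\<Sum>k. (Dop ^^ k) \<beta> m vs / fact k) = (\<Sum>k\<le>n. (Dop ^^ k) \<beta> m vs / fact k)"
    by (rule suminf_finite) (auto simp: p nil fsubst_zero)
  also have "\<dots> = mval (mexp omres * fsubst mures (\<Sum>k\<le>n. (1 / fact k) *\<^sub>R (fop ^^ k) Z0)) vs"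
    by (simp add: p fsubst_linear sum_distrib_left mval_sum)
  also have "(\<Sum>k\<le>n. (1 / fact k) *\<^sub>R (fop ^^ k) Z0) = Z0 * cl_chain (\<lambda>i. cl_gen i * cl_gen (n + i)) n"
    by (rule exp_fusion_op) (use yv_rel yv_twist in auto)
  also have "mval (mexp omres * fsubst mures \<dots>) vs = Gam' vs"
    using Gam'_res mval_mrestr[of vs V "Mform Gam'"] vs by (simp add: lists_eq_set)
  finally show "(\<Sum>k. (Dop ^^ k) \<beta> m vs / fact k) = Gam' vs" .
qed

text \<open>The image of a basis of the model space spans the tangent space and has at most
  \<open>dim\<close> elements, so \<open>malt_vanishes\<close> applies to any longer list.\<close>

lemma Gam_vanishes:
  assumes vs: "vs \<in> lists V" "dim (UNIV :: 'f set) < length vs"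
  shows "Gam vs = 0"
proof -
  have "malt V omres" unfolding omres_def
    by (rule alternating_form_malt[OF subV, of 2]) (simp add: om_def alt_om)
  moreover have "malt V (fsubst mures Z0)"
  proof (rule malt_fsubst)
    fix i v w r s assume "v \<in> V" "w \<in> V"
    moreover then have "r *\<^sub>R v + s *\<^sub>R w \<in> V" using subV by (simp add: subspace_add subspace_scale)
    ultimately show "mures i (r *\<^sub>R v + s *\<^sub>R w) = r * mures i v + s * mures i w"
      by (simp add: mures_def mu_linear)
  qed
  ultimately have malt: "malt V (mexp omres * fsubst mures Z0)"
    by (intro malt_mult malt_mexp mhom_om)
  obtain c where c: "c \<in> charts_at B m" using chart_at_ex[OF dmBm] by blast
  obtain J :: "'f \<Rightarrow> ('m, 'f) tvec" where J: "linear J" "range J = V"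
    using tangent_space_linear[OF dmBm c] by blast
  obtain F0 :: "'f set" where F0: "finite F0" "span F0 = UNIV"
    using H by (auto simp: group_valued_hamiltonian_def manifold_def)
  obtain F :: "'f set" where F: "independent F" "UNIV \<subseteq> span F" "card F = dim (UNIV :: 'f set)"
    using basis_exists[of "UNIV :: 'f set"] by metis
  have fin: "finite F" using independent_span_bound[OF F0(1) F(1)] F0(2) by simp
  have "V = span (J ` F)" using J F(2) linear_span_image[OF J(1), of F] by (metis top.extremum_uniqueI)
  then have "mval (mexp omres * fsubst mures Z0) vs = 0"
    using J vs F(3) card_image_le[OF fin, of J] fin
    by (intro malt_vanishes[OF subV malt, of "J ` F"])
      (auto simp: lists_eq_set intro: span_mono[THEN subsetD])
  then show ?thesis using Gam_list[OF vs(1)] by simp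
qed

text \<open>Every application inserts two further tangent vectors, so the \<open>k\<close>-th power
  evaluates the form on lists longer by \<open>2 * k\<close>.\<close>

lemma Dop_top:
  assumes \<beta>: "\<beta> m = Gam" and vs: "vs \<in> lists V" and len: "dim (UNIV :: 'f set) < length vs + 2 * k"
  shows "(Dop ^^ k) \<beta> m vs = 0"
  using vs len
proof (induction k arbitrary: vs)
  case (Suc k)
  have "(Dop ^^ k) \<beta> m (X2 i # X1 i # vs) = 0" if "i < n" for i
    using Suc X_in[OF that] by (intro Suc.IH) auto
  then show ?case by (simp add: Dop_def[of "(Dop ^^ k) \<beta>"] contraction_def)
qed (simp add: \<beta> Gam_vanishes)

lemma top_degree:
  assumes vs: "vs \<in> lists V" and len: "length vs = dim (UNIV :: 'f set)"
  shows "Gam' vs = Gam vs"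
proof -
  \<comment> \<open>The operator acts pointwise, so a form with the value \<open>Gam\<close> at
    \<open>m\<close> serves whatever it does elsewhere.\<close>
  define \<beta> :: "('m, 'f) form" where "\<beta> = (\<lambda>_. Gam)"
  have "(\<Sum>k. (Dop ^^ k) \<beta> m vs / fact k) = (\<Sum>k\<in>{0}. (Dop ^^ k) \<beta> m vs / fact k)"
    using Dop_top[of \<beta> vs] vs len by (intro suminf_finite) (auto simp: \<beta>_def)
  then show ?thesis using exp_Dop[of \<beta> vs] vs by (simp add: \<beta>_def)
qed

end

lemma fusion_forms:
  fixes T \<Gamma> \<Gamma>'
  defines "T \<equiv> T_form A G ip n e \<tau>"
  defines "\<Gamma> \<equiv> wedge_forms (wedge_forms (\<lambda>m. exp_form (\<omega> m)) (pullback B A \<Phi>1 T)) (pullback B A \<Phi>2 T)"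
    and "\<Gamma>' \<equiv> wedge_forms (\<lambda>m. exp_form (\<lambda>vs. \<omega> m vs - 1/2 * wedge_by ip
        (one_form (\<lambda>v. theta_L A G (\<Phi>1 m) (differential B A \<Phi>1 m v)))
        (one_form (\<lambda>v. theta_R A G (\<Phi>2 m) (differential B A \<Phi>2 m v))) vs))
      (pullback B A (\<lambda>m. \<Phi>1 m \<otimes>\<^bsub>G\<^esub> \<Phi>2 m) T)"
  shows "form_eq B \<Gamma>' (exp_operator Dop \<Gamma>)"
    and "form_eq B (degree_part (dim (UNIV :: 'f set)) \<Gamma>') (degree_part (dim (UNIV :: 'f set)) \<Gamma>)"
proof -
  have \<Gamma>: "\<Gamma> m = Gam m" "\<Gamma>' m = Gam' m" for m
    by (simp_all add: \<Gamma>_def \<Gamma>'_def T_def Gam_def Gam'_def)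
  show "form_eq B \<Gamma>' (exp_operator Dop \<Gamma>)"
    unfolding form_eq_def exp_operator_def using exp_Dop[of \<Gamma>] \<Gamma> by simp
  show "form_eq B (degree_part (dim (UNIV :: 'f set)) \<Gamma>') (degree_part (dim (UNIV :: 'f set)) \<Gamma>)"
    unfolding form_eq_def degree_part_def using top_degree \<Gamma> by simp
qed

end

theorem theorem3p5:
  fixes A :: "('g::{t2_space, second_countable_topology}, 'e::real_normed_vector) chart set"
    and G :: "'g monoid"
    and ip :: "('g, 'e) pairing"
    and n :: nat
    and e :: "nat \<Rightarrow> ('g, 'e) tvec"
    and \<tau> :: "'g \<Rightarrow> cliff"
    and B :: "('m::{t2_space, second_countable_topology}, 'f::real_normed_vector) chart set"
    and act :: "'g \<times> 'g \<Rightarrow> 'm \<Rightarrow> 'm"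
    and act' :: "'g \<Rightarrow> 'm \<Rightarrow> 'm"
    and \<omega> \<omega>' :: "('m, 'f) form"
    and \<Phi>1 \<Phi>2 \<Phi>' :: "'m \<Rightarrow> 'g"
  assumes "compact_lie_group A G"
    and "invariant_inner_product A G ip"
    and "orthonormal_basis A G ip n e"
    and "pin_lift A G ip n e \<tau>"
    and "group_valued_hamiltonian (prod_atlas A A) (G \<times>\<times> G) (prod_ip A G ip)
           B act \<omega> (\<lambda>m. (\<Phi>1 m, \<Phi>2 m))"
    and "(act', \<omega>', \<Phi>') = fusion A G ip B act \<omega> \<Phi>1 \<Phi>2"
  shows "let T = T_form A G ip n e \<tau>;
             \<Gamma> = wedge_forms (wedge_forms (\<lambda>m. exp_form (\<omega> m)) (pullback B A \<Phi>1 T))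
                   (pullback B A \<Phi>2 T);
             \<Gamma>' = wedge_forms (\<lambda>m. exp_form (\<omega>' m)) (pullback B A \<Phi>' T);
             \<iota>1 = (\<lambda>i. contraction
                    (generating_field (prod_atlas A A) (G \<times>\<times> G) B act (incl1 A G (e i))));
             \<iota>2 = (\<lambda>i. contraction
                    (generating_field (prod_atlas A A) (G \<times>\<times> G) B act (incl2 A G (e i))));
             D = (\<lambda>\<beta> m vs. - (1/2) * (\<Sum>i<n. \<iota>1 i (\<iota>2 i \<beta>) m vs))
         in form_eq B \<Gamma>' (exp_operator D \<Gamma>) \<and>
            form_eq B (degree_part (dim (UNIV :: 'f set)) \<Gamma>')
                      (degree_part (dim (UNIV :: 'f set)) \<Gamma>)"
proof -
  have L: "lie_group A G" using assms(1) by (simp add: compact_lie_group_def)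
  have f: "\<omega>' = (\<lambda>m vs. \<omega> m vs - 1/2 * wedge_by ip
        (one_form (\<lambda>v. theta_L A G (\<Phi>1 m) (differential B A \<Phi>1 m v)))
        (one_form (\<lambda>v. theta_R A G (\<Phi>2 m) (differential B A \<Phi>2 m v))) vs)"
    "\<Phi>' = (\<lambda>m. \<Phi>1 m \<otimes>\<^bsub>G\<^esub> \<Phi>2 m)"
    using assms(6) unfolding fusion_def by (simp_all only: prod.inject)
  show ?thesis
    unfolding Let_def f
    using fusion_forms[OF L assms(2-5)] unfolding Dop_def[OF L assms(2-5), abs_def] by blast
qed

end
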